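(* For pairs of integers $(k,\ell),(m,n)\neq(0,0)$, let $$G_{(k,\ell),(m,n)}=\langle a,b,t : [a,b]=1,\ t a^m b^n t^{-1}=a^k b^\ell\rangle .$$ **A. (Commensurability classification)** The groups $G_{(k,\ell),(m,n)}$ where $kn-\ell m\neq 0$ are all commensurable to each other. For $kn-\ell m=0$, the group $G_{(k,\ell),(m,n)}$ is isomorphic to $G_{(\gcd(k,\ell),0),(\gcd(m,n),0)}$. Two groups of this form $G_{(m_1,0),(n_1,0)}$, $G_{(m_2,0),(n_2,0)}$ where $1\le |m_i|\le n_i$ are commensurable if and only if: - $m_1=\pm m_2$, i.e. $G_{(m,0),(n,0)}\sim G_{(-m,0),(n,0)}$; - $\frac{m_2}{m_1}=\frac{n_2}{n_1}$, i.e. $G_{(m,0),(n,0)}\sim G_{(cm,0),(cn,0)}$ for $c\in\mathbb{Z}_{\neq 0}$. **B. (Quasi-isometry classification)** The groups $G_{(k,\ell),(m,n)}$ fall into the following three quasi-isometry classes: - $G_{(k,\ell),(m,n)}$ where $kn-\ell m\neq 0$; - $G_{(k,\ell),(\pm k,\pm\ell)}$ (these are isomorphic to groups of the form $G_{(m,0),(m,0)}$); - $G_{(k,\ell),(m,n)}$ where $kn-\ell m=0$ but $(k,\ell)\neq(\pm m,\pm n)$ (these are isomorphic to groups of the form $G_{(m,0),(n,0)}$ for $m\neq\pm n$). These groups are quasi-isometric to $BS(2,3)$.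
   Context: Two groups $H_1,H_2$ are (abstractly) commensurable, written $H_1\sim H_2$, if they contain isomorphic finite index subgroups. A finitely generated group is regarded as a metric space via the word metric of a finite generating set, and two finitely generated groups are quasi-isometric if these metric spaces are quasi-isometric (this does not depend on the choice of finite generating sets). The Baumslag--Solitar group is $BS(m,n)=\langle a,t : t a^m t^{-1}=a^n\rangle$, so $BS(2,3)=\langle a,t : t a^2 t^{-1}=a^3\rangle$. $\gcd$ denotes the greatest common divisor.
   Formalization: If (k,l),(m,n) point in opposite directions, G is isomorphic to G_{(-gcd(k,l),0),(gcd(m,n),0)}, and G_{(k,l),(-k,-l)} to some G_{(m,0),(-m,0)}; the unsigned forms are false. The two bullets are read as moves that may be combined: m_2/(±m_1) = n_2/n_1. *)

theory Defs
  imports Complex_Main "HOL-Algebra.Generated_Groups"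
begin

section \<open>Groups given by generators and relations\<close>

text \<open>A letter is a generator \<open>(x, True)\<close> or a formal inverse \<open>(x, False)\<close>.
  A relation \<open>u = v\<close> is a pair of words.  The generators are all elements of the type \<open>'g\<close>.\<close>

type_synonym 'g word = "('g \<times> bool) list"

inductive pres_eq :: "('g word \<times> 'g word) set \<Rightarrow> 'g word \<Rightarrow> 'g word \<Rightarrow> bool"
  for R :: "('g word \<times> 'g word) set" where
  rel: "(u, v) \<in> R \<Longrightarrow> pres_eq R u v"
| cancel: "pres_eq R [(x, e), (x, \<not> e)] []"
| refl: "pres_eq R u u"
| sym: "pres_eq R u v \<Longrightarrow> pres_eq R v u"
| trans: "pres_eq R u v \<Longrightarrow> pres_eq R v w \<Longrightarrow> pres_eq R u w"
| cong: "pres_eq R u u' \<Longrightarrow> pres_eq R v v' \<Longrightarrow> pres_eq R (u @ v) (u' @ v')"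

definition pres_class :: "('g word \<times> 'g word) set \<Rightarrow> 'g word \<Rightarrow> 'g word set" where
  "pres_class R u = {v. pres_eq R u v}"

definition presented_group :: "('g word \<times> 'g word) set \<Rightarrow> 'g word set monoid" where
  "presented_group R =
     \<lparr>carrier = range (pres_class R),
      mult = (\<lambda>X Y. {w. \<exists>x\<in>X. \<exists>y\<in>Y. pres_eq R (x @ y) w}),
      one = pres_class R []\<rparr>"

definition gen_pow :: "'g \<Rightarrow> int \<Rightarrow> 'g word" where
  "gen_pow x z = replicate (nat \<bar>z\<bar>) (x, 0 \<le> z)"

definition inv_word :: "'g word \<Rightarrow> 'g word" where
  "inv_word u = rev (map (\<lambda>(x, e). (x, \<not> e)) u)"

lemma pres_class_eq_iff: "pres_class R u = pres_class R v \<longleftrightarrow> pres_eq R u v"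
proof
  assume "pres_class R u = pres_class R v"
  moreover have "v \<in> pres_class R v"
    by (simp add: pres_class_def pres_eq.refl)
  ultimately have "v \<in> pres_class R u"
    by simp
  then show "pres_eq R u v"
    by (simp add: pres_class_def)
next
  assume *: "pres_eq R u v"
  show "pres_class R u = pres_class R v"
    unfolding pres_class_def
    using pres_eq.trans[OF *] pres_eq.trans[OF pres_eq.sym[OF *]] by fast
qed

lemma mult_pres_class:
  "pres_class R u \<otimes>\<^bsub>presented_group R\<^esub> pres_class R v = pres_class R (u @ v)"
proof -
  have "(\<exists>x\<in>pres_class R u. \<exists>y\<in>pres_class R v. pres_eq R (x @ y) w) \<longleftrightarrow> pres_eq R (u @ v) w" for w
  proof
    assume "\<exists>x\<in>pres_class R u. \<exists>y\<in>pres_class R v. pres_eq R (x @ y) w"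
    then obtain x y where "pres_eq R u x" "pres_eq R v y" "pres_eq R (x @ y) w"
      by (auto simp: pres_class_def)
    then show "pres_eq R (u @ v) w"
      using pres_eq.trans[OF pres_eq.cong] by blast
  next
    assume *: "pres_eq R (u @ v) w"
    have "u \<in> pres_class R u" "v \<in> pres_class R v"
      by (simp_all add: pres_class_def pres_eq.refl)
    with * show "\<exists>x\<in>pres_class R u. \<exists>y\<in>pres_class R v. pres_eq R (x @ y) w"
      by (rule_tac bexI[of _ u], rule_tac bexI[of _ v])
  qed
  then show ?thesis
    by (simp add: presented_group_def pres_class_def[of R "u @ v"])
qed

lemma inv_word_left: "pres_eq R (inv_word u @ u) []"
proof (induction u)
  case Nil
  show ?case by (simp add: inv_word_def pres_eq.refl)
next
  case (Cons p u)
  obtain x e where p: "p = (x, e)" by (cases p)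
  have "pres_eq R ([(x, \<not> e), (x, \<not> \<not> e)] @ u) ([] @ u)"
    by (rule pres_eq.cong[OF pres_eq.cancel pres_eq.refl])
  then have "pres_eq R (inv_word u @ ([(x, \<not> e), (x, e)] @ u)) (inv_word u @ u)"
    by (auto dest: pres_eq.cong[OF pres_eq.refl[of R "inv_word u"]])
  then have "pres_eq R (inv_word u @ ([(x, \<not> e), (x, e)] @ u)) []"
    by (rule pres_eq.trans[OF _ Cons.IH])
  then show ?case
    by (simp add: p inv_word_def)
qed

lemma group_presented_group: "group (presented_group R)"
proof (rule groupI)
  fix X Y assume "X \<in> carrier (presented_group R)" "Y \<in> carrier (presented_group R)"
  then obtain u v where "X = pres_class R u" "Y = pres_class R v"
    by (auto simp: presented_group_def)
  then show "X \<otimes>\<^bsub>presented_group R\<^esub> Y \<in> carrier (presented_group R)"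
    by (simp only: mult_pres_class) (simp add: presented_group_def)
next
  show "\<one>\<^bsub>presented_group R\<^esub> \<in> carrier (presented_group R)"
    by (simp add: presented_group_def)
next
  fix X Y Z assume "X \<in> carrier (presented_group R)" "Y \<in> carrier (presented_group R)"
    "Z \<in> carrier (presented_group R)"
  then obtain u v w where "X = pres_class R u" "Y = pres_class R v" "Z = pres_class R w"
    by (auto simp: presented_group_def)
  then show "X \<otimes>\<^bsub>presented_group R\<^esub> Y \<otimes>\<^bsub>presented_group R\<^esub> Z
      = X \<otimes>\<^bsub>presented_group R\<^esub> (Y \<otimes>\<^bsub>presented_group R\<^esub> Z)"
    by (simp only: mult_pres_class append_assoc)
next
  fix X assume "X \<in> carrier (presented_group R)"
  then obtain u where X: "X = pres_class R u"
    by (auto simp: presented_group_def)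
  have one: "\<one>\<^bsub>presented_group R\<^esub> = pres_class R []"
    by (simp add: presented_group_def)
  show "\<one>\<^bsub>presented_group R\<^esub> \<otimes>\<^bsub>presented_group R\<^esub> X = X"
    by (simp only: X one mult_pres_class append_Nil)
  have "pres_class R (inv_word u) \<otimes>\<^bsub>presented_group R\<^esub> X = \<one>\<^bsub>presented_group R\<^esub>"
    by (simp only: X one mult_pres_class pres_class_eq_iff inv_word_left)
  moreover have "pres_class R (inv_word u) \<in> carrier (presented_group R)"
    by (simp add: presented_group_def)
  ultimately show "\<exists>Y\<in>carrier (presented_group R).
      Y \<otimes>\<^bsub>presented_group R\<^esub> X = \<one>\<^bsub>presented_group R\<^esub>"
    by blast
qed

section \<open>The groups of the classification\<close>

datatype hnn_gen = A | B | T

definition hnn_group :: "int \<times> int \<Rightarrow> int \<times> int \<Rightarrow> hnn_gen word set monoid" where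
  "hnn_group = (\<lambda>(k, l) (m, n). presented_group
     {([(A, True), (B, True), (A, False), (B, False)], []),
      ([(T, True)] @ gen_pow A m @ gen_pow B n @ [(T, False)], gen_pow A k @ gen_pow B l)})"

datatype bs_gen = a | t

definition baumslag_solitar :: "int \<Rightarrow> int \<Rightarrow> bs_gen word set monoid" where
  "baumslag_solitar m n = presented_group
     {([(t, True)] @ gen_pow a m @ [(t, False)], gen_pow a n)}"

hide_const (open) A B T a t

section \<open>Commensurability\<close>

definition commensurable :: "('a, 'c) monoid_scheme \<Rightarrow> ('b, 'd) monoid_scheme \<Rightarrow> bool" where
  "commensurable G G' \<longleftrightarrow>
     (\<exists>H H'. subgroup H G \<and> finite (rcosets\<^bsub>G\<^esub> H) \<and>
             subgroup H' G' \<and> finite (rcosets\<^bsub>G'\<^esub> H') \<and>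
             G\<lparr>carrier := H\<rparr> \<cong> G'\<lparr>carrier := H'\<rparr>)"

section \<open>Word metrics and quasi-isometry\<close>

definition finite_gen_set :: "('a, 'c) monoid_scheme \<Rightarrow> 'a set \<Rightarrow> bool" where
  "finite_gen_set G S \<longleftrightarrow> finite S \<and> S \<subseteq> carrier G \<and> generate G S = carrier G"

definition word_length :: "('a, 'c) monoid_scheme \<Rightarrow> 'a set \<Rightarrow> 'a \<Rightarrow> nat" where
  "word_length G S g =
     (LEAST n. \<exists>ws. length ws = n \<and> set ws \<subseteq> S \<union> m_inv G ` S \<and>
                    foldr (\<otimes>\<^bsub>G\<^esub>) ws \<one>\<^bsub>G\<^esub> = g)"

definition word_dist :: "('a, 'c) monoid_scheme \<Rightarrow> 'a set \<Rightarrow> 'a \<Rightarrow> 'a \<Rightarrow> real" where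
  "word_dist G S g h = real (word_length G S (inv\<^bsub>G\<^esub> g \<otimes>\<^bsub>G\<^esub> h))"

definition quasi_isometric_spaces ::
  "'a set \<Rightarrow> ('a \<Rightarrow> 'a \<Rightarrow> real) \<Rightarrow> 'b set \<Rightarrow> ('b \<Rightarrow> 'b \<Rightarrow> real) \<Rightarrow> bool" where
  "quasi_isometric_spaces X d Y d' \<longleftrightarrow>
     (\<exists>f K C. f \<in> X \<rightarrow> Y \<and> K \<ge> 1 \<and> C \<ge> 0 \<and>
        (\<forall>x\<in>X. \<forall>x'\<in>X. d x x' / K - C \<le> d' (f x) (f x') \<and> d' (f x) (f x') \<le> K * d x x' + C) \<and>
        (\<forall>y\<in>Y. \<exists>x\<in>X. d' (f x) y \<le> C))"

definition quasi_isometric :: "('a, 'c) monoid_scheme \<Rightarrow> ('b, 'd) monoid_scheme \<Rightarrow> bool" where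
  "quasi_isometric G H \<longleftrightarrow>
     (\<exists>S S'. finite_gen_set G S \<and> finite_gen_set H S' \<and>
        quasi_isometric_spaces (carrier G) (word_dist G S) (carrier H) (word_dist H S'))"

section \<open>Parameter families\<close>

definition params :: "((int \<times> int) \<times> (int \<times> int)) set" where
  "params = {(p, q). p \<noteq> (0, 0) \<and> q \<noteq> (0, 0)}"

definition transverse_params :: "((int \<times> int) \<times> (int \<times> int)) set" where
  "transverse_params = {((k, l), (m, n)) \<in> params. k * n - l * m \<noteq> 0}"

text \<open>The two signs in \<open>(\<plusminus>k, \<plusminus>l)\<close> are read as equal.\<close>

definition unimodular_params :: "((int \<times> int) \<times> (int \<times> int)) set" where
  "unimodular_params = {((k, l), (m, n)) \<in> params. (m, n) = (k, l) \<or> (m, n) = (- k, - l)}"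

definition nonunimodular_params :: "((int \<times> int) \<times> (int \<times> int)) set" where
  "nonunimodular_params =
     {((k, l), (m, n)) \<in> params. k * n - l * m = 0 \<and> (k, l) \<noteq> (m, n) \<and> (k, l) \<noteq> (- m, - n)}"

end

(* Maps between the groups are given by crossed maps: a finite state machine rewrites words of one
   presentation into words of another one.  If two machines invert each other up to a bounded
   correction, the stabilizers of their base states are isomorphic subgroups of finite index and the
   machines are quasi-isometries; with a single state they are isomorphisms.  This gives the base
   change of the group of A and B, the change of sign, the scaling by c, and the reduction of every
   transverse group to T A T^-1 = B.

   Converse in part A.  Divide by common factors, so that T A^n T^-1 = A^m with m, n coprime and
   |m| < n.  Some power of A is conjugated by a power of T to a power of a different exponent, so it
   has translation length 0 on the Bass-Serre tree of the other group; an isomorphism between finite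
   index subgroups hence sends, after a conjugation, a power of A to a power of A'.  The image of T^c
   then yields m^c = m'^e and n^c = n'^e up to sign.  Finally, for a prime p dividing n, the
   centralizer of A^K grows under K -> pK exactly when v_p(K) + 1 is a multiple of v_p(n), as long as
   K is divisible enough by the other primes.  Comparing the periods gives v_p(n) = v_p(n'), so c = e.

   Part B, positive half.  A nonunimodular group acts on a product of its Bass-Serre tree and a line
   that is scaled along the edges.  Following Whyte, all these trees with their height functions are
   encoded by one and the same tree: each vertex is blown up to a strip of bounded height, and the
   children of a strip are listed by first child and next sibling.  The resulting map of vertices
   distorts the scaling by a bounded factor, so it extends to the groups.

   Part B, negative half.  Nonunimodular groups do not satisfy a cubic isoperimetric inequality: with
   T^-1 A T = A^2, the power A^(2^n) is short and commutes with B, and the integral of x dy over the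
   resulting loop is 2^n.  The other groups do, by their normal forms.  The unimodular group
   F_2 x Z has linear divergence, whereas in the transverse group T A T^-1 = B consecutive flats
   T^i <A, B> meet in orthogonal axes, so a detour around T^N has to cross about N flats at distance
   about N from the axes, which takes quadratic length. *)

theory Submission
  imports Defs "HOL-Computational_Algebra.Primes"
begin

section \<open>Words acting on states\<close>

text \<open>A commensuration preserves the distorted generator only up to conjugacy and powers, so
  the modulus alone gives \<open>m^c = m'^E\<close> with unrelated \<open>c\<close> and
  \<open>E\<close> and cannot separate, say, the exponents 1, 2 from 1, 4. What separates them is
  the set of exponents \<open>K\<close> at which the centralizer of \<open>A^K\<close> grows; it is
  visible thanks to \<open>B\<close>, because for coprime exponents \<open>T^-s B T^s\<close>
  commutes with \<open>A^K\<close> exactly when \<open>m^s\<close> divides \<open>K\<close>. Passing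
  to a subgroup of finite index costs only a power of \<open>B\<close>.

  Every group is handled through an explicit set of states on which words act, so that
  well-definedness is checked on relators. \<open>B\<close> is treated as one more stable letter
  with exponents 1; this puts BS(2,3) and the nonunimodular groups into one frame with cyclic vertex
  groups. Both exponents of the letter that changes the scale are made at least 2 by doubling, which
  leaves at every vertex a way up and a way down that does not backtrack.

  The isoperimetric obstruction is stated dually, through functions on pairs of points, because
  these pull back along a quasi-isometry, whereas discs would have to be rebuilt.\<close>

abbreviation "PG \<equiv> presented_group"
abbreviation "cls \<equiv> pres_class"

text \<open>Letters that act invertibly on \<open>S\<close> and satisfy the relators define an
  action of the presented group. Well-definedness of machines and uniqueness of all normal forms
  below reduce to this check. Closure of \<open>S\<close> lets the congruence case run the second
  factor from the state reached by the first.\<close>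

lemma run_cong:
  assumes closed: "\<And>s l. s \<in> S \<Longrightarrow> step s l \<in> S"
    and cancel: "\<And>s x e. s \<in> S \<Longrightarrow> step (step s (x, e)) (x, \<not> e) = s"
    and rel: "\<And>s u v. s \<in> S \<Longrightarrow> (u, v) \<in> R \<Longrightarrow> foldl step s u = foldl step s v"
    and eq: "pres_eq R u v" and s: "s \<in> S"
  shows "foldl step s u = foldl step s v"
proof -
  have cl: "s \<in> S \<Longrightarrow> foldl step s w \<in> S" for s w
    by (induction w arbitrary: s) (auto simp: closed)
  show ?thesis using eq s
  proof (induction arbitrary: s)
    case (cong u u' v v')
    then show ?case using cl by (metis foldl_append)
  qed (auto simp: rel cancel)
qed

lemma inv_word_Nil [simp]: "inv_word [] = []"
  by (simp add: inv_word_def)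

lemma inv_word_append [simp]: "inv_word (u @ v) = inv_word v @ inv_word u"
  by (simp add: inv_word_def)

lemma inv_word_Cons: "inv_word ((x, e) # u) = inv_word u @ [(x, \<not> e)]"
  by (simp add: inv_word_def)

lemma inv_word_inv_word [simp]: "inv_word (inv_word u) = u"
  by (induction u) (auto simp: inv_word_Cons inv_word_def)

lemma length_inv_word [simp]: "length (inv_word u) = length u"
  by (simp add: inv_word_def)

lemma carrier_presented: "carrier (PG R) = range (cls R)"
  by (simp add: presented_group_def)

lemma one_presented: "\<one>\<^bsub>PG R\<^esub> = cls R []"
  by (simp add: presented_group_def)

lemma pres_class_closed [simp]: "cls R u \<in> carrier (PG R)"
  by (simp add: carrier_presented)

lemma inv_pres_class: "inv\<^bsub>PG R\<^esub> (cls R u) = cls R (inv_word u)"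
  by (rule group.inv_equality[OF group_presented_group])
     (simp_all add: mult_pres_class one_presented pres_class_eq_iff inv_word_left)

lemma inv_word_right: "pres_eq R (u @ inv_word u) []"
  using inv_word_left[of R "inv_word u"] by simp

lemma pres_class_append:
  "cls R (u @ v) = cls R u \<otimes>\<^bsub>PG R\<^esub> cls R v"
  by (simp add: mult_pres_class)

lemma pres_class_False:
  "cls R [(x, False)] = inv\<^bsub>PG R\<^esub> cls R [(x, True)]"
  by (simp add: inv_pres_class inv_word_def)

lemma pres_class_replicate:
  "cls R (replicate k l) = cls R [l] [^]\<^bsub>PG R\<^esub> (k::nat)"
proof (induction k)
  case 0
  then show ?case by (simp add: one_presented)
next
  case (Suc k)
  have "cls R (replicate (Suc k) l) = cls R (replicate k l @ [l])"
    by (simp add: replicate_append_same)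
  then show ?case using Suc by (simp add: pres_class_append)
qed

lemma pres_class_gen_pow:
  "cls R (gen_pow x z) = cls R [(x, True)] [^]\<^bsub>PG R\<^esub> (z::int)"
proof -
  interpret group "PG R" by (rule group_presented_group)
  show ?thesis
  proof (cases "0 \<le> z")
    case False
    have "cls R (gen_pow x z) = (inv\<^bsub>PG R\<^esub> cls R [(x, True)]) [^]\<^bsub>PG R\<^esub> nat (- z)"
      using False unfolding gen_pow_def by (simp only: pres_class_replicate) (simp add: pres_class_False)
    also have "\<dots> = inv\<^bsub>PG R\<^esub> (cls R [(x, True)] [^]\<^bsub>PG R\<^esub> nat (- z))"
      by (rule nat_pow_inv) (rule pres_class_closed)
    finally show ?thesis using False unfolding int_pow_def2 by (simp only: if_True not_le)
  next
    case True
    then show ?thesis unfolding int_pow_def2 gen_pow_def by (simp only: pres_class_replicate) simp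
  qed
qed

section \<open>Crossed maps between presentations\<close>

text \<open>A machine reads words over \<open>'g\<close> in a state of \<open>S\<close> and writes words over \<open>'h\<close>;
  reading an inverse letter undoes the corresponding forward transition.\<close>

fun mstate :: "('s \<Rightarrow> 'g \<Rightarrow> 's) \<Rightarrow> ('s \<Rightarrow> 'g \<Rightarrow> 's) \<Rightarrow> 's \<Rightarrow> 'g word \<Rightarrow> 's" where
  "mstate d di s [] = s"
| "mstate d di s ((x, e) # w) = mstate d di (if e then d s x else di s x) w"

fun mout :: "('s \<Rightarrow> 'g \<Rightarrow> 's) \<Rightarrow> ('s \<Rightarrow> 'g \<Rightarrow> 's) \<Rightarrow> ('s \<Rightarrow> 'g \<Rightarrow> 'h word) \<Rightarrow> 's \<Rightarrow> 'g word \<Rightarrow> 'h word" where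
  "mout d di f s [] = []"
| "mout d di f s ((x, e) # w) =
     (if e then f s x @ mout d di f (d s x) w
      else inv_word (f (di s x) x) @ mout d di f (di s x) w)"

lemma mstate_append: "mstate d di s (u @ v) = mstate d di (mstate d di s u) v"
  by (induction u arbitrary: s) auto

lemma mout_append: "mout d di f s (u @ v) = mout d di f s u @ mout d di f (mstate d di s u) v"
  by (induction u arbitrary: s) auto

locale machine =
  fixes R :: "('g word \<times> 'g word) set" and R' :: "('h word \<times> 'h word) set"
    and S :: "'s set" and d di :: "'s \<Rightarrow> 'g \<Rightarrow> 's" and f :: "'s \<Rightarrow> 'g \<Rightarrow> 'h word" and s0 :: 's
  assumes fin: "finite S" and s0: "s0 \<in> S"
    and d_in: "s \<in> S \<Longrightarrow> d s x \<in> S" and di_in: "s \<in> S \<Longrightarrow> di s x \<in> S"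
    and di_d: "s \<in> S \<Longrightarrow> di (d s x) x = s" and d_di: "s \<in> S \<Longrightarrow> d (di s x) x = s"
    and state_rel: "s \<in> S \<Longrightarrow> (u, v) \<in> R \<Longrightarrow> mstate d di s u = mstate d di s v"
    and out_rel: "s \<in> S \<Longrightarrow> (u, v) \<in> R \<Longrightarrow> pres_eq R' (mout d di f s u) (mout d di f s v)"
begin

abbreviation "st \<equiv> mstate d di"
abbreviation "ou \<equiv> mout d di f"

lemma st_in: "s \<in> S \<Longrightarrow> st s w \<in> S"
proof (induction w arbitrary: s)
  case (Cons l w)
  then show ?case by (cases l) (auto simp: d_in di_in)
qed simp

text \<open>The state together with the class written so far. Letters act invertibly on this
  product, so \<open>run_cong\<close> yields the congruence of states and that of outputs in one
  go.\<close>

definition mstep :: "'s \<times> 'h word set \<Rightarrow> 'g \<times> bool \<Rightarrow> 's \<times> 'h word set" where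
  "mstep = (\<lambda>(s, Y) (x, e). (if e then d s x else di s x,
     Y \<otimes>\<^bsub>PG R'\<^esub> cls R' (if e then f s x else inv_word (f (di s x) x))))"

lemma foldl_mstep:
  "foldl mstep (s, cls R' y) w = (st s w, cls R' (y @ ou s w))"
proof (induction w arbitrary: s y)
  case (Cons l w)
  obtain x e where l: "l = (x, e)" by (cases l)
  show ?case using Cons[of _ "y @ (if e then f s x else inv_word (f (di s x) x))"]
    by (simp add: l mstep_def mult_pres_class)
qed simp

lemma machine_cong:
  assumes "pres_eq R u v" "s \<in> S"
  shows "st s u = st s v" and "pres_eq R' (ou s u) (ou s v)"
proof -
  let ?S = "S \<times> carrier (PG R')"
  have "foldl mstep (s, cls R' []) u = foldl mstep (s, cls R' []) v"
  proof (rule run_cong[where S = ?S, OF _ _ _ assms(1)])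
    fix p l assume "p \<in> ?S"
    then obtain s y where p: "p = (s, cls R' y)" "s \<in> S" by (auto simp: carrier_presented)
    show "mstep p l \<in> ?S"
      by (cases l) (auto simp: p mstep_def d_in di_in mult_pres_class)
  next
    fix p x e assume "p \<in> ?S"
    then obtain s y where p: "p = (s, cls R' y)" "s \<in> S" by (auto simp: carrier_presented)
    have "pres_eq R' (y @ w @ inv_word w) y" for w
      using pres_eq.cong[OF pres_eq.refl[of R' y] inv_word_right[of R' w]] by simp
    moreover have "pres_eq R' (y @ inv_word w @ w) y" for w
      using pres_eq.cong[OF pres_eq.refl[of R' y] inv_word_left[of R' w]] by simp
    ultimately show "mstep (mstep p (x, e)) (x, \<not> e) = p"
      by (auto simp: p mstep_def mult_pres_class pres_class_eq_iff di_d d_di)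
  next
    fix p u v assume "p \<in> ?S" and uv: "(u, v) \<in> R"
    then obtain s y where p: "p = (s, cls R' y)" "s \<in> S" by (auto simp: carrier_presented)
    show "foldl mstep p u = foldl mstep p v"
      using state_rel[OF p(2) uv] out_rel[OF p(2) uv]
      by (auto simp: p foldl_mstep pres_class_append pres_class_eq_iff[symmetric])
  qed (use assms in auto)
  then show "st s u = st s v" and "pres_eq R' (ou s u) (ou s v)"
    by (auto simp: foldl_mstep pres_class_eq_iff)
qed

lemma st_inv_word: "s \<in> S \<Longrightarrow> st (st s w) (inv_word w) = s"
  using machine_cong(1)[OF inv_word_right[of R w], of s] by (simp add: mstate_append)

definition "stab = {cls R w | w. st s0 w = s0}"

definition mmap :: "'g word set \<Rightarrow> 'h word set" where
  "mmap X = cls R' (ou s0 (SOME w. X = cls R w))"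

lemma mmap: "mmap (cls R w) = cls R' (ou s0 w)"
proof -
  have "cls R w = cls R (SOME v. cls R w = cls R v)"
    by (rule someI[of "\<lambda>v. cls R w = cls R v"]) simp
  then show ?thesis
    using machine_cong(2)[OF _ s0] by (simp add: mmap_def pres_class_eq_iff pres_eq.sym)
qed

lemma stab_iff: "cls R w \<in> stab \<longleftrightarrow> st s0 w = s0"
proof
  assume "cls R w \<in> stab"
  then obtain v where "pres_eq R w v" "st s0 v = s0" by (auto simp: stab_def pres_class_eq_iff)
  then show "st s0 w = s0" using machine_cong(1)[of w v s0] s0 by simp
qed (auto simp: stab_def)

lemma stab_subgroup: "subgroup stab (PG R)"
proof
  show "stab \<subseteq> carrier (PG R)" by (auto simp: stab_def)
  show "\<one>\<^bsub>PG R\<^esub> \<in> stab" by (simp add: one_presented stab_iff)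
  fix X Y assume "X \<in> stab" "Y \<in> stab"
  then obtain u v where "X = cls R u" "Y = cls R v" "st s0 u = s0" "st s0 v = s0"
    by (auto simp: stab_def)
  then show "X \<otimes>\<^bsub>PG R\<^esub> Y \<in> stab" by (simp add: mult_pres_class stab_iff mstate_append)
next
  fix X assume "X \<in> stab"
  then obtain u where "X = cls R u" "st s0 u = s0" by (auto simp: stab_def)
  then show "inv\<^bsub>PG R\<^esub> X \<in> stab"
    using st_inv_word[OF s0, of u] by (simp add: inv_pres_class stab_iff)
qed

lemma stab_finite_index: "finite (rcosets\<^bsub>PG R\<^esub> stab)"
proof -
  \<comment> \<open>A right coset is determined by the state to which its members lead from
    \<open>s0\<close>, so the index is at most the number of states.\<close>
  have "stab #>\<^bsub>PG R\<^esub> cls R w = {cls R u | u. st s0 u = st s0 w}" for w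
  proof safe
    fix X assume "X \<in> stab #>\<^bsub>PG R\<^esub> cls R w"
    then obtain v where "X = cls R (v @ w)" "st s0 v = s0"
      by (auto simp: r_coset_def stab_def mult_pres_class)
    then show "\<exists>u. X = cls R u \<and> st s0 u = st s0 w" by (auto simp: mstate_append)
  next
    fix u assume u: "st s0 u = st s0 w"
    have "pres_eq R u ((u @ inv_word w) @ w)"
      using pres_eq.sym[OF pres_eq.cong[OF pres_eq.refl[of R u] inv_word_left[of R w]]] by simp
    moreover have "cls R (u @ inv_word w) \<in> stab"
      by (simp add: stab_iff mstate_append u st_inv_word s0)
    ultimately show "cls R u \<in> stab #>\<^bsub>PG R\<^esub> cls R w"
      unfolding r_coset_def by (simp only: UN_iff singleton_iff) (rule bexI, simp_all add: mult_pres_class pres_class_eq_iff)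
  qed
  then have "rcosets\<^bsub>PG R\<^esub> stab \<subseteq> (\<lambda>s. {cls R u | u. st s0 u = s}) ` S"
    by (auto simp: RCOSETS_def carrier_presented st_in s0)
  then show ?thesis using fin finite_surj by blast
qed

end

section \<open>Machines that invert each other up to a correction\<close>

lemma (in group) mult_inv_cancel_middle:
  assumes "x \<in> carrier G" "y \<in> carrier G" "z \<in> carrier G"
  shows "(x \<otimes> inv y) \<otimes> (y \<otimes> z) = x \<otimes> z"
  using assms by (simp add: m_assoc) (simp add: m_assoc[symmetric])

text \<open>\<open>loop\<close> keeps each output in the stabilizer of the other base state.
  \<open>comp\<close> says that the composite of the two machines fixes every letter up to the
  coboundary of \<open>c\<close>; since \<open>c s0\<close> is empty, nothing of it is left on the
  stabilizer.\<close>

locale machine_pair =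
  M: machine R R' S d di f s0 + M': machine R' R S' d' di' f' s0'
  for R :: "('g word \<times> 'g word) set" and R' :: "('h word \<times> 'h word) set"
    and S :: "'s set" and d di f s0 and S' :: "'t set" and d' di' f' s0' +
  fixes c :: "'s \<Rightarrow> 'g word" and c' :: "'t \<Rightarrow> 'h word"
  assumes c0: "c s0 = []" "c' s0' = []"
    and loop: "s \<in> S \<Longrightarrow> mstate d' di' s0' (f s x) = s0'"
    and loop': "s' \<in> S' \<Longrightarrow> mstate d di s0 (f' s' x') = s0"
    and comp: "s \<in> S \<Longrightarrow>
      pres_eq R (mout d' di' f' s0' (f s x)) (c s @ [(x, True)] @ inv_word (c (d s x)))"
    and comp': "s' \<in> S' \<Longrightarrow>
      pres_eq R' (mout d di f s0 (f' s' x')) (c' s' @ [(x', True)] @ inv_word (c' (d' s' x')))"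
begin

lemma sym_pair: "machine_pair R' R S' d' di' f' s0' S d di f s0 c' c"
  apply unfold_locales
  apply (fact c0)
  apply (fact c0)
  apply (erule loop')
  apply (erule loop)
  apply (erule comp')
  apply (erule comp)
  done

lemma st_loop: "s \<in> S \<Longrightarrow> M'.st s0' (M.ou s w) = s0'"
proof (induction w arbitrary: s)
  case (Cons l w)
  obtain x e where l: "l = (x, e)" by (cases l)
  have "M'.st s0' (inv_word (f (di s x) x)) = s0'"
    using M'.st_inv_word[OF M'.s0, of "f (di s x) x"] loop[of "di s x" x] M.di_in[OF Cons.prems]
    by simp
  then show ?case using Cons M.d_in M.di_in loop by (auto simp: l mstate_append)
qed simp

lemma mout_inv_word:
  assumes "s \<in> S" shows "pres_eq R' (M.ou (M.st s w) (inv_word w)) (inv_word (M.ou s w))"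
proof -
  have "pres_eq R' (M.ou s (w @ inv_word w)) []"
    using M.machine_cong(2)[OF inv_word_right[of R w] assms] by simp
  then have "pres_eq R' (inv_word (M.ou s w) @ (M.ou s w @ M.ou (M.st s w) (inv_word w))) (inv_word (M.ou s w) @ [])"
    unfolding mout_append by (intro pres_eq.cong pres_eq.refl)
  moreover have "pres_eq R' (inv_word (M.ou s w) @ (M.ou s w @ M.ou (M.st s w) (inv_word w))) (M.ou (M.st s w) (inv_word w))"
    using pres_eq.cong[OF inv_word_left[of R' "M.ou s w"] pres_eq.refl] by fastforce
  ultimately show ?thesis by (metis append_Nil2 pres_eq.sym pres_eq.trans)
qed

end

context machine_pair begin

text \<open>The corrections of consecutive letters cancel. An inverse letter writes the inverse of a
  forward output, and the other machine turns it into an inverse again by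
  \<open>mout_inv_word\<close>.\<close>

lemma out_out:
  assumes "s \<in> S"
  shows "pres_eq R (M'.ou s0' (M.ou s w)) (c s @ w @ inv_word (c (M.st s w)))"
  using assms
proof (induction w arbitrary: s)
  case Nil
  then show ?case by (simp add: pres_eq.sym[OF inv_word_right])
next
  case (Cons l w)
  interpret G: group "PG R" by (rule group_presented_group)
  interpret M'M: machine_pair R' R S' d' di' f' s0' S d di f s0 c' c by (rule sym_pair)
  obtain x e where l: "l = (x, e)" by (cases l)
  let ?p = "cls R"
  have out: "?p (M'.ou s0' (f s x)) = ?p (c s) \<otimes>\<^bsub>PG R\<^esub> ?p [(x, True)] \<otimes>\<^bsub>PG R\<^esub> ?p (inv_word (c (d s x)))"
    if "s \<in> S" for s using comp[OF that, of x]
    by (simp only: mult_pres_class pres_class_eq_iff append_assoc)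
  show ?case
  proof (cases e)
    case True
    have IH: "?p (M'.ou s0' (M.ou (d s x) w)) = ?p (c (d s x)) \<otimes>\<^bsub>PG R\<^esub> ?p w \<otimes>\<^bsub>PG R\<^esub> ?p (inv_word (c (M.st (d s x) w)))"
      using Cons.IH[OF M.d_in[OF Cons.prems]]
      by (simp only: mult_pres_class pres_class_eq_iff append_assoc)
    have "?p (M'.ou s0' (M.ou s (l # w))) = ?p (M'.ou s0' (f s x)) \<otimes>\<^bsub>PG R\<^esub> ?p (M'.ou s0' (M.ou (d s x) w))"
      using True loop[OF Cons.prems] by (simp add: l mout_append pres_class_append)
    also have "\<dots> = ?p (c s) \<otimes>\<^bsub>PG R\<^esub> ?p [(x, True)] \<otimes>\<^bsub>PG R\<^esub> ?p w \<otimes>\<^bsub>PG R\<^esub> ?p (inv_word (c (M.st (d s x) w)))"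
      using G.mult_inv_cancel_middle[of "?p (c s) \<otimes>\<^bsub>PG R\<^esub> ?p [(x, True)]" "?p (c (d s x))"
        "?p w \<otimes>\<^bsub>PG R\<^esub> ?p (inv_word (c (M.st (d s x) w)))"]
      by (simp add: out IH Cons.prems inv_pres_class[symmetric] G.m_assoc)
    also have "\<dots> = ?p (c s @ (l # w) @ inv_word (c (M.st s (l # w))))"
      using True by (simp add: l mult_pres_class)
    finally show ?thesis by (simp add: pres_class_eq_iff)
  next
    case False
    let ?s = "di s x"
    have s: "?s \<in> S" "d ?s x = s" using Cons.prems by (auto simp: M.di_in M.d_di)
    have IH: "?p (M'.ou s0' (M.ou ?s w)) = ?p (c ?s) \<otimes>\<^bsub>PG R\<^esub> ?p w \<otimes>\<^bsub>PG R\<^esub> ?p (inv_word (c (M.st ?s w)))"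
      using Cons.IH[OF s(1)]
      by (simp only: mult_pres_class pres_class_eq_iff append_assoc)
    have inv: "M'.st s0' (inv_word (f ?s x)) = s0'"
      using M'.st_inv_word[OF M'.s0, of "f ?s x"] loop[OF s(1), of x] by simp
    have "pres_eq R (M'.ou (M'.st s0' (f ?s x)) (inv_word (f ?s x))) (inv_word (M'.ou s0' (f ?s x)))"
      by (rule M'M.mout_inv_word[OF M'.s0])
    then have i2: "?p (M'.ou s0' (inv_word (f ?s x))) = inv\<^bsub>PG R\<^esub> ?p (M'.ou s0' (f ?s x))"
      using loop[OF s(1), of x] by (simp add: inv_pres_class pres_class_eq_iff)
    have "?p (M'.ou s0' (M.ou s (l # w))) = ?p (M'.ou s0' (inv_word (f ?s x))) \<otimes>\<^bsub>PG R\<^esub> ?p (M'.ou s0' (M.ou ?s w))"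
      using False inv by (simp add: l mout_append pres_class_append)
    also have "\<dots> = ?p (c s) \<otimes>\<^bsub>PG R\<^esub> ?p [(x, False)] \<otimes>\<^bsub>PG R\<^esub> ?p w \<otimes>\<^bsub>PG R\<^esub> ?p (inv_word (c (M.st ?s w)))"
      using G.mult_inv_cancel_middle[of "?p (c s) \<otimes>\<^bsub>PG R\<^esub> inv\<^bsub>PG R\<^esub> ?p [(x, True)]" "?p (c ?s)"
        "?p w \<otimes>\<^bsub>PG R\<^esub> ?p (inv_word (c (M.st ?s w)))"]
      by (simp add: i2 out[OF s(1)] IH s(2) pres_class_False inv_pres_class[symmetric] G.m_assoc G.inv_mult_group)
    also have "\<dots> = ?p (c s @ (l # w) @ inv_word (c (M.st s (l # w))))"
      using False by (simp add: l mult_pres_class)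
    finally show ?thesis by (simp add: pres_class_eq_iff)
  qed
qed

lemma mmap_hom: "M.mmap \<in> hom (PG R\<lparr>carrier := M.stab\<rparr>) (PG R'\<lparr>carrier := M'.stab\<rparr>)"
proof (rule homI)
  fix X assume "X \<in> carrier (PG R\<lparr>carrier := M.stab\<rparr>)"
  then obtain u where "X = cls R u" "M.st s0 u = s0" by (auto simp: M.stab_def)
  then show "M.mmap X \<in> carrier (PG R'\<lparr>carrier := M'.stab\<rparr>)"
    by (simp add: M.mmap M'.stab_iff st_loop M.s0)
next
  fix X Y assume "X \<in> carrier (PG R\<lparr>carrier := M.stab\<rparr>)" "Y \<in> carrier (PG R\<lparr>carrier := M.stab\<rparr>)"
  then obtain u v where "X = cls R u" "M.st s0 u = s0" "Y = cls R v" "M.st s0 v = s0"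
    by (auto simp: M.stab_def)
  then show "M.mmap (X \<otimes>\<^bsub>PG R\<lparr>carrier := M.stab\<rparr>\<^esub> Y) =
    M.mmap X \<otimes>\<^bsub>PG R'\<lparr>carrier := M'.stab\<rparr>\<^esub> M.mmap Y"
    by (simp add: M.mmap mult_pres_class mout_append)
qed

lemma mmap_mmap: "X \<in> M.stab \<Longrightarrow> M'.mmap (M.mmap X) = X"
proof -
  assume "X \<in> M.stab"
  then obtain w where w: "X = cls R w" "M.st s0 w = s0" by (auto simp: M.stab_def)
  show ?thesis using out_out[OF M.s0, of w] by (simp add: w M.mmap M'.mmap pres_class_eq_iff c0)
qed

end

context machine_pair begin

lemma stab_iso:
  "PG R\<lparr>carrier := M.stab\<rparr> \<cong> PG R'\<lparr>carrier := M'.stab\<rparr>"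
proof -
  interpret M'M: machine_pair R' R S' d' di' f' s0' S d di f s0 c' c by (rule sym_pair)
  have "bij_betw M.mmap M.stab M'.stab"
    using mmap_hom M'M.mmap_hom mmap_mmap M'M.mmap_mmap
    by (intro bij_betwI[where g = M'.mmap]) (simp_all add: hom_def)
  then have "M.mmap \<in> iso (PG R\<lparr>carrier := M.stab\<rparr>) (PG R'\<lparr>carrier := M'.stab\<rparr>)"
    using mmap_hom by (simp add: iso_def)
  then show ?thesis unfolding is_iso_def by blast
qed

theorem machine_commensurable: "commensurable (PG R) (PG R')"
  unfolding commensurable_def
  by (intro exI conjI) (rule M.stab_subgroup M.stab_finite_index M'.stab_subgroup M'.stab_finite_index stab_iso)+

theorem machine_iso:
  assumes "S = {s0}" "S' = {s0'}"
  shows "PG R \<cong> PG R'"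
proof -
  have "M.st s0 w = s0" "M'.st s0' w' = s0'" for w w'
    using M.st_in[OF M.s0] M'.st_in[OF M'.s0] assms by auto
  then have "M.stab = carrier (PG R)" "M'.stab = carrier (PG R')"
    by (auto simp: M.stab_def M'.stab_def carrier_presented)
  then show ?thesis using stab_iso by simp
qed

end

section \<open>Word metrics and quasi-isometries\<close>

locale gen_group = group G for G (structure) +
  fixes S assumes gens: "finite_gen_set G S"
begin

abbreviation "wl \<equiv> word_length G S"
abbreviation "wd \<equiv> word_dist G S"
abbreviation "letters \<equiv> S \<union> m_inv G ` S"
abbreviation "wprod ws \<equiv> foldr (\<otimes>) ws \<one>"

lemma S_carrier: "S \<subseteq> carrier G" and finS: "finite S" and gen: "generate G S = carrier G"
  using gens by (auto simp: finite_gen_set_def)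

lemma letters_carrier: "letters \<subseteq> carrier G"
  using S_carrier by auto

lemma letters_inv: "x \<in> letters \<Longrightarrow> inv x \<in> letters"
  using S_carrier by auto

lemma letters_inv_set: "set ws \<subseteq> letters \<Longrightarrow> set (rev (map (m_inv G) ws)) \<subseteq> letters"
proof
  fix x assume "set ws \<subseteq> letters" "x \<in> set (rev (map (m_inv G) ws))"
  then obtain y where "y \<in> letters" "x = inv y" by (metis image_iff set_map set_rev subsetD)
  then show "x \<in> letters" using letters_inv by simp
qed

lemma wprod_closed: "set ws \<subseteq> letters \<Longrightarrow> wprod ws \<in> carrier G"
  using letters_carrier by (induction ws) auto

lemma wprod_append: "set us \<subseteq> letters \<Longrightarrow> set ws \<subseteq> letters \<Longrightarrow> wprod (us @ ws) = wprod us \<otimes> wprod ws"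
proof (induction us)
  case (Cons u us)
  have "u \<in> carrier G" using Cons.prems letters_carrier by auto
  then show ?case using Cons wprod_closed by (auto simp: m_assoc)
qed (simp add: wprod_closed)

lemma wprod_inv: "set ws \<subseteq> letters \<Longrightarrow> wprod (rev (map (m_inv G) ws)) = inv (wprod ws)"
proof (induction ws)
  case (Cons w ws)
  have w: "w \<in> carrier G" "w \<in> letters" using Cons.prems letters_carrier by auto
  have s: "set (rev (map (m_inv G) ws)) \<subseteq> letters" using Cons.prems letters_inv_set[of ws] by auto
  have s2: "set [inv w] \<subseteq> letters" using letters_inv[OF w(2)] by simp
  have "wprod (rev (map (m_inv G) (w # ws))) = wprod (rev (map (m_inv G) ws) @ [inv w])" by simp
  also have "\<dots> = wprod (rev (map (m_inv G) ws)) \<otimes> wprod [inv w]"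
    by (rule wprod_append[OF s s2])
  also have "\<dots> = inv (wprod (w # ws))"
    using Cons w wprod_closed by (simp add: inv_mult_group)
  finally show ?case .
qed simp

lemma ex_word: "g \<in> carrier G \<Longrightarrow> \<exists>ws. set ws \<subseteq> letters \<and> wprod ws = g"
  unfolding gen[symmetric]
proof (induction rule: generate.induct)
  case one
  then show ?case by (intro exI[of _ "[]"]) auto
next
  case (incl h)
  then show ?case using S_carrier by (intro exI[of _ "[h]"]) auto
next
  case (inv h)
  then show ?case using S_carrier by (intro exI[of _ "[inv h]"]) auto
next
  case (eng h1 h2)
  then obtain us vs where "set us \<subseteq> letters" "wprod us = h1" "set vs \<subseteq> letters" "wprod vs = h2" by auto
  then show ?case by (intro exI[of _ "us @ vs"]) (auto simp: wprod_append[symmetric])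
qed

lemma wl_le: "set ws \<subseteq> letters \<Longrightarrow> wl (wprod ws) \<le> length ws"
  unfolding word_length_def by (rule Least_le) auto

lemma wl_attained:
  assumes "g \<in> carrier G"
  obtains ws where "set ws \<subseteq> letters" "wprod ws = g" "length ws = wl g"
proof -
  have "\<exists>n ws. length ws = n \<and> set ws \<subseteq> letters \<and> wprod ws = g" using ex_word[OF assms] by blast
  from LeastI_ex[OF this] show ?thesis unfolding word_length_def[symmetric] using that by blast
qed

lemma wl_one: "wl \<one> = 0"
  using wl_le[of "[]"] by simp

lemma wl_mult:
  assumes "g \<in> carrier G" "h \<in> carrier G" shows "wl (g \<otimes> h) \<le> wl g + wl h"
proof -
  obtain us where us: "set us \<subseteq> letters" "wprod us = g" "length us = wl g" by (rule wl_attained[OF assms(1)])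
  obtain vs where vs: "set vs \<subseteq> letters" "wprod vs = h" "length vs = wl h" by (rule wl_attained[OF assms(2)])
  show ?thesis using wl_le[of "us @ vs"] us vs by (simp add: wprod_append del: foldr_append)
qed

lemma wl_inv: assumes "g \<in> carrier G" shows "wl (inv g) = wl g"
proof -
  have le: "wl (inv g) \<le> wl g" if "g \<in> carrier G" for g
  proof -
    obtain us where us: "set us \<subseteq> letters" "wprod us = g" "length us = wl g" by (rule wl_attained[OF \<open>g \<in> carrier G\<close>])
    from wl_le[OF letters_inv_set[OF us(1)]] show ?thesis by (simp add: wprod_inv[OF us(1)] us)
  qed
  show ?thesis using le[OF assms] le[of "inv g"] assms by simp
qed

lemma wd_nonneg: "0 \<le> wd g h"
  by (simp add: word_dist_def)

lemma wd_self: "g \<in> carrier G \<Longrightarrow> wd g g = 0"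
  by (simp add: word_dist_def wl_one)

lemma wd_sym: assumes "g \<in> carrier G" "h \<in> carrier G" shows "wd g h = wd h g"
  using wl_inv[of "inv g \<otimes> h"] assms by (simp add: word_dist_def inv_mult_group)

lemma wd_triangle:
  assumes "g \<in> carrier G" "h \<in> carrier G" "k \<in> carrier G" shows "wd g k \<le> wd g h + wd h k"
proof -
  have "(inv g \<otimes> h) \<otimes> (inv h \<otimes> k) = inv g \<otimes> k"
    using assms by (simp add: m_assoc) (simp add: m_assoc[symmetric])
  then show ?thesis using wl_mult[of "inv g \<otimes> h" "inv h \<otimes> k"] assms by (simp add: word_dist_def)
qed

lemma wd_mult: "g \<in> carrier G \<Longrightarrow> h \<in> carrier G \<Longrightarrow> wd g (g \<otimes> h) = wl h"
  by (simp add: word_dist_def m_assoc[symmetric])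

end

section \<open>Coarse inverses, composition and construction of quasi-isometries\<close>

definition pseudometric :: "'a set \<Rightarrow> ('a \<Rightarrow> 'a \<Rightarrow> real) \<Rightarrow> bool" where
  "pseudometric X d \<longleftrightarrow> (\<forall>x\<in>X. \<forall>y\<in>X. 0 \<le> d x y \<and> d x y = d y x \<and> d x x = 0 \<and>
     (\<forall>z\<in>X. d x z \<le> d x y + d y z))"

lemma (in gen_group) pseudometric_wd: "pseudometric (carrier G) wd"
  unfolding pseudometric_def using wd_nonneg wd_sym wd_self wd_triangle by blast

lemma qi_inverse:
  assumes qi: "quasi_isometric_spaces X d Y e" and Y: "pseudometric Y e"
  obtains f g K C where "f \<in> X \<rightarrow> Y" "g \<in> Y \<rightarrow> X" "K \<ge> 1" "C \<ge> 0"
    "\<And>x x'. x \<in> X \<Longrightarrow> x' \<in> X \<Longrightarrow> e (f x) (f x') \<le> K * d x x' + C"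
    "\<And>y y'. y \<in> Y \<Longrightarrow> y' \<in> Y \<Longrightarrow> d (g y) (g y') \<le> K * e y y' + C"
    "\<And>x. x \<in> X \<Longrightarrow> d (g (f x)) x \<le> C"
    "\<And>y. y \<in> Y \<Longrightarrow> e (f (g y)) y \<le> C"
proof -
  obtain f K C where f: "f \<in> X \<rightarrow> Y" and K: "K \<ge> 1" and C: "C \<ge> 0"
    and lo: "\<And>x x'. x \<in> X \<Longrightarrow> x' \<in> X \<Longrightarrow> d x x' / K - C \<le> e (f x) (f x')"
    and up: "\<And>x x'. x \<in> X \<Longrightarrow> x' \<in> X \<Longrightarrow> e (f x) (f x') \<le> K * d x x' + C"
    and su: "\<And>y. y \<in> Y \<Longrightarrow> \<exists>x\<in>X. e (f x) y \<le> C"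
    using qi unfolding quasi_isometric_spaces_def by blast
  have lo': "d x x' \<le> K * (e (f x) (f x') + C)" if "x \<in> X" "x' \<in> X" for x x'
    using lo[OF that] K by (simp add: field_simps)
  obtain g where g: "\<And>y. y \<in> Y \<Longrightarrow> g y \<in> X \<and> e (f (g y)) y \<le> C" using su by metis
  \<comment> \<open>Passing from distances in \<open>Y\<close> back to \<open>X\<close> multiplies
    errors by \<open>K\<close>. For \<open>g\<close> the error is \<open>C\<close> at each of two
    points plus the additive constant of \<open>f\<close>, hence \<open>3 * K * C\<close>.\<close>
  define C' where "C' = 3 * K * C + C"
  have CK: "0 \<le> K * C" using K C by simp
  have C': "C \<le> C'" "K * (C + C) \<le> C'" using K C CK by (simp_all add: C'_def algebra_simps)
  show ?thesis
  proof (rule that[of f g K C'])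
    show "g \<in> Y \<rightarrow> X" using g by auto
    show "0 \<le> C'" using C C'(1) by simp
    show "e (f x) (f x') \<le> K * d x x' + C'" if "x \<in> X" "x' \<in> X" for x x' using up[OF that] C' by linarith
    show "e (f (g y)) y \<le> C'" if "y \<in> Y" for y using g[OF that] C' by linarith
    show "d (g (f x)) x \<le> C'" if "x \<in> X" for x
    proof -
      have "f x \<in> Y" using f that by auto
      then have "K * (e (f (g (f x))) (f x) + C) \<le> K * (C + C)" using g[of "f x"] K by (intro mult_left_mono) auto
      then show ?thesis using lo'[of "g (f x)" x] g[OF \<open>f x \<in> Y\<close>] that C'(2) by linarith
    qed
    show "d (g y) (g y') \<le> K * e y y' + C'" if y: "y \<in> Y" "y' \<in> Y" for y y'
    proof -
      have "f (g y) \<in> Y" "f (g y') \<in> Y" using f g y by auto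
      then have "e (f (g y)) (f (g y')) \<le> e (f (g y)) y + (e y y' + e y' (f (g y')))"
        using Y y unfolding pseudometric_def by (smt (verit, best))
      moreover have "e y' (f (g y')) = e (f (g y')) y'" using Y y \<open>f (g y') \<in> Y\<close> unfolding pseudometric_def by blast
      ultimately have "e (f (g y)) (f (g y')) \<le> e y y' + 2 * C" using g[OF y(1)] g[OF y(2)] by linarith
      then have "K * (e (f (g y)) (f (g y')) + C) \<le> K * (e y y' + 3 * C)" using K by (intro mult_left_mono) auto
      also have "\<dots> \<le> K * e y y' + C'" using C by (simp add: C'_def algebra_simps)
      finally show ?thesis using lo'[of "g y" "g y'"] g[OF y(1)] g[OF y(2)] by linarith
    qed
  qed (use f K in auto)
qed

lemma qi_sym:
  assumes qi: "quasi_isometric_spaces X d Y e" and Y: "pseudometric Y e"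
  shows "quasi_isometric_spaces Y e X d"
proof -
  obtain f g K C where f: "f \<in> X \<rightarrow> Y" and g: "g \<in> Y \<rightarrow> X" and K: "K \<ge> 1" and C: "C \<ge> 0"
    and fL: "\<And>x x'. x \<in> X \<Longrightarrow> x' \<in> X \<Longrightarrow> e (f x) (f x') \<le> K * d x x' + C"
    and gL: "\<And>y y'. y \<in> Y \<Longrightarrow> y' \<in> Y \<Longrightarrow> d (g y) (g y') \<le> K * e y y' + C"
    and gf: "\<And>x. x \<in> X \<Longrightarrow> d (g (f x)) x \<le> C"
    and fg: "\<And>y. y \<in> Y \<Longrightarrow> e (f (g y)) y \<le> C"
    by (rule qi_inverse[OF qi Y]) (rule that)
  show ?thesis unfolding quasi_isometric_spaces_def
  proof (rule exI[of _ g], rule exI[of _ K], rule exI[of _ "3 * C"], intro conjI ballI)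
    fix y y' assume y: "y \<in> Y" "y' \<in> Y"
    then have i: "f (g y) \<in> Y" "f (g y') \<in> Y" "g y \<in> X" "g y' \<in> X" using f g by auto
    have "e y y' \<le> e y (f (g y)) + e (f (g y)) y'" "e (f (g y)) y' \<le> e (f (g y)) (f (g y')) + e (f (g y')) y'"
      "e y (f (g y)) = e (f (g y)) y"
      using Y y i unfolding pseudometric_def by blast+
    then have "e y y' \<le> K * d (g y) (g y') + 3 * C" using fg[OF y(1)] fg[OF y(2)] fL[OF i(3,4)] by linarith
    also have "\<dots> \<le> K * (d (g y) (g y') + 3 * C)" using mult_right_mono[OF K, of "3 * C"] C by (simp add: distrib_left)
    finally have "e y y' / K \<le> d (g y) (g y') + 3 * C" using K by (simp add: divide_le_eq mult.commute)
    then show "e y y' / K - 3 * C \<le> d (g y) (g y')" by simp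
    show "d (g y) (g y') \<le> K * e y y' + 3 * C" using gL[OF y] C by linarith
  next
    fix x assume "x \<in> X"
    then have "f x \<in> Y" "d (g (f x)) x \<le> 3 * C" using f gf[of x] C by auto
    then show "\<exists>y\<in>Y. d (g y) x \<le> 3 * C" by blast
  qed (use g K C in auto)
qed

lemma qi_trans:
  assumes "quasi_isometric_spaces X d Y e" "quasi_isometric_spaces Y e Z h"
    and Z: "pseudometric Z h"
  shows "quasi_isometric_spaces X d Z h"
proof -
  obtain f K C where f: "f \<in> X \<rightarrow> Y" and K: "K \<ge> 1" and C: "C \<ge> 0"
    and lo: "\<And>x x'. x \<in> X \<Longrightarrow> x' \<in> X \<Longrightarrow> d x x' / K - C \<le> e (f x) (f x')"
    and up: "\<And>x x'. x \<in> X \<Longrightarrow> x' \<in> X \<Longrightarrow> e (f x) (f x') \<le> K * d x x' + C"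
    and sur: "\<And>y. y \<in> Y \<Longrightarrow> \<exists>x\<in>X. e (f x) y \<le> C"
    using assms(1) unfolding quasi_isometric_spaces_def by blast
  obtain g L D where g: "g \<in> Y \<rightarrow> Z" and L: "L \<ge> 1" and D: "D \<ge> 0"
    and lo': "\<And>x x'. x \<in> Y \<Longrightarrow> x' \<in> Y \<Longrightarrow> e x x' / L - D \<le> h (g x) (g x')"
    and up': "\<And>x x'. x \<in> Y \<Longrightarrow> x' \<in> Y \<Longrightarrow> h (g x) (g x') \<le> L * e x x' + D"
    and sur': "\<And>y. y \<in> Z \<Longrightarrow> \<exists>x\<in>Y. h (g x) y \<le> D"
    using assms(2) unfolding quasi_isometric_spaces_def by blast
  have LC: "C \<le> L * C" "0 \<le> L * C" using mult_right_mono[OF L C] C L by simp_all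
  show ?thesis unfolding quasi_isometric_spaces_def
  proof (rule exI[of _ "g \<circ> f"], rule exI[of _ "K * L"], rule exI[of _ "L * C + 2 * D"], intro conjI ballI)
    show "g \<circ> f \<in> X \<rightarrow> Z" using f g by auto
    show "1 \<le> K * L" using K L mult_mono[of 1 K 1 L] by simp
    show "0 \<le> L * C + 2 * D" using LC D by simp
    fix x x' assume x: "x \<in> X" "x' \<in> X"
    have fx: "f x \<in> Y" "f x' \<in> Y" using f x by auto
    have "h (g (f x)) (g (f x')) \<le> L * e (f x) (f x') + D" using up'[OF fx] .
    also have "\<dots> \<le> L * (K * d x x' + C) + D"
      using up[OF x] L by (intro add_right_mono mult_left_mono) auto
    finally show "h ((g \<circ> f) x) ((g \<circ> f) x') \<le> K * L * d x x' + (L * C + 2 * D)"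
      using D by (simp add: algebra_simps)
    have "(d x x' / K - C) / L - D \<le> e (f x) (f x') / L - D"
      using lo[OF x] L by (intro diff_right_mono divide_right_mono) auto
    also have "\<dots> \<le> h (g (f x)) (g (f x'))" using lo'[OF fx] .
    finally have "d x x' / (K * L) - C / L - D \<le> h (g (f x)) (g (f x'))"
      by (simp add: diff_divide_distrib)
    moreover have "C / L \<le> L * C"
    proof -
      have "C / L \<le> C" using L C by (simp add: divide_le_eq mult_left_mono[of 1 L C, simplified])
      then show ?thesis using LC by simp
    qed
    ultimately show "d x x' / (K * L) - (L * C + 2 * D) \<le> h ((g \<circ> f) x) ((g \<circ> f) x')" using D by simp
  next
    fix z assume z: "z \<in> Z"
    then obtain y where y: "y \<in> Y" "h (g y) z \<le> D" using sur' by blast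
    then obtain x where x: "x \<in> X" "e (f x) y \<le> C" using sur by blast
    have fx: "f x \<in> Y" using f x by auto
    have "h (g (f x)) (g y) \<le> L * C + D"
      using up'[OF fx y(1)] mult_left_mono[OF x(2), of L] L by linarith
    moreover have "h (g (f x)) z \<le> h (g (f x)) (g y) + h (g y) z"
    proof -
      have "g (f x) \<in> Z" "g y \<in> Z" using g fx y by auto
      then show ?thesis using Z z unfolding pseudometric_def by blast
    qed
    ultimately have "h ((g \<circ> f) x) z \<le> L * C + 2 * D" using y by simp
    then show "\<exists>x\<in>X. h ((g \<circ> f) x) z \<le> L * C + 2 * D" using x by blast
  qed
qed

text \<open>The word metric is measured by paths of right multiplications, so a bound over the
  generators propagates along a geodesic word; an inverse generator is the same edge read
  backwards.\<close>

lemma (in gen_group) lipschitz_extend: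
  assumes Y: "pseudometric Y e" and f: "f \<in> carrier G \<rightarrow> Y"
    and B: "\<And>g s. g \<in> carrier G \<Longrightarrow> s \<in> S \<Longrightarrow> e (f g) (f (g \<otimes> s)) \<le> B"
    and gh: "g \<in> carrier G" "h \<in> carrier G"
  shows "e (f g) (f h) \<le> B * wd g h"
proof -
  have B': "e (f g) (f (g \<otimes> s)) \<le> B" if "g \<in> carrier G" "s \<in> letters" for g s
  proof (cases "s \<in> S")
    case False
    with \<open>s \<in> letters\<close> obtain r where r: "r \<in> S" "s = inv r" by blast
    have c: "r \<in> carrier G" using r S_carrier by auto
    have "e (f (g \<otimes> s)) (f (g \<otimes> s \<otimes> r)) \<le> B" using B[of "g \<otimes> s" r] that r c by simp
    moreover have "g \<otimes> s \<otimes> r = g" using that r c by (simp add: m_assoc)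
    moreover have "e (f (g \<otimes> s)) (f g) = e (f g) (f (g \<otimes> s))"
      using Y f that r c unfolding pseudometric_def by (auto simp: Pi_iff)
    ultimately show ?thesis by simp
  qed (use that B in auto)
  have path: "g \<in> carrier G \<Longrightarrow> set ws \<subseteq> letters \<Longrightarrow> e (f g) (f (g \<otimes> wprod ws)) \<le> B * length ws" for g ws
  proof (induction ws arbitrary: g)
    case Nil
    then show ?case using Y f unfolding pseudometric_def by (auto simp: Pi_iff)
  next
    case (Cons w ws)
    have w: "w \<in> letters" "w \<in> carrier G" "wprod ws \<in> carrier G" using Cons.prems letters_carrier wprod_closed by auto
    have "e (f g) (f (g \<otimes> w \<otimes> wprod ws)) \<le> e (f g) (f (g \<otimes> w)) + e (f (g \<otimes> w)) (f (g \<otimes> w \<otimes> wprod ws))"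
    proof -
      have "f g \<in> Y" "f (g \<otimes> w) \<in> Y" "f (g \<otimes> w \<otimes> wprod ws) \<in> Y"
        using f Cons.prems(1) w by (auto simp: Pi_iff)
      then show ?thesis using Y unfolding pseudometric_def by blast
    qed
    moreover have "e (f g) (f (g \<otimes> w)) \<le> B" using B' Cons.prems w by auto
    moreover have "e (f (g \<otimes> w)) (f (g \<otimes> w \<otimes> wprod ws)) \<le> B * length ws" using Cons w by auto
    moreover have "g \<otimes> wprod (w # ws) = g \<otimes> w \<otimes> wprod ws" using Cons.prems w by (simp add: m_assoc)
    ultimately show ?case by (simp add: algebra_simps)
  qed
  obtain ws where ws: "set ws \<subseteq> letters" "wprod ws = inv g \<otimes> h" "length ws = wl (inv g \<otimes> h)"
    using wl_attained[of "inv g \<otimes> h"] gh by auto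
  have "g \<otimes> wprod ws = h" using gh ws by (simp add: m_assoc[symmetric])
  then show ?thesis using path[OF gh(1) ws(1)] ws by (simp add: word_dist_def)
qed

text \<open>The lower bound comes from the Lipschitz bound for \<open>g\<close>: going to the other
  group and back moves each of the two points by at most \<open>B\<close>, hence the additive
  constant \<open>2 * B\<close>. The factor is \<open>B + 1\<close> so as to be at least 1.\<close>

lemma quasi_isometric_spacesI:
  assumes G: "gen_group G S" and H: "gen_group H S'"
    and f: "f \<in> carrier G \<rightarrow> carrier H" and g: "g \<in> carrier H \<rightarrow> carrier G" and B: "B \<ge> 0"
    and fB: "\<And>x s. x \<in> carrier G \<Longrightarrow> s \<in> S \<Longrightarrow> word_dist H S' (f x) (f (x \<otimes>\<^bsub>G\<^esub> s)) \<le> B"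
    and gB: "\<And>x s. x \<in> carrier H \<Longrightarrow> s \<in> S' \<Longrightarrow> word_dist G S (g x) (g (x \<otimes>\<^bsub>H\<^esub> s)) \<le> B"
    and gf: "\<And>x. x \<in> carrier G \<Longrightarrow> word_dist G S (g (f x)) x \<le> B"
    and fg: "\<And>x. x \<in> carrier H \<Longrightarrow> word_dist H S' (f (g x)) x \<le> B"
  shows "quasi_isometric_spaces (carrier G) (word_dist G S) (carrier H) (word_dist H S')"
proof -
  interpret G: gen_group G S by fact
  interpret H: gen_group H S' by fact
  show ?thesis unfolding quasi_isometric_spaces_def
  proof (rule exI[of _ f], rule exI[of _ "B + 1"], rule exI[of _ "2 * B"], intro conjI ballI)
    fix x x' assume x: "x \<in> carrier G" "x' \<in> carrier G"
    have fx: "f x \<in> carrier H" "f x' \<in> carrier H" using f x by auto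
    have gfx: "g (f x) \<in> carrier G" "g (f x') \<in> carrier G" using g fx by auto
    have "H.wd (f x) (f x') \<le> B * G.wd x x'"
      by (rule G.lipschitz_extend[OF H.pseudometric_wd f fB x])
    also have "\<dots> \<le> (B + 1) * G.wd x x' + 2 * B"
      using B by (simp add: G.wd_nonneg algebra_simps)
    finally show "H.wd (f x) (f x') \<le> (B + 1) * G.wd x x' + 2 * B" .
    have "G.wd (g (f x)) (g (f x')) \<le> B * H.wd (f x) (f x')"
      by (rule H.lipschitz_extend[OF G.pseudometric_wd g gB fx])
    moreover have "G.wd x x' \<le> G.wd x (g (f x)) + G.wd (g (f x)) x'"
        "G.wd (g (f x)) x' \<le> G.wd (g (f x)) (g (f x')) + G.wd (g (f x')) x'"
        "G.wd x (g (f x)) = G.wd (g (f x)) x"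
      using x gfx by (auto intro: G.wd_triangle G.wd_sym)
    ultimately have "G.wd x x' \<le> B * H.wd (f x) (f x') + 2 * B"
      using gf[OF x(1)] gf[OF x(2)] by linarith
    also have "\<dots> \<le> (B + 1) * (H.wd (f x) (f x') + 2 * B)"
      using B H.wd_nonneg[of "f x" "f x'"] by (simp add: algebra_simps)
    finally have "G.wd x x' / (B + 1) \<le> H.wd (f x) (f x') + 2 * B"
      using B by (simp add: divide_le_eq mult.commute)
    then show "G.wd x x' / (B + 1) - 2 * B \<le> H.wd (f x) (f x')" by simp
  next
    fix y assume "y \<in> carrier H"
    then show "\<exists>x\<in>carrier G. H.wd (f x) y \<le> 2 * B"
      using g fg[of y] B by (intro bexI[of _ "g y"]) auto
  qed (use f B in auto)
qed

lemma word_dist_change_gens: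
  assumes "gen_group G S" "gen_group G S'"
  shows "quasi_isometric_spaces (carrier G) (word_dist G S) (carrier G) (word_dist G S')"
proof -
  interpret G: gen_group G S by fact
  interpret G': gen_group G S' by fact
  define B where "B = real ((\<Sum>s\<in>S. G'.wl s) + (\<Sum>s\<in>S'. G.wl s))"
  have B: "B \<ge> 0" by (simp only: B_def of_nat_0_le_iff)
  have 1: "G'.wl s \<le> (\<Sum>s\<in>S. G'.wl s)" if "s \<in> S" for s
    using that G.finS by (simp add: member_le_sum)
  have 2: "G.wl s \<le> (\<Sum>s\<in>S'. G.wl s)" if "s \<in> S'" for s
    using that G'.finS by (simp add: member_le_sum)
  show ?thesis
  proof (rule quasi_isometric_spacesI[OF assms, where f = id and g = id and B = B])
    show "B \<ge> 0" by (rule B)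
    fix x s assume "x \<in> carrier G" "s \<in> S"
    then show "G'.wd (id x) (id (x \<otimes>\<^bsub>G\<^esub> s)) \<le> B"
      using 1[of s] G.S_carrier G'.wd_mult[of x s] unfolding B_def id_apply by (auto simp del: of_nat_add of_nat_sum)
  next
    fix x s assume "x \<in> carrier G" "s \<in> S'"
    then show "G.wd (id x) (id (x \<otimes>\<^bsub>G\<^esub> s)) \<le> B"
      using 2[of s] G'.S_carrier G.wd_mult[of x s] unfolding B_def id_apply by (auto simp del: of_nat_add of_nat_sum)
  qed (use B in \<open>auto simp: G.wd_self G'.wd_self\<close>)
qed

text \<open>Replaces the existential over generating sets by one fixed choice, so that a
  quasi-isometry can be refuted in a single pair of metrics.\<close>

lemma quasi_isometric_iff:
  assumes G: "gen_group G S" and H: "gen_group H S'"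
  shows "quasi_isometric G H \<longleftrightarrow>
    quasi_isometric_spaces (carrier G) (word_dist G S) (carrier H) (word_dist H S')"
proof
  assume "quasi_isometric G H"
  then obtain T T' where T: "finite_gen_set G T" "finite_gen_set H T'"
    and qi: "quasi_isometric_spaces (carrier G) (word_dist G T) (carrier H) (word_dist H T')"
    unfolding quasi_isometric_def by blast
  have GT: "gen_group G T" "gen_group H T'"
    using G H T unfolding gen_group_def gen_group_axioms_def by auto
  show "quasi_isometric_spaces (carrier G) (word_dist G S) (carrier H) (word_dist H S')"
    by (rule qi_trans[OF qi_trans[OF word_dist_change_gens[OF G GT(1)] qi gen_group.pseudometric_wd[OF GT(2)]]
        word_dist_change_gens[OF GT(2) H] gen_group.pseudometric_wd[OF H]])
next
  assume "quasi_isometric_spaces (carrier G) (word_dist G S) (carrier H) (word_dist H S')"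
  then show "quasi_isometric G H"
    using gen_group.gens[OF G] gen_group.gens[OF H] unfolding quasi_isometric_def by blast
qed

section \<open>Word metrics of finitely generated presentations\<close>

definition std_gens :: "('g word \<times> 'g word) set \<Rightarrow> 'g word set set" where
  "std_gens R = range (\<lambda>x. cls R [(x, True)])"

lemma gen_group_presented: "gen_group (PG (R :: ('g::finite word \<times> 'g word) set)) (std_gens R)"
proof -
  interpret group "PG R" by (rule group_presented_group)
  have "cls R w \<in> generate (PG R) (std_gens R)" for w
  proof (induction w)
    case Nil
    then show ?case by (simp add: one_presented[symmetric] generate.one)
  next
    case (Cons l w)
    obtain x e where l: "l = (x, e)" by (cases l)
    have "cls R [l] \<in> generate (PG R) (std_gens R)"
      by (cases e) (auto simp: l std_gens_def pres_class_False intro: generate.incl generate.inv)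
    then have "cls R ([l] @ w) \<in> generate (PG R) (std_gens R)"
      unfolding pres_class_append using Cons by (rule generate.eng)
    then show ?case by simp
  qed
  moreover have "generate (PG R) (std_gens R) \<subseteq> carrier (PG R)"
    by (rule generate_incl) (auto simp: std_gens_def)
  ultimately show ?thesis
    by unfold_locales (auto simp: finite_gen_set_def std_gens_def carrier_presented)
qed

abbreviation pdist :: "('g word \<times> 'g word) set \<Rightarrow> 'g word set \<Rightarrow> 'g word set \<Rightarrow> real" where
  "pdist R \<equiv> word_dist (PG R) (std_gens R)"

lemma quasi_isometric_presented:
  fixes R :: "('g::finite word \<times> 'g word) set" and R' :: "('h::finite word \<times> 'h word) set"
  shows "quasi_isometric (PG R) (PG R') \<longleftrightarrow>
    quasi_isometric_spaces (carrier (PG R)) (pdist R) (carrier (PG R')) (pdist R')"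
  by (rule quasi_isometric_iff[OF gen_group_presented gen_group_presented])

lemma quasi_isometric_presented_sym:
  fixes R :: "('g::finite word \<times> 'g word) set" and R' :: "('h::finite word \<times> 'h word) set"
  shows "quasi_isometric (PG R) (PG R') \<Longrightarrow> quasi_isometric (PG R') (PG R)"
  unfolding quasi_isometric_presented
  by (rule qi_sym) (auto intro: gen_group.pseudometric_wd[OF gen_group_presented])

lemma quasi_isometric_presented_trans:
  fixes R :: "('g::finite word \<times> 'g word) set" and R' :: "('h::finite word \<times> 'h word) set"
    and R'' :: "('k::finite word \<times> 'k word) set"
  shows "quasi_isometric (PG R) (PG R') \<Longrightarrow>
    quasi_isometric (PG R') (PG R'') \<Longrightarrow>
    quasi_isometric (PG R) (PG R'')"
  unfolding quasi_isometric_presented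
  by (rule qi_trans) (auto intro: gen_group.pseudometric_wd[OF gen_group_presented])

lemma pres_class_wprod:
  assumes "set ws \<subseteq> std_gens R \<union> m_inv (PG R) ` std_gens R"
  shows "\<exists>w. length w = length ws \<and> foldr (\<otimes>\<^bsub>PG R\<^esub>) ws \<one>\<^bsub>PG R\<^esub> = cls R w"
  using assms
proof (induction ws)
  case Nil
  then show ?case by (simp add: one_presented)
next
  case (Cons a ws)
  then obtain w where w: "length w = length ws" "foldr (\<otimes>\<^bsub>PG R\<^esub>) ws \<one>\<^bsub>PG R\<^esub> = cls R w"
    by auto
  have "\<exists>l. a = cls R [l]"
    using Cons.prems by (force simp: std_gens_def pres_class_False[symmetric])
  then obtain l where "a = cls R [l]" ..
  with w show ?case by (intro exI[of _ "l # w"]) (simp add: mult_pres_class)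
qed

lemma wprod_pres_class:
  "\<exists>ws. length ws = length w \<and> set ws \<subseteq> std_gens R \<union> m_inv (PG R) ` std_gens R \<and>
    foldr (\<otimes>\<^bsub>PG R\<^esub>) ws \<one>\<^bsub>PG R\<^esub> = cls R w"
proof (induction w)
  case Nil
  then show ?case by (simp add: one_presented)
next
  case (Cons l w)
  then obtain ws where ws: "length ws = length w" "set ws \<subseteq> std_gens R \<union> m_inv (PG R) ` std_gens R"
    "foldr (\<otimes>\<^bsub>PG R\<^esub>) ws \<one>\<^bsub>PG R\<^esub> = cls R w" by blast
  obtain x e where l: "l = (x, e)" by (cases l)
  have "cls R [l] \<in> std_gens R \<union> m_inv (PG R) ` std_gens R"
    by (cases e) (auto simp: l std_gens_def pres_class_False)
  then show ?case using ws
    by (intro exI[of _ "cls R [l] # ws"]) (simp add: mult_pres_class)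
qed

lemma word_length_presented_le:
  "word_length (PG (R :: ('g::finite word \<times> 'g word) set)) (std_gens R) (cls R w) \<le> length w"
proof -
  interpret gen_group "PG R" "std_gens R" by (rule gen_group_presented)
  show ?thesis using wprod_pres_class[of w R] wl_le by metis
qed

lemma word_length_presented_attained:
  fixes R :: "('g::finite word \<times> 'g word) set"
  obtains v where "pres_eq R w v" "length v = word_length (PG R) (std_gens R) (cls R w)"
proof -
  interpret gen_group "PG R" "std_gens R" by (rule gen_group_presented)
  obtain ws where "set ws \<subseteq> letters" "wprod ws = cls R w" "length ws = wl (cls R w)"
    by (rule wl_attained[of "cls R w"]) auto
  with pres_class_wprod[of ws R] that show ?thesis by (auto simp: pres_class_eq_iff)
qed

lemma pdist_le: "pdist (R :: ('g::finite word \<times> 'g word) set) (cls R u) (cls R (u @ w)) \<le> length w"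
proof -
  interpret gen_group "PG R" "std_gens R" by (rule gen_group_presented)
  show ?thesis using word_length_presented_le[of R w] by (simp add: pres_class_append wd_mult)
qed

lemma pdist_attained:
  fixes R :: "('g::finite word \<times> 'g word) set"
  obtains w where "pres_eq R (u @ w) v" "length w = pdist R (cls R u) (cls R v)"
proof -
  obtain w where w: "pres_eq R (inv_word u @ v) w"
    "length w = word_length (PG R) (std_gens R) (cls R (inv_word u @ v))"
    by (rule word_length_presented_attained)
  have "pres_eq R (u @ (inv_word u @ v)) (u @ w)"
    by (rule pres_eq.cong[OF pres_eq.refl w(1)])
  moreover have "pres_eq R ((u @ inv_word u) @ v) ([] @ v)"
    by (rule pres_eq.cong[OF inv_word_right pres_eq.refl])
  ultimately have "pres_eq R (u @ w) v" by (metis append.assoc append_Nil pres_eq.sym pres_eq.trans)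
  moreover have "length w = pdist R (cls R u) (cls R v)"
    by (simp add: word_dist_def inv_pres_class mult_pres_class w)
  ultimately show ?thesis by (rule that)
qed

lemma pres_class_cases:
  assumes "X \<in> carrier (PG R)" obtains w where "X = cls R w"
  using assms by (auto simp: carrier_presented)

lemma quasi_isometric_presentedI:
  fixes R :: "('g::finite word \<times> 'g word) set" and R' :: "('h::finite word \<times> 'h word) set"
  assumes f: "f \<in> carrier (PG R) \<rightarrow> carrier (PG R')"
    and g: "g \<in> carrier (PG R') \<rightarrow> carrier (PG R)"
    and fB: "\<And>w x. pdist R' (f (cls R w)) (f (cls R (w @ [(x, True)]))) \<le> B"
    and gB: "\<And>w x. pdist R (g (cls R' w)) (g (cls R' (w @ [(x, True)]))) \<le> B"
    and gf: "\<And>w. pdist R (g (f (cls R w))) (cls R w) \<le> B"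
    and fg: "\<And>w. pdist R' (f (g (cls R' w))) (cls R' w) \<le> B"
  shows "quasi_isometric (PG R) (PG R')"
  unfolding quasi_isometric_presented
proof (rule quasi_isometric_spacesI[OF gen_group_presented gen_group_presented f g, where B = B])
  have "0 \<le> pdist R (g (f (cls R []))) (cls R [])"
    by (simp add: word_dist_def)
  then show "B \<ge> 0" using gf[of "[]"] by linarith
next
  fix X s assume "X \<in> carrier (PG R)" "s \<in> std_gens R"
  then show "pdist R' (f X) (f (X \<otimes>\<^bsub>PG R\<^esub> s)) \<le> B"
    using fB by (auto simp: carrier_presented std_gens_def[of R] mult_pres_class)
next
  fix X s assume "X \<in> carrier (PG R')" "s \<in> std_gens R'"
  then show "pdist R (g X) (g (X \<otimes>\<^bsub>PG R'\<^esub> s)) \<le> B"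
    using gB by (auto simp: carrier_presented std_gens_def[of R'] mult_pres_class)
qed (auto simp: carrier_presented gf fg)

section \<open>Machines as quasi-isometries\<close>

context machine_pair begin

lemma mmap_funcset: "M.mmap \<in> carrier (PG R) \<rightarrow> carrier (PG R')"
  by (auto simp: carrier_presented M.mmap)

lemma mmap_letter:
  fixes L :: nat
  assumes "\<And>s x. s \<in> S \<Longrightarrow> length (f s x) \<le> L"
  shows "\<exists>v. length v \<le> L \<and> M.mmap (cls R (w @ [(x, True)])) = cls R' (M.ou s0 w @ v)"
  using assms[OF M.st_in[OF M.s0, of w], of x] by (auto simp: M.mmap mout_append)

lemma mmap_mmap_near:
  "pres_eq R (M'.ou s0' (M.ou s0 w)) (w @ inv_word (c (M.st s0 w)))"
  using out_out[OF M.s0] by (simp add: c0)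

end

theorem machine_quasi_isometric:
  fixes R :: "('g::finite word \<times> 'g word) set" and R' :: "('h::finite word \<times> 'h word) set"
  assumes "machine_pair R R' S d di f s0 S' d' di' f' s0' c c'"
  shows "quasi_isometric (PG R) (PG R')"
proof -
  interpret P: machine_pair R R' S d di f s0 S' d' di' f' s0' c c' by fact
  interpret P': machine_pair R' R S' d' di' f' s0' S d di f s0 c' c by (rule P.sym_pair)
  interpret G: gen_group "PG R" "std_gens R" by (rule gen_group_presented)
  interpret G': gen_group "PG R'" "std_gens R'" by (rule gen_group_presented)
  define L where "L = (\<Sum>(s, x)\<in>S \<times> UNIV. length (f s x)) + (\<Sum>(s, x)\<in>S' \<times> UNIV. length (f' s x))
     + (\<Sum>s\<in>S. length (c s)) + (\<Sum>s\<in>S'. length (c' s))"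
  have "length (f s x) \<le> (\<Sum>(s, x)\<in>S \<times> UNIV. length (f s x))" if "s \<in> S" for s x
    using member_le_sum[of "(s, x)" "S \<times> UNIV" "\<lambda>(s, x). length (f s x)"] that P.M.fin by simp
  then have L1: "length (f s x) \<le> L" if "s \<in> S" for s x
    using that unfolding L_def by (meson trans_le_add1)
  have "length (f' s x) \<le> (\<Sum>(s, x)\<in>S' \<times> UNIV. length (f' s x))" if "s \<in> S'" for s x
    using member_le_sum[of "(s, x)" "S' \<times> UNIV" "\<lambda>(s, x). length (f' s x)"] that P.M'.fin by simp
  then have L2: "length (f' s x) \<le> L" if "s \<in> S'" for s x
    using that unfolding L_def by (meson trans_le_add1 trans_le_add2)
  have "length (c s) \<le> (\<Sum>s\<in>S. length (c s))" if "s \<in> S" for s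
    using that P.M.fin by (intro member_le_sum) auto
  then have L3: "length (c s) \<le> L" if "s \<in> S" for s
    using that unfolding L_def by (meson trans_le_add1 trans_le_add2)
  have "length (c' s) \<le> (\<Sum>s\<in>S'. length (c' s))" if "s \<in> S'" for s
    using that P.M'.fin by (intro member_le_sum) auto
  then have L4: "length (c' s) \<le> L" if "s \<in> S'" for s
    using that unfolding L_def by (meson trans_le_add2)
  show ?thesis
  proof (rule quasi_isometric_presentedI[OF P.mmap_funcset P'.mmap_funcset, where B = L])
    fix w x
    show "pdist R' (P.M.mmap (cls R w)) (P.M.mmap (cls R (w @ [(x, True)]))) \<le> L"
      using P.mmap_letter[OF L1, of w x] pdist_le[of R'] by (fastforce simp: P.M.mmap intro: order_trans)
  next
    fix w x
    show "pdist R (P.M'.mmap (cls R' w)) (P.M'.mmap (cls R' (w @ [(x, True)]))) \<le> L"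
      using P'.mmap_letter[OF L2, of w x] pdist_le[of R] by (fastforce simp: P.M'.mmap intro: order_trans)
  next
    fix w
    have "pdist R (cls R w) (cls R (w @ inv_word (c (P.M.st s0 w)))) \<le> L"
      using pdist_le[of R w "inv_word (c (P.M.st s0 w))"] L3[OF P.M.st_in[OF P.M.s0, of w]] by simp
    then show "pdist R (P.M'.mmap (P.M.mmap (cls R w))) (cls R w) \<le> L"
      using P.mmap_mmap_near[of w] G.wd_sym by (simp add: P.M.mmap P.M'.mmap pres_class_eq_iff[symmetric])
  next
    fix w
    have "pdist R' (cls R' w) (cls R' (w @ inv_word (c' (P.M'.st s0' w)))) \<le> L"
      using pdist_le[of R' w "inv_word (c' (P.M'.st s0' w))"] L4[OF P.M'.st_in[OF P.M'.s0, of w]] by simp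
    then show "pdist R' (P.M.mmap (P.M'.mmap (cls R' w))) (cls R' w) \<le> L"
      using P'.mmap_mmap_near[of w] G'.wd_sym by (simp add: P.M.mmap P.M'.mmap pres_class_eq_iff[symmetric])
  qed
qed

section \<open>Commensurability\<close>

definition fin_index :: "('a, 'c) monoid_scheme \<Rightarrow> 'a set \<Rightarrow> bool" where
  "fin_index G H \<longleftrightarrow> subgroup H G \<and> finite (rcosets\<^bsub>G\<^esub> H)"

context group begin

text \<open>A finite cover by cosets passes to towers and to isomorphic images by multiplying or
  mapping the representatives.\<close>

lemma finite_rcosets_iff:
  assumes H: "subgroup H G"
  shows "finite (rcosets H) \<longleftrightarrow> (\<exists>F. finite F \<and> F \<subseteq> carrier G \<and> carrier G \<subseteq> (\<Union>f\<in>F. H #> f))"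
proof
  assume fin: "finite (rcosets H)"
  have "rcosets H = (#>) H ` carrier G" by (auto simp: RCOSETS_def)
  with fin obtain F where F: "finite F" "F \<subseteq> carrier G" "rcosets H = (#>) H ` F"
    by (metis finite_subset_image subset_refl)
  have "g \<in> (\<Union>f\<in>F. H #> f)" if g: "g \<in> carrier G" for g
  proof -
    have "H #> g \<in> rcosets H" using g by (auto simp: RCOSETS_def)
    then obtain f where "f \<in> F" "H #> g = H #> f" using F by auto
    moreover have "g \<in> H #> g" using rcos_self[OF g H] .
    ultimately show ?thesis by auto
  qed
  then show "\<exists>F. finite F \<and> F \<subseteq> carrier G \<and> carrier G \<subseteq> (\<Union>f\<in>F. H #> f)" using F by blast
next
  assume "\<exists>F. finite F \<and> F \<subseteq> carrier G \<and> carrier G \<subseteq> (\<Union>f\<in>F. H #> f)"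
  then obtain F where F: "finite F" "F \<subseteq> carrier G" "carrier G \<subseteq> (\<Union>f\<in>F. H #> f)" by blast
  have "rcosets H \<subseteq> (#>) H ` F"
  proof
    fix X assume "X \<in> rcosets H"
    then obtain g where g: "g \<in> carrier G" "X = H #> g" by (auto simp: RCOSETS_def)
    then obtain f where f: "f \<in> F" "g \<in> H #> f" using F by blast
    have "H #> f = H #> g" using repr_independence[OF f(2) _ H] F f by auto
    then show "X \<in> (#>) H ` F" using g f by auto
  qed
  then show "finite (rcosets H)" by (rule finite_surj[OF F(1)])
qed

lemma fin_index_Int:
  assumes "fin_index G H" "fin_index G K" shows "fin_index G (H \<inter> K)"
proof -
  have H: "subgroup H G" "finite (rcosets H)" and K: "subgroup K G" "finite (rcosets K)"
    using assms by (auto simp: fin_index_def)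
  have HK: "subgroup (H \<inter> K) G" by (rule subgroups_Inter_pair[OF H(1) K(1)])
  have "(H \<inter> K) #> g = (H #> g) \<inter> (K #> g)" if g: "g \<in> carrier G" for g
  proof
    show "(H #> g) \<inter> (K #> g) \<subseteq> (H \<inter> K) #> g"
    proof
      fix x assume "x \<in> (H #> g) \<inter> (K #> g)"
      then obtain h k where hk: "h \<in> H" "k \<in> K" "x = h \<otimes> g" "x = k \<otimes> g" by (auto simp: r_coset_def)
      moreover have "h = k" using hk g subgroup.mem_carrier[OF H(1)] subgroup.mem_carrier[OF K(1)] by (metis right_cancel)
      ultimately show "x \<in> (H \<inter> K) #> g" by (auto simp: r_coset_def)
    qed
  qed (auto simp: r_coset_def)
  then have "rcosets (H \<inter> K) \<subseteq> (\<lambda>(A, B). A \<inter> B) ` ((rcosets H) \<times> (rcosets K))"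
    by (force simp: RCOSETS_def)
  then have "finite (rcosets (H \<inter> K))" using H K by (meson finite_SigmaI finite_surj)
  with HK show ?thesis by (simp add: fin_index_def)
qed

lemma fin_index_restrict:
  assumes K: "fin_index G K" and H: "subgroup H G" and KH: "K \<subseteq> H"
  shows "fin_index (G\<lparr>carrier := H\<rparr>) K"
proof -
  have "rcosets\<^bsub>G\<lparr>carrier := H\<rparr>\<^esub> K \<subseteq> rcosets K"
    using subgroup.subset[OF H] by (auto simp: RCOSETS_def r_coset_def)
  moreover have "subgroup K (G\<lparr>carrier := H\<rparr>)"
    using K H KH by (simp add: fin_index_def subgroup_incl)
  ultimately show ?thesis using K finite_subset by (auto simp: fin_index_def)
qed

lemma fin_index_tower:
  assumes L: "fin_index (G\<lparr>carrier := H\<rparr>) L" and H: "fin_index G H"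
  shows "fin_index G L"
proof -
  have sH: "subgroup H G" using H by (simp add: fin_index_def)
  interpret GH: group "G\<lparr>carrier := H\<rparr>" by (rule subgroup.subgroup_is_group[OF sH is_group])
  have sL: "subgroup L (G\<lparr>carrier := H\<rparr>)" using L by (simp add: fin_index_def)
  have sLG: "subgroup L G" using incl_subgroup[OF sH sL] .
  obtain F where F: "finite F" "F \<subseteq> carrier G" "carrier G \<subseteq> (\<Union>f\<in>F. H #> f)"
    using finite_rcosets_iff[OF sH] H by (auto simp: fin_index_def)
  obtain E where E: "finite E" "E \<subseteq> H" "H \<subseteq> (\<Union>e\<in>E. L #> e)"
    using GH.finite_rcosets_iff[OF sL] L by (auto simp: fin_index_def r_coset_def)
  have "carrier G \<subseteq> (\<Union>x\<in>(\<lambda>(e, f). e \<otimes> f) ` (E \<times> F). L #> x)"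
  proof
    fix g assume "g \<in> carrier G"
    then obtain f h where f: "f \<in> F" "h \<in> H" "g = h \<otimes> f" using F by (fastforce simp: r_coset_def)
    then obtain e l where e: "e \<in> E" "l \<in> L" "h = l \<otimes> e" using E by (fastforce simp: r_coset_def)
    have "g = l \<otimes> (e \<otimes> f)" using e f F E subgroup.mem_carrier[OF sH] subgroup.mem_carrier[OF sLG]
      by (simp add: m_assoc subset_eq)
    then show "g \<in> (\<Union>x\<in>(\<lambda>(e, f). e \<otimes> f) ` (E \<times> F). L #> x)"
      using e f by (auto simp: r_coset_def)
  qed
  moreover have "finite ((\<lambda>(e, f). e \<otimes> f) ` (E \<times> F))" using E F by simp
  moreover have "e \<otimes> f \<in> carrier G" if "e \<in> E" "f \<in> F" for e f
    using that E(2) F(2) subgroup.mem_carrier[OF sH] by (meson m_closed subsetD)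
  then have "(\<lambda>(e, f). e \<otimes> f) ` (E \<times> F) \<subseteq> carrier G" by auto
  ultimately have "\<exists>F. finite F \<and> F \<subseteq> carrier G \<and> carrier G \<subseteq> (\<Union>f\<in>F. L #> f)" by (intro exI conjI)
  then have "finite (rcosets L)" using finite_rcosets_iff[OF sLG] by simp
  then show ?thesis using sLG by (simp add: fin_index_def)
qed

text \<open>Pigeonhole on the cosets of the powers of \<open>g\<close>.\<close>

lemma fin_index_power:
  assumes "fin_index G H" "g \<in> carrier G"
  obtains k :: nat where "k \<ge> 1" "g [^] k \<in> H"
proof -
  have H: "subgroup H G" "finite (rcosets H)" using assms by (auto simp: fin_index_def)
  have "\<not> inj (\<lambda>k::nat. H #> (g [^] k))"
  proof
    assume "inj (\<lambda>k::nat. H #> (g [^] k))"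
    moreover have "range (\<lambda>k::nat. H #> (g [^] k)) \<subseteq> rcosets H" using assms by (auto simp: RCOSETS_def)
    ultimately show False using H(2) by (metis finite_imageD finite_subset infinite_UNIV_nat)
  qed
  then obtain i j :: nat where ij: "i \<noteq> j" "H #> (g [^] i) = H #> (g [^] j)" by (auto simp: inj_def)
  have "\<exists>k\<ge>1. g [^] (k::nat) \<in> H" if "i < j" "H #> (g [^] i) = H #> (g [^] j)" for i j :: nat
  proof -
    have c: "g [^] i \<in> carrier G" "g [^] j \<in> carrier G" using assms by auto
    have "g [^] j \<in> H #> (g [^] i)" using that rcos_self[OF c(2) H(1)] by simp
    then obtain h where h: "h \<in> H" "g [^] j = h \<otimes> g [^] i" by (auto simp: r_coset_def)
    have "g [^] j = g [^] (j - i) \<otimes> g [^] i" using that assms by (simp add: nat_pow_mult)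
    then have "g [^] (j - i) = h" using h assms c subgroup.mem_carrier[OF H(1)] by (metis nat_pow_closed right_cancel)
    then show ?thesis using h that by (intro exI[of _ "j - i"]) auto
  qed
  then show ?thesis using that ij by (metis linorder_neqE_nat)
qed

end

lemma iso_restrict:
  assumes h: "h \<in> iso (G\<lparr>carrier := H\<rparr>) (G'\<lparr>carrier := H'\<rparr>)" and L: "L \<subseteq> H"
  shows "h \<in> iso (G\<lparr>carrier := L\<rparr>) (G'\<lparr>carrier := h ` L\<rparr>)"
  using assms by (auto simp: iso_def hom_def bij_betw_def inj_on_subset subset_eq Pi_iff intro: inj_on_subset)

lemma fin_index_iso_image:
  assumes G: "group G" and G': "group G'" and h: "h \<in> iso G G'" and L: "fin_index G L"
  shows "fin_index G' (h ` L)"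
proof -
  interpret G: group G by fact
  interpret G': group G' by fact
  interpret h: group_hom G G' h using h by unfold_locales (auto simp: iso_def)
  have sL: "subgroup L G" using L by (simp add: fin_index_def)
  have sL': "subgroup (h ` L) G'" using h.subgroup_img_is_subgroup[OF sL] .
  obtain F where F: "finite F" "F \<subseteq> carrier G" "carrier G \<subseteq> (\<Union>f\<in>F. L #>\<^bsub>G\<^esub> f)"
    using G.finite_rcosets_iff[OF sL] L by (auto simp: fin_index_def)
  have "carrier G' \<subseteq> (\<Union>f\<in>h ` F. h ` L #>\<^bsub>G'\<^esub> f)"
  proof
    fix y assume "y \<in> carrier G'"
    then obtain x where x: "x \<in> carrier G" "y = h x" using h by (auto simp: iso_def bij_betw_def)
    then obtain f l where f: "f \<in> F" "l \<in> L" "x = l \<otimes>\<^bsub>G\<^esub> f" using F by (fastforce simp: r_coset_def)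
    then have "y = h l \<otimes>\<^bsub>G'\<^esub> h f" using x F subgroup.mem_carrier[OF sL] by auto
    then show "y \<in> (\<Union>f\<in>h ` F. h ` L #>\<^bsub>G'\<^esub> f)" using f by (auto simp: r_coset_def)
  qed
  then have "finite (rcosets\<^bsub>G'\<^esub> (h ` L))"
    using G'.finite_rcosets_iff[OF sL'] F by (meson finite_imageI h.hom_closed image_subsetI subsetD)
  then show ?thesis using sL' by (simp add: fin_index_def)
qed

lemma commensurable_alt:
  "commensurable G G' \<longleftrightarrow> (\<exists>H H' h. fin_index G H \<and> fin_index G' H' \<and> h \<in> iso (G\<lparr>carrier := H\<rparr>) (G'\<lparr>carrier := H'\<rparr>))"
  unfolding commensurable_def fin_index_def is_iso_def by blast

lemma commensurable_sym:
  assumes "group G" "group G'" "commensurable G G'" shows "commensurable G' G"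
proof -
  obtain H H' where H: "subgroup H G" "finite (rcosets\<^bsub>G\<^esub> H)" "subgroup H' G'" "finite (rcosets\<^bsub>G'\<^esub> H')"
    "G\<lparr>carrier := H\<rparr> \<cong> G'\<lparr>carrier := H'\<rparr>"
    using assms(3) unfolding commensurable_def by blast
  have "group (G\<lparr>carrier := H\<rparr>)" using H assms by (simp add: subgroup.subgroup_is_group)
  then have "G'\<lparr>carrier := H'\<rparr> \<cong> G\<lparr>carrier := H\<rparr>" using H(5) by (rule group.iso_sym)
  then show ?thesis using H unfolding commensurable_def by blast
qed

text \<open>The two finite index subgroups of the middle group are intersected, and both
  isomorphisms are restricted to the intersection.\<close>

lemma commensurable_trans:
  assumes G: "group G" "group G'" "group G''" and c: "commensurable G G'" "commensurable G' G''"
  shows "commensurable G G''"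
proof -
  obtain H H' h where H: "fin_index G' H" "fin_index G H'" "h \<in> iso (G'\<lparr>carrier := H\<rparr>) (G\<lparr>carrier := H'\<rparr>)"
    using commensurable_sym[OF G(1,2) c(1)] unfolding commensurable_alt by blast
  obtain K K'' k where K: "fin_index G' K" "fin_index G'' K''" "k \<in> iso (G'\<lparr>carrier := K\<rparr>) (G''\<lparr>carrier := K''\<rparr>)"
    using c(2) unfolding commensurable_alt by blast
  interpret G: group G by fact
  interpret G': group G' by fact
  interpret G'': group G'' by fact
  have sub: "subgroup H G'" "subgroup H' G" "subgroup K G'" "subgroup K'' G''"
    using H K by (auto simp: fin_index_def)
  note grp = subgroup.subgroup_is_group[OF sub(1) G(2)] subgroup.subgroup_is_group[OF sub(2) G(1)]
    subgroup.subgroup_is_group[OF sub(3) G(2)] subgroup.subgroup_is_group[OF sub(4) G(3)]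
  let ?L = "H \<inter> K"
  have L: "fin_index G' ?L" using G'.fin_index_Int H K by blast
  have "fin_index (G\<lparr>carrier := H'\<rparr>) (h ` ?L)"
    by (rule fin_index_iso_image[OF grp(1,2) H(3) G'.fin_index_restrict[OF L sub(1)]]) auto
  then have 1: "fin_index G (h ` ?L)" using G.fin_index_tower H by blast
  have "fin_index (G''\<lparr>carrier := K''\<rparr>) (k ` ?L)"
    by (rule fin_index_iso_image[OF grp(3,4) K(3) G'.fin_index_restrict[OF L sub(3)]]) auto
  then have 2: "fin_index G'' (k ` ?L)" using G''.fin_index_tower K by blast
  have "h \<in> iso (G'\<lparr>carrier := ?L\<rparr>) (G\<lparr>carrier := h ` ?L\<rparr>)"
    by (rule iso_restrict[OF H(3)]) auto
  then have "G'\<lparr>carrier := ?L\<rparr> \<cong> G\<lparr>carrier := h ` ?L\<rparr>" unfolding is_iso_def by blast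
  moreover have "group (G'\<lparr>carrier := ?L\<rparr>)"
    using L G by (auto simp: fin_index_def subgroup.subgroup_is_group)
  ultimately have "G\<lparr>carrier := h ` ?L\<rparr> \<cong> G'\<lparr>carrier := ?L\<rparr>" by (simp add: group.iso_sym)
  moreover have "k \<in> iso (G'\<lparr>carrier := ?L\<rparr>) (G''\<lparr>carrier := k ` ?L\<rparr>)"
    by (rule iso_restrict[OF K(3)]) auto
  then have "G'\<lparr>carrier := ?L\<rparr> \<cong> G''\<lparr>carrier := k ` ?L\<rparr>" unfolding is_iso_def by blast
  ultimately have "G\<lparr>carrier := h ` ?L\<rparr> \<cong> G''\<lparr>carrier := k ` ?L\<rparr>" by (rule iso_trans)
  then show ?thesis using 1 2 unfolding commensurable_def fin_index_def by blast
qed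

section \<open>Changing the parameters\<close>

abbreviation "gA \<equiv> hnn_gen.A"
abbreviation "gB \<equiv> hnn_gen.B"
abbreviation "gT \<equiv> hnn_gen.T"

definition hnn_rel :: "int \<Rightarrow> int \<Rightarrow> int \<Rightarrow> int \<Rightarrow> (hnn_gen word \<times> hnn_gen word) set" where
  "hnn_rel k l m n =
     {([(gA, True), (gB, True), (gA, False), (gB, False)], []),
      ([(gT, True)] @ gen_pow gA m @ gen_pow gB n @ [(gT, False)],
       gen_pow gA k @ gen_pow gB l)}"

lemma hnn_group_eq: "hnn_group (k, l) (m, n) = PG (hnn_rel k l m n)"
  by (simp add: hnn_group_def hnn_rel_def)

instance hnn_gen :: finite
proof
  have "(UNIV :: hnn_gen set) = {gA, gB, gT}"
    using hnn_gen.exhaust by auto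
  then show "finite (UNIV :: hnn_gen set)" by (metis finite.emptyI finite_insert)
qed

instance bs_gen :: finite
proof
  have "(UNIV :: bs_gen set) = {bs_gen.a, bs_gen.t}"
    using bs_gen.exhaust by auto
  then show "finite (UNIV :: bs_gen set)" by (metis finite.emptyI finite_insert)
qed

abbreviation w2 :: "int \<Rightarrow> int \<Rightarrow> hnn_gen word" where
  "w2 x y \<equiv> gen_pow gA x @ gen_pow gB y"

section \<open>Calculation with powers of \<open>A\<close>, \<open>B\<close> and one letter
  \<open>T\<close>\<close>

lemma (in group) commute_nat_pow:
  assumes "x \<in> carrier G" "y \<in> carrier G" "x \<otimes> y = y \<otimes> x"
  shows "x [^] (i::nat) \<otimes> y = y \<otimes> x [^] i"
proof (induction i)
  case (Suc i)
  have "x [^] Suc i \<otimes> y = x [^] i \<otimes> (x \<otimes> y)" using assms by (simp add: m_assoc)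
  also have "\<dots> = (x [^] i \<otimes> y) \<otimes> x" using assms by (simp add: m_assoc)
  also have "\<dots> = y \<otimes> x [^] Suc i" using Suc assms by (simp add: m_assoc)
  finally show ?case .
qed (use assms in simp)

lemma (in group) commute_inv:
  assumes "x \<in> carrier G" "y \<in> carrier G" "x \<otimes> y = y \<otimes> x"
  shows "inv x \<otimes> y = y \<otimes> inv x"
proof -
  have "inv x \<otimes> y = inv x \<otimes> (y \<otimes> x) \<otimes> inv x" using assms(1,2) by (simp add: m_assoc)
  also have "\<dots> = inv x \<otimes> (x \<otimes> y) \<otimes> inv x" using assms by simp
  also have "\<dots> = y \<otimes> inv x" using assms(1,2) by (simp add: m_assoc[symmetric])
  finally show ?thesis .
qed

lemma (in group) commute_int_pow:
  assumes "x \<in> carrier G" "y \<in> carrier G" "x \<otimes> y = y \<otimes> x"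
  shows "x [^] (i::int) \<otimes> y = y \<otimes> x [^] i"
proof (cases "i < 0")
  case True
  have c: "x [^] nat (- i) \<in> carrier G" using assms(1) by (rule nat_pow_closed)
  show ?thesis using commute_inv[OF c assms(2) commute_nat_pow[OF assms]] True unfolding int_pow_def2 by simp
next
  case False
  then show ?thesis using commute_nat_pow[OF assms, of "nat i"] unfolding int_pow_def2 by (simp only: if_False)
qed

lemma (in group) commute_int_pow2:
  assumes "x \<in> carrier G" "y \<in> carrier G" "x \<otimes> y = y \<otimes> x"
  shows "x [^] (i::int) \<otimes> y [^] (j::int) = y [^] j \<otimes> x [^] i"
  using commute_int_pow[OF assms(2) int_pow_closed[OF assms(1)], of i j] commute_int_pow[OF assms, of i] assms
  by metis

context
  fixes k l m n :: int
begin

interpretation group "PG (hnn_rel k l m n)" by (rule group_presented_group)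

definition "hP x y = cls (hnn_rel k l m n) (w2 x y)"
definition "hT = cls (hnn_rel k l m n) [(gT, True)]"

lemma hP_closed [simp]: "hP x y \<in> carrier (PG (hnn_rel k l m n))"
  and hT_closed [simp]: "hT \<in> carrier (PG (hnn_rel k l m n))"
  by (auto simp: hP_def hT_def)

lemma hnn_AB_commute:
  "cls (hnn_rel k l m n) [(gA, True)] \<otimes>\<^bsub>PG (hnn_rel k l m n)\<^esub> cls (hnn_rel k l m n) [(gB, True)]
  = cls (hnn_rel k l m n) [(gB, True)] \<otimes>\<^bsub>PG (hnn_rel k l m n)\<^esub> cls (hnn_rel k l m n) [(gA, True)]"
  (is "?a \<otimes>\<^bsub>?G\<^esub> ?b = _")
proof -
  have "pres_eq (hnn_rel k l m n) ([(gA, True), (gB, True), (gA, False), (gB, False)]) []"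
    by (rule pres_eq.rel) (simp add: hnn_rel_def)
  then have "?a \<otimes>\<^bsub>?G\<^esub> ?b \<otimes>\<^bsub>?G\<^esub> inv\<^bsub>?G\<^esub> (?b \<otimes>\<^bsub>?G\<^esub> ?a) = \<one>\<^bsub>?G\<^esub>"
    by (simp add: mult_pres_class inv_pres_class inv_word_def pres_class_eq_iff one_presented)
  then show ?thesis by (metis inv_equality inv_inv inv_closed m_closed pres_class_closed)
qed

lemma hP_pow: "hP x y = cls (hnn_rel k l m n) [(gA, True)] [^]\<^bsub>PG (hnn_rel k l m n)\<^esub> x
  \<otimes>\<^bsub>PG (hnn_rel k l m n)\<^esub> cls (hnn_rel k l m n) [(gB, True)] [^]\<^bsub>PG (hnn_rel k l m n)\<^esub> y"
  by (simp add: hP_def pres_class_append pres_class_gen_pow)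

lemma hP_mult: "hP x y \<otimes>\<^bsub>PG (hnn_rel k l m n)\<^esub> hP x' y' = hP (x + x') (y + y')"
  (is "_ \<otimes>\<^bsub>?G\<^esub> _ = _")
proof -
  let ?a = "cls (hnn_rel k l m n) [(gA, True)]"
  let ?b = "cls (hnn_rel k l m n) [(gB, True)]"
  have c: "?a [^]\<^bsub>?G\<^esub> x' \<otimes>\<^bsub>?G\<^esub> ?b [^]\<^bsub>?G\<^esub> y = ?b [^]\<^bsub>?G\<^esub> y \<otimes>\<^bsub>?G\<^esub> ?a [^]\<^bsub>?G\<^esub> x'"
    by (rule commute_int_pow2) (auto simp: hnn_AB_commute)
  have "hP x y \<otimes>\<^bsub>?G\<^esub> hP x' y' = ?a [^]\<^bsub>?G\<^esub> x \<otimes>\<^bsub>?G\<^esub> (?b [^]\<^bsub>?G\<^esub> y \<otimes>\<^bsub>?G\<^esub> ?a [^]\<^bsub>?G\<^esub> x') \<otimes>\<^bsub>?G\<^esub> ?b [^]\<^bsub>?G\<^esub> y'"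
    by (simp add: hP_pow m_assoc)
  also have "\<dots> = (?a [^]\<^bsub>?G\<^esub> x \<otimes>\<^bsub>?G\<^esub> ?a [^]\<^bsub>?G\<^esub> x') \<otimes>\<^bsub>?G\<^esub> (?b [^]\<^bsub>?G\<^esub> y \<otimes>\<^bsub>?G\<^esub> ?b [^]\<^bsub>?G\<^esub> y')"
    unfolding c[symmetric] by (simp add: m_assoc)
  finally show ?thesis by (simp add: hP_pow int_pow_mult)
qed

lemma hP_0: "hP 0 0 = \<one>\<^bsub>PG (hnn_rel k l m n)\<^esub>"
  by (simp add: hP_pow)

lemma hP_inv: "inv\<^bsub>PG (hnn_rel k l m n)\<^esub> hP x y = hP (- x) (- y)"
  by (rule inv_equality) (auto simp: hP_mult hP_0)

lemma hT_hP: "hT \<otimes>\<^bsub>PG (hnn_rel k l m n)\<^esub> hP m n = hP k l \<otimes>\<^bsub>PG (hnn_rel k l m n)\<^esub> hT"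
  (is "_ \<otimes>\<^bsub>?G\<^esub> _ = _")
proof -
  have "pres_eq (hnn_rel k l m n) ([(gT, True)] @ w2 m n @ [(gT, False)]) (w2 k l)"
    by (rule pres_eq.rel) (simp add: hnn_rel_def)
  then have "hT \<otimes>\<^bsub>?G\<^esub> (hP m n \<otimes>\<^bsub>?G\<^esub> inv\<^bsub>?G\<^esub> hT) = hP k l"
    by (simp add: hP_def hT_def inv_pres_class inv_word_def mult_pres_class pres_class_eq_iff)
  then show ?thesis by (metis hP_closed hT_closed inv_closed inv_solve_right m_assoc m_closed inv_inv)
qed

lemma hT_hP_mult: "hT \<otimes>\<^bsub>PG (hnn_rel k l m n)\<^esub> hP (e * m) (e * n) = hP (e * k) (e * l) \<otimes>\<^bsub>PG (hnn_rel k l m n)\<^esub> hT"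
  (is "_ \<otimes>\<^bsub>?G\<^esub> _ = _")
proof (induction e rule: int_induct[where k = 0])
  case base
  then show ?case by (simp add: hP_0)
next
  case (step1 i)
  have "hT \<otimes>\<^bsub>?G\<^esub> hP ((i + 1) * m) ((i + 1) * n) = hT \<otimes>\<^bsub>?G\<^esub> hP (i * m) (i * n) \<otimes>\<^bsub>?G\<^esub> hP m n"
    by (simp add: m_assoc hP_mult algebra_simps)
  also have "\<dots> = hP (i * k) (i * l) \<otimes>\<^bsub>?G\<^esub> (hT \<otimes>\<^bsub>?G\<^esub> hP m n)" by (simp add: step1 m_assoc)
  also have "\<dots> = hP ((i + 1) * k) ((i + 1) * l) \<otimes>\<^bsub>?G\<^esub> hT"
    unfolding hT_hP by (simp add: m_assoc[symmetric] hP_mult algebra_simps)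
  finally show ?case .
next
  case (step2 i)
  have "(hT \<otimes>\<^bsub>?G\<^esub> hP ((i - 1) * m) ((i - 1) * n)) \<otimes>\<^bsub>?G\<^esub> hP m n = hT \<otimes>\<^bsub>?G\<^esub> hP (i * m) (i * n)"
    by (simp add: m_assoc hP_mult algebra_simps)
  also have "\<dots> = hP ((i - 1) * k) ((i - 1) * l) \<otimes>\<^bsub>?G\<^esub> (hP k l \<otimes>\<^bsub>?G\<^esub> hT)"
    by (simp add: step2 m_assoc[symmetric] hP_mult algebra_simps)
  also have "\<dots> = (hP ((i - 1) * k) ((i - 1) * l) \<otimes>\<^bsub>?G\<^esub> hT) \<otimes>\<^bsub>?G\<^esub> hP m n"
    by (simp add: hT_hP[symmetric] m_assoc)
  finally show ?case by (metis hP_closed hT_closed m_closed right_cancel)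
qed

end

text \<open>The abelian part of a machine between two of our presentations: reading \<open>A\<^sup>x B\<^sup>y\<close> in state \<open>s\<close>
  leads to \<open>mv s x y\<close> and writes the exponents \<open>ox s x y\<close>, \<open>oy s x y\<close>; reading \<open>T\<close> writes
  \<open>T\<close> between two abelian words.\<close>

locale zmach =
  fixes k l m n k' l' m' n' :: int and S :: "'s set"
    and mv :: "'s \<Rightarrow> int \<Rightarrow> int \<Rightarrow> 's" and ox oy :: "'s \<Rightarrow> int \<Rightarrow> int \<Rightarrow> int"
    and tm ti :: "'s \<Rightarrow> 's" and lx ly rx ry :: "'s \<Rightarrow> int" and s0 :: 's
  assumes fin: "finite S" and s0: "s0 \<in> S"
    and mv_in: "s \<in> S \<Longrightarrow> mv s x y \<in> S" and mv_0: "s \<in> S \<Longrightarrow> mv s 0 0 = s"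
    and mv_add: "s \<in> S \<Longrightarrow> mv (mv s x y) x' y' = mv s (x + x') (y + y')"
    and ox_add: "s \<in> S \<Longrightarrow> ox s (x + x') (y + y') = ox s x y + ox (mv s x y) x' y'"
    and oy_add: "s \<in> S \<Longrightarrow> oy s (x + x') (y + y') = oy s x y + oy (mv s x y) x' y'"
    and tm_in: "s \<in> S \<Longrightarrow> tm s \<in> S" and ti_in: "s \<in> S \<Longrightarrow> ti s \<in> S"
    and tm_ti: "s \<in> S \<Longrightarrow> tm (ti s) = s" and ti_tm: "s \<in> S \<Longrightarrow> ti (tm s) = s"
    and T_state: "s \<in> S \<Longrightarrow> mv (tm s) m n = tm (mv s k l)"
    and T_out: "s \<in> S \<Longrightarrow> \<exists>e. rx s + ox (tm s) m n - rx (mv s k l) = e * m' \<and>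
       ry s + oy (tm s) m n - ry (mv s k l) = e * n' \<and>
       lx s - lx (mv s k l) + e * k' = ox s k l \<and> ly s - ly (mv s k l) + e * l' = oy s k l"
begin

definition zd :: "'s \<Rightarrow> hnn_gen \<Rightarrow> 's" where
  "zd s x = (case x of gA \<Rightarrow> mv s 1 0 | gB \<Rightarrow> mv s 0 1 | gT \<Rightarrow> tm s)"

definition zdi :: "'s \<Rightarrow> hnn_gen \<Rightarrow> 's" where
  "zdi s x = (case x of gA \<Rightarrow> mv s (-1) 0 | gB \<Rightarrow> mv s 0 (-1) | gT \<Rightarrow> ti s)"

definition zf :: "'s \<Rightarrow> hnn_gen \<Rightarrow> hnn_gen word" where
  "zf s x = (case x of gA \<Rightarrow> w2 (ox s 1 0) (oy s 1 0) | gB \<Rightarrow> w2 (ox s 0 1) (oy s 0 1)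
     | gT \<Rightarrow> w2 (lx s) (ly s) @ [(gT, True)] @ w2 (rx s) (ry s))"

lemma zd_simps: "zd s gA = mv s 1 0" "zd s gB = mv s 0 1" "zd s gT = tm s"
  and zdi_simps: "zdi s gA = mv s (-1) 0" "zdi s gB = mv s 0 (-1)" "zdi s gT = ti s"
  and zf_simps: "zf s gA = w2 (ox s 1 0) (oy s 1 0)" "zf s gB = w2 (ox s 0 1) (oy s 0 1)"
    "zf s gT = w2 (lx s) (ly s) @ [(gT, True)] @ w2 (rx s) (ry s)"
  by (simp_all add: zd_def zdi_def zf_def)

lemma ox_0: "s \<in> S \<Longrightarrow> ox s 0 0 = 0" and oy_0: "s \<in> S \<Longrightarrow> oy s 0 0 = 0"
  using ox_add[of s 0 0 0 0] oy_add[of s 0 0 0 0] by (auto simp: mv_0)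

abbreviation "R' \<equiv> hnn_rel k' l' m' n'"
abbreviation "P \<equiv> hP k' l' m' n'"
abbreviation "st \<equiv> mstate zd zdi"
abbreviation "ou \<equiv> mout zd zdi zf"

sublocale G': group "PG R'" by (rule group_presented_group)

lemma P_eq: "cls R' (w2 x y) = P x y"
  by (simp add: hP_def)

lemma inv_P_eq: "cls R' (inv_word (w2 x y)) = P (- x) (- y)"
  by (simp only: inv_pres_class[symmetric] P_eq hP_inv)

lemma replicate_A: "s \<in> S \<Longrightarrow> st s (replicate i (gA, True)) = mv s (int i) 0 \<and>
   cls R' (ou s (replicate i (gA, True))) = P (ox s (int i) 0) (oy s (int i) 0)"
proof (induction i arbitrary: s)
  case 0
  then show ?case by (simp add: mv_0 ox_0 oy_0 hP_0 one_presented)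
next
  case (Suc i)
  let ?s = "mv s 1 0"
  have s: "?s \<in> S" by (rule mv_in[OF Suc.prems])
  have "cls R' (ou s (replicate (Suc i) (gA, True))) = P (ox s 1 0) (oy s 1 0) \<otimes>\<^bsub>PG R'\<^esub> P (ox ?s (int i) 0) (oy ?s (int i) 0)"
    using Suc.IH[OF s] by (simp add: zd_simps zf_simps pres_class_append[of R' "w2 _ _", unfolded append_assoc] P_eq)
  then show ?case using Suc.IH[OF s] ox_add[OF Suc.prems, of 1 "int i" 0 0] oy_add[OF Suc.prems, of 1 "int i" 0 0] mv_add[OF Suc.prems, of 1 0 "int i" 0]
    by (simp add: zd_simps hP_mult)
qed

lemma replicate_A': "s \<in> S \<Longrightarrow> st s (replicate i (gA, False)) = mv s (- int i) 0 \<and>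
   cls R' (ou s (replicate i (gA, False))) = P (ox s (- int i) 0) (oy s (- int i) 0)"
proof (induction i arbitrary: s)
  case 0
  then show ?case by (simp add: mv_0 ox_0 oy_0 hP_0 one_presented)
next
  case (Suc i)
  let ?s = "mv s (-1) 0"
  have s: "?s \<in> S" by (rule mv_in[OF Suc.prems])
  have e: "- ox ?s 1 0 = ox s (-1) 0" "- oy ?s 1 0 = oy s (-1) 0"
    using ox_add[OF Suc.prems, of "-1" 1 0 0] oy_add[OF Suc.prems, of "-1" 1 0 0] ox_0[OF Suc.prems] oy_0[OF Suc.prems] by auto
  have "cls R' (ou s (replicate (Suc i) (gA, False))) = P (ox s (-1) 0) (oy s (-1) 0) \<otimes>\<^bsub>PG R'\<^esub> P (ox ?s (- int i) 0) (oy ?s (- int i) 0)"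
    using Suc.IH[OF s] inv_P_eq[of "ox ?s 1 0" "oy ?s 1 0"]
    by (simp add: zdi_simps zf_simps pres_class_append[of R' "inv_word (w2 _ _)", unfolded append_assoc] e del: inv_word_append)
  then show ?case using Suc.IH[OF s] ox_add[OF Suc.prems, of "-1" "- int i" 0 0] oy_add[OF Suc.prems, of "-1" "- int i" 0 0] mv_add[OF Suc.prems, of "-1" 0 "- int i" 0]
    by (simp add: zdi_simps hP_mult)
qed

lemma replicate_B: "s \<in> S \<Longrightarrow> st s (replicate i (gB, True)) = mv s 0 (int i) \<and>
   cls R' (ou s (replicate i (gB, True))) = P (ox s 0 (int i)) (oy s 0 (int i))"
proof (induction i arbitrary: s)
  case 0
  then show ?case by (simp add: mv_0 ox_0 oy_0 hP_0 one_presented)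
next
  case (Suc i)
  let ?s = "mv s 0 1"
  have s: "?s \<in> S" by (rule mv_in[OF Suc.prems])
  have "cls R' (ou s (replicate (Suc i) (gB, True))) = P (ox s 0 1) (oy s 0 1) \<otimes>\<^bsub>PG R'\<^esub> P (ox ?s 0 (int i)) (oy ?s 0 (int i))"
    using Suc.IH[OF s] by (simp add: zd_simps zf_simps pres_class_append[of R' "w2 _ _", unfolded append_assoc] P_eq)
  then show ?case using Suc.IH[OF s] ox_add[OF Suc.prems, of 0 0 1 "int i"] oy_add[OF Suc.prems, of 0 0 1 "int i"] mv_add[OF Suc.prems, of 0 1 0 "int i"]
    by (simp add: zd_simps hP_mult)
qed

lemma replicate_B': "s \<in> S \<Longrightarrow> st s (replicate i (gB, False)) = mv s 0 (- int i) \<and>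
   cls R' (ou s (replicate i (gB, False))) = P (ox s 0 (- int i)) (oy s 0 (- int i))"
proof (induction i arbitrary: s)
  case 0
  then show ?case by (simp add: mv_0 ox_0 oy_0 hP_0 one_presented)
next
  case (Suc i)
  let ?s = "mv s 0 (-1)"
  have s: "?s \<in> S" by (rule mv_in[OF Suc.prems])
  have e: "- ox ?s 0 1 = ox s 0 (-1)" "- oy ?s 0 1 = oy s 0 (-1)"
    using ox_add[OF Suc.prems, of 0 0 "-1" 1] oy_add[OF Suc.prems, of 0 0 "-1" 1] ox_0[OF Suc.prems] oy_0[OF Suc.prems] by auto
  have "cls R' (ou s (replicate (Suc i) (gB, False))) = P (ox s 0 (-1)) (oy s 0 (-1)) \<otimes>\<^bsub>PG R'\<^esub> P (ox ?s 0 (- int i)) (oy ?s 0 (- int i))"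
    using Suc.IH[OF s] inv_P_eq[of "ox ?s 0 1" "oy ?s 0 1"]
    by (simp add: zdi_simps zf_simps pres_class_append[of R' "inv_word (w2 _ _)", unfolded append_assoc] e del: inv_word_append)
  then show ?case using Suc.IH[OF s] ox_add[OF Suc.prems, of 0 0 "-1" "- int i"] oy_add[OF Suc.prems, of 0 0 "-1" "- int i"] mv_add[OF Suc.prems, of 0 "-1" 0 "- int i"]
    by (simp add: zdi_simps hP_mult)
qed

lemma st_w2: "s \<in> S \<Longrightarrow> st s (w2 x y) = mv s x y"
  and ou_w2: "s \<in> S \<Longrightarrow> cls R' (ou s (w2 x y)) = P (ox s x y) (oy s x y)"
proof -
  assume s: "s \<in> S"
  have A: "st s (gen_pow gA x) = mv s x 0 \<and> cls R' (ou s (gen_pow gA x)) = P (ox s x 0) (oy s x 0)"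
    using replicate_A[OF s, of "nat x"] replicate_A'[OF s, of "nat (- x)"] by (cases "0 \<le> x") (simp_all add: gen_pow_def)
  have s': "mv s x 0 \<in> S" using mv_in[OF s] .
  have B: "st (mv s x 0) (gen_pow gB y) = mv (mv s x 0) 0 y \<and> cls R' (ou (mv s x 0) (gen_pow gB y)) = P (ox (mv s x 0) 0 y) (oy (mv s x 0) 0 y)"
    using replicate_B[OF s', of "nat y"] replicate_B'[OF s', of "nat (- y)"] by (cases "0 \<le> y") (simp_all add: gen_pow_def)
  show "st s (w2 x y) = mv s x y" using A B mv_add[OF s, of x 0 0 y] by (simp add: mstate_append)
  show "cls R' (ou s (w2 x y)) = P (ox s x y) (oy s x y)"
    using A B ox_add[OF s, of x 0 0 y] oy_add[OF s, of x 0 0 y] by (simp add: mout_append pres_class_append hP_mult)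
qed

lemma T_eq: "cls R' [(gT, True)] = hT k' l' m' n'"
  by (simp add: hT_def)

lemma w2_T_w2: "cls R' (w2 x y @ [(gT, True)] @ w2 x' y')
    = P x y \<otimes>\<^bsub>PG R'\<^esub> hT k' l' m' n' \<otimes>\<^bsub>PG R'\<^esub> P x' y'"
proof -
  have "cls R' (w2 x y @ [(gT, True)] @ w2 x' y')
    = cls R' (w2 x y) \<otimes>\<^bsub>PG R'\<^esub> cls R' ([(gT, True)] @ w2 x' y')"
    by (rule pres_class_append)
  also have "cls R' ([(gT, True)] @ w2 x' y')
    = cls R' [(gT, True)] \<otimes>\<^bsub>PG R'\<^esub> cls R' (w2 x' y')"
    by (rule pres_class_append)
  finally show ?thesis by (simp only: P_eq T_eq) (simp add: G'.m_assoc)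
qed

text \<open>The abelian output between the two letters \<open>T\<close> collapses to a multiple
  \<open>e\<close> of the vector \<open>(m', n')\<close>, which the target relation carries across
  \<open>T\<close> as \<open>e\<close> times \<open>(k', l')\<close>; \<open>T_out\<close> is
  exactly this bookkeeping.\<close>

lemma T_rel: assumes s: "s \<in> S" shows
  "st s ([(gT, True)] @ w2 m n @ [(gT, False)]) = st s (w2 k l)"
  "cls R' (ou s ([(gT, True)] @ w2 m n @ [(gT, False)])) = cls R' (ou s (w2 k l))"
proof -
  let ?s = "mv s k l" and ?G = "PG R'" and ?t = "hT k' l' m' n'"
  note in1 = tm_in[OF s] mv_in[OF s, of k l]
  have t: "mv (tm s) m n = tm ?s" by (rule T_state[OF s])
  show "st s ([(gT, True)] @ w2 m n @ [(gT, False)]) = st s (w2 k l)"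
    using st_w2[OF in1(1), of m n] st_w2[OF s, of k l] ti_tm[OF in1(2)]
    by (simp add: mstate_append zd_simps zdi_simps t)
  obtain e where e: "rx s + ox (tm s) m n - rx ?s = e * m'"
       "ry s + oy (tm s) m n - ry ?s = e * n'"
       "lx s - lx ?s + e * k' = ox s k l" "ly s - ly ?s + e * l' = oy s k l"
    using T_out[OF s] by blast
  have 1: "cls R' (ou s [(gT, True)]) = P (lx s) (ly s) \<otimes>\<^bsub>?G\<^esub> ?t \<otimes>\<^bsub>?G\<^esub> P (rx s) (ry s)"
    using w2_T_w2 by (simp add: zf_simps)
  have 2: "cls R' (ou (tm ?s) [(gT, False)]) = P (- rx ?s) (- ry ?s) \<otimes>\<^bsub>?G\<^esub> inv\<^bsub>?G\<^esub> ?t \<otimes>\<^bsub>?G\<^esub> P (- lx ?s) (- ly ?s)"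
  proof -
    have "cls R' (ou (tm ?s) [(gT, False)]) = inv\<^bsub>?G\<^esub> (cls R' (zf ?s gT))"
      by (simp add: zdi_simps ti_tm[OF in1(2)] inv_pres_class)
    also have "cls R' (zf ?s gT) = P (lx ?s) (ly ?s) \<otimes>\<^bsub>?G\<^esub> ?t \<otimes>\<^bsub>?G\<^esub> P (rx ?s) (ry ?s)"
      unfolding zf_simps by (rule w2_T_w2)
    finally show ?thesis by (simp add: G'.inv_mult_group hP_inv G'.m_assoc)
  qed
  have "cls R' (ou s ([(gT, True)] @ w2 m n @ [(gT, False)])) =
    cls R' (ou s [(gT, True)]) \<otimes>\<^bsub>?G\<^esub> (P (ox (tm s) m n) (oy (tm s) m n) \<otimes>\<^bsub>?G\<^esub> cls R' (ou (tm ?s) [(gT, False)]))"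
    using ou_w2[OF in1(1), of m n] st_w2[OF in1(1), of m n]
    by (simp only: mout_append[of _ _ _ _ "[_]"] mout_append[of _ _ _ _ "w2 _ _"] pres_class_append[of _ "ou _ [_]"] pres_class_append[of _ "ou _ (w2 _ _)"]) (simp add: zd_simps t)
  also have "\<dots> = P (lx s) (ly s) \<otimes>\<^bsub>?G\<^esub> (?t \<otimes>\<^bsub>?G\<^esub> (P (rx s) (ry s) \<otimes>\<^bsub>?G\<^esub> P (ox (tm s) m n) (oy (tm s) m n) \<otimes>\<^bsub>?G\<^esub> P (- rx ?s) (- ry ?s))) \<otimes>\<^bsub>?G\<^esub> inv\<^bsub>?G\<^esub> ?t \<otimes>\<^bsub>?G\<^esub> P (- lx ?s) (- ly ?s)"
    unfolding 1 2 by (simp add: G'.m_assoc)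
  also have "P (rx s) (ry s) \<otimes>\<^bsub>?G\<^esub> P (ox (tm s) m n) (oy (tm s) m n) \<otimes>\<^bsub>?G\<^esub> P (- rx ?s) (- ry ?s) = P (e * m') (e * n')"
    using e(1,2) by (simp add: hP_mult)
  also have "?t \<otimes>\<^bsub>?G\<^esub> P (e * m') (e * n') = P (e * k') (e * l') \<otimes>\<^bsub>?G\<^esub> ?t" by (rule hT_hP_mult)
  also have "P (lx s) (ly s) \<otimes>\<^bsub>?G\<^esub> (P (e * k') (e * l') \<otimes>\<^bsub>?G\<^esub> ?t) \<otimes>\<^bsub>?G\<^esub> inv\<^bsub>?G\<^esub> ?t \<otimes>\<^bsub>?G\<^esub> P (- lx ?s) (- ly ?s)
    = P (lx s) (ly s) \<otimes>\<^bsub>?G\<^esub> P (e * k') (e * l') \<otimes>\<^bsub>?G\<^esub> P (- lx ?s) (- ly ?s)"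
    by (simp add: G'.m_assoc)
  also have "\<dots> = P (ox s k l) (oy s k l)" using e(3,4) by (simp add: hP_mult algebra_simps)
  finally show "cls R' (ou s ([(gT, True)] @ w2 m n @ [(gT, False)])) = cls R' (ou s (w2 k l))"
    using ou_w2[OF s, of k l] by simp
qed

lemma AB_rel: assumes s: "s \<in> S" shows
  "st s [(gA, True), (gB, True), (gA, False), (gB, False)] = s"
  "cls R' (ou s [(gA, True), (gB, True), (gA, False), (gB, False)]) = cls R' []"
proof -
  \<comment> \<open>Written with mixed exponents, the commutator is covered by \<open>ou_w2\<close>,
    and additivity leaves exponents 0.\<close>
  have w: "[(gA, True), (gB, True), (gA, False), (gB, False)] = w2 1 1 @ w2 (-1) (-1)"
    by (simp add: gen_pow_def)
  note i = mv_in[OF s, of 1 1]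
  show "st s [(gA, True), (gB, True), (gA, False), (gB, False)] = s"
    unfolding w mstate_append[of _ _ _ "w2 1 1"] st_w2[OF s] st_w2[OF i] using mv_add[OF s, of 1 1 "-1" "-1"] mv_0[OF s] by simp
  show "cls R' (ou s [(gA, True), (gB, True), (gA, False), (gB, False)]) = cls R' []"
    unfolding w mout_append[of _ _ _ _ "w2 1 1"] st_w2[OF s] pres_class_append[of _ "ou s (w2 1 1)"] ou_w2[OF s] ou_w2[OF i]
    using ox_add[OF s, of 1 "-1" 1 "-1"] oy_add[OF s, of 1 "-1" 1 "-1"] ox_0[OF s] oy_0[OF s]
    by (simp add: hP_mult hP_0 one_presented[symmetric])
qed

sublocale M: machine "hnn_rel k l m n" R' S zd zdi zf s0
proof
  fix s x assume s: "s \<in> S"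
  show "zd s x \<in> S" "zdi s x \<in> S" using s by (auto simp: zd_def zdi_def mv_in tm_in ti_in split: hnn_gen.split)
  show "zdi (zd s x) x = s" "zd (zdi s x) x = s"
    using s by (auto simp: zd_def zdi_def mv_add mv_0 tm_ti ti_tm split: hnn_gen.split)
next
  fix s u v assume s: "s \<in> S" and "(u, v) \<in> hnn_rel k l m n"
  then show "st s u = st s v" and "pres_eq R' (ou s u) (ou s v)"
    using T_rel[OF s] AB_rel[OF s] by (auto simp: hnn_rel_def pres_class_eq_iff)
qed (use fin s0 in auto)

end

text \<open>\<open>machine_pair\<close> with all words reduced to exponents. In \<open>compT\<close>
  the integer \<open>e\<close> counts the applications of the relation that move the surplus abelian
  word from one side of \<open>T\<close> to the other.\<close>

locale zpair =
  Z: zmach k l m n k' l' m' n' S mv ox oy tm ti lx ly rx ry s0 +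
  Z': zmach k' l' m' n' k l m n S' mv' ox' oy' tm' ti' lx' ly' rx' ry' s0'
  for k l m n k' l' m' n' :: int and S :: "'s set" and mv ox oy tm ti lx ly rx ry s0
    and S' :: "'t set" and mv' ox' oy' tm' ti' lx' ly' rx' ry' s0' +
  fixes cx cy :: "'s \<Rightarrow> int" and cx' cy' :: "'t \<Rightarrow> int"
  assumes c0: "cx s0 = 0" "cy s0 = 0" "cx' s0' = 0" "cy' s0' = 0"
    and loop: "s \<in> S \<Longrightarrow> mv' s0' (ox s 1 0) (oy s 1 0) = s0'" "s \<in> S \<Longrightarrow> mv' s0' (ox s 0 1) (oy s 0 1) = s0'"
      "s \<in> S \<Longrightarrow> mv' (tm' (mv' s0' (lx s) (ly s))) (rx s) (ry s) = s0'"
    and loop': "s' \<in> S' \<Longrightarrow> mv s0 (ox' s' 1 0) (oy' s' 1 0) = s0" "s' \<in> S' \<Longrightarrow> mv s0 (ox' s' 0 1) (oy' s' 0 1) = s0"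
      "s' \<in> S' \<Longrightarrow> mv (tm (mv s0 (lx' s') (ly' s'))) (rx' s') (ry' s') = s0"
    and compA: "s \<in> S \<Longrightarrow> ox' s0' (ox s 1 0) (oy s 1 0) = cx s + 1 - cx (mv s 1 0) \<and> oy' s0' (ox s 1 0) (oy s 1 0) = cy s - cy (mv s 1 0)"
    and compB: "s \<in> S \<Longrightarrow> ox' s0' (ox s 0 1) (oy s 0 1) = cx s - cx (mv s 0 1) \<and> oy' s0' (ox s 0 1) (oy s 0 1) = cy s + 1 - cy (mv s 0 1)"
    and compA': "s' \<in> S' \<Longrightarrow> ox s0 (ox' s' 1 0) (oy' s' 1 0) = cx' s' + 1 - cx' (mv' s' 1 0) \<and> oy s0 (ox' s' 1 0) (oy' s' 1 0) = cy' s' - cy' (mv' s' 1 0)"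
    and compB': "s' \<in> S' \<Longrightarrow> ox s0 (ox' s' 0 1) (oy' s' 0 1) = cx' s' - cx' (mv' s' 0 1) \<and> oy s0 (ox' s' 0 1) (oy' s' 0 1) = cy' s' + 1 - cy' (mv' s' 0 1)"
    and compT: "s \<in> S \<Longrightarrow> (let s1 = mv' s0' (lx s) (ly s) in
       \<exists>e. ox' s0' (lx s) (ly s) + lx' s1 = cx s + e * k \<and> oy' s0' (lx s) (ly s) + ly' s1 = cy s + e * l \<and>
           rx' s1 + ox' (tm' s1) (rx s) (ry s) = - cx (tm s) - e * m \<and> ry' s1 + oy' (tm' s1) (rx s) (ry s) = - cy (tm s) - e * n)"
    and compT': "s' \<in> S' \<Longrightarrow> (let s1 = mv s0 (lx' s') (ly' s') in
       \<exists>e. ox s0 (lx' s') (ly' s') + lx s1 = cx' s' + e * k' \<and> oy s0 (lx' s') (ly' s') + ly s1 = cy' s' + e * l' \<and>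
           rx s1 + ox (tm s1) (rx' s') (ry' s') = - cx' (tm' s') - e * m' \<and> ry s1 + oy (tm s1) (rx' s') (ry' s') = - cy' (tm' s') - e * n')"
begin

lemma sym_zpair: "zpair k' l' m' n' k l m n S' mv' ox' oy' tm' ti' lx' ly' rx' ry' s0' S mv ox oy tm ti lx ly rx ry s0 cx' cy' cx cy"
  apply unfold_locales
  by (fact c0 loop loop' compA compB compA' compB' compT compT' | erule loop loop' compA compB compA' compB' compT compT')+

lemma zloop: assumes s: "s \<in> S" shows "mstate Z'.zd Z'.zdi s0' (Z.zf s x) = s0'"
proof -
  note w = Z'.st_w2[OF Z'.s0]
  show ?thesis
  proof (cases x)
    case T
    let ?s = "mv' s0' (lx s) (ly s)"
    have "Z'.st s0' (w2 (lx s) (ly s) @ [(gT, True)] @ w2 (rx s) (ry s)) = mv' (tm' ?s) (rx s) (ry s)"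
      unfolding mstate_append[of _ _ _ "w2 _ _"] w mstate_append[of _ _ _ "[_]"]
      using Z'.st_w2[OF Z'.tm_in[OF Z'.mv_in[OF Z'.s0]]] by (simp add: Z'.zd_simps)
    then show ?thesis using loop[OF s] T by (simp add: Z.zf_simps)
  qed (use loop[OF s] w in \<open>auto simp: Z.zf_simps\<close>)
qed

lemma zcomp: assumes s: "s \<in> S"
  shows "pres_eq (hnn_rel k l m n) (Z'.ou s0' (Z.zf s x)) (w2 (cx s) (cy s) @ [(x, True)] @ inv_word (w2 (cx (Z.zd s x)) (cy (Z.zd s x))))"
proof -
  let ?G = "PG (hnn_rel k l m n)" and ?p = "cls (hnn_rel k l m n)" and ?P = "hP k l m n" and ?t = "hT k l m n"
  note w = Z'.ou_w2[OF Z'.s0]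
  have A: "?p [(gA, True)] = ?P 1 0" by (simp add: hP_def gen_pow_def)
  have B: "?p [(gB, True)] = ?P 0 1" by (simp add: hP_def gen_pow_def)
  have rhs: "?p (w2 (cx s) (cy s) @ [(x, True)] @ inv_word (w2 (cx s') (cy s'))) = ?P (cx s) (cy s) \<otimes>\<^bsub>?G\<^esub> ?p [(x, True)] \<otimes>\<^bsub>?G\<^esub> ?P (- cx s') (- cy s')" for s'
    unfolding pres_class_append[of _ "w2 _ _"] pres_class_append[of _ "[_]"] Z'.inv_P_eq Z'.P_eq by (simp add: Z'.G'.m_assoc)
  have "?p (Z'.ou s0' (Z.zf s x)) = ?p (w2 (cx s) (cy s) @ [(x, True)] @ inv_word (w2 (cx (Z.zd s x)) (cy (Z.zd s x))))"
  proof (cases x)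
    case A': A
    show ?thesis unfolding rhs using compA[OF s] w by (simp add: A' Z.zf_simps Z.zd_simps A hP_mult)
  next
    case B': B
    show ?thesis unfolding rhs using compB[OF s] w by (simp add: B' Z.zf_simps Z.zd_simps B hP_mult)
  next
    case T
    let ?s = "mv' s0' (lx s) (ly s)"
    have si: "?s \<in> S'" "tm' ?s \<in> S'" using Z'.mv_in[OF Z'.s0] Z'.tm_in by auto
    obtain e where e: "ox' s0' (lx s) (ly s) + lx' ?s = cx s + e * k" "oy' s0' (lx s) (ly s) + ly' ?s = cy s + e * l"
           "rx' ?s + ox' (tm' ?s) (rx s) (ry s) = - cx (tm s) - e * m" "ry' ?s + oy' (tm' ?s) (rx s) (ry s) = - cy (tm s) - e * n"
      using compT[OF s] by (auto simp: Let_def)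
    have ot: "?p (Z'.ou ?s [(gT, True)]) = ?P (lx' ?s) (ly' ?s) \<otimes>\<^bsub>?G\<^esub> ?t \<otimes>\<^bsub>?G\<^esub> ?P (rx' ?s) (ry' ?s)"
      using Z'.w2_T_w2 by (simp add: Z'.zf_simps)
    have "Z'.ou s0' (Z.zf s x) = Z'.ou s0' (w2 (lx s) (ly s)) @ Z'.ou ?s [(gT, True)] @ Z'.ou (tm' ?s) (w2 (rx s) (ry s))"
    proof -
      have "Z.zf s x = w2 (lx s) (ly s) @ [(gT, True)] @ w2 (rx s) (ry s)" by (simp add: T Z.zf_simps)
      then show ?thesis
        unfolding mout_append[of _ _ _ _ "w2 (lx s) (ly s)"] mout_append[of _ _ _ _ "[_]"] mout_append[of _ _ _ _ "w2 (lx s) (ly s)"] Z'.st_w2[OF Z'.s0]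
        by (simp only: mout_append[of _ _ _ _ "w2 (lx s) (ly s)"] mout_append[of _ _ _ _ "[_]"] Z'.st_w2[OF Z'.s0] mstate.simps if_True) (simp add: Z'.zd_simps)
    qed
    then have "?p (Z'.ou s0' (Z.zf s x)) = ?p (Z'.ou s0' (w2 (lx s) (ly s))) \<otimes>\<^bsub>?G\<^esub> (?p (Z'.ou ?s [(gT, True)]) \<otimes>\<^bsub>?G\<^esub> ?p (Z'.ou (tm' ?s) (w2 (rx s) (ry s))))"
      by (simp only: pres_class_append[of _ "Z'.ou _ _"])
    also have "\<dots> = (?P (ox' s0' (lx s) (ly s)) (oy' s0' (lx s) (ly s)) \<otimes>\<^bsub>?G\<^esub> ?P (lx' ?s) (ly' ?s)) \<otimes>\<^bsub>?G\<^esub> ?t \<otimes>\<^bsub>?G\<^esub> (?P (rx' ?s) (ry' ?s) \<otimes>\<^bsub>?G\<^esub> ?P (ox' (tm' ?s) (rx s) (ry s)) (oy' (tm' ?s) (rx s) (ry s)))"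
      unfolding ot w Z'.ou_w2[OF si(2)] by (simp add: Z'.G'.m_assoc)
    also have "\<dots> = ?P (cx s) (cy s) \<otimes>\<^bsub>?G\<^esub> (?P (e * k) (e * l) \<otimes>\<^bsub>?G\<^esub> ?t) \<otimes>\<^bsub>?G\<^esub> (?P (- e * m) (- e * n) \<otimes>\<^bsub>?G\<^esub> ?P (- cx (tm s)) (- cy (tm s)))"
      unfolding hP_mult e by (simp add: Z'.G'.m_assoc[symmetric] hP_mult) (rule arg_cong2[where f = "hP k l m n"]; simp)
    also have "\<dots> = ?P (cx s) (cy s) \<otimes>\<^bsub>?G\<^esub> ?t \<otimes>\<^bsub>?G\<^esub> (?P (e * m) (e * n) \<otimes>\<^bsub>?G\<^esub> ?P (- e * m) (- e * n)) \<otimes>\<^bsub>?G\<^esub> ?P (- cx (tm s)) (- cy (tm s))"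
      unfolding hT_hP_mult[symmetric] by (simp add: Z'.G'.m_assoc)
    also have "\<dots> = ?P (cx s) (cy s) \<otimes>\<^bsub>?G\<^esub> ?t \<otimes>\<^bsub>?G\<^esub> ?P (- cx (tm s)) (- cy (tm s))"
      by (simp add: hP_mult hP_0)
    finally show ?thesis unfolding rhs by (simp add: T Z.zd_simps Z'.T_eq)
  qed
  then show ?thesis by (simp add: pres_class_eq_iff)
qed

end

sublocale zpair \<subseteq> MP: machine_pair "hnn_rel k l m n" "hnn_rel k' l' m' n'" S Z.zd Z.zdi Z.zf s0 S' Z'.zd Z'.zdi Z'.zf s0'
    "\<lambda>s. w2 (cx s) (cy s)" "\<lambda>s. w2 (cx' s) (cy' s)"
proof -
  interpret Y: zpair k' l' m' n' k l m n S' mv' ox' oy' tm' ti' lx' ly' rx' ry' s0' S mv ox oy tm ti lx ly rx ry s0 cx' cy' cx cy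
    by (rule sym_zpair)
  show "machine_pair (hnn_rel k l m n) (hnn_rel k' l' m' n') S Z.zd Z.zdi Z.zf s0 S' Z'.zd Z'.zdi Z'.zf s0'
    (\<lambda>s. w2 (cx s) (cy s)) (\<lambda>s. w2 (cx' s) (cy' s))"
    apply unfold_locales
    subgoal by (simp add: c0 gen_pow_def)
    subgoal by (simp add: c0 gen_pow_def)
    subgoal by (rule zloop)
    subgoal by (rule Y.zloop)
    subgoal by (rule zcomp)
    subgoal by (rule Y.zcomp)
    done
qed

section \<open>Explicit machines: base change, scaling, transverse parameters\<close>

lemma zpair_base_change:
  fixes \<alpha> \<beta> \<gamma> \<delta> e :: int
  assumes e: "\<alpha> * \<delta> - \<beta> * \<gamma> = e" "e * e = 1"
  shows "zpair k l m n (k * \<alpha> + l * \<gamma>) (k * \<beta> + l * \<delta>) (m * \<alpha> + n * \<gamma>) (m * \<beta> + n * \<delta>)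
    {()} (\<lambda>_ _ _. ()) (\<lambda>_ x y. x * \<alpha> + y * \<gamma>) (\<lambda>_ x y. x * \<beta> + y * \<delta>) id id (\<lambda>_. 0) (\<lambda>_. 0) (\<lambda>_. 0) (\<lambda>_. 0) ()
    {()} (\<lambda>_ _ _. ()) (\<lambda>_ x y. e * (x * \<delta> - y * \<gamma>)) (\<lambda>_ x y. e * (y * \<alpha> - x * \<beta>)) id id (\<lambda>_. 0) (\<lambda>_. 0) (\<lambda>_. 0) (\<lambda>_. 0) ()
    (\<lambda>_. 0) (\<lambda>_. 0) (\<lambda>_. 0) (\<lambda>_. 0)"
proof -
  \<comment> \<open>The second machine uses \<open>e\<close> times the adjugate matrix, which is the
    inverse because the determinant \<open>e\<close> is its own inverse.\<close>
  have E: "e * ((x * \<alpha> + y * \<gamma>) * \<delta> - (x * \<beta> + y * \<delta>) * \<gamma>) = x"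
    "e * ((x * \<beta> + y * \<delta>) * \<alpha> - (x * \<alpha> + y * \<gamma>) * \<beta>) = y" for x y
  proof -
    have "(x * \<alpha> + y * \<gamma>) * \<delta> - (x * \<beta> + y * \<delta>) * \<gamma> = x * e"
      unfolding e(1)[symmetric] by (simp add: algebra_simps)
    then show "e * ((x * \<alpha> + y * \<gamma>) * \<delta> - (x * \<beta> + y * \<delta>) * \<gamma>) = x"
      using e(2) by (simp add: mult.left_commute[of e] )
    have "(x * \<beta> + y * \<delta>) * \<alpha> - (x * \<alpha> + y * \<gamma>) * \<beta> = y * e"
      unfolding e(1)[symmetric] by (simp add: algebra_simps)
    then show "e * ((x * \<beta> + y * \<delta>) * \<alpha> - (x * \<alpha> + y * \<gamma>) * \<beta>) = y"
      using e(2) by (simp add: mult.left_commute[of e] )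
  qed
  have F: "\<alpha> * (e * \<delta>) - \<beta> * (e * \<gamma>) = 1"
  proof -
    have "\<alpha> * (e * \<delta>) - \<beta> * (e * \<gamma>) = e * (\<alpha> * \<delta> - \<beta> * \<gamma>)" by (simp add: algebra_simps)
    then show ?thesis by (simp only: e)
  qed
  have F': "x * \<alpha> * (e * \<delta>) - x * \<beta> * (e * \<gamma>) = x" for x
    using arg_cong[OF F, of "\<lambda>z. x * z"] by (simp add: algebra_simps)
  show ?thesis
    apply (rule zpair.intro)
    subgoal by (rule zmach.intro; (simp add: algebra_simps)?) (rule exI[of _ 1], simp add: algebra_simps)
    subgoal
      apply (rule zmach.intro)
      subgoal by simp
      subgoal by simp
      subgoal by simp
      subgoal by simp
      subgoal by simp
      subgoal by (simp add: algebra_simps)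
      subgoal by (simp add: algebra_simps)
      subgoal by simp
      subgoal by simp
      subgoal by simp
      subgoal by simp
      subgoal by simp
      subgoal by (rule exI[of _ 1]) (simp add: E)
      done
    subgoal
      apply (rule zpair_axioms.intro)
                     apply (simp_all add: Let_def E[of 1 0, simplified] E[of 0 1, simplified])
      subgoal using F by (simp add: algebra_simps)
      subgoal using F by (simp add: algebra_simps)
      subgoal by (rule exI[of _ 0]) simp
      subgoal by (rule exI[of _ 0]) simp
      done
    done
qed

text \<open>The carry of a sum added in two instalments; it makes the outputs of a counter modulo
  \<open>c\<close> additive along its states.\<close>

lemma div_add_int: "c \<noteq> 0 \<Longrightarrow> ((y::int) + z) div c = y div c + (y mod c + z) div c"
proof -
  assume c: "c \<noteq> 0"
  have "(y + z) div c = (c * (y div c) + (y mod c + z)) div c" by (simp add: add.assoc[symmetric])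
  also have "\<dots> = y div c + (y mod c + z) div c" using c by (rule div_mult_self4)
  finally show ?thesis .
qed

text \<open>In the first group the words with \<open>A\<close>-exponent divisible by
  \<open>c\<close> form a subgroup generated by \<open>A^c\<close>, \<open>B\<close> and the
  conjugates of \<open>T\<close> by \<open>A^s\<close>; in the second those with
  \<open>B\<close>-exponent divisible by \<open>c\<close> form one generated by \<open>A\<close>,
  \<open>B^c\<close> and the conjugates of \<open>T\<close> by \<open>B^s\<close>. Both have
  \<open>c\<close> stable letters with exponents \<open>q\<close> and \<open>p\<close>, so
  \<open>A^c\<close> is matched with \<open>A\<close>, \<open>B\<close> with \<open>B^c\<close>, and
  the conjugates with each other.\<close>

lemma zpair_scale:
  fixes c p q :: int
  assumes c: "c \<ge> 1"
  shows "zpair (c * q) 0 (c * p) 0 q 0 p 0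
    {0..<c} (\<lambda>s x y. (s + x) mod c) (\<lambda>s x y. (s + x) div c) (\<lambda>s x y. c * y) id id (\<lambda>_. 0) (\<lambda>s. s) (\<lambda>_. 0) (\<lambda>s. - s) 0
    {0..<c} (\<lambda>s x y. (s + y) mod c) (\<lambda>s x y. c * x) (\<lambda>s x y. (s + y) div c) id id (\<lambda>s. s) (\<lambda>_. 0) (\<lambda>s. - s) (\<lambda>_. 0) 0
    (\<lambda>s. s) (\<lambda>_. 0) (\<lambda>_. 0) (\<lambda>s. s)"
proof -
  have c0: "c \<noteq> 0" using c by simp
  have add: "(x + (y + z)) div c = (x + y) div c + ((x + y) mod c + z) div c" for x y z
    using div_add_int[OF c0, of "x + y" z] by (simp add: add.assoc)
  have one: "s + 1 - (s + 1) mod c = c * ((s + 1) div c)" for s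
    using minus_mod_eq_mult_div[of "s + 1" c] by simp
  show ?thesis
    apply (rule zpair.intro)
    subgoal
      apply (rule zmach.intro)
      subgoal by simp
      subgoal using c by simp
      subgoal using c by simp
      subgoal by simp
      subgoal by (simp add: mod_add_left_eq add.assoc)
      subgoal by (simp add: add ring_distribs)
      subgoal by (simp add: add ring_distribs)
      subgoal by simp
      subgoal by simp
      subgoal by simp
      subgoal by simp
      subgoal using c by simp
      subgoal for s using c by (intro exI[of _ 1]) auto
      done
    subgoal
      apply (rule zmach.intro)
      subgoal by simp
      subgoal using c by simp
      subgoal using c by simp
      subgoal by simp
      subgoal by (simp add: mod_add_left_eq add.assoc)
      subgoal by (simp add: add ring_distribs)
      subgoal by (simp add: add ring_distribs)
      subgoal by simp
      subgoal by simp
      subgoal by simp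
      subgoal by simp
      subgoal using c by simp
      subgoal for s using c by (intro exI[of _ 1]) auto
      done
    subgoal
      apply (rule zpair_axioms.intro)
                     apply (use c one in \<open>simp_all add: Let_def\<close>)
      subgoal for s by (rule exI[of _ 0]) simp
      subgoal for s by (rule exI[of _ 0]) simp
      done
    done
qed

text \<open>The states of the first machine are the cosets of the lattice spanned by
  \<open>A^h\<close> and \<open>A^k B^l\<close>, those of the second the exponents of
  \<open>A\<close> and \<open>B\<close> modulo \<open>d\<close>, exchanged by \<open>T\<close>. The
  two stabilizers have the same shape: one flat and \<open>d = h * l\<close> stable letters, each of
  which conjugates the first basis vector to the second.\<close>

lemma zpair_transverse:
  fixes h k l :: int
  assumes h: "h \<ge> 1" and l: "l \<ge> 1"
  defines "d \<equiv> h * l"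
  shows "zpair k l h 0 0 1 1 0
    ({0..<h} \<times> {0..<l})
    (\<lambda>s x y. ((fst s + x - k * ((snd s + y) div l)) mod h, (snd s + y) mod l))
    (\<lambda>s x y. d * ((fst s + x - k * ((snd s + y) div l)) div h)) (\<lambda>s x y. d * ((snd s + y) div l))
    id id (\<lambda>s. fst s + h * snd s) (\<lambda>_. 0) (\<lambda>_. 0) (\<lambda>s. - (fst s + h * snd s)) (0, 0)
    ({0..<d} \<times> {0..<d})
    (\<lambda>s x y. ((fst s + x) mod d, (snd s + y) mod d))
    (\<lambda>s x y. h * ((fst s + x) div d) + k * ((snd s + y) div d)) (\<lambda>s x y. l * ((snd s + y) div d))
    prod.swap prod.swap (\<lambda>s. fst s mod h) (\<lambda>s. fst s div h) (\<lambda>s. - (fst s mod h)) (\<lambda>s. - (fst s div h)) (0, 0)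
    fst snd fst snd"
proof -
  have d: "d \<ge> 1" using h l mult_mono[of 1 h 1 l] by (simp add: d_def)
  have n0: "h \<noteq> 0" "l \<noteq> 0" "d \<noteq> 0" using h l d by auto
  have add: "(x + (y + z)) div d = (x + y) div d + ((x + y) mod d + z) div d" for x y z
    using div_add_int[OF n0(3), of "x + y" z] by (simp add: add.assoc)
  have addl: "(x + (y + z)) div l = (x + y) div l + ((x + y) mod l + z) div l" for x y z
    using div_add_int[OF n0(2), of "x + y" z] by (simp add: add.assoc)
  have addh: "(i + (x + x') - k * (Y + Y')) div h = (i + x - k * Y) div h + ((i + x - k * Y) mod h + x' - k * Y') div h" for i x x' Y Y'
    using div_add_int[OF n0(1), of "i + x - k * Y" "x' - k * Y'"] by (simp add: algebra_simps)
  have modh: "((i + x - k * Y) mod h + x' - k * Y') mod h = (i + (x + x') - k * (Y + Y')) mod h" for i x x' Y Y'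
    using mod_add_left_eq[of "i + x - k * Y" h "x' - k * Y'"] by (simp add: algebra_simps)
  \<comment> \<open>\<open>i + h * j\<close> numbers the cosets of the lattice; the reverse machine
    recovers \<open>i\<close> and \<open>j\<close> as remainder and quotient by
    \<open>h\<close>.\<close>
  have N: "0 \<le> i + h * j" "i + h * j < d" if "0 \<le> i" "i < h" "0 \<le> j" "j < l" for i j
  proof -
    show "0 \<le> i + h * j" using that h by simp
    have "h * (j + 1) \<le> h * l" using that h by (intro mult_left_mono) auto
    then show "i + h * j < d" using that by (simp add: d_def algebra_simps)
  qed
  have Nd: "(i + h * j) mod h = i" "(i + h * j) div h = j" if "0 \<le> i" "i < h" for i j
    using that n0 by simp_all
  have dl: "x div h < l" if "0 \<le> x" "x < d" for x
  proof -
    have "h * (x div h) \<le> x" using h by (simp add: minus_mod_eq_mult_div[symmetric])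
    then have "h * (x div h) < h * l" using that by (simp add: d_def)
    then show ?thesis using h by simp
  qed
  have one: "s + 1 - (s + 1) mod d = d * ((s + 1) div d)" for s
    using minus_mod_eq_mult_div[of "s + 1" d] by simp
  show ?thesis
    apply (rule zpair.intro)
    subgoal
      apply (rule zmach.intro)
      subgoal by simp
      subgoal using h l by simp
      subgoal using h l by simp
      subgoal by auto
      subgoal by (auto simp: modh addl mod_add_left_eq add.assoc)
      subgoal by (simp only: fst_conv snd_conv addl addh distrib_left[of d])
      subgoal by (simp add: addl ring_distribs)
      subgoal by simp
      subgoal by simp
      subgoal by simp
      subgoal by simp
      subgoal using n0 by auto
      subgoal for s
        using n0 by (intro exI[of _ d]) auto
      done
    subgoal
      apply (rule zmach.intro)
      subgoal by simp
      subgoal using d by simp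
      subgoal using d by simp
      subgoal by auto
      subgoal by (auto simp: mod_add_left_eq add.assoc)
      subgoal by (simp add: add ring_distribs)
      subgoal by (simp add: add ring_distribs)
      subgoal by auto
      subgoal by auto
      subgoal by simp
      subgoal by simp
      subgoal by auto
      subgoal for s
        by (intro exI[of _ "(snd s + 1) div d"]) auto
      done
    subgoal
      apply (rule zpair_axioms.intro)
      subgoal by simp
      subgoal by simp
      subgoal by simp
      subgoal by simp
      subgoal by auto
      subgoal by auto
      subgoal for s using N[of "fst s" "snd s"] by auto
      subgoal by (auto simp: d_def)
      subgoal for s using n0 by (auto simp: mod_diff_left_eq algebra_simps)
      subgoal for s using n0 dl[of "fst s"] h pos_imp_zdiv_nonneg_iff[of h "fst s"] by auto
      subgoal for s using n0 minus_mod_eq_mult_div[of "fst s + 1" h] by (auto simp: d_def)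
      subgoal for s
        using n0 minus_mod_eq_mult_div[of "snd s + 1" l] minus_mod_eq_mult_div[of "fst s - k * ((snd s + 1) div l)" h]
        by (auto simp: algebra_simps)
      subgoal for s using n0 one[of "fst s"] by (auto simp: d_def)
      subgoal for s using n0 one[of "snd s"] by (auto simp: d_def)
      subgoal for s
        using N[of "fst s" "snd s"] n0 unfolding Let_def by (intro exI[of _ 0]) (auto simp: Nd)
      subgoal for s
        using dl[of "fst s"] h n0 minus_mod_eq_mult_div[of "fst s" h] unfolding Let_def
        by (intro exI[of _ "- snd s"]) (auto simp: pos_imp_zdiv_nonneg_iff)
      done
    done
qed

section \<open>Change of sign through the parity of the \<open>T\<close>-exponent\<close>

lemma (in group) inv_mult_cancel: "x \<in> carrier G \<Longrightarrow> y \<in> carrier G \<Longrightarrow> inv x \<otimes> (x \<otimes> y) = y"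
  by (simp add: m_assoc[symmetric])

lemma (in group) conj_int_pow:
  assumes "x \<in> carrier G" "g \<in> carrier G"
  shows "(g \<otimes> x \<otimes> inv g) [^] (z::int) = g \<otimes> x [^] z \<otimes> inv g"
proof -
  have "(\<lambda>y. g \<otimes> y \<otimes> inv g) \<in> hom G G"
    using assms(2) by (intro homI) (simp_all add: m_assoc inv_mult_cancel)
  then interpret h: group_hom G G "\<lambda>y. g \<otimes> y \<otimes> inv g" by unfold_locales
  show ?thesis using h.hom_int_pow[OF assms(1), of z] by simp
qed

lemma mstate_gen_pow_fixed:
  assumes "d s x = s" "di s x = s"
  shows "mstate d di s (gen_pow x z) = s"
proof -
  have "mstate d di s (replicate i (x, b)) = s" for i b
    using assms by (induction i) auto
  then show ?thesis by (simp add: gen_pow_def)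
qed

lemma mout_gen_pow_fixed:
  assumes "d s x = s" "di s x = s"
  shows "cls R (mout d di f s (gen_pow x z)) = cls R (f s x) [^]\<^bsub>PG R\<^esub> z"
proof -
  interpret group "PG R" by (rule group_presented_group)
  have 1: "cls R (mout d di f s (replicate i (x, True))) = cls R (f s x) [^]\<^bsub>PG R\<^esub> i" for i :: nat
  proof (induction i)
    case (Suc i)
    have "cls R (f s x @ mout d di f s (replicate i (x, True))) = cls R (f s x) \<otimes>\<^bsub>PG R\<^esub> cls R (f s x) [^]\<^bsub>PG R\<^esub> i"
      using Suc by (simp add: pres_class_append)
    then show ?case using assms nat_pow_comm[of "cls R (f s x)" 1 i] by simp
  qed (simp add: one_presented)
  have 2: "cls R (mout d di f s (replicate i (x, False))) = inv\<^bsub>PG R\<^esub> (cls R (f s x) [^]\<^bsub>PG R\<^esub> i)" for i :: nat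
  proof (induction i)
    case (Suc i)
    have "cls R (inv_word (f s x) @ mout d di f s (replicate i (x, False))) = inv\<^bsub>PG R\<^esub> (cls R (f s x)) \<otimes>\<^bsub>PG R\<^esub> inv\<^bsub>PG R\<^esub> (cls R (f s x) [^]\<^bsub>PG R\<^esub> i)"
      using Suc by (simp add: pres_class_append inv_pres_class)
    then show ?case using assms by (simp add: inv_mult_group)
  qed (simp add: one_presented[symmetric])
  show ?thesis
  proof (cases "z < 0")
    case True
    then show ?thesis using 2[of "nat (- z)"] unfolding int_pow_def2 gen_pow_def by (simp only: if_True) simp
  next
    case False
    then show ?thesis using 1[of "nat z"] unfolding int_pow_def2 gen_pow_def by (simp only: if_False) simp
  qed
qed

definition fd :: "bool \<Rightarrow> hnn_gen \<Rightarrow> bool" where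
  "fd s x = (if x = gT then \<not> s else s)"

definition ff :: "bool \<Rightarrow> hnn_gen \<Rightarrow> hnn_gen word" where
  "ff s x = (case x of
      gA \<Rightarrow> if s then [(gA, True)] else [(gT, True), (gA, False), (gT, False)]
    | gB \<Rightarrow> if s then [(gB, True)] else [(gT, True), (gB, True), (gT, False)]
    | gT \<Rightarrow> if s then [] else [(gT, True), (gT, True)])"

lemma gen_pow_0 [simp]: "gen_pow x 0 = []"
  by (simp add: gen_pow_def)

text \<open>Reidemeister-Schreier rewriting for the words of even \<open>T\<close>-exponent, with
  transversal 1, \<open>T\<close>. In that subgroup \<open>A\<close> and its conjugate by
  \<open>T\<close> are separate generators; inverting only the conjugate turns the relations for
  \<open>q\<close> into those for \<open>- q\<close>.\<close>

lemma flip_machine: "machine (hnn_rel q 0 p 0) (hnn_rel (- q) 0 p 0) {True, False} fd fd ff True"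
proof -
  let ?R = "hnn_rel (- q) 0 p 0"
  let ?p = "cls ?R" and ?G = "PG ?R"
  interpret G: group ?G by (rule group_presented_group)
  let ?a = "?p [(gA, True)]" and ?b = "?p [(gB, True)]" and ?t = "?p [(gT, True)]"
  have odd: "?p [(gT, True), (gA, False), (gT, False)] = ?t \<otimes>\<^bsub>?G\<^esub> inv\<^bsub>?G\<^esub> ?a \<otimes>\<^bsub>?G\<^esub> inv\<^bsub>?G\<^esub> ?t"
    by (simp add: pres_class_False[symmetric] mult_pres_class)
  have A: "?p (mout fd fd ff s (gen_pow gA z)) = (if s then ?a [^]\<^bsub>?G\<^esub> z else ?t \<otimes>\<^bsub>?G\<^esub> ?a [^]\<^bsub>?G\<^esub> (- z) \<otimes>\<^bsub>?G\<^esub> inv\<^bsub>?G\<^esub> ?t)" for s z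
    using mout_gen_pow_fixed[of fd s gA fd ?R ff z] G.conj_int_pow[of "inv\<^bsub>?G\<^esub> ?a" ?t z] G.int_pow_inv[of ?a z]
    by (simp add: fd_def ff_def odd G.int_pow_neg)
  have sA: "mstate fd fd s (gen_pow gA z) = s" for s z
    by (rule mstate_gen_pow_fixed) (simp_all add: fd_def)
  have rel: "?t \<otimes>\<^bsub>?G\<^esub> ?a [^]\<^bsub>?G\<^esub> p \<otimes>\<^bsub>?G\<^esub> inv\<^bsub>?G\<^esub> ?t = ?a [^]\<^bsub>?G\<^esub> (- q)"
  proof -
    have "pres_eq ?R ([(gT, True)] @ gen_pow gA p @ [(gT, False)]) (gen_pow gA (- q))"
      by (rule pres_eq.rel) (simp add: hnn_rel_def)
    then show ?thesis
      by (simp only: pres_class_eq_iff[symmetric] pres_class_append pres_class_gen_pow pres_class_False) (simp add: G.m_assoc)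
  qed
  have rel': "?t \<otimes>\<^bsub>?G\<^esub> ?a [^]\<^bsub>?G\<^esub> (- p) \<otimes>\<^bsub>?G\<^esub> inv\<^bsub>?G\<^esub> ?t = ?a [^]\<^bsub>?G\<^esub> q"
    using arg_cong[OF rel, of "m_inv ?G"] by (simp add: G.inv_mult_group G.int_pow_neg G.m_assoc)
  show ?thesis
  proof
    fix s u v assume "(u, v) \<in> hnn_rel q 0 p 0"
    then consider "u = [(gA, True), (gB, True), (gA, False), (gB, False)]" "v = []"
      | "u = [(gT, True)] @ gen_pow gA p @ [(gT, False)]" "v = gen_pow gA q"
      by (auto simp: hnn_rel_def)
    then have "mstate fd fd s u = mstate fd fd s v \<and> pres_eq ?R (mout fd fd ff s u) (mout fd fd ff s v)"
    proof cases
      case 1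
      have c: "?a \<otimes>\<^bsub>?G\<^esub> ?b = ?b \<otimes>\<^bsub>?G\<^esub> ?a" by (rule hnn_AB_commute)
      have c': "inv\<^bsub>?G\<^esub> ?a \<otimes>\<^bsub>?G\<^esub> ?b = ?b \<otimes>\<^bsub>?G\<^esub> inv\<^bsub>?G\<^esub> ?a" using c by (intro G.commute_inv) auto
      have "?p (mout fd fd ff s u) = ?p []"
      proof (cases s)
        case True
        then have "?p (mout fd fd ff s u) = ?a \<otimes>\<^bsub>?G\<^esub> ?b \<otimes>\<^bsub>?G\<^esub> inv\<^bsub>?G\<^esub> (?b \<otimes>\<^bsub>?G\<^esub> ?a)"
          by (simp add: 1 fd_def ff_def inv_word_def mult_pres_class inv_pres_class)
        then show ?thesis by (simp add: c one_presented[symmetric] del: pres_class_eq_iff)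
      next
        case False
        let ?x = "?t \<otimes>\<^bsub>?G\<^esub> inv\<^bsub>?G\<^esub> ?a \<otimes>\<^bsub>?G\<^esub> inv\<^bsub>?G\<^esub> ?t" and ?y = "?t \<otimes>\<^bsub>?G\<^esub> ?b \<otimes>\<^bsub>?G\<^esub> inv\<^bsub>?G\<^esub> ?t"
        have "?p (mout fd fd ff s u) = ?x \<otimes>\<^bsub>?G\<^esub> ?y \<otimes>\<^bsub>?G\<^esub> inv\<^bsub>?G\<^esub> (?y \<otimes>\<^bsub>?G\<^esub> ?x)"
          using False by (simp add: 1 fd_def ff_def inv_word_def pres_class_False[symmetric] mult_pres_class inv_pres_class)
        moreover have "?x \<otimes>\<^bsub>?G\<^esub> ?y = ?t \<otimes>\<^bsub>?G\<^esub> (inv\<^bsub>?G\<^esub> ?a \<otimes>\<^bsub>?G\<^esub> ?b) \<otimes>\<^bsub>?G\<^esub> inv\<^bsub>?G\<^esub> ?t"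
          by (simp add: G.m_assoc G.inv_mult_cancel)
        moreover have "?y \<otimes>\<^bsub>?G\<^esub> ?x = ?t \<otimes>\<^bsub>?G\<^esub> (?b \<otimes>\<^bsub>?G\<^esub> inv\<^bsub>?G\<^esub> ?a) \<otimes>\<^bsub>?G\<^esub> inv\<^bsub>?G\<^esub> ?t"
          by (simp add: G.m_assoc G.inv_mult_cancel)
        ultimately show ?thesis by (simp add: c' one_presented[symmetric])
      qed
      then show ?thesis by (simp add: 1 fd_def pres_class_eq_iff)
    next
      case 2
      have st: "mstate fd fd s u = s" "mstate fd fd s v = s"
        using sA by (simp_all add: 2 mstate_append fd_def)
      have "?p (mout fd fd ff s u) = ?p (mout fd fd ff s v)"
      proof (cases s)
        case True
        have "mout fd fd ff s u = mout fd fd ff False (gen_pow gA p)"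
          using True sA by (simp add: 2 mout_append fd_def ff_def)
        then show ?thesis using A[of False p] A[of True q] rel' True by (simp add: 2)
      next
        case False
        have "mout fd fd ff s u = [(gT, True), (gT, True)] @ mout fd fd ff True (gen_pow gA p) @ inv_word [(gT, True), (gT, True)]"
          using False sA by (simp add: 2 mout_append fd_def ff_def)
        moreover have "?p [(gT, True), (gT, True)] = ?t \<otimes>\<^bsub>?G\<^esub> ?t" by (simp add: mult_pres_class)
        ultimately have "?p (mout fd fd ff s u) = ?t \<otimes>\<^bsub>?G\<^esub> ?t \<otimes>\<^bsub>?G\<^esub> ?a [^]\<^bsub>?G\<^esub> p \<otimes>\<^bsub>?G\<^esub> inv\<^bsub>?G\<^esub> (?t \<otimes>\<^bsub>?G\<^esub> ?t)"
          using A[of True p] by (simp only: pres_class_append inv_pres_class[symmetric] if_True) (simp add: G.m_assoc)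
        also have "\<dots> = ?t \<otimes>\<^bsub>?G\<^esub> (?t \<otimes>\<^bsub>?G\<^esub> ?a [^]\<^bsub>?G\<^esub> p \<otimes>\<^bsub>?G\<^esub> inv\<^bsub>?G\<^esub> ?t) \<otimes>\<^bsub>?G\<^esub> inv\<^bsub>?G\<^esub> ?t"
          by (simp add: G.m_assoc G.inv_mult_group)
        finally show ?thesis using A[of False q] rel False by (simp add: 2)
      qed
      then show ?thesis using st by (simp add: pres_class_eq_iff)
    qed
    then show "mstate fd fd s u = mstate fd fd s v" "pres_eq ?R (mout fd fd ff s u) (mout fd fd ff s v)" by auto
  qed (auto simp: fd_def)
qed

lemma flip_pair: "machine_pair (hnn_rel q 0 p 0) (hnn_rel (- q) 0 p 0) {True, False} fd fd ff True {True, False} fd fd ff True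
  (\<lambda>s. if s then [] else [(gT, True)]) (\<lambda>s. if s then [] else [(gT, True)])"
proof -
  have loop: "mstate fd fd True (ff s x) = True" for s x
    by (auto simp: fd_def ff_def split: hnn_gen.split)
  have comp: "pres_eq R (mout fd fd ff True (ff s x)) ((if s then [] else [(gT, True)]) @ [(x, True)] @ inv_word (if fd s x then [] else [(gT, True)]))" for R s x
  proof -
    have "pres_eq R [] [(gT, True), (gT, False)]"
      using pres_eq.sym[OF pres_eq.cancel[of R gT True]] by simp
    then show ?thesis by (auto simp: fd_def ff_def inv_word_def pres_eq.refl split: hnn_gen.split)
  qed
  note m = flip_machine[of q p] flip_machine[of "- q" p, simplified]
  show ?thesis
    by (intro machine_pair.intro machine_pair_axioms.intro m) (auto simp: loop comp[simplified])
qed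

section \<open>Normalising the parameters\<close>

definition hnn_equiv :: "int \<times> int \<Rightarrow> int \<times> int \<Rightarrow> int \<times> int \<Rightarrow> int \<times> int \<Rightarrow> bool" where
  "hnn_equiv p q p' q' \<longleftrightarrow> commensurable (hnn_group p q) (hnn_group p' q') \<and> quasi_isometric (hnn_group p q) (hnn_group p' q')"

lemma hnn_presented: "\<exists>R. hnn_group p q = PG R"
  using hnn_group_eq by (cases p, cases q) metis

lemma group_hnn: "group (hnn_group p q)"
  using hnn_presented[of p q] group_presented_group by metis

lemma quasi_isometric_hnn_sym: "quasi_isometric (hnn_group p q) (hnn_group p' q') \<Longrightarrow> quasi_isometric (hnn_group p' q') (hnn_group p q)"
  using hnn_presented[of p q] hnn_presented[of p' q'] quasi_isometric_presented_sym by metis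

lemma quasi_isometric_hnn_trans: "quasi_isometric (hnn_group p q) (hnn_group p' q') \<Longrightarrow>
    quasi_isometric (hnn_group p' q') (hnn_group p'' q'') \<Longrightarrow> quasi_isometric (hnn_group p q) (hnn_group p'' q'')"
  using hnn_presented[of p q] hnn_presented[of p' q'] hnn_presented[of p'' q''] quasi_isometric_presented_trans by metis

lemma hnn_equiv_sym: "hnn_equiv p q p' q' \<Longrightarrow> hnn_equiv p' q' p q"
  unfolding hnn_equiv_def using commensurable_sym group_hnn quasi_isometric_hnn_sym by blast

lemma hnn_equiv_trans [trans]: "hnn_equiv p q p' q' \<Longrightarrow> hnn_equiv p' q' p'' q'' \<Longrightarrow> hnn_equiv p q p'' q''"
  unfolding hnn_equiv_def using commensurable_trans[OF group_hnn group_hnn group_hnn] quasi_isometric_hnn_trans by blast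

lemma machine_hnn_equiv:
  "machine_pair (hnn_rel k l m n) (hnn_rel k' l' m' n') S d di f s0 S' d' di' f' s0' c c' \<Longrightarrow>
   hnn_equiv (k, l) (m, n) (k', l') (m', n')"
  unfolding hnn_equiv_def hnn_group_eq
  by (intro conjI) (erule machine_pair.machine_commensurable, erule machine_quasi_isometric)

lemma (in zpair) zpair_equiv: "hnn_equiv (k, l) (m, n) (k', l') (m', n')"
  by (rule machine_hnn_equiv[OF MP.machine_pair_axioms])

lemma (in zpair) zpair_iso: "S = {s0} \<Longrightarrow> S' = {s0'} \<Longrightarrow> hnn_group (k, l) (m, n) \<cong> hnn_group (k', l') (m', n')"
  unfolding hnn_group_eq by (rule MP.machine_iso)

lemma hnn_base_change:
  fixes \<alpha> \<beta> \<gamma> \<delta> :: int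
  assumes "\<alpha> * \<delta> - \<beta> * \<gamma> = 1 \<or> \<alpha> * \<delta> - \<beta> * \<gamma> = -1"
  shows "hnn_group (k, l) (m, n) \<cong> hnn_group (k * \<alpha> + l * \<gamma>, k * \<beta> + l * \<delta>) (m * \<alpha> + n * \<gamma>, m * \<beta> + n * \<delta>)"
    and "hnn_equiv (k, l) (m, n) (k * \<alpha> + l * \<gamma>, k * \<beta> + l * \<delta>) (m * \<alpha> + n * \<gamma>, m * \<beta> + n * \<delta>)"
proof -
  have e: "(\<alpha> * \<delta> - \<beta> * \<gamma>) * (\<alpha> * \<delta> - \<beta> * \<gamma>) = 1" using assms by auto
  note z = zpair_base_change[OF HOL.refl e, of k l m n]
  show "hnn_group (k, l) (m, n) \<cong> hnn_group (k * \<alpha> + l * \<gamma>, k * \<beta> + l * \<delta>) (m * \<alpha> + n * \<gamma>, m * \<beta> + n * \<delta>)"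
    by (rule zpair.zpair_iso[OF z]) auto
  show "hnn_equiv (k, l) (m, n) (k * \<alpha> + l * \<gamma>, k * \<beta> + l * \<delta>) (m * \<alpha> + n * \<gamma>, m * \<beta> + n * \<delta>)"
    by (rule zpair.zpair_equiv[OF z])
qed

lemma hnn_equiv_refl: "hnn_equiv p q p q"
  using hnn_base_change(2)[of 1 1 0 0 "fst p" "snd p" "fst q" "snd q"] by simp

lemma hnn_equiv_neg: "hnn_equiv (k, 0) (m, 0) (- k, 0) (- m, 0)"
  using hnn_base_change(2)[of "-1" 1 0 0 k 0 m 0] by simp

lemma hnn_equiv_flip: "hnn_equiv (k, 0) (m, 0) (- k, 0) (m, 0)"
  by (rule machine_hnn_equiv[OF flip_pair])

lemma hnn_equiv_scale:
  assumes "c \<noteq> 0" shows "hnn_equiv (k, 0) (m, 0) (c * k, 0) (c * m, 0)"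
proof -
  have pos: "hnn_equiv (k, 0) (m, 0) (c * k, 0) (c * m, 0)" if "c \<ge> 1" for c k m
    by (rule hnn_equiv_sym[OF zpair.zpair_equiv[OF zpair_scale[OF that]]])
  show ?thesis
  proof (cases "c \<ge> 1")
    case False
    then have "hnn_equiv (k, 0) (m, 0) ((- c) * k, 0) ((- c) * m, 0)" using assms by (intro pos) auto
    then show ?thesis using hnn_equiv_trans hnn_equiv_neg[of "- c * k" "- c * m"] by force
  qed (rule pos)
qed

text \<open>Both parameter vectors are multiples of one primitive vector \<open>(x, y)\<close>, and
  a Bezout identity completes it to a basis in which it becomes \<open>(1, 0)\<close>. The multiple
  for \<open>(m, n)\<close> is the positive gcd, so the one for \<open>(k, l)\<close> is the gcd
  with the sign of the inner product.\<close>

lemma hnn_collinear_iso: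
  assumes 0: "(k, l) \<noteq> (0, 0)" "(m, n) \<noteq> (0, 0)" and det: "k * n - l * m = 0"
  shows "hnn_group (k, l) (m, n) \<cong> hnn_group (sgn (k * m + l * n) * gcd k l, 0) (gcd m n, 0)"
    and "hnn_equiv (k, l) (m, n) (sgn (k * m + l * n) * gcd k l, 0) (gcd m n, 0)"
proof -
  define h where "h = gcd m n"
  have h: "h > 0" using 0(2) by (auto simp: h_def)
  obtain x y where xy: "m = h * x" "n = h * y" by (metis dvdE gcd_dvd1 gcd_dvd2 h_def)
  obtain u v where "u * m + v * n = h" using bezout_int[of m n] h_def by auto
  then have "h * (u * x + v * y) = h * 1" by (simp add: xy algebra_simps)
  then have uv: "u * x + v * y = 1" using h by simp
  define \<kappa> where "\<kappa> = k * u + l * v"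
  have "h * (k * y) = h * (l * x)" using det by (simp add: xy algebra_simps)
  then have ky: "k * y = l * x" using h by simp
  have "\<kappa> * x = k * (u * x + v * y)" using ky by (simp add: \<kappa>_def algebra_simps)
  then have k: "k = \<kappa> * x" using uv by simp
  have "\<kappa> * y = l * (u * x + v * y)" using ky by (simp add: \<kappa>_def algebra_simps)
  then have l: "l = \<kappa> * y" using uv by simp
  have "gcd x y = 1" using uv by (metis coprime_iff_gcd_eq_1 coprimeI dvd_add dvd_mult)
  then have g: "gcd k l = \<bar>\<kappa>\<bar>" by (simp add: k l gcd_mult_left)
  have "\<kappa> \<noteq> 0" using 0 k l by auto
  have "x * x + y * y > 0"
    using uv by (auto simp: sum_squares_gt_zero_iff)
  moreover have "k * m + l * n = \<kappa> * (h * (x * x + y * y))" by (simp add: k l xy algebra_simps)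
  ultimately have "sgn (k * m + l * n) = sgn \<kappa>" using h by (simp add: sgn_mult)
  then have s: "sgn (k * m + l * n) * gcd k l = \<kappa>" using g by (simp add: sgn_mult_abs)
  have d: "u * x - (- y) * v = 1 \<or> u * x - (- y) * v = -1" using uv by (simp add: mult.commute)
  have e1: "k * u + l * v = \<kappa>" "k * - y + l * x = 0" using ky by (simp_all add: \<kappa>_def)
  have e2: "m * u + n * v = h" "m * - y + n * x = 0" using \<open>u * m + v * n = h\<close> by (simp_all add: xy algebra_simps)
  show "hnn_group (k, l) (m, n) \<cong> hnn_group (sgn (k * m + l * n) * gcd k l, 0) (gcd m n, 0)"
    "hnn_equiv (k, l) (m, n) (sgn (k * m + l * n) * gcd k l, 0) (gcd m n, 0)"
    using hnn_base_change[OF d, of k l m n] unfolding e1 e2 s h_def[symmetric] by auto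
qed

text \<open>A basis adapted to \<open>(m, n)\<close> brings the parameters to
  \<open>(k', l')\<close> and \<open>(h, 0)\<close>, where \<open>h * l'\<close> is minus the
  determinant, so \<open>l'\<close> is nonzero; inverting \<open>B\<close> makes it
  positive.\<close>

lemma hnn_transverse_equiv:
  assumes det: "k * n - l * m \<noteq> 0"
  shows "hnn_equiv (k, l) (m, n) (0, 1) (1, 0)"
proof -
  define h where "h = gcd m n"
  have h: "h \<ge> 1" using det by (auto simp: h_def intro!: gcd_ge_0_int le_neq_trans simp: int_one_le_iff_zero_less zero_less_iff_neq_zero)
  obtain x y where xy: "m = h * x" "n = h * y" by (metis dvdE gcd_dvd1 gcd_dvd2 h_def)
  obtain u v where um: "u * m + v * n = h" using bezout_int[of m n] h_def by auto
  then have "h * (u * x + v * y) = h * 1" by (simp add: xy algebra_simps)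
  then have uv: "u * x + v * y = 1" using h by simp
  define k' where "k' = k * u + l * v"
  define l' where "l' = k * - y + l * x"
  have d: "u * x - (- y) * v = 1 \<or> u * x - (- y) * v = -1" using uv by (simp add: mult.commute)
  have e2: "m * u + n * v = h" "m * - y + n * x = 0" using um by (simp_all add: xy algebra_simps)
  have eq: "hnn_equiv (k, l) (m, n) (k', l') (h, 0)"
    using hnn_base_change(2)[OF d, of k l m n] unfolding e2 k'_def l'_def by auto
  have "h * l' = - (k * n - l * m)" by (simp add: l'_def xy algebra_simps)
  then have "l' \<noteq> 0" using det by auto
  have tr: "hnn_equiv (k', l') (h, 0) (0, 1) (1, 0)" if "l' \<ge> 1" for l'
    by (rule zpair.zpair_equiv[OF zpair_transverse[OF h that]])
  show ?thesis
  proof (cases "l' \<ge> 1")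
    case True
    then show ?thesis using hnn_equiv_trans[OF eq tr] by simp
  next
    case False
    then have "- l' \<ge> 1" using \<open>l' \<noteq> 0\<close> by simp
    moreover have "hnn_equiv (k', l') (h, 0) (k', - l') (h, 0)"
      using hnn_base_change(2)[of 1 "-1" 0 0 k' l' h 0] by simp
    ultimately show ?thesis using hnn_equiv_trans[OF eq] hnn_equiv_trans tr by blast
  qed
qed

section \<open>Normal forms\<close>

text \<open>A rose has one vertex group, generated by \<open>a\<close>, and every other generator \<open>x\<close> is a stable letter
  with \<open>x a\<^sup>p x\<^sup>-\<^sup>1 = a\<^sup>q\<close>, where \<open>p = p x\<close> and \<open>q = q x\<close>.  A vertex of the Bass-Serre tree
  is the list of the digits \<open>(x, e, i)\<close> of a coset of \<open>\<langle>a\<rangle>\<close>, last syllable \<open>a\<^sup>i x\<^sup>e\<close> first.\<close>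

type_synonym 'g vertex = "('g \<times> bool \<times> int) list"

locale rose0 =
  fixes a :: "'g::finite" and p q :: "'g \<Rightarrow> int"
  assumes pq: "x \<noteq> a \<Longrightarrow> p x \<noteq> 0" "x \<noteq> a \<Longrightarrow> q x \<noteq> 0"
begin

text \<open>\<open>a^(inn x e)\<close> passes the letter \<open>x^e\<close> from left to right and
  comes out as \<open>a^(out x e)\<close>; the digits in front of \<open>x^e\<close> are residues
  modulo \<open>inn x e\<close>.\<close>

definition inn :: "'g \<Rightarrow> bool \<Rightarrow> int" where "inn x e = (if e then q x else p x)"
definition out :: "'g \<Rightarrow> bool \<Rightarrow> int" where "out x e = (if e then p x else q x)"

lemma inn_not [simp]: "inn x (\<not> e) = out x e" and out_not [simp]: "out x (\<not> e) = inn x e"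
  by (auto simp: inn_def out_def)

lemma inn_nz: "x \<noteq> a \<Longrightarrow> inn x e \<noteq> 0" and out_nz: "x \<noteq> a \<Longrightarrow> out x e \<noteq> 0"
  using pq by (auto simp: inn_def out_def)

definition bk :: "'g vertex \<Rightarrow> 'g \<Rightarrow> bool \<Rightarrow> bool" where
  "bk ds x e = (case ds of [] \<Rightarrow> False | d # _ \<Rightarrow> fst d = x \<and> fst (snd d) = (\<not> e))"

lemma bk_simps [simp]: "\<not> bk [] x e" "bk ((y, f, i) # ds) x e \<longleftrightarrow> y = x \<and> f = (\<not> e)"
  by (auto simp: bk_def)

lemma bkE: assumes "bk ds x e" obtains i ds' where "ds = (x, \<not> e, i) # ds'"
  using assms by (cases ds) auto

text \<open>Britton's condition with coset representatives. As \<open>mod\<close> takes the sign of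
  the modulus, \<open>i mod inn x e = i\<close> selects one full residue system also when the
  exponent is negative.\<close>

fun valid :: "'g vertex \<Rightarrow> bool" where
  "valid [] = True"
| "valid ((x, e, i) # ds) = (x \<noteq> a \<and> i mod inn x e = i \<and> (i = 0 \<longrightarrow> \<not> bk ds x e) \<and> valid ds)"

text \<open>Right multiplication by \<open>x^e\<close> of the element with vertex \<open>ds\<close>
  and exponent \<open>j\<close>: the residue of \<open>j\<close> becomes a digit and the rest passes
  the letter. A zero residue against an inverse letter cancels and releases the digit of the removed
  syllable.\<close>

definition app :: "'g vertex \<Rightarrow> int \<Rightarrow> 'g \<Rightarrow> bool \<Rightarrow> 'g vertex \<times> int" where
  "app ds j x e = (if j mod inn x e = 0 \<and> bk ds x e
     then (tl ds, snd (snd (hd ds)) + j div inn x e * out x e)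
     else ((x, e, j mod inn x e) # ds, j div inn x e * out x e))"

definition nstep :: "'g vertex \<times> int \<Rightarrow> 'g \<times> bool \<Rightarrow> 'g vertex \<times> int" where
  "nstep s l = (if fst l = a then (fst s, if snd l then snd s + 1 else snd s - 1)
     else app (fst s) (snd s) (fst l) (snd l))"

abbreviation "run \<equiv> foldl nstep"

lemma nstep_a: "nstep (ds, j) (a, e) = (ds, if e then j + 1 else j - 1)"
  by (simp add: nstep_def)

lemma nstep_x: "x \<noteq> a \<Longrightarrow> nstep (ds, j) (x, e) = app ds j x e"
  by (simp add: nstep_def)

lemma app_bk: "j mod inn x e = 0 \<Longrightarrow> app ((x, \<not> e, i) # ds) j x e = (ds, i + j div inn x e * out x e)"
  by (simp add: app_def)

lemma app_bk': "j mod out x e = 0 \<Longrightarrow> app ((x, e, i) # ds) j x (\<not> e) = (ds, i + j div out x e * inn x e)"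
  using app_bk[of j x "\<not> e" i ds] by simp

lemma app_forward: "\<not> (j mod inn x e = 0 \<and> bk ds x e) \<Longrightarrow> app ds j x e = ((x, e, j mod inn x e) # ds, j div inn x e * out x e)"
  unfolding app_def by (rule if_not_P)

lemma app_valid: assumes "valid ds" "x \<noteq> a" shows "valid (fst (app ds j x e))"
proof (cases "j mod inn x e = 0 \<and> bk ds x e")
  case True
  then show ?thesis using assms by (auto elim!: bkE simp: app_bk)
next
  case False
  then show ?thesis using assms by (simp add: app_forward[OF False])
qed

lemma nstep_valid: "valid (fst s) \<Longrightarrow> valid (fst (nstep s l))"
  using app_valid[of "fst s" "fst l" "snd s" "snd l"] by (auto simp: nstep_def)

lemma run_valid: "valid (fst s) \<Longrightarrow> valid (fst (run s w))"
  by (induction w arbitrary: s) (auto simp: nstep_valid)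

lemma div_zero_digit: "x \<noteq> a \<Longrightarrow> i mod inn x e = i \<Longrightarrow> i div inn x e = 0"
  using inn_nz[of x e] div_mult_mod_eq[of i "inn x e"] by simp

text \<open>The released digit is a residue modulo \<open>out x e\<close>, so division of the new
  exponent by \<open>out x e\<close> returns both this digit and the old quotient.\<close>

lemma app_cancel:
  assumes "valid ds" "x \<noteq> a" and "app ds j x e = (ds', j')"
  shows "app ds' j' x (\<not> e) = (ds, j)"
proof (cases "j mod inn x e = 0 \<and> bk ds x e")
  case True
  then obtain i es where ds: "ds = (x, \<not> e, i) # es" by (auto elim: bkE)
  have e: "ds' = es" "j' = i + j div inn x e * out x e" using assms(3) True by (auto simp: ds app_bk)
  have i: "i mod out x e = i" "i = 0 \<Longrightarrow> \<not> bk es x (\<not> e)" using assms(1) by (auto simp: ds)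
  have i0: "i div out x e = 0" using div_zero_digit[of x i "\<not> e"] i assms by simp
  have "j' mod out x e = i" "j' div out x e = j div inn x e"
    using i i0 out_nz[OF assms(2), of e] by (simp_all add: e)
  moreover have "j div inn x e * inn x e = j" using True by auto
  ultimately show ?thesis using i app_forward[of j' x "\<not> e" ds'] by (simp add: ds e(1))
next
  case False
  then have "ds' = (x, e, j mod inn x e) # ds" "j' = j div inn x e * out x e"
    using assms(3) app_forward[OF False] by auto
  then show ?thesis using app_bk'[of j' x e] out_nz[OF assms(2), of e] by simp
qed

lemma nstep_cancel: assumes "valid (fst s)" shows "nstep (nstep s (x, e)) (x, \<not> e) = s"
proof (cases "x = a")
  case True
  then show ?thesis by (cases s) (auto simp: nstep_a)
next
  case False
  obtain ds j where s: "s = (ds, j)" by (cases s)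
  obtain ds' j' where "app ds j x e = (ds', j')" by (cases "app ds j x e")
  then show ?thesis using app_cancel[of ds x j e ds' j'] assms False by (simp add: s nstep_x)
qed

lemma app_shift:
  assumes "x \<noteq> a" shows "app ds (j + inn x e * z) x e = (fst (app ds j x e), snd (app ds j x e) + out x e * z)"
proof -
  have "(j + inn x e * z) mod inn x e = j mod inn x e" "(j + inn x e * z) div inn x e = j div inn x e + z"
    using inn_nz[OF assms, of e] by simp_all
  then show ?thesis by (simp add: app_def algebra_simps)
qed

lemma run_gen_pow: "run (ds, j) (gen_pow a z) = (ds, j + z)"
proof -
  have "run (ds, j) (replicate i (a, True)) = (ds, j + int i)" for i j
    by (induction i arbitrary: j) (auto simp: nstep_a)
  moreover have "run (ds, j) (replicate i (a, False)) = (ds, j - int i)" for i j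
    by (induction i arbitrary: j) (auto simp: nstep_a)
  ultimately show ?thesis by (cases "0 \<le> z") (simp_all add: gen_pow_def)
qed

fun ew :: "'g vertex \<Rightarrow> 'g word" where
  "ew [] = []"
| "ew ((x, e, i) # ds) = ew ds @ gen_pow a i @ [(x, e)]"

definition nword :: "'g vertex \<times> int \<Rightarrow> 'g word" where
  "nword s = ew (fst s) @ gen_pow a (snd s)"

abbreviation "nf \<equiv> run ([], 0)"

lemma nf_ew: "valid ds \<Longrightarrow> nf (ew ds) = (ds, 0)"
proof (induction ds)
  case (Cons d ds)
  obtain x e i where d: "d = (x, e, i)" by (cases d)
  have "app ds i x e = ((x, e, i) # ds, 0)"
    using Cons.prems app_forward[of i x e ds] div_zero_digit[of x i e] by (auto simp: d)
  then show ?case using Cons by (auto simp: d run_gen_pow nstep_x)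
qed simp

lemma nf_nword: "valid (fst s) \<Longrightarrow> nf (nword s) = s"
  by (cases s) (simp add: nword_def nf_ew run_gen_pow)

text \<open>The lattice points of the line over a vertex sit at the positions \<open>pos ds + Dl ds * j\<close>.\<close>

fun Dl :: "'g vertex \<Rightarrow> real" where
  "Dl [] = 1"
| "Dl ((x, e, i) # ds) = Dl ds * (of_int (inn x e) / of_int (out x e))"

fun pos :: "'g vertex \<Rightarrow> real" where
  "pos [] = 0"
| "pos ((x, e, i) # ds) = pos ds + Dl ds * of_int i"

definition Xc :: "'g vertex \<times> int \<Rightarrow> real" where
  "Xc s = pos (fst s) + Dl (fst s) * of_int (snd s)"

lemma Dl_nz: "valid ds \<Longrightarrow> Dl ds \<noteq> 0"
proof (induction ds)
  case (Cons d ds)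
  then show ?case by (cases d) (auto simp: inn_nz out_nz)
qed simp

text \<open>The part of \<open>j\<close> that becomes a digit enters \<open>pos\<close>, and the
  part that passes the letter is rescaled by \<open>Dl\<close>. Thus only the letter
  \<open>a\<close> moves the coordinate.\<close>

lemma Xc_app: assumes "x \<noteq> a" shows "Xc (app ds j x e) = Xc (ds, j)"
proof (cases "j mod inn x e = 0 \<and> bk ds x e")
  case True
  then obtain i es where ds: "ds = (x, \<not> e, i) # es" by (auto elim: bkE)
  have "real_of_int j = of_int (j div inn x e) * of_int (inn x e)"
    using True by (metis add.right_neutral div_mult_mod_eq of_int_mult)
  then show ?thesis using True inn_nz[OF assms, of e] by (simp add: ds app_bk Xc_def field_simps)
next
  case False
  have "real_of_int j = of_int (j div inn x e) * of_int (inn x e) + of_int (j mod inn x e)"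
    by (metis div_mult_mod_eq of_int_add of_int_mult)
  then show ?thesis using out_nz[OF assms, of e] by (simp add: app_forward[OF False] Xc_def field_simps)
qed

section \<open>Nearby vertices and nearby group elements\<close>

definition adj :: "'g vertex \<Rightarrow> 'g vertex \<Rightarrow> bool" where
  "adj v w \<longleftrightarrow> valid v \<and> valid w \<and> (\<exists>d. w = d # v \<or> v = d # w)"

lemma adj_sym: "adj v w \<Longrightarrow> adj w v"
  by (auto simp: adj_def)

lemma app_adj: assumes "valid ds" "x \<noteq> a" shows "adj ds (fst (app ds j x e))"
  using app_valid[OF assms, of j e] assms
  by (cases "j mod inn x e = 0 \<and> bk ds x e") (auto simp: adj_def app_bk app_forward elim!: bkE)

fun near :: "nat \<Rightarrow> 'g vertex \<Rightarrow> 'g vertex \<Rightarrow> bool" where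
  "near 0 v w \<longleftrightarrow> v = w"
| "near (Suc k) v w \<longleftrightarrow> (\<exists>u. near k v u \<and> (u = w \<or> adj u w))"

lemma near_refl: "near k v v"
  by (induction k) auto

lemma near_mono: "k \<le> k' \<Longrightarrow> near k v w \<Longrightarrow> near k' v w"
  by (induction rule: dec_induct) auto

lemma near_trans: "near k v w \<Longrightarrow> near k' w u \<Longrightarrow> near (k + k') v u"
  by (induction k' arbitrary: u) auto

lemma near_sym: "near k v w \<Longrightarrow> near k w v"
proof (induction k arbitrary: w)
  case (Suc k)
  then obtain u where u: "near k u v" "u = w \<or> adj u w" by auto
  have "near 1 w u" using u(2) adj_sym by auto
  from near_trans[OF this u(1)] show ?case by simp
qed simp

lemma near_valid: "near k v w \<Longrightarrow> valid v \<Longrightarrow> valid w"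
  by (induction k arbitrary: w) (auto simp: adj_def)

definition Mx :: int where "Mx = 1 + (\<Sum>x\<in>UNIV. \<bar>p x\<bar> + \<bar>q x\<bar>)"

lemma inn_Mx: "\<bar>inn x e\<bar> + 1 \<le> Mx" and out_Mx: "\<bar>out x e\<bar> + 1 \<le> Mx"
proof -
  have "\<bar>p x\<bar> + \<bar>q x\<bar> \<le> (\<Sum>x\<in>UNIV. \<bar>p x\<bar> + \<bar>q x\<bar>)"
    by (rule member_le_sum) auto
  then show "\<bar>inn x e\<bar> + 1 \<le> Mx" "\<bar>out x e\<bar> + 1 \<le> Mx" by (auto simp: Mx_def inn_def out_def)
qed

lemma Mx_ge1: "Mx \<ge> 1"
  unfolding Mx_def by (simp add: sum_nonneg)

lemma adj_Dl: assumes "adj v w" shows "\<bar>Dl w\<bar> \<le> Mx * \<bar>Dl v\<bar>"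
proof -
  have m: "\<bar>real_of_int (inn x e)\<bar> / \<bar>real_of_int (out x e)\<bar> \<le> Mx" "\<bar>real_of_int (out x e)\<bar> / \<bar>real_of_int (inn x e)\<bar> \<le> Mx"
    if "x \<noteq> a" for x e
  proof -
    have "1 \<le> \<bar>inn x e\<bar>" "1 \<le> \<bar>out x e\<bar>" using inn_nz[OF that, of e] out_nz[OF that, of e] by auto
    then have "1 \<le> \<bar>real_of_int (inn x e)\<bar>" "1 \<le> \<bar>real_of_int (out x e)\<bar>" by linarith+
    moreover have "\<bar>real_of_int (inn x e)\<bar> \<le> Mx" "\<bar>real_of_int (out x e)\<bar> \<le> Mx" using inn_Mx[of x e] out_Mx[of x e] by linarith+
    ultimately show "\<bar>real_of_int (inn x e)\<bar> / \<bar>real_of_int (out x e)\<bar> \<le> Mx" "\<bar>real_of_int (out x e)\<bar> / \<bar>real_of_int (inn x e)\<bar> \<le> Mx"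
      by (smt (verit, ccfv_SIG) divide_le_eq mult_le_cancel_left1)+
  qed
  consider x e i where "w = (x, e, i) # v" "x \<noteq> a" | x e i where "v = (x, e, i) # w" "x \<noteq> a"
    using assms by (auto simp: adj_def)
  then show ?thesis
  proof cases
    case 1
    then show ?thesis using mult_left_mono[OF m(1)[of x e], of "\<bar>Dl v\<bar>"] by (simp add: abs_mult mult.commute)
  next
    case 2
    have "\<bar>Dl w\<bar> = \<bar>Dl v\<bar> * (\<bar>real_of_int (out x e)\<bar> / \<bar>real_of_int (inn x e)\<bar>)"
      using 2 inn_nz[of x e] out_nz[of x e] by (simp add: abs_mult)
    also have "\<dots> \<le> \<bar>Dl v\<bar> * Mx" by (rule mult_left_mono[OF m(2)[OF 2(2)]]) simp
    finally show ?thesis by (simp add: mult.commute)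
  qed
qed

lemma near_Dl: "near k v w \<Longrightarrow> \<bar>Dl w\<bar> \<le> Mx ^ k * \<bar>Dl v\<bar>"
proof (induction k arbitrary: w)
  case (Suc k)
  then obtain u where u: "near k v u" "u = w \<or> adj u w" by auto
  have "\<bar>Dl w\<bar> \<le> Mx * \<bar>Dl u\<bar>"
    using u(2) adj_Dl[of u w] Mx_ge1 mult_right_mono[of 1 "real_of_int Mx" "\<bar>Dl u\<bar>"] by auto
  also have "\<dots> \<le> Mx * (Mx ^ k * \<bar>Dl v\<bar>)"
    using Suc.IH[OF u(1)] Mx_ge1 by (intro mult_left_mono) auto
  finally show ?case by simp
qed simp

definition joined :: "nat \<Rightarrow> 'g vertex \<times> int \<Rightarrow> 'g vertex \<times> int \<Rightarrow> bool" where
  "joined n s s' \<longleftrightarrow> (\<exists>w. length w \<le> n \<and> run s w = s')"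

lemma joined_trans: "joined n s s' \<Longrightarrow> joined n' s' s'' \<Longrightarrow> joined (n + n') s s''"
  unfolding joined_def by (metis add_mono foldl_append length_append)

lemma joined_line: "joined (nat \<bar>z\<bar>) (v, j) (v, j + z)"
  unfolding joined_def by (intro exI[of _ "gen_pow a z"]) (simp add: run_gen_pow, simp add: gen_pow_def)

text \<open>A bounded number of steps along the line reaches a residue from which one letter leads
  to \<open>w\<close>; that letter leaves the coordinate unchanged.\<close>

lemma adj_joined:
  assumes "adj v w" shows "\<exists>j'. joined (nat Mx) (v, j) (w, j') \<and> \<bar>Xc (w, j') - Xc (v, j)\<bar> \<le> Mx * \<bar>Dl v\<bar>"
proof -
  have move: "\<exists>j'. joined (nat Mx) (v, j) (w, j') \<and> \<bar>Xc (w, j') - Xc (v, j)\<bar> \<le> Mx * \<bar>Dl v\<bar>"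
    if x: "x \<noteq> a" and ap: "fst (app v (j + z) x e) = w" and z: "\<bar>z\<bar> + 1 \<le> Mx" for x e z
  proof (intro exI conjI)
    let ?j = "snd (app v (j + z) x e)"
    have e: "app v (j + z) x e = (w, ?j)" using ap by (metis prod.collapse)
    have "joined 1 (v, j + z) (w, ?j)" unfolding joined_def using e x
      by (intro exI[of _ "[(x, e)]"]) (simp add: nstep_x)
    then have "joined (nat \<bar>z\<bar> + 1) (v, j) (w, ?j)" using joined_line joined_trans by blast
    moreover have "nat \<bar>z\<bar> + 1 \<le> nat Mx" using z by linarith
    ultimately show "joined (nat Mx) (v, j) (w, ?j)" unfolding joined_def by (meson order_trans)
    have "Xc (w, ?j) = Xc (v, j + z)" using Xc_app[OF x, of v "j + z" e] e by simp
    then have "\<bar>Xc (w, ?j) - Xc (v, j)\<bar> = \<bar>Dl v\<bar> * \<bar>of_int z\<bar>" by (simp add: Xc_def abs_mult algebra_simps)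
    also have "\<dots> \<le> \<bar>Dl v\<bar> * Mx"
    proof (rule mult_left_mono)
      have "\<bar>z\<bar> \<le> Mx" using z by simp
      then show "\<bar>real_of_int z\<bar> \<le> real_of_int Mx" by linarith
    qed simp
    finally show "\<bar>Xc (w, ?j) - Xc (v, j)\<bar> \<le> Mx * \<bar>Dl v\<bar>" by (simp add: mult.commute)
  qed
  have modbound: "\<bar>i - j mod c\<bar> + 1 \<le> \<bar>c\<bar>" if "c \<noteq> 0" "i mod c = i" for i c :: int
  proof (cases "c > 0")
    case True
    then have "0 \<le> j mod c" "j mod c < c" "0 \<le> i" "i < c"
      using pos_mod_bound[OF True, of i] pos_mod_sign[OF True, of i] that(2) by auto
    then show ?thesis by linarith
  next
    case False
    then have c: "c < 0" using that(1) by simp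
    then have "j mod c \<le> 0" "c < j mod c" "i \<le> 0" "c < i"
      using neg_mod_bound[OF c, of i] neg_mod_sign[OF c, of i] that(2) by auto
    then show ?thesis by linarith
  qed
  consider x e i where "w = (x, e, i) # v" "x \<noteq> a" "i mod inn x e = i" "i = 0 \<longrightarrow> \<not> bk v x e"
    | x e i where "v = (x, e, i) # w" "x \<noteq> a"
    using assms by (auto simp: adj_def)
  then show ?thesis
  proof cases
    case 1
    let ?z = "i - j mod inn x e"
    have m: "(j + ?z) mod inn x e = i" using 1(3) by (metis add.commute diff_add_eq mod_add_left_eq mod_add_self2 mod_diff_right_eq add_diff_cancel_left' diff_add_cancel)
    have "\<bar>?z\<bar> + 1 \<le> Mx" using modbound[OF inn_nz[OF 1(2), of e] 1(3)] inn_Mx[of x e] by linarith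
    moreover have "fst (app v (j + ?z) x e) = w" using m 1 by (subst app_forward) auto
    ultimately show ?thesis using move[OF 1(2)] by blast
  next
    case 2
    let ?z = "0 - j mod out x e"
    have m: "(j + ?z) mod out x e = 0" by simp
    have "\<bar>?z\<bar> + 1 \<le> Mx" using modbound[OF out_nz[OF 2(2), of e], of 0] out_Mx[of x e] by simp
    moreover have "fst (app v (j + ?z) x (\<not> e)) = w" unfolding 2(1) by (subst app_bk'[OF m]) simp
    ultimately show ?thesis using move[OF 2(2)] by blast
  qed
qed

lemma near_joined:
  "\<exists>C. \<forall>v w j. near k v w \<longrightarrow> (\<exists>j'. joined C (v, j) (w, j') \<and> \<bar>Xc (w, j') - Xc (v, j)\<bar> \<le> C * \<bar>Dl v\<bar>)"
proof (induction k)
  case 0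
  show ?case by (intro exI[of _ 0]) (auto simp: joined_def)
next
  case (Suc k)
  then obtain C where C: "\<And>v w j. near k v w \<Longrightarrow> \<exists>j'. joined C (v, j) (w, j') \<and> \<bar>Xc (w, j') - Xc (v, j)\<bar> \<le> C * \<bar>Dl v\<bar>" by blast
  let ?C = "C + nat Mx * nat Mx ^ k + nat Mx"
  show ?case
  proof (intro exI[of _ ?C] allI impI)
    fix v w j assume "near (Suc k) v w"
    then obtain u where u: "near k v u" "u = w \<or> adj u w" by auto
    obtain i where i: "joined C (v, j) (u, i)" "\<bar>Xc (u, i) - Xc (v, j)\<bar> \<le> C * \<bar>Dl v\<bar>" using C[OF u(1)] by blast
    have "\<exists>j'. joined (nat Mx) (u, i) (w, j') \<and> \<bar>Xc (w, j') - Xc (u, i)\<bar> \<le> Mx * \<bar>Dl u\<bar>"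
    proof (cases "adj u w")
      case False
      then show ?thesis using u Mx_ge1 by (intro exI[of _ i]) (auto simp: joined_def intro: exI[of _ "[]"])
    qed (rule adj_joined)
    then obtain j' where j': "joined (nat Mx) (u, i) (w, j')" "\<bar>Xc (w, j') - Xc (u, i)\<bar> \<le> Mx * \<bar>Dl u\<bar>" by blast
    have "joined (C + nat Mx) (v, j) (w, j')" using joined_trans i j' by blast
    then have 1: "joined ?C (v, j) (w, j')" unfolding joined_def by (meson order_trans add_mono le_add1 order_refl add_le_mono)
    have "Mx * \<bar>Dl u\<bar> \<le> Mx * (Mx ^ k * \<bar>Dl v\<bar>)"
      using near_Dl[OF u(1)] Mx_ge1 by (intro mult_left_mono) auto
    then have "\<bar>Xc (w, j') - Xc (v, j)\<bar> \<le> (C + Mx * Mx ^ k) * \<bar>Dl v\<bar>"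
      using i(2) j'(2) by (simp add: algebra_simps)
    also have "\<dots> \<le> ?C * \<bar>Dl v\<bar>" using Mx_ge1 by (intro mult_right_mono) auto
    finally show "\<exists>j'. joined ?C (v, j) (w, j') \<and> \<bar>Xc (w, j') - Xc (v, j)\<bar> \<le> ?C * \<bar>Dl v\<bar>" using 1 by blast
  qed
qed

text \<open>Turns closeness in the tree and on the line into bounded word distance, the form in
  which the maps below are estimated. The unit on the line over \<open>v\<close> is
  \<open>Dl v\<close>, and over a near vertex it differs by at most the factor
  \<open>Mx ^ k\<close>, so the coordinate gap is a bounded number of letters
  \<open>a\<close>.\<close>

lemma close_joined:
  "\<exists>B. \<forall>v w j j'. valid v \<and> near k v w \<and> \<bar>Xc (w, j') - Xc (v, j)\<bar> \<le> L * \<bar>Dl v\<bar> \<longrightarrow> joined B (v, j) (w, j')"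
proof -
  obtain C where C: "\<And>v w j. near k v w \<Longrightarrow> \<exists>j'. joined C (v, j) (w, j') \<and> \<bar>Xc (w, j') - Xc (v, j)\<bar> \<le> C * \<bar>Dl v\<bar>"
    using near_joined[of k] by blast
  define E where "E = nat \<lceil>(C + \<bar>L\<bar>) * Mx ^ k\<rceil>"
  show ?thesis
  proof (intro exI[of _ "C + E"] allI impI)
    fix v w j j' assume h: "valid v \<and> near k v w \<and> \<bar>Xc (w, j') - Xc (v, j)\<bar> \<le> L * \<bar>Dl v\<bar>"
    obtain i where i: "joined C (v, j) (w, i)" "\<bar>Xc (w, i) - Xc (v, j)\<bar> \<le> C * \<bar>Dl v\<bar>" using C h by blast
    have w: "valid w" using h near_valid by blast
    have "\<bar>Dl v\<bar> \<le> Mx ^ k * \<bar>Dl w\<bar>" using near_Dl[OF near_sym] h by blast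
    then have "(C + \<bar>L\<bar>) * \<bar>Dl v\<bar> \<le> (C + \<bar>L\<bar>) * (Mx ^ k * \<bar>Dl w\<bar>)" by (intro mult_left_mono) auto
    moreover have "L * \<bar>Dl v\<bar> \<le> \<bar>L\<bar> * \<bar>Dl v\<bar>" by (intro mult_right_mono) auto
    then have "\<bar>Xc (w, j') - Xc (w, i)\<bar> \<le> (C + \<bar>L\<bar>) * \<bar>Dl v\<bar>"
      using h i(2) unfolding distrib_right by linarith
    moreover have "\<bar>Xc (w, j') - Xc (w, i)\<bar> = \<bar>Dl w\<bar> * \<bar>of_int (j' - i)\<bar>"
      by (simp add: Xc_def abs_mult[symmetric] algebra_simps)
    ultimately have "\<bar>Dl w\<bar> * \<bar>of_int (j' - i)\<bar> \<le> \<bar>Dl w\<bar> * ((C + \<bar>L\<bar>) * Mx ^ k)" by (simp add: algebra_simps)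
    then have "\<bar>of_int (j' - i)\<bar> \<le> (C + \<bar>L\<bar>) * Mx ^ k" using Dl_nz[OF w] by simp
    then have "nat \<bar>j' - i\<bar> \<le> E" unfolding E_def by linarith
    moreover have "joined (nat \<bar>j' - i\<bar>) (w, i) (w, j')" using joined_line[of "j' - i" w i] by simp
    ultimately have "joined E (w, i) (w, j')" unfolding joined_def by (meson order_trans)
    then show "joined (C + E) (v, j) (w, j')" using i joined_trans by blast
  qed
qed

end

text \<open>\<open>nf_rel\<close> makes the normal form an invariant of the class,
  \<open>pres_rel\<close> makes every word equal to its normal form.\<close>

locale rose = rose0 a p q for a :: "'g::finite" and p q +
  fixes R :: "('g word \<times> 'g word) set"
  assumes nf_rel: "valid ds \<Longrightarrow> (u, v) \<in> R \<Longrightarrow> run (ds, j) u = run (ds, j) v"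
    and pres_rel: "x \<noteq> a \<Longrightarrow> pres_eq R ([(x, True)] @ gen_pow a (p x)) (gen_pow a (q x) @ [(x, True)])"
begin

sublocale G: group "PG R" by (rule group_presented_group)

lemma run_pres_eq: fixes s :: "'g vertex \<times> int" assumes "pres_eq R u v" "valid (fst s)" shows "run s u = run s v"
proof (rule run_cong[where S = "{s :: 'g vertex \<times> int. valid (fst s)}", OF _ _ _ assms(1)])
  fix s :: "'g vertex \<times> int" and u v assume "s \<in> {s. valid (fst s)}" "(u, v) \<in> R"
  then show "run s u = run s v" using nf_rel[of "fst s" u v "snd s"] by simp
qed (use assms in \<open>auto simp: nstep_valid nstep_cancel\<close>)

abbreviation "pc \<equiv> cls R"
abbreviation "ga \<equiv> pc [(a, True)]"

lemma letter_pow: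
  assumes "x \<noteq> a"
  shows "ga [^]\<^bsub>PG R\<^esub> (inn x e * z) \<otimes>\<^bsub>PG R\<^esub> pc [(x, e)]
    = pc [(x, e)] \<otimes>\<^bsub>PG R\<^esub> ga [^]\<^bsub>PG R\<^esub> (out x e * z)"
proof -
  let ?G = "PG R" and ?x = "pc [(x, True)]"
  have r: "?x \<otimes>\<^bsub>?G\<^esub> ga [^]\<^bsub>?G\<^esub> (p x) = ga [^]\<^bsub>?G\<^esub> (q x) \<otimes>\<^bsub>?G\<^esub> ?x"
    using pres_rel[OF assms] by (simp only: pres_class_eq_iff[symmetric] pres_class_append pres_class_gen_pow)
  then have c: "?x \<otimes>\<^bsub>?G\<^esub> ga [^]\<^bsub>?G\<^esub> (p x) \<otimes>\<^bsub>?G\<^esub> inv\<^bsub>?G\<^esub> ?x = ga [^]\<^bsub>?G\<^esub> (q x)"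
    by (simp add: G.m_assoc)
  have 1: "?x \<otimes>\<^bsub>?G\<^esub> ga [^]\<^bsub>?G\<^esub> (p x * z) \<otimes>\<^bsub>?G\<^esub> inv\<^bsub>?G\<^esub> ?x = ga [^]\<^bsub>?G\<^esub> (q x * z)"
    using G.conj_int_pow[of "ga [^]\<^bsub>?G\<^esub> (p x)" ?x z] by (simp add: c G.int_pow_pow)
  show ?thesis
  proof (cases e)
    case True
    have "ga [^]\<^bsub>?G\<^esub> (q x * z) \<otimes>\<^bsub>?G\<^esub> ?x = ?x \<otimes>\<^bsub>?G\<^esub> ga [^]\<^bsub>?G\<^esub> (p x * z)"
      unfolding 1[symmetric] by (simp add: G.m_assoc)
    then show ?thesis using True by (simp add: inn_def out_def)
  next
    case False
    have "inv\<^bsub>?G\<^esub> ?x \<otimes>\<^bsub>?G\<^esub> ga [^]\<^bsub>?G\<^esub> (q x * z) = ga [^]\<^bsub>?G\<^esub> (p x * z) \<otimes>\<^bsub>?G\<^esub> inv\<^bsub>?G\<^esub> ?x"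
      unfolding 1[symmetric] by (simp add: G.m_assoc G.inv_mult_cancel)
    then show ?thesis using False by (simp add: inn_def out_def pres_class_False)
  qed
qed

lemma nword_nstep: assumes "valid (fst s)" shows "pres_eq R (nword (nstep s l)) (nword s @ [l])"
proof -
  let ?G = "PG R"
  obtain ds j where s: "s = (ds, j)" by (cases s)
  obtain x e where l: "l = (x, e)" by (cases l)
  have nw: "pc (nword (ds, j)) = pc (ew ds) \<otimes>\<^bsub>?G\<^esub> ga [^]\<^bsub>?G\<^esub> j" for ds j
    by (simp add: nword_def pres_class_append pres_class_gen_pow)
  have "pc (nword (nstep s l)) = pc (nword s) \<otimes>\<^bsub>?G\<^esub> pc [l]"
  proof (cases "x = a")
    case True
    have "ga [^]\<^bsub>?G\<^esub> (j + 1) = ga [^]\<^bsub>?G\<^esub> j \<otimes>\<^bsub>?G\<^esub> ga" "ga [^]\<^bsub>?G\<^esub> (j - 1) = ga [^]\<^bsub>?G\<^esub> j \<otimes>\<^bsub>?G\<^esub> inv\<^bsub>?G\<^esub> ga"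
      using G.int_pow_mult[of ga j 1] G.int_pow_mult[of ga j "-1"] by (simp_all add: G.int_pow_neg)
    then show ?thesis using True by (simp add: s l nstep_a nw G.m_assoc pres_class_False)
  next
    case False
    let ?i = "j mod inn x e" and ?k = "j div inn x e"
    have "j = ?i + inn x e * ?k" by simp
    then have "ga [^]\<^bsub>?G\<^esub> j \<otimes>\<^bsub>?G\<^esub> pc [l] = ga [^]\<^bsub>?G\<^esub> ?i \<otimes>\<^bsub>?G\<^esub> (ga [^]\<^bsub>?G\<^esub> (inn x e * ?k) \<otimes>\<^bsub>?G\<^esub> pc [l])"
      by (metis G.int_pow_mult G.m_assoc G.int_pow_closed pres_class_closed)
    then have m: "ga [^]\<^bsub>?G\<^esub> j \<otimes>\<^bsub>?G\<^esub> pc [l] = ga [^]\<^bsub>?G\<^esub> ?i \<otimes>\<^bsub>?G\<^esub> (pc [l] \<otimes>\<^bsub>?G\<^esub> ga [^]\<^bsub>?G\<^esub> (out x e * ?k))"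
      using letter_pow[OF False, of e ?k] by (simp add: l)
    show ?thesis
    proof (cases "?i = 0 \<and> bk ds x e")
      case True
      then obtain i es where ds: "ds = (x, \<not> e, i) # es" by (auto elim: bkE)
      have "nstep s l = (es, i + ?k * out x e)" using True False by (simp add: s l nstep_x ds app_bk)
      then have L: "pc (nword (nstep s l)) = pc (ew es) \<otimes>\<^bsub>?G\<^esub> (ga [^]\<^bsub>?G\<^esub> i \<otimes>\<^bsub>?G\<^esub> ga [^]\<^bsub>?G\<^esub> (out x e * ?k))"
        by (simp add: nw G.int_pow_mult[symmetric] mult.commute)
      have "pc (ew ds) = pc (ew es) \<otimes>\<^bsub>?G\<^esub> ga [^]\<^bsub>?G\<^esub> i \<otimes>\<^bsub>?G\<^esub> inv\<^bsub>?G\<^esub> pc [l]"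
        by (cases e) (simp_all add: ds pres_class_append pres_class_gen_pow G.m_assoc l pres_class_False)
      then have "pc (nword s) \<otimes>\<^bsub>?G\<^esub> pc [l] = pc (ew es) \<otimes>\<^bsub>?G\<^esub> ga [^]\<^bsub>?G\<^esub> i \<otimes>\<^bsub>?G\<^esub> inv\<^bsub>?G\<^esub> pc [l] \<otimes>\<^bsub>?G\<^esub> (pc [l] \<otimes>\<^bsub>?G\<^esub> ga [^]\<^bsub>?G\<^esub> (out x e * ?k))"
        using True m by (simp add: s nw G.m_assoc)
      also have "\<dots> = pc (nword (nstep s l))" unfolding L by (simp add: G.m_assoc G.inv_mult_cancel)
      finally show ?thesis by simp
    next
      case F: False
      have "nstep s l = ((x, e, ?i) # ds, ?k * out x e)" using F False by (simp add: s l nstep_x app_forward)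
      then show ?thesis using m
        by (simp add: s nw pres_class_append pres_class_gen_pow G.m_assoc l[symmetric] mult.commute)
    qed
  qed
  then show ?thesis by (simp only: mult_pres_class pres_class_eq_iff)
qed

lemma nword_run: "valid (fst s) \<Longrightarrow> pres_eq R (nword (run s w)) (nword s @ w)"
proof (induction w rule: rev_induct)
  case (snoc l w)
  have "pres_eq R (nword (run s w) @ [l]) ((nword s @ w) @ [l])"
    using snoc pres_eq.cong pres_eq.refl by blast
  then show ?case using nword_nstep[of "run s w" l] run_valid[of s w] snoc.prems pres_eq.trans by fastforce
qed (simp add: pres_eq.refl)

lemma nword_nf: "pres_eq R (nword (nf w)) w"
  using nword_run[of "([], 0)" w] by (simp add: nword_def)

lemma joined_pdist: "valid (fst s) \<Longrightarrow> joined n s s' \<Longrightarrow> pdist R (pc (nword s)) (pc (nword s')) \<le> n"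
proof -
  assume v: "valid (fst s)" and "joined n s s'"
  then obtain w where w: "length w \<le> n" "run s w = s'" by (auto simp: joined_def)
  have "pc (nword s') = pc (nword s @ w)" using nword_run[OF v, of w] w by (simp add: pres_class_eq_iff)
  then show ?thesis using pdist_le[of R "nword s" w] w by simp
qed

end

section \<open>Quasi-isometries from maps of Bass-Serre trees\<close>

locale rose_map = A: rose a p q R + A': rose a' p' q' R'
  for a :: "'g::finite" and p q R and a' :: "'h::finite" and p' q' R' +
  fixes \<phi> :: "'g vertex \<Rightarrow> 'h vertex" and K :: nat and C :: real
  assumes \<phi>_valid: "A.valid v \<Longrightarrow> A'.valid (\<phi> v)"
    and \<phi>_adj: "A.adj v w \<Longrightarrow> A'.near K (\<phi> v) (\<phi> w)"
    and \<phi>_Dl: "A.valid v \<Longrightarrow> \<bar>A'.Dl (\<phi> v)\<bar> \<le> C * \<bar>A.Dl v\<bar>" "A.valid v \<Longrightarrow> \<bar>A.Dl v\<bar> \<le> C * \<bar>A'.Dl (\<phi> v)\<bar>"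
    and C1: "C \<ge> 1"
begin

text \<open>The coordinate on the line is kept and rounded to the lattice of points over the new
  vertex.\<close>

definition F :: "'g vertex \<times> int \<Rightarrow> 'h vertex \<times> int" where
  "F s = (\<phi> (fst s), \<lfloor>(A.Xc s - A'.pos (\<phi> (fst s))) / A'.Dl (\<phi> (fst s))\<rfloor>)"

lemma Xc_F: assumes "A.valid (fst s)" shows "\<bar>A'.Xc (F s) - A.Xc s\<bar> \<le> \<bar>A'.Dl (\<phi> (fst s))\<bar>"
proof -
  let ?d = "A'.Dl (\<phi> (fst s))" and ?y = "A.Xc s - A'.pos (\<phi> (fst s))"
  have d: "?d \<noteq> 0" using A'.Dl_nz \<phi>_valid assms by blast
  have "A'.Xc (F s) - A.Xc s = ?d * (of_int \<lfloor>?y / ?d\<rfloor> - ?y / ?d)"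
    using d by (simp add: A'.Xc_def F_def field_simps)
  moreover have "\<bar>of_int \<lfloor>?y / ?d\<rfloor> - ?y / ?d\<bar> \<le> 1" by linarith
  ultimately show ?thesis using mult_left_mono[of "\<bar>of_int \<lfloor>?y / ?d\<rfloor> - ?y / ?d\<bar>" 1 "\<bar>?d\<bar>"] by (simp add: abs_mult)
qed

lemma F_valid: "A.valid (fst s) \<Longrightarrow> A'.valid (fst (F s))"
  by (simp add: F_def \<phi>_valid)

lemma nstep_near: assumes "A.valid (fst s)"
  shows "fst (A.nstep s l) = fst s \<or> A.adj (fst s) (fst (A.nstep s l))"
    and "\<bar>A.Xc (A.nstep s l) - A.Xc s\<bar> \<le> \<bar>A.Dl (fst s)\<bar>"
proof -
  obtain ds j where s: "s = (ds, j)" by (cases s)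
  obtain x e where l: "l = (x, e)" by (cases l)
  show "fst (A.nstep s l) = fst s \<or> A.adj (fst s) (fst (A.nstep s l))"
    using assms A.app_adj[of ds x j e] by (auto simp: s l A.nstep_def)
  show "\<bar>A.Xc (A.nstep s l) - A.Xc s\<bar> \<le> \<bar>A.Dl (fst s)\<bar>"
    by (cases "x = a") (auto simp: s l A.nstep_a A.nstep_x A.Xc_app, simp_all add: A.Xc_def algebra_simps)
qed

lemma F_lipschitz: "\<exists>B. \<forall>s l. A.valid (fst s) \<longrightarrow> A'.joined B (F s) (F (A.nstep s l))"
proof -
  \<comment> \<open>Summands in units of the old image vertex: the rounding there, the length of the
    step, and the rounding at the new image vertex, whose unit is larger by at most the factor
    \<open>C * Mx * C\<close>.\<close>
  obtain B where B: "\<And>v w j j'. A'.valid v \<Longrightarrow> A'.near K v w \<Longrightarrow>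
      \<bar>A'.Xc (w, j') - A'.Xc (v, j)\<bar> \<le> (1 + C + C * A.Mx * C) * \<bar>A'.Dl v\<bar> \<Longrightarrow> A'.joined B (v, j) (w, j')"
    using A'.close_joined[of K "1 + C + C * A.Mx * C"] by blast
  have "A'.joined B (F s) (F (A.nstep s l))" if s: "A.valid (fst s)" for s l
  proof -
    let ?t = "A.nstep s l" and ?v = "\<phi> (fst s)"
    have t: "A.valid (fst ?t)" using A.nstep_valid[OF s] .
    have nr: "A'.near K ?v (\<phi> (fst ?t))" using nstep_near(1)[OF s, of l] \<phi>_adj A'.near_refl by metis
    have M: "\<bar>A.Dl (fst ?t)\<bar> \<le> A.Mx * \<bar>A.Dl (fst s)\<bar>"
      using nstep_near(1)[OF s, of l] A.adj_Dl A.Mx_ge1 mult_right_mono[of 1 "real_of_int A.Mx" "\<bar>A.Dl (fst s)\<bar>"] by auto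
    have "\<bar>A'.Xc (F ?t) - A'.Xc (F s)\<bar> \<le> \<bar>A'.Dl (\<phi> (fst ?t))\<bar> + \<bar>A.Dl (fst s)\<bar> + \<bar>A'.Dl ?v\<bar>"
      using Xc_F[OF s] Xc_F[OF t] nstep_near(2)[OF s, of l] by linarith
    also have "\<dots> \<le> C * (A.Mx * (C * \<bar>A'.Dl ?v\<bar>)) + C * \<bar>A'.Dl ?v\<bar> + \<bar>A'.Dl ?v\<bar>"
    proof -
      have "A.Mx * \<bar>A.Dl (fst s)\<bar> \<le> A.Mx * (C * \<bar>A'.Dl ?v\<bar>)"
        using \<phi>_Dl(2)[OF s] A.Mx_ge1 by (intro mult_left_mono) auto
      then have "C * \<bar>A.Dl (fst ?t)\<bar> \<le> C * (A.Mx * (C * \<bar>A'.Dl ?v\<bar>))"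
        using M C1 by (intro mult_left_mono) auto
      then show ?thesis using \<phi>_Dl(1)[OF t] \<phi>_Dl(2)[OF s] by linarith
    qed
    also have "\<dots> = (1 + C + C * A.Mx * C) * \<bar>A'.Dl ?v\<bar>" by (simp add: algebra_simps)
    finally show ?thesis
      using B[OF \<phi>_valid[OF s] nr, of "snd (F ?t)" "snd (F s)"] by (simp add: F_def)
  qed
  then show ?thesis by blast
qed

definition Fg :: "'g word set \<Rightarrow> 'h word set" where
  "Fg X = A'.pc (A'.nword (F (A.nf (SOME w. X = A.pc w))))"

lemma Fg: "Fg (A.pc w) = A'.pc (A'.nword (F (A.nf w)))"
proof -
  have "A.pc w = A.pc (SOME v. A.pc w = A.pc v)"
    by (rule someI[of "\<lambda>v. A.pc w = A.pc v"]) simp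
  then show ?thesis
    using A.run_pres_eq[of w "SOME v. A.pc w = A.pc v" "([], 0)"] by (simp add: Fg_def pres_class_eq_iff)
qed

lemma Fg_lipschitz: "\<exists>B. \<forall>w x. pdist R' (Fg (A.pc w)) (Fg (A.pc (w @ [(x, True)]))) \<le> real B"
proof -
  obtain B where B: "\<And>s l. A.valid (fst s) \<Longrightarrow> A'.joined B (F s) (F (A.nstep s l))" using F_lipschitz by blast
  have "pdist R' (Fg (A.pc w)) (Fg (A.pc (w @ [(x, True)]))) \<le> real B" for w x
    using A'.joined_pdist[OF F_valid B, of "A.nf w"] A.run_valid[of "([], 0)" w] by (simp add: Fg)
  then show ?thesis by blast
qed

end

locale rose_pair = X: rose_map a p q R a' p' q' R' \<phi> K C + Y: rose_map a' p' q' R' a p q R \<psi> K C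
  for a :: "'g::finite" and p q R and a' :: "'h::finite" and p' q' R' and \<phi> \<psi> and K :: nat and C :: real +
  assumes \<psi>_\<phi>: "X.A.valid v \<Longrightarrow> X.A.near K (\<psi> (\<phi> v)) v"
begin

lemma Fg_Fg: "\<exists>B. \<forall>w. pdist R (Y.Fg (X.Fg (cls R w))) (cls R w) \<le> real B"
proof -
  \<comment> \<open>The two roundings have sizes \<open>C * C\<close> and \<open>C\<close> in the
    unit of the original vertex; the power of \<open>Mx\<close> converts to the unit of the vertex
    returned by the round trip.\<close>
  let ?L = "(C + C * C) * X.A.Mx ^ K"
  obtain B where B: "\<And>v w j j'. X.A.valid v \<Longrightarrow> X.A.near K v w \<Longrightarrow>
    \<bar>X.A.Xc (w, j') - X.A.Xc (v, j)\<bar> \<le> ?L * \<bar>X.A.Dl v\<bar> \<Longrightarrow> X.A.joined B (v, j) (w, j')"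
    using X.A.close_joined[of K ?L] by blast
  have "pdist R (Y.Fg (X.Fg (cls R w))) (cls R w) \<le> real B" for w
  proof -
    let ?s = "X.A.nf w"
    have v: "X.A.valid (fst ?s)" using X.A.run_valid[of "([], 0)" w] by simp
    note v' = X.F_valid[OF v] and v'' = Y.F_valid[OF X.F_valid[OF v]]
    have f: "fst (Y.F (X.F ?s)) = \<psi> (\<phi> (fst ?s))" by (simp add: X.F_def Y.F_def)
    have nr: "X.A.near K (\<psi> (\<phi> (fst ?s))) (fst ?s)" using \<psi>_\<phi> v by blast
    have "\<bar>X.A.Xc (Y.F (X.F ?s)) - X.A.Xc ?s\<bar> \<le> \<bar>X.A.Dl (\<psi> (fst (X.F ?s)))\<bar> + \<bar>X.A'.Dl (\<phi> (fst ?s))\<bar>"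
      using X.Xc_F[OF v] Y.Xc_F[OF v'] by linarith
    also have "\<dots> \<le> C * \<bar>X.A'.Dl (fst (X.F ?s))\<bar> + C * \<bar>X.A.Dl (fst ?s)\<bar>"
      using Y.\<phi>_Dl(1)[OF v'] X.\<phi>_Dl(1)[OF v] by linarith
    also have "\<dots> \<le> C * (C * \<bar>X.A.Dl (fst ?s)\<bar>) + C * \<bar>X.A.Dl (fst ?s)\<bar>"
      using X.\<phi>_Dl(1)[OF v] X.C1 by (intro add_right_mono mult_left_mono) (auto simp: X.F_def)
    also have "\<dots> = (C + C * C) * \<bar>X.A.Dl (fst ?s)\<bar>" by (simp add: algebra_simps)
    also have "\<dots> \<le> (C + C * C) * (X.A.Mx ^ K * \<bar>X.A.Dl (fst (Y.F (X.F ?s)))\<bar>)"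
      using X.A.near_Dl[OF nr] X.C1 unfolding f by (intro mult_left_mono) auto
    finally have "\<bar>X.A.Xc (Y.F (X.F ?s)) - X.A.Xc ?s\<bar> \<le> ?L * \<bar>X.A.Dl (fst (Y.F (X.F ?s)))\<bar>" by simp
    then have "X.A.joined B (Y.F (X.F ?s)) ?s"
      using B[of "fst (Y.F (X.F ?s))" "fst ?s" "snd ?s" "snd (Y.F (X.F ?s))"] v'' nr unfolding f
      by (simp add: f[symmetric] abs_minus_commute)
    then have "pdist R (X.A.pc (X.A.nword (Y.F (X.F ?s)))) (X.A.pc (X.A.nword ?s)) \<le> real B"
      using X.A.joined_pdist[OF v''] by blast
    moreover have "X.A.pc (X.A.nword ?s) = cls R w" using X.A.nword_nf pres_class_eq_iff by blast
    moreover have "X.A'.nf (X.A'.nword (X.F ?s)) = X.F ?s" using X.A'.nf_nword v' by blast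
    ultimately show ?thesis by (simp add: X.Fg Y.Fg)
  qed
  then show ?thesis by blast
qed

end

theorem rose_quasi_isometric:
  assumes "rose_pair a p q R a' p' q' R' \<phi> \<psi> K C" "rose_pair a' p' q' R' a p q R \<psi> \<phi> K C"
  shows "quasi_isometric (PG R) (PG R')"
proof -
  interpret P: rose_pair a p q R a' p' q' R' \<phi> \<psi> K C by fact
  interpret P': rose_pair a' p' q' R' a p q R \<psi> \<phi> K C by fact
  obtain B1 where B1: "\<And>w x. pdist R' (P.X.Fg (cls R w)) (P.X.Fg (cls R (w @ [(x, True)]))) \<le> real B1"
    using P.X.Fg_lipschitz by blast
  obtain B2 where B2: "\<And>w x. pdist R (P.Y.Fg (cls R' w)) (P.Y.Fg (cls R' (w @ [(x, True)]))) \<le> real B2"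
    using P.Y.Fg_lipschitz by blast
  obtain B3 where B3: "\<And>w. pdist R (P.Y.Fg (P.X.Fg (cls R w))) (cls R w) \<le> real B3"
    using P.Fg_Fg by blast
  obtain B4 where B4: "\<And>w. pdist R' (P.X.Fg (P.Y.Fg (cls R' w))) (cls R' w) \<le> real B4"
    using P'.Fg_Fg by blast
  let ?B = "real (B1 + B2 + B3 + B4)"
  show ?thesis
  proof (rule quasi_isometric_presentedI[where f = P.X.Fg and g = P.Y.Fg and B = ?B])
    show "P.X.Fg \<in> carrier (PG R) \<rightarrow> carrier (PG R')" by (auto simp: carrier_presented P.X.Fg)
    show "P.Y.Fg \<in> carrier (PG R') \<rightarrow> carrier (PG R)" by (auto simp: carrier_presented P.Y.Fg)
    show "pdist R' (P.X.Fg (cls R w)) (P.X.Fg (cls R (w @ [(x, True)]))) \<le> ?B" for w x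
      by (rule order_trans[OF B1]) simp
    show "pdist R (P.Y.Fg (cls R' w)) (P.Y.Fg (cls R' (w @ [(x, True)]))) \<le> ?B" for w x
      by (rule order_trans[OF B2]) simp
    show "pdist R (P.Y.Fg (P.X.Fg (cls R w))) (cls R w) \<le> ?B" for w
      by (rule order_trans[OF B3]) simp
    show "pdist R' (P.X.Fg (P.Y.Fg (cls R' w))) (cls R' w) \<le> ?B" for w
      by (rule order_trans[OF B4]) simp
  qed
qed

section \<open>Whyte's classification of nonunimodular trees\<close>

text \<open>Letters of the universal binary-like tree: up, down, and two letters that keep the level.\<close>

datatype dir = U | D | Z0 | Z1

fun lvl :: "dir list \<Rightarrow> int" where
  "lvl [] = 0"
| "lvl (l # x) = lvl x + (case l of U \<Rightarrow> 1 | D \<Rightarrow> -1 | _ \<Rightarrow> 0)"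

text \<open>Only the letter \<open>x0\<close> changes the scale, and \<open>eu\<close> is the
  direction in which the scale grows. A strip at least four steps high leaves room for two steps
  inside it, up or down, from every vertex. The height \<open>W\<close> is a parameter because two
  trees have to share it.\<close>

locale updown = rose0 a p q for a :: "'g::finite" and p q +
  fixes x0 :: 'g and eu :: bool and W :: real
  assumes x0: "x0 \<noteq> a" and p2: "\<bar>p x0\<bar> \<ge> 2" and q2: "\<bar>q x0\<bar> \<ge> 2"
    and eu: "\<bar>inn x0 eu\<bar> > \<bar>out x0 eu\<bar>"
    and other: "x \<noteq> a \<Longrightarrow> x \<noteq> x0 \<Longrightarrow> \<bar>p x\<bar> = \<bar>q x\<bar>"
    and W: "W \<ge> 4 * ln (\<bar>real_of_int (inn x0 eu)\<bar> / \<bar>real_of_int (out x0 eu)\<bar>)"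
begin

definition \<sigma> :: real where "\<sigma> = ln (\<bar>real_of_int (inn x0 eu)\<bar> / \<bar>real_of_int (out x0 eu)\<bar>)"

lemma \<sigma>_pos: "\<sigma> > 0" and W_pos: "W > 0" and W4: "4 * \<sigma> \<le> W"
proof -
  have "1 \<le> \<bar>out x0 eu\<bar>" using out_nz[OF x0, of eu] by auto
  then have "0 < \<bar>real_of_int (out x0 eu)\<bar>" by linarith
  moreover have "\<bar>real_of_int (out x0 eu)\<bar> < \<bar>real_of_int (inn x0 eu)\<bar>" using eu by linarith
  ultimately show s: "\<sigma> > 0" by (simp add: \<sigma>_def)
  show "4 * \<sigma> \<le> W" using W by (simp add: \<sigma>_def)
  with s show "W > 0" by linarith
qed

fun ht :: "'g vertex \<Rightarrow> int" where
  "ht [] = 0"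
| "ht ((x, e, i) # ds) = ht ds + (if x = x0 then (if e = eu then 1 else -1) else 0)"

lemma Dl_ht: "valid ds \<Longrightarrow> \<bar>Dl ds\<bar> = exp (\<sigma> * ht ds)"
proof (induction ds)
  case (Cons d ds)
  obtain x e i where d: "d = (x, e, i)" by (cases d)
  have x: "x \<noteq> a" and v: "valid ds" using Cons.prems by (auto simp: d)
  have nz: "inn x e \<noteq> 0" "out x e \<noteq> 0" using inn_nz out_nz x by auto
  have r: "exp \<sigma> = \<bar>real_of_int (inn x0 eu)\<bar> / \<bar>real_of_int (out x0 eu)\<bar>"
    using inn_nz[OF x0, of eu] out_nz[OF x0, of eu] by (simp add: \<sigma>_def)
  have e: "\<bar>Dl (d # ds)\<bar> = exp (\<sigma> * ht ds) * (\<bar>real_of_int (inn x e)\<bar> / \<bar>real_of_int (out x e)\<bar>)"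
    using Cons.IH[OF v] by (simp add: d abs_mult)
  consider "x \<noteq> x0" | "x = x0" "e = eu" | "x = x0" "e \<noteq> eu" by blast
  then show ?case
  proof cases
    case 1
    then have "\<bar>real_of_int (inn x e)\<bar> = \<bar>real_of_int (out x e)\<bar>" using other[OF x 1]
      by (auto simp: inn_def out_def of_int_abs[symmetric] simp del: of_int_abs)
    then show ?thesis unfolding e using 1 nz by (simp add: d)
  next
    case 2
    then show ?thesis unfolding e by (simp add: d r exp_add distrib_left)
  next
    case 3
    then have "e = (\<not> eu)" by simp
    then have "\<bar>real_of_int (inn x e)\<bar> / \<bar>real_of_int (out x e)\<bar> = inverse (exp \<sigma>)"
      using 3 by (simp add: r)
    then show ?thesis unfolding e using 3 by (simp add: d exp_diff right_diff_distrib divide_inverse)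
  qed
qed simp

definition lev :: "'g vertex \<Rightarrow> int" where "lev u = \<lfloor>\<sigma> * ht u / W\<rfloor>"

lemma lev_cong: "ht u = ht v \<Longrightarrow> lev u = lev v"
  by (simp add: lev_def)

lemma lev_step: assumes "\<bar>ht u - ht v\<bar> \<le> 1" shows "\<bar>lev u - lev v\<bar> \<le> 1"
proof -
  have "\<bar>real_of_int (ht u) - real_of_int (ht v)\<bar> \<le> 1" using assms by linarith
  then have "\<sigma> * \<bar>real_of_int (ht u) - real_of_int (ht v)\<bar> \<le> \<sigma> * 1" using \<sigma>_pos by (intro mult_left_mono) auto
  then have "\<sigma> * \<bar>real_of_int (ht u) - real_of_int (ht v)\<bar> \<le> W" using W4 \<sigma>_pos by linarith
  moreover have "\<bar>\<sigma> * ht u / W - \<sigma> * ht v / W\<bar> = \<sigma> * \<bar>real_of_int (ht u) - real_of_int (ht v)\<bar> / W"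
    using \<sigma>_pos W_pos by (simp add: diff_divide_distrib[symmetric] right_diff_distrib[symmetric] abs_mult)
  ultimately have "\<bar>\<sigma> * ht u / W - \<sigma> * ht v / W\<bar> \<le> 1"
    using W_pos W4 \<sigma>_pos by simp
  then show ?thesis unfolding lev_def by linarith
qed

lemma lev_mono: "ht u \<le> ht v \<Longrightarrow> lev u \<le> lev v"
  unfolding lev_def using \<sigma>_pos W_pos by (intro floor_mono divide_right_mono mult_left_mono) auto

section \<open>Tiles of vertices within one strip\<close>

definition ch :: "bool \<Rightarrow> 'g vertex \<Rightarrow> 'g vertex" where
  "ch e u = (x0, e, 1 mod inn x0 e) # u"

text \<open>Exponents of absolute value at least 2 make the digit nonzero, so this step never
  backtracks, whatever the last letter of \<open>u\<close> is.\<close>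

lemma ch_valid: "valid u \<Longrightarrow> valid (ch e u)"
proof -
  have "\<bar>inn x0 e\<bar> \<ge> 2" using p2 q2 by (simp add: inn_def)
  then have "1 mod inn x0 e \<noteq> 0" by (auto simp: mod_eq_0_iff_dvd dest!: zdvd1_eq[THEN iffD1])
  then show "valid u \<Longrightarrow> valid (ch e u)" by (simp add: ch_def x0)
qed

lemma ch_simps [simp]: "tl (ch e u) = u" "ch e u \<noteq> []" "ch e u = ch e' u' \<longleftrightarrow> e = e' \<and> u = u'"
  by (auto simp: ch_def)

lemma adj_Cons: "valid (d # u) \<Longrightarrow> adj u (d # u)"
  by (cases d) (auto simp: adj_def)

lemma adj_ch: "valid u \<Longrightarrow> adj u (ch e u)"
  using adj_Cons ch_valid[of u e] by (simp add: ch_def)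

definition sg :: "bool \<Rightarrow> int" where "sg e = (if e = eu then 1 else -1)"

lemma ht_ch: "ht (ch e u) = ht u + sg e"
  by (simp add: ch_def sg_def)

lemma sg_not: "sg (\<not> e) = - sg e"
  by (auto simp: sg_def)

text \<open>The tile of a hat vertex (\<open>stt u = None\<close>) consists of an ascending and a descending spine
  that are followed as long as the level does not change.\<close>

fun stt :: "'g vertex \<Rightarrow> bool option" where
  "stt [] = None"
| "stt (d # u) = (let e = fst (snd d) in
     if d # u = ch e u \<and> lev (d # u) = lev u \<and> (stt u = None \<or> stt u = Some e) then Some e else None)"

fun hat :: "'g vertex \<Rightarrow> 'g vertex" where
  "hat [] = []"
| "hat (d # u) = (if stt (d # u) = None then d # u else hat u)"

lemma stt_ch: "stt (ch e u) = (if lev (ch e u) = lev u \<and> (stt u = None \<or> stt u = Some e) then Some e else None)"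
  by (simp add: ch_def Let_def)

lemma hat_ch: "hat (ch e u) = (if stt (ch e u) = None then ch e u else hat u)"
  by (simp add: ch_def)

lemma stt_hat: "stt (hat u) = None"
  by (induction u) (auto simp del: stt.simps(2))

lemma hat_hat: "stt u = None \<Longrightarrow> hat u = u"
  by (cases u) (auto simp del: stt.simps(2))

lemma stt_Some: "stt u = Some e \<Longrightarrow> \<exists>w. u = ch e w \<and> lev u = lev w \<and> (stt w = None \<or> stt w = Some e)"
  by (cases u) (auto simp: Let_def ch_def split: if_splits)

lemma hat_valid: "valid u \<Longrightarrow> valid (hat u)"
proof (induction u)
  case (Cons d u)
  then show ?case by (cases d) (auto simp del: stt.simps(2))
qed simp

lemma lev_hat: "lev (hat u) = lev u"
proof (induction u)
  case (Cons d u)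
  then show ?case using stt_Some[of "d # u"] by (auto simp del: stt.simps(2) simp: ch_def)
qed simp

lemma spine: "stt u = Some e \<Longrightarrow> \<exists>k. u = (ch e ^^ k) (hat u) \<and> k \<ge> 1"
proof (induction u)
  case (Cons d u)
  obtain w where w: "d # u = ch e w" "stt w = None \<or> stt w = Some e" using stt_Some[OF Cons.prems] by blast
  then have wu: "w = u" by (simp add: ch_def)
  have h: "hat (d # u) = hat u" using Cons.prems by (simp del: stt.simps)
  show ?case
  proof (cases "stt u")
    case None
    then show ?thesis using w wu h hat_hat by (intro exI[of _ 1]) (simp del: stt.simps)
  next
    case (Some e')
    then obtain k where "u = (ch e ^^ k) (hat u)" using Cons.IH w wu by auto
    then show ?thesis using w wu h by (intro exI[of _ "Suc k"]) (simp del: stt.simps hat.simps)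
  qed
qed simp

lemma ht_spine: "ht ((ch e ^^ k) u) = ht u + sg e * int k"
  by (induction k) (auto simp: ht_ch algebra_simps)

definition Dp :: nat where "Dp = nat \<lceil>W / \<sigma>\<rceil>"

lemma same_lev_ht: assumes "lev u = lev v" shows "\<bar>ht u - ht v\<bar> \<le> int Dp"
proof -
  have "\<bar>\<sigma> * ht u / W - \<sigma> * ht v / W\<bar> \<le> 1" using assms unfolding lev_def by linarith
  moreover have "\<bar>\<sigma> * ht u / W - \<sigma> * ht v / W\<bar> = \<sigma> * \<bar>real_of_int (ht u) - real_of_int (ht v)\<bar> / W"
    using \<sigma>_pos W_pos by (simp add: diff_divide_distrib[symmetric] right_diff_distrib[symmetric] abs_mult)
  ultimately have "\<sigma> * \<bar>real_of_int (ht u) - real_of_int (ht v)\<bar> \<le> W" using W_pos by simp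
  then have "\<bar>real_of_int (ht u) - real_of_int (ht v)\<bar> \<le> W / \<sigma>" using \<sigma>_pos by (simp add: le_divide_eq mult.commute)
  then show ?thesis unfolding Dp_def by linarith
qed

lemma tile: "stt u = None \<Longrightarrow> u = (ch True ^^ 0) (hat u)" "stt u = Some e \<Longrightarrow> \<exists>k\<le>Dp. u = (ch e ^^ k) (hat u)"
proof -
  show "stt u = None \<Longrightarrow> u = (ch True ^^ 0) (hat u)" using hat_hat by simp
  assume "stt u = Some e"
  then obtain k where k: "u = (ch e ^^ k) (hat u)" using spine by blast
  have "\<bar>ht u - ht (hat u)\<bar> \<le> int Dp" by (rule same_lev_ht) (simp add: lev_hat)
  moreover have "ht u = ht (hat u) + sg e * int k" using ht_spine[of k e "hat u"] k by simp
  ultimately have "k \<le> Dp" by (auto simp: sg_def split: if_splits)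
  then show "\<exists>k\<le>Dp. u = (ch e ^^ k) (hat u)" using k by blast
qed

lemma tile_ex: "\<exists>e. \<exists>k\<le>Dp. u = (ch e ^^ k) (hat u)"
  using tile[of u] by (cases "stt u") blast+

lemma spine_near: "valid u \<Longrightarrow> near k u ((ch e ^^ k) u) \<and> valid ((ch e ^^ k) u)"
proof (induction k)
  case (Suc k)
  then show ?case using ch_valid[of "(ch e ^^ k) u" e] adj_ch[of "(ch e ^^ k) u" e] by auto
qed simp

lemma hat_near: assumes "valid u" shows "near Dp (hat u) u"
proof -
  obtain e k where k: "k \<le> Dp" "u = (ch e ^^ k) (hat u)" using tile_ex by blast
  show ?thesis using near_mono[OF k(1)] spine_near[OF hat_valid[OF assms], of k e] k(2) by simp
qed

text \<open>The children of the tile with hat \<open>v\<close> in the tree of tiles, sorted by their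
  change of level.\<close>

definition Kset :: "'g vertex \<Rightarrow> int \<Rightarrow> 'g vertex set" where
  "Kset v t = {w. valid w \<and> w \<noteq> [] \<and> stt w = None \<and> hat (tl w) = v \<and> lev w = lev v + t}"

definition digits :: "('g \<times> bool \<times> int) set" where
  "digits = {(x, e, i). x \<noteq> a \<and> i mod inn x e = i}"

lemma finite_digits: "finite digits"
proof -
  have "digits \<subseteq> UNIV \<times> UNIV \<times> {- Mx..Mx}"
  proof
    fix d assume "d \<in> digits"
    then obtain x e i where d: "d = (x, e, i)" "x \<noteq> a" "i mod inn x e = i" by (auto simp: digits_def)
    have "\<bar>i mod inn x e\<bar> \<le> \<bar>inn x e\<bar>" using inn_nz[OF d(2), of e] by (simp add: abs_mod_less less_imp_le)
    then show "d \<in> UNIV \<times> UNIV \<times> {- Mx..Mx}" using inn_Mx[of x e] d by auto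
  qed
  then show ?thesis by (rule finite_subset) simp
qed

definition Nk :: nat where "Nk = card (digits \<times> (UNIV :: bool set) \<times> {..Dp})"

lemma Kset_finite: "finite (Kset v t)" and Kset_card: "card (Kset v t) \<le> Nk"
proof -
  let ?f = "\<lambda>(d, e, k). d # (ch e ^^ k) v"
  have sub: "Kset v t \<subseteq> ?f ` (digits \<times> UNIV \<times> {..Dp})"
  proof
    fix w assume w: "w \<in> Kset v t"
    then obtain d u where du: "w = d # u" "valid w" "hat u = v" by (cases w) (auto simp: Kset_def)
    obtain e k where k: "k \<le> Dp" "u = (ch e ^^ k) (hat u)" using tile_ex by blast
    have "d \<in> digits" using du by (cases d) (auto simp: digits_def)
    then show "w \<in> ?f ` (digits \<times> UNIV \<times> {..Dp})" using du k by (intro image_eqI[of _ _ "(d, e, k)"]) auto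
  qed
  have fin: "finite (digits \<times> (UNIV :: bool set) \<times> {..Dp})" using finite_digits by simp
  show "finite (Kset v t)" using finite_subset[OF sub] fin by simp
  show "card (Kset v t) \<le> Nk" unfolding Nk_def using card_mono[OF _ sub] card_image_le[OF fin, of ?f] fin by fastforce
qed

lemma Kset_near: assumes "w \<in> Kset v t" shows "near (Suc Dp) v w"
proof -
  obtain d u where du: "w = d # u" "valid w" "hat u = v" using assms by (cases w) (auto simp: Kset_def)
  have u: "valid u" using du by (cases d) auto
  then show ?thesis using hat_near[OF u] du adj_Cons[of d u] by auto
qed

lemma spine_tile:
  assumes v: "stt v = None" and k: "\<And>i. i \<le> k \<Longrightarrow> lev ((ch e ^^ i) v) = lev v"
  shows "hat ((ch e ^^ k) v) = v \<and> stt ((ch e ^^ k) v) = (if k = 0 then None else Some e)"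
  using k
proof (induction k)
  case (Suc k)
  let ?u = "(ch e ^^ k) v"
  have IH: "hat ?u = v" "stt ?u = None \<or> stt ?u = Some e" using Suc by auto
  have "lev (ch e ?u) = lev ?u" using Suc.prems[of "Suc k"] Suc.prems[of k] by simp
  then have "stt (ch e ?u) = Some e" using IH by (simp add: stt_ch)
  then show ?case using IH by (simp add: hat_ch)
qed (use v hat_hat in simp)

text \<open>The spine in direction \<open>e\<close> leaves the strip, because heights in a strip are
  bounded; its first vertex outside is a hat exactly one level away, since a step is lower than a
  strip.\<close>

lemma Kset_updown: assumes v: "valid v" "stt v = None" shows "Kset v (sg e) \<noteq> {}"
proof -
  have "\<exists>k. lev ((ch e ^^ k) v) \<noteq> lev v"
  proof (rule ccontr)
    assume "\<not> ?thesis"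
    then have "lev ((ch e ^^ Suc Dp) v) = lev v" by blast
    from same_lev_ht[OF this] show False unfolding ht_spine by (simp add: sg_def split: if_splits)
  qed
  then obtain k where k: "lev ((ch e ^^ k) v) \<noteq> lev v" "\<And>i. i < k \<Longrightarrow> lev ((ch e ^^ i) v) = lev v"
    using exists_least_iff[of "\<lambda>k. lev ((ch e ^^ k) v) \<noteq> lev v"] by blast
  then obtain j where j: "k = Suc j" by (cases k) auto
  let ?u = "(ch e ^^ j) v"
  have u: "hat ?u = v" using spine_tile[OF v(2), of j e] k j by auto
  have lu: "lev ?u = lev v" using k j by simp
  have w: "lev (ch e ?u) \<noteq> lev v" using k j by simp
  have "\<bar>lev (ch e ?u) - lev v\<bar> \<le> 1" using lev_step[of "ch e ?u" ?u] lu by (simp add: ht_ch sg_def)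
  moreover have "sg e = 1 \<Longrightarrow> lev ?u \<le> lev (ch e ?u)" "sg e = -1 \<Longrightarrow> lev (ch e ?u) \<le> lev ?u"
    by (auto intro!: lev_mono simp: ht_ch)
  ultimately have l: "lev (ch e ?u) = lev v + sg e" using w lu by (auto simp: sg_def split: if_splits)
  have "stt (ch e ?u) = None" using w lu by (simp add: stt_ch)
  then have "ch e ?u \<in> Kset v (sg e)"
    using l u ch_valid spine_near[OF v(1), of j e] by (simp add: Kset_def)
  then show ?thesis by blast
qed

text \<open>From each of two spine vertices inside the strip, the step in the opposite direction
  leaves the spine and stays on the level, so it reaches a new hat. Two children are required
  because \<open>Z0\<close> and \<open>Z1\<close> both need something to encode after the last
  sibling.\<close>

lemma Kset_zero: assumes v: "valid v" "stt v = None" shows "\<exists>w1 w2. w1 \<noteq> w2 \<and> w1 \<in> Kset v 0 \<and> w2 \<in> Kset v 0"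
proof -
  have floor_diff: "\<lfloor>x\<rfloor> - \<lfloor>y\<rfloor> \<ge> 2 \<Longrightarrow> x - y > 1" for x y :: real by linarith
  \<comment> \<open>If two steps left the strip both upwards and downwards, four steps would be
    higher than \<open>W\<close>.\<close>
  have "\<exists>e. lev (ch e (ch e v)) = lev v"
  proof (rule ccontr)
    assume n: "\<not> ?thesis"
    have h: "ht (ch eu (ch eu v)) = ht v + 2" "ht (ch (\<not> eu) (ch (\<not> eu) v)) = ht v - 2"
      by (auto simp: ht_ch sg_def)
    have "lev v < lev (ch eu (ch eu v))" using n lev_mono[of v "ch eu (ch eu v)"] h by (metis diff_ge_0_iff_ge order_le_less add_diff_cancel_left' zero_le_numeral)
    moreover have "lev (ch (\<not> eu) (ch (\<not> eu) v)) < lev v" using n lev_mono[of "ch (\<not> eu) (ch (\<not> eu) v)" v] h by (smt (verit))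
    ultimately have "lev (ch eu (ch eu v)) - lev (ch (\<not> eu) (ch (\<not> eu) v)) \<ge> 2" by linarith
    then have "\<sigma> * (ht v + 2) / W - \<sigma> * (ht v - 2) / W > 1"
      unfolding lev_def h using floor_diff by blast
    then have "4 * \<sigma> > W" using W_pos by (simp add: diff_divide_distrib[symmetric] field_simps)
    then show False using W4 by simp
  qed
  then obtain e where e: "lev (ch e (ch e v)) = lev v" ..
  have e1: "lev (ch e v) = lev v"
    using lev_mono[of v "ch e v"] lev_mono[of "ch e v" "ch e (ch e v)"] lev_mono[of "ch e v" v] lev_mono[of "ch e (ch e v)" "ch e v"] e
    by (cases "e = eu") (auto simp: ht_ch sg_def)
  let ?u1 = "ch e v" and ?u2 = "ch e (ch e v)"
  have u1: "hat ?u1 = v" "stt ?u1 = Some e" using v(2) e1 hat_hat[OF v(2)] by (auto simp: stt_ch hat_ch)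
  have u2: "hat ?u2 = v" "stt ?u2 = Some e" using u1 e e1 by (auto simp: stt_ch hat_ch[of e "ch e v"])
  have val: "valid ?u1" "valid ?u2" using ch_valid v by auto
  have "stt (ch (\<not> e) ?u1) = None" "stt (ch (\<not> e) ?u2) = None"
    using u1(2) u2(2) by (auto simp: stt_ch)
  moreover have "lev (ch (\<not> e) ?u1) = lev v" "lev (ch (\<not> e) ?u2) = lev v"
    using lev_cong[of "ch (\<not> e) ?u1" v] lev_cong[of "ch (\<not> e) ?u2" ?u1] e1 by (auto simp: ht_ch sg_not)
  ultimately have "ch (\<not> e) ?u1 \<in> Kset v 0" "ch (\<not> e) ?u2 \<in> Kset v 0"
    using u1(1) u2(1) ch_valid[OF val(1), of "\<not> e"] ch_valid[OF val(2), of "\<not> e"]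
    by (auto simp: Kset_def)
  moreover have "ch (\<not> e) ?u1 \<noteq> ch (\<not> e) ?u2" by (simp add: ch_def)
  ultimately show ?thesis by blast
qed

definition kl :: "'g vertex \<Rightarrow> int \<Rightarrow> 'g vertex list" where
  "kl v t = (SOME xs. distinct xs \<and> set xs = Kset v t)"

lemma kl: "distinct (kl v t)" "set (kl v t) = Kset v t"
  using someI_ex[OF finite_distinct_list[OF Kset_finite[of v t], unfolded conj_commute[of "set _ = _"]]] by (auto simp: kl_def)

lemma kl_length: "length (kl v t) \<le> Nk"
  using Kset_card[of v t] kl distinct_card by metis

lemma kl_updown: "valid v \<Longrightarrow> stt v = None \<Longrightarrow> kl v 1 \<noteq> []" "valid v \<Longrightarrow> stt v = None \<Longrightarrow> kl v (-1) \<noteq> []"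
  using Kset_updown[of v eu] Kset_updown[of v "\<not> eu"] kl(2)[of v 1] kl(2)[of v "-1"] by (auto simp: sg_def)

lemma kl_zero: assumes "valid v" "stt v = None" shows "length (kl v 0) \<ge> 2"
proof -
  obtain w1 w2 where "w1 \<noteq> w2" "w1 \<in> set (kl v 0)" "w2 \<in> set (kl v 0)" using Kset_zero[OF assms] kl(2) by auto
  then show ?thesis by (cases "kl v 0" rule: list.exhaust; cases "tl (kl v 0)") auto
qed

section \<open>Encoding all trees of tiles by one tree\<close>

definition idx :: "'b list \<Rightarrow> 'b \<Rightarrow> nat" where
  "idx xs w = (SOME i. i < length xs \<and> xs ! i = w)"

lemma idx: "w \<in> set xs \<Longrightarrow> idx xs w < length xs \<and> xs ! idx xs w = w"
  unfolding idx_def by (rule someI_ex) (auto simp: in_set_conv_nth)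

lemma idx_nth: "distinct xs \<Longrightarrow> i < length xs \<Longrightarrow> idx xs (xs ! i) = i"
  using idx[of "xs ! i" xs] nth_eq_iff_index_eq[of xs "idx xs (xs ! i)" i] by simp

text \<open>The first child / next sibling encoding: \<open>Ph x\<close> is the list of siblings still to be
  visited, of which the first one is the vertex encoded by \<open>x\<close>.\<close>

fun Ph :: "dir list \<Rightarrow> 'g vertex list" where
  "Ph [] = [[]]"
| "Ph (U # x) = kl (hd (Ph x)) 1"
| "Ph (D # x) = kl (hd (Ph x)) (-1)"
| "Ph (Z0 # x) = (if tl (Ph x) \<noteq> [] then tl (Ph x) else take 1 (kl (hd (Ph x)) 0))"
| "Ph (Z1 # x) = (if tl (Ph x) \<noteq> [] then kl (hd (Ph x)) 0 else drop 1 (kl (hd (Ph x)) 0))"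

text \<open>The number of letters \<open>Z0\<close> in front is the position among the siblings,
  reduced by one when the first level-keeping child has been split off under a letter
  \<open>Z0\<close> of its own.\<close>

fun en :: "'g vertex \<Rightarrow> dir list" where
  "en [] = []"
| "en (d # u) = (if stt (d # u) \<noteq> None then en u else
     let t = lev (d # u) - lev u; i = idx (kl (hat u) t) (d # u) in
     (if t = 1 then replicate i Z0 @ U # en u
      else if t = -1 then replicate i Z0 @ D # en u
      else if tl (Ph (en u)) \<noteq> [] then replicate i Z0 @ Z1 # en u
      else if i = 0 then Z0 # en u else replicate (i - 1) Z0 @ Z1 # en u))"

lemma en_hat: "en (hat u) = en u"
  by (induction u) (auto simp del: stt.simps)

lemma en_Kset:
  assumes w: "w \<in> Kset v t"
  shows "en w = (let i = idx (kl v t) w in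
     (if t = 1 then replicate i Z0 @ U # en v
      else if t = -1 then replicate i Z0 @ D # en v
      else if tl (Ph (en v)) \<noteq> [] then replicate i Z0 @ Z1 # en v
      else if i = 0 then Z0 # en v else replicate (i - 1) Z0 @ Z1 # en v))"
proof -
  obtain d u where du: "w = d # u" "hat u = v" "stt w = None" "lev w = lev v + t"
    using w by (cases w) (auto simp: Kset_def)
  have "en u = en v" "lev u = lev v" using en_hat[of u] lev_hat[of u] du by auto
  then show ?thesis using du by (simp add: Let_def del: stt.simps)
qed

text \<open>Every node of the code tree has all four successors, whatever tree is encoded. While
  siblings remain, \<open>Z0\<close> lists them and \<open>Z1\<close> the level-keeping children;
  after the last sibling, \<open>Z0\<close> takes the first such child and \<open>Z1\<close> the
  others. This makes the code tree the same for all groups.\<close>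

lemma Ph_inv:
  "Ph x \<noteq> [] \<and> (\<forall>w\<in>set (Ph x). valid w \<and> stt w = None \<and> lev w = lvl x) \<and>
   (\<forall>i<length (Ph x). en (Ph x ! i) = replicate i Z0 @ x) \<and>
   (Ph x = [[]] \<or> (\<exists>v t. valid v \<and> set (Ph x) \<subseteq> Kset v t))"
proof (induction x)
  case Nil
  show ?case by (simp add: lev_def)
next
  case (Cons l x)
  let ?v = "hd (Ph x)"
  have vx: "?v \<in> set (Ph x)" using Cons by auto
  have v: "valid ?v" "stt ?v = None" "lev ?v = lvl x" using Cons vx by auto
  have env: "en ?v = x" using Cons by (cases "Ph x") auto
  have kin: "valid w \<and> stt w = None \<and> lev w = lvl x + t" if "w \<in> set (kl ?v t)" for w t
    using that v(3) by (auto simp: kl(2) Kset_def)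
  have enk: "en (kl ?v t ! i) = (if t = 1 then replicate i Z0 @ U # x
      else if t = -1 then replicate i Z0 @ D # x
      else if tl (Ph x) \<noteq> [] then replicate i Z0 @ Z1 # x
      else if i = 0 then Z0 # x else replicate (i - 1) Z0 @ Z1 # x)" if "i < length (kl ?v t)" for i t
  proof -
    have "kl ?v t ! i \<in> Kset ?v t" using that kl(2)[of ?v t] nth_mem by blast
    from en_Kset[OF this] show ?thesis by (simp add: idx_nth kl(1) that env Let_def)
  qed
  have z2: "length (kl ?v 0) \<ge> 2" by (rule kl_zero[OF v(1,2)])
  show ?case
  proof (cases l)
    case U
    then show ?thesis using kl_updown(1)[OF v(1,2)] kin[of _ 1] enk[of _ 1] kl(2)[of ?v 1] v(1) by auto
  next
    case D
    then show ?thesis using kl_updown(2)[OF v(1,2)] kin[of _ "-1"] enk[of _ "-1"] kl(2)[of ?v "-1"] v(1) by auto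
  next
    case Z0
    show ?thesis
    proof (cases "tl (Ph x) \<noteq> []")
      case True
      then obtain w ws where ws: "Ph x = w # ws" "ws \<noteq> []" by (cases "Ph x") auto
      have "\<forall>i<length ws. en (ws ! i) = replicate i Z0 @ Z0 # x"
      proof (intro allI impI)
        fix i assume "i < length ws"
        then have "en (Ph x ! Suc i) = replicate (Suc i) Z0 @ x" using Cons ws by auto
        then show "en (ws ! i) = replicate i Z0 @ Z0 # x" using ws by (simp add: replicate_app_Cons_same)
      qed
      then show ?thesis using Cons ws Z0 by auto
    next
      case False
      obtain w ws where ws: "kl ?v 0 = w # ws" using z2 by (cases "kl ?v 0") auto
      have "w \<in> Kset ?v 0" using kl(2)[of ?v 0] ws by auto
      moreover have "en w = Z0 # x" using enk[of 0 0] False ws by simp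
      ultimately show ?thesis using False Z0 ws kin[of w 0] v(1) by auto
    qed
  next
    case Z1
    show ?thesis
    proof (cases "tl (Ph x) \<noteq> []")
      case True
      then show ?thesis using z2 kin[of _ 0] enk[of _ 0] kl(2)[of ?v 0] v(1) Z1 by auto
    next
      case False
      then have P: "Ph (l # x) = drop 1 (kl ?v 0)" using Z1 by simp
      have "\<forall>i<length (drop 1 (kl ?v 0)). en (drop 1 (kl ?v 0) ! i) = replicate i Z0 @ Z1 # x"
        using enk[of "Suc _" 0] False by auto
      moreover have "set (drop 1 (kl ?v 0)) \<subseteq> Kset ?v 0" using kl(2)[of ?v 0] set_drop_subset by fastforce
      ultimately show ?thesis unfolding P using z2 kin[of _ 0] v(1) kl(2)[of ?v 0] Z1 by auto
    qed
  qed
qed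

definition fv :: "dir list \<Rightarrow> 'g vertex" where "fv x = hd (Ph x)"

lemma fv_in: "fv x \<in> set (Ph x)"
  using Ph_inv[of x] by (simp add: fv_def)

lemma fv_valid: "valid (fv x)" and lev_fv: "lev (fv x) = lvl x"
  using Ph_inv[of x] fv_in[of x] by auto

lemma en_fv: "en (fv x) = x"
  using Ph_inv[of x] by (cases "Ph x") (auto simp: fv_def)

text \<open>As long as siblings remain, \<open>Z0\<close> only shortens the list.\<close>

lemma Ph_Z0: "i < length (Ph x) \<Longrightarrow> Ph (replicate i Z0 @ x) = drop i (Ph x)"
proof (induction i)
  case (Suc i)
  then have "tl (drop i (Ph x)) \<noteq> []" by (cases "drop (Suc i) (Ph x)") (auto simp: drop_Suc tl_drop)
  then show ?case using Suc by (simp add: drop_Suc tl_drop)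
qed simp

text \<open>Induction along the tree of tiles: the hat of the parent tile is strictly shorter than
  \<open>u\<close>, and its code is a suffix of the code of \<open>u\<close>.\<close>

lemma fv_en_hat: "valid u \<Longrightarrow> stt u = None \<Longrightarrow> fv (en u) = u"
proof (induction "length u" arbitrary: u rule: less_induct)
  case less
  show ?case
  proof (cases u)
    case Nil
    then show ?thesis by (simp add: fv_def)
  next
    case (Cons d w)
    let ?v = "hat w" and ?t = "lev u - lev w"
    have w: "valid w" using less.prems Cons by (cases d) auto
    have len: "length (hat z) \<le> length z" for z
      by (induction z) (auto simp del: stt.simps)
    have IH: "fv (en ?v) = ?v" using less.hyps[of ?v] len[of w] hat_valid[OF w] stt_hat Cons by (simp add: le_imp_less_Suc)
    have "\<bar>ht u - ht w\<bar> \<le> 1" using Cons by (cases d) auto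
    then have t: "?t = 1 \<or> ?t = -1 \<or> ?t = 0" using lev_step[of u w] by linarith
    have uK: "u \<in> Kset ?v ?t" using less.prems Cons by (auto simp: Kset_def lev_hat simp del: stt.simps)
    let ?i = "idx (kl ?v ?t) u"
    have i: "?i < length (kl ?v ?t)" "kl ?v ?t ! ?i = u" using idx[of u "kl ?v ?t"] uK kl(2) by auto
    have hd: "hd (Ph (en ?v)) = ?v" using IH by (simp add: fv_def)
    have nth: "fv (replicate i Z0 @ x) = Ph x ! i" if "i < length (Ph x)" for i x
      using Ph_Z0[OF that] that by (simp add: fv_def hd_drop_conv_nth)
    consider "?t = 1" | "?t = -1" | "?t = 0" "tl (Ph (en ?v)) \<noteq> []" | "?t = 0" "tl (Ph (en ?v)) = []" "?i = 0"
      | "?t = 0" "tl (Ph (en ?v)) = []" "?i \<noteq> 0" using t by blast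
    then show ?thesis
    proof cases
      case 1
      then show ?thesis using en_Kset[OF uK] nth[of ?i "U # en ?v"] i hd by (simp add: Let_def)
    next
      case 2
      then show ?thesis using en_Kset[OF uK] nth[of ?i "D # en ?v"] i hd by (simp add: Let_def)
    next
      case 3
      then show ?thesis using en_Kset[OF uK] nth[of ?i "Z1 # en ?v"] i hd by (simp add: Let_def)
    next
      case 4
      then show ?thesis using en_Kset[OF uK] i hd by (cases "kl ?v 0") (auto simp: Let_def fv_def)
    next
      case 5
      then show ?thesis using en_Kset[OF uK] nth[of "?i - 1" "Z1 # en ?v"] i hd by (simp add: Let_def)
    qed
  qed
qed

text \<open>The code forgets the position inside a tile, so the round trip returns the hat, at
  distance at most the depth of a tile.\<close>

lemma fv_en: "valid u \<Longrightarrow> fv (en u) = hat u"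
  using fv_en_hat[OF hat_valid stt_hat, of u] en_hat[of u] by simp

lemma lvl_en: "valid u \<Longrightarrow> lvl (en u) = lev u"
  using lev_fv[of "en u"] fv_en lev_hat by simp

text \<open>A child is found after at most \<open>Nk\<close> siblings, so the codes of neighbours
  differ by a prefix of bounded length.\<close>

lemma en_adj: assumes "valid (d # u)" shows "\<exists>ys. length ys \<le> Suc Nk \<and> en (d # u) = ys @ en u"
proof (cases "stt (d # u) = None")
  case True
  let ?t = "lev (d # u) - lev u"
  have uK: "d # u \<in> Kset (hat u) ?t" using True assms by (auto simp: Kset_def lev_hat simp del: stt.simps)
  let ?i = "idx (kl (hat u) ?t) (d # u)"
  have i: "?i < length (kl (hat u) ?t)" using idx[of "d # u" "kl (hat u) ?t"] uK kl(2) by auto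
  then have "?i \<le> Nk" using kl_length[of "hat u" ?t] by simp
  moreover have "\<exists>k l. k \<le> ?i \<and> en (d # u) = (replicate k Z0 @ [l]) @ en u"
    unfolding en_Kset[OF uK] Let_def en_hat by (auto intro: exI[of _ ?i] exI[of _ "?i - 1"])
  ultimately show ?thesis by force
next
  case False
  then show ?thesis by (auto simp del: stt.simps)
qed

text \<open>A letter leads to a child or to a later sibling, and siblings are close because they
  hang on the same tile.\<close>

lemma fv_step: "near (2 * Suc Dp) (fv x) (fv (l # x))"
proof -
  have mem: "near (2 * Suc Dp) (fv x) w" if "w \<in> set (Ph x) \<or> (\<exists>t. w \<in> set (kl (fv x) t))" for w
  proof -
    from that consider t where "w \<in> Kset (fv x) t" | "w \<in> set (Ph x)" by (auto simp: kl(2))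
    then show ?thesis
    proof cases
      case 1
      then show ?thesis using near_mono[OF _ Kset_near, of "2 * Suc Dp"] by simp
    next
      case 2
      from Ph_inv[of x] consider "Ph x = [[]]" | v t where "set (Ph x) \<subseteq> Kset v t" by blast
      then show ?thesis
      proof cases
        case 1
        then show ?thesis using 2 near_refl by (simp add: fv_def del: near.simps)
      next
        case (2 v t)
        then have "near (Suc Dp) v w" "near (Suc Dp) v (fv x)" using \<open>w \<in> set (Ph x)\<close> fv_in Kset_near by blast+
        then show ?thesis using near_trans[OF near_sym] by (metis mult_2)
      qed
    qed
  qed
  have "fv (l # x) \<in> set (Ph (l # x))" by (rule fv_in)
  then have "fv (l # x) \<in> set (Ph x) \<or> (\<exists>t. fv (l # x) \<in> set (kl (fv x) t))"
    by (cases l) (auto simp: fv_def[of x] split: if_splits dest: in_set_takeD in_set_dropD list.set_sel(2)[rotated])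
  then show ?thesis by (rule mem)
qed

lemma fv_append: "near (length ys * (2 * Suc Dp)) (fv x) (fv (ys @ x))"
proof (induction ys)
  case Nil
  then show ?case by simp
next
  case (Cons l ys)
  have e: "length (l # ys) * (2 * Suc Dp) = length ys * (2 * Suc Dp) + 2 * Suc Dp" by simp
  show ?case using near_trans[OF Cons fv_step[of "ys @ x" l]] unfolding e by simp
qed

end

section \<open>The map between the trees of two groups\<close>

locale updown_pair = A: updown a p q x0 eu W + A': updown a' p' q' x0' eu' W
  for a :: "'g::finite" and p q x0 eu and a' :: "'h::finite" and p' q' x0' eu' and W
begin

definition KK :: nat where
  "KK = Suc A.Nk * (2 * Suc A'.Dp) + Suc A'.Nk * (2 * Suc A.Dp) + A.Dp + A'.Dp"

lemma tree_map_adj: assumes "A.adj v w" shows "A'.near KK (A'.fv (A.en v)) (A'.fv (A.en w))"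
proof -
  have *: "A'.near KK (A'.fv (A.en v)) (A'.fv (A.en (d # v)))" if "A.valid (d # v)" for d v
  proof -
    obtain ys where ys: "length ys \<le> Suc A.Nk" "A.en (d # v) = ys @ A.en v" using A.en_adj \<open>A.valid (d # v)\<close> by blast
    have "length ys * (2 * Suc A'.Dp) \<le> Suc A.Nk * (2 * Suc A'.Dp)" by (rule mult_le_mono1[OF ys(1)])
    then have "length ys * (2 * Suc A'.Dp) \<le> KK" by (simp add: KK_def)
    then show ?thesis using A'.near_mono A'.fv_append ys(2) by metis
  qed
  from assms consider d where "w = d # v" "A.valid w" | d where "v = d # w" "A.valid v" by (auto simp: A.adj_def)
  then show ?thesis using * A'.near_sym by cases blast+
qed

text \<open>Both trees are cut into strips of the same height \<open>W\<close> and the map preserves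
  levels, so the logarithms of the scales differ by at most \<open>W\<close>.\<close>

lemma tree_map_Dl: assumes "A.valid v"
  shows "\<bar>A'.Dl (A'.fv (A.en v))\<bar> \<le> exp W * \<bar>A.Dl v\<bar>" "\<bar>A.Dl v\<bar> \<le> exp W * \<bar>A'.Dl (A'.fv (A.en v))\<bar>"
proof -
  let ?u = "A'.fv (A.en v)"
  have "A'.lev ?u = A.lev v" using A'.lev_fv A.lvl_en[OF assms] by simp
  then have "\<bar>A'.\<sigma> * A'.ht ?u / W - A.\<sigma> * A.ht v / W\<bar> \<le> 1" unfolding A.lev_def A'.lev_def by linarith
  then have "\<bar>A'.\<sigma> * A'.ht ?u - A.\<sigma> * A.ht v\<bar> \<le> W"
    using A.W_pos by (simp add: diff_divide_distrib[symmetric])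
  then have "A'.\<sigma> * A'.ht ?u \<le> W + A.\<sigma> * A.ht v" "A.\<sigma> * A.ht v \<le> W + A'.\<sigma> * A'.ht ?u" by linarith+
  then show "\<bar>A'.Dl ?u\<bar> \<le> exp W * \<bar>A.Dl v\<bar>" "\<bar>A.Dl v\<bar> \<le> exp W * \<bar>A'.Dl ?u\<bar>"
    by (simp_all add: A.Dl_ht[OF assms] A'.Dl_ht[OF A'.fv_valid] exp_add[symmetric])
qed

lemma tree_map_inverse: "A.valid v \<Longrightarrow> A.near KK (A.fv (A'.en (A'.fv (A.en v)))) v"
  using A.near_mono[OF _ A.hat_near, of KK v] by (simp add: A'.en_fv A.fv_en KK_def)

end

lemma updown_quasi_isometric:
  assumes "rose a p q R" "rose a' p' q' R'"
    and "updown a p q x0 eu W" "updown a' p' q' x0' eu' W"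
  shows "quasi_isometric (PG R) (PG R')"
proof -
  interpret X: rose a p q R by fact
  interpret X': rose a' p' q' R' by fact
  interpret P: updown_pair a p q x0 eu a' p' q' x0' eu' W using assms(3,4) by (rule updown_pair.intro)
  interpret P': updown_pair a' p' q' x0' eu' a p q x0 eu W using assms(4,3) by (rule updown_pair.intro)
  have e: "P'.KK = P.KK" by (simp add: P.KK_def P'.KK_def)
  have C: "1 \<le> exp W" using P.A.W_pos by simp
  show ?thesis
  proof (rule rose_quasi_isometric)
    have m1: "rose_map a p q R a' p' q' R' (\<lambda>v. P.A'.fv (P.A.en v)) P.KK (exp W)"
      by unfold_locales (use C in \<open>auto simp: P.A'.fv_valid P.tree_map_adj P.tree_map_Dl\<close>)
    have m2: "rose_map a' p' q' R' a p q R (\<lambda>v. P.A.fv (P.A'.en v)) P.KK (exp W)"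
      by unfold_locales (use C in \<open>auto simp: P.A.fv_valid P'.tree_map_adj[unfolded e] P'.tree_map_Dl\<close>)
    show "rose_pair a p q R a' p' q' R' (\<lambda>v. P.A'.fv (P.A.en v)) (\<lambda>v. P.A.fv (P.A'.en v)) P.KK (exp W)"
      by (intro rose_pair.intro rose_pair_axioms.intro m1 m2) (rule P.tree_map_inverse)
    show "rose_pair a' p' q' R' a p q R (\<lambda>v. P.A.fv (P.A'.en v)) (\<lambda>v. P.A'.fv (P.A.en v)) P.KK (exp W)"
      by (intro rose_pair.intro rose_pair_axioms.intro m1 m2) (rule P'.tree_map_inverse[unfolded e])
  qed
qed

lemma updown_quasi_isometric':
  assumes R: "rose a p q R" "rose a' p' q' R'"
    and z: "z \<noteq> a" "2 \<le> \<bar>p z\<bar>" "2 \<le> \<bar>q z\<bar>" "\<bar>p z\<bar> \<noteq> \<bar>q z\<bar>" "\<And>x. x \<noteq> a \<Longrightarrow> x \<noteq> z \<Longrightarrow> \<bar>p x\<bar> = \<bar>q x\<bar>"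
    and w: "w \<noteq> a'" "2 \<le> \<bar>p' w\<bar>" "2 \<le> \<bar>q' w\<bar>" "\<bar>p' w\<bar> \<noteq> \<bar>q' w\<bar>" "\<And>x. x \<noteq> a' \<Longrightarrow> x \<noteq> w \<Longrightarrow> \<bar>p' x\<bar> = \<bar>q' x\<bar>"
  shows "quasi_isometric (PG R) (PG R')"
proof -
  interpret X: rose a p q R by fact
  interpret X': rose a' p' q' R' by fact
  let ?eu = "\<bar>q z\<bar> > \<bar>p z\<bar>" and ?eu' = "\<bar>q' w\<bar> > \<bar>p' w\<bar>"
  let ?s = "ln (\<bar>real_of_int (X.inn z ?eu)\<bar> / \<bar>real_of_int (X.out z ?eu)\<bar>)"
  let ?s' = "ln (\<bar>real_of_int (X'.inn w ?eu')\<bar> / \<bar>real_of_int (X'.out w ?eu')\<bar>)"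
  let ?W = "4 * max ?s ?s'"
  show ?thesis
  proof (rule updown_quasi_isometric[OF R])
    show "updown a p q z ?eu ?W"
      by unfold_locales (use z in \<open>auto simp: X.inn_def X.out_def\<close>)
    show "updown a' p' q' w ?eu' ?W"
      by unfold_locales (use w in \<open>auto simp: X'.inn_def X'.out_def\<close>)
  qed
qed

text \<open>\<open>B\<close> is a stable letter with exponents 1, which leaves the cyclic vertex
  group generated by \<open>A\<close>.\<close>

definition hp :: "int \<Rightarrow> hnn_gen \<Rightarrow> int" where
  "hp m x = (if x = gT then m else 1)"

lemma hnn_rose: assumes "k \<noteq> 0" "m \<noteq> 0" shows "rose gA (hp m) (hp k) (hnn_rel k 0 m 0)"
proof -
  interpret rose0 gA "hp m" "hp k"
    by unfold_locales (use assms in \<open>auto simp: hp_def\<close>)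
  note cl = group.inv_closed[OF group_presented_group]
  show ?thesis
  proof
    fix ds j u v assume ds: "valid ds" and uv: "(u, v) \<in> hnn_rel k 0 m 0"
    have sh: "app ds (j + z) gB True = (fst (app ds j gB True), snd (app ds j gB True) + z)" for ds j z
      using app_shift[of gB ds j True z] by (simp add: inn_def out_def hp_def)
    have sT: "app ds (j + k) gT True = (fst (app ds j gT True), snd (app ds j gT True) + m)" for ds j
      using app_shift[of gT ds j True 1] by (simp add: inn_def out_def hp_def)
    from uv consider "u = [(gA, True), (gB, True), (gA, False), (gB, False)]" "v = []"
      | "u = [(gT, True)] @ gen_pow gA m @ [(gT, False)]" "v = gen_pow gA k"
      by (auto simp: hnn_rel_def)
    then show "run (ds, j) u = run (ds, j) v"
    proof cases
      case 1
      have "run (ds, j) u = app (fst (app ds j gB True)) (snd (app ds j gB True)) gB False"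
        using sh[of ds j 1] by (simp add: 1 nstep_a nstep_def)
      also have "\<dots> = (ds, j)" using app_cancel[OF ds, of gB j True] by (cases "app ds j gB True") simp
      finally show ?thesis using 1 by simp
    next
      case 2
      have "run (ds, j) u = nstep (run (app ds j gT True) (gen_pow gA m)) (gT, False)"
        by (simp add: 2 nstep_x)
      also have "run (app ds j gT True) (gen_pow gA m) = app ds (j + k) gT True"
        using run_gen_pow[of "fst (app ds j gT True)" "snd (app ds j gT True)" m] sT[of ds j] by simp
      also have "nstep \<dots> (gT, False) = (ds, j + k)"
        using app_cancel[OF ds, of gT "j + k" True] by (cases "app ds (j + k) gT True") (simp add: nstep_x)
      finally show ?thesis using 2 by (simp add: run_gen_pow)
    qed
  next
    fix x assume x: "x \<noteq> gA"
    let ?R = "hnn_rel k 0 m 0"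
    show "pres_eq ?R ([(x, True)] @ gen_pow gA (hp m x)) (gen_pow gA (hp k x) @ [(x, True)])"
    proof (cases x)
      case B
      then show ?thesis using hnn_AB_commute[of k 0 m 0] by (simp add: hp_def gen_pow_def mult_pres_class pres_class_eq_iff pres_eq.sym)
    next
      case T
      then show ?thesis using hT_hP[of k 0 m 0]
        by (simp add: hp_def hT_def hP_def mult_pres_class pres_class_eq_iff)
    qed (use x in simp)
  qed
qed

definition bs_rel :: "(bs_gen word \<times> bs_gen word) set" where
  "bs_rel = {([(bs_gen.t, True)] @ gen_pow bs_gen.a 2 @ [(bs_gen.t, False)], gen_pow bs_gen.a 3)}"

lemma bs_rose: "rose bs_gen.a (\<lambda>_. 2) (\<lambda>_. 3) bs_rel"
proof -
  interpret rose0 bs_gen.a "\<lambda>_. 2" "\<lambda>_. 3" by unfold_locales auto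
  show ?thesis
  proof
    fix ds j u v assume ds: "valid ds" and "(u, v) \<in> bs_rel"
    then have uv: "u = [(bs_gen.t, True)] @ gen_pow bs_gen.a 2 @ [(bs_gen.t, False)]" "v = gen_pow bs_gen.a 3"
      by (auto simp: bs_rel_def)
    have sT: "app ds (j + 3) bs_gen.t True = (fst (app ds j bs_gen.t True), snd (app ds j bs_gen.t True) + 2)"
      using app_shift[of bs_gen.t ds j True 1] by (simp add: inn_def out_def)
    have "run (ds, j) u = nstep (run (app ds j bs_gen.t True) (gen_pow bs_gen.a 2)) (bs_gen.t, False)"
      by (simp add: uv nstep_x)
    also have "run (app ds j bs_gen.t True) (gen_pow bs_gen.a 2) = app ds (j + 3) bs_gen.t True"
      using run_gen_pow[of "fst (app ds j bs_gen.t True)" "snd (app ds j bs_gen.t True)" 2] sT by simp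
    also have "nstep \<dots> (bs_gen.t, False) = (ds, j + 3)"
      using app_cancel[OF ds, of bs_gen.t "j + 3" True] by (cases "app ds (j + 3) bs_gen.t True") (simp add: nstep_x)
    finally show "run (ds, j) u = run (ds, j) v" by (simp add: uv run_gen_pow)
  next
    fix x assume "x \<noteq> bs_gen.a"
    then have x: "x = bs_gen.t" by (cases x) auto
    interpret G: group "PG bs_rel" by (rule group_presented_group)
    have "pres_eq bs_rel ([(bs_gen.t, True)] @ gen_pow bs_gen.a 2 @ [(bs_gen.t, False)]) (gen_pow bs_gen.a 3)"
      by (rule pres_eq.rel) (simp add: bs_rel_def)
    then have "cls bs_rel [(bs_gen.t, True)] \<otimes>\<^bsub>PG bs_rel\<^esub> (cls bs_rel (gen_pow bs_gen.a 2) \<otimes>\<^bsub>PG bs_rel\<^esub> inv\<^bsub>PG bs_rel\<^esub> cls bs_rel [(bs_gen.t, True)])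
      = cls bs_rel (gen_pow bs_gen.a 3)"
      by (simp only: pres_class_eq_iff[symmetric] pres_class_append pres_class_False)
    then have "cls bs_rel [(bs_gen.t, True)] \<otimes>\<^bsub>PG bs_rel\<^esub> cls bs_rel (gen_pow bs_gen.a 2)
      = cls bs_rel (gen_pow bs_gen.a 3) \<otimes>\<^bsub>PG bs_rel\<^esub> cls bs_rel [(bs_gen.t, True)]"
      by (metis G.inv_closed G.inv_solve_right G.m_assoc G.m_closed G.inv_inv pres_class_closed)
    then show "pres_eq bs_rel ([(x, True)] @ gen_pow bs_gen.a 2) (gen_pow bs_gen.a 3 @ [(x, True)])"
      unfolding x by (simp only: pres_class_append[symmetric] pres_class_eq_iff)
  qed
qed

lemma bs_group_eq: "baumslag_solitar 2 3 = PG bs_rel"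
  by (simp add: baumslag_solitar_def bs_rel_def)

lemma nonunimodular_bs:
  assumes "k \<noteq> 0" "m \<noteq> 0" "\<bar>k\<bar> \<noteq> \<bar>m\<bar>"
  shows "quasi_isometric (hnn_group (k, 0) (m, 0)) (baumslag_solitar 2 3)"
proof -
  \<comment> \<open>Doubling makes both exponents of \<open>T\<close> at least 2 in absolute value,
    as \<open>updown\<close> demands.\<close>
  have "quasi_isometric (hnn_group (k, 0) (m, 0)) (hnn_group (2 * k, 0) (2 * m, 0))"
    using hnn_equiv_scale[of 2 k m] by (simp add: hnn_equiv_def)
  moreover have "quasi_isometric (hnn_group (2 * k, 0) (2 * m, 0)) (baumslag_solitar 2 3)"
    unfolding hnn_group_eq bs_group_eq
    by (rule updown_quasi_isometric'[OF hnn_rose bs_rose, where z = gT and w = bs_gen.t])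
       (use assms bs_gen.exhaust in \<open>auto simp: hp_def\<close>)
  ultimately show ?thesis unfolding hnn_group_eq bs_group_eq by (rule quasi_isometric_presented_trans)
qed

section \<open>Elliptic elements and centralizers\<close>

context rose0
begin

lemma Dl_app: "x \<noteq> a \<Longrightarrow> Dl (fst (app ds j x e)) = Dl ds * (of_int (inn x e) / of_int (out x e))"
  by (cases "j mod inn x e = 0 \<and> bk ds x e")
     (auto simp: app_bk app_forward inn_nz out_nz elim!: bkE)

lemma Dl_nstep: "Dl (fst (nstep s l)) = Dl (fst s) * Dl (fst (nstep ([], 0) l))"
proof (cases "fst l = a")
  case False
  then show ?thesis using Dl_app[of "fst l" "fst s" "snd s" "snd l"] Dl_app[of "fst l" "[]" 0 "snd l"]
    by (simp add: nstep_def)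
qed (simp add: nstep_def)

lemma Dl_run: "Dl (fst (run s w)) = Dl (fst s) * Dl (fst (nf w))"
proof (induction w rule: rev_induct)
  case (snoc l w)
  then show ?case using Dl_nstep[of "run s w" l] Dl_nstep[of "nf w" l] by simp
qed simp

lemma Xc_nstep: "Xc (nstep s l) = Xc s + Dl (fst s) * Xc (nstep ([], 0) l)"
proof (cases "fst l = a")
  case False
  then show ?thesis using Xc_app[of "fst l" "fst s" "snd s" "snd l"] Xc_app[of "fst l" "[]" 0 "snd l"]
    by (simp add: nstep_def Xc_def)
qed (auto simp: nstep_def Xc_def algebra_simps)

text \<open>Together with \<open>Dl_run\<close> this is the homomorphism to the affine group of the
  line: \<open>a\<close> translates and the stable letters scale.\<close>

lemma Xc_run: "Xc (run s w) = Xc s + Dl (fst s) * Xc (nf w)"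
proof (induction w rule: rev_induct)
  case (snoc l w)
  then show ?case using Xc_nstep[of "run s w" l] Xc_nstep[of "nf w" l] Dl_run[of s w]
    by (simp add: algebra_simps)
qed (simp add: Xc_def)

lemma length_app: "length (fst (app ds j x e)) \<le> Suc (length ds)"
  by (auto simp: app_def)

lemma length_nstep: "length (fst (nstep s l)) \<le> length (fst s) + (if fst l = a then 0 else 1)"
  using length_app[of "fst s" "snd s" "fst l" "snd l"] by (simp add: nstep_def)

lemma length_run: "length (fst (run s w)) \<le> length (fst s) + length (filter (\<lambda>l. fst l \<noteq> a) w)"
proof (induction w rule: rev_induct)
  case (snoc l w)
  then show ?case using length_nstep[of "run s w" l] by (simp split: if_splits)
qed simp

lemma filter_gen_pow: "filter (\<lambda>l. fst l \<noteq> a) (gen_pow a z) = []"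
  by (simp add: gen_pow_def)

lemma filter_ew: "valid ds \<Longrightarrow> length (filter (\<lambda>l. fst l \<noteq> a) (ew ds)) = length ds"
proof (induction ds)
  case (Cons d ds)
  then show ?case by (cases d) (auto simp: filter_gen_pow)
qed simp

lemma filter_nword: "valid (fst s) \<Longrightarrow> length (filter (\<lambda>l. fst l \<noteq> a) (nword s)) = length (fst s)"
  by (simp add: nword_def filter_ew filter_gen_pow)

text \<open>The exponent obtained by moving \<open>a\<^sup>K\<close> from the left to the right of \<open>ew ds\<close>.\<close>

fun tr :: "'g vertex \<Rightarrow> int \<Rightarrow> int option" where
  "tr [] K = Some K"
| "tr ((x, e, i) # ds) K = (case tr ds K of None \<Rightarrow> None
     | Some K1 \<Rightarrow> if inn x e dvd K1 then Some (K1 div inn x e * out x e) else None)"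

lemma tr_iff: "valid ds \<Longrightarrow> (tr ds K = Some K' \<longleftrightarrow> run ([], K) (ew ds) = (ds, K'))
    \<and> (fst (run ([], K) (ew ds)) = ds \<longrightarrow> tr ds K \<noteq> None)"
proof (induction ds arbitrary: K')
  case (Cons d ds)
  obtain x e i where d: "d = (x, e, i)" by (cases d)
  have v: "valid ds" "x \<noteq> a" "i mod inn x e = i" "i = 0 \<Longrightarrow> \<not> bk ds x e" using Cons.prems by (auto simp: d)
  have i0: "i div inn x e = 0" by (rule div_zero_digit[OF v(2,3)])
  obtain v1 K1 where r: "run ([], K) (ew ds) = (v1, K1)" by (cases "run ([], K) (ew ds)")
  \<comment> \<open>A letter that cancels would end on a vertex shorter than \<open>d # ds\<close>;
    hence a run that ends on \<open>d # ds\<close> went forward with its last letter.\<close>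
  have len: "length v1 \<le> length ds" using length_run[of "([], K)" "ew ds"] filter_ew[OF v(1)] r by simp
  have step: "run ([], K) (ew (d # ds)) = app v1 (K1 + i) x e"
    using v(2) by (simp add: d r run_gen_pow nstep_x)
  have v1: "v1 = ds \<and> (K1 + i) mod inn x e = i" if "fst (app v1 (K1 + i) x e) = d # ds"
  proof (cases "(K1 + i) mod inn x e = 0 \<and> bk v1 x e")
    case True
    then have "length (d # ds) < length v1" using that by (auto simp: app_bk elim!: bkE)
    then show ?thesis using len by simp
  next
    case False
    then show ?thesis using that by (simp add: app_forward d)
  qed
  have dv: "(K1 + i) mod inn x e = i \<longleftrightarrow> inn x e dvd K1"
    using v(3) by (metis add_diff_cancel_right' mod_eq_dvd_iff)
  have fw: "app ds (K1 + i) x e = (d # ds, K1 div inn x e * out x e)" if "inn x e dvd K1"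
  proof -
    have "(K1 + i) mod inn x e = i" using that dv by simp
    moreover have "(K1 + i) div inn x e = K1 div inn x e" using that i0 by (simp add: div_plus_div_distrib_dvd_left)
    ultimately show ?thesis using v(4) app_forward[of "K1 + i" x e ds] by (auto simp: d)
  qed
  show ?case
  proof (cases "v1 = ds")
    case True
    then have t: "tr ds K = Some K1" using Cons.IH[OF v(1)] r by simp
    show ?thesis
    proof (cases "inn x e dvd K1")
      case dvd: True
      then show ?thesis unfolding step using fw True t by (simp add: d)
    next
      case False
      then have "fst (app v1 (K1 + i) x e) \<noteq> d # ds" using v1 dv by blast
      then show ?thesis unfolding step using t False by (auto simp: d)
    qed
  next
    case False
    then have "tr ds K = None" using Cons.IH[OF v(1)] r by (cases "tr ds K") auto
    moreover have "fst (app v1 (K1 + i) x e) \<noteq> d # ds" using v1 False by blast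
    ultimately show ?thesis unfolding step by (auto simp: d)
  qed
qed simp

text \<open>If the first letter of a reduced word does not cancel against \<open>L\<close>, no later
  one does: after each letter the exponent is a multiple of \<open>out\<close>, so a cancellation
  would need a zero digit in front of the inverse letter, which validity excludes.\<close>

lemma first_letter:
  assumes "valid (ds @ [(x1, e1, i1)])"
    and first: "\<not> ((J + i1) mod inn x1 e1 = 0 \<and> bk L x1 e1)"
  shows "\<exists>L1 x e i i' J1. run (L, J) (ew (ds @ [(x1, e1, i1)])) = ((x, e, i') # L1, J1) \<and> length L1 = length L + length ds
    \<and> hd (ds @ [(x1, e1, i1)]) = (x, e, i) \<and> J1 mod out x e = 0 \<and> x \<noteq> a"
  using assms(1)
proof (induction ds)
  case Nil
  then show ?case using app_forward[OF first] by (simp add: run_gen_pow nstep_x)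
next
  case (Cons d ds)
  obtain y f k where d: "d = (y, f, k)" by (cases d)
  have v: "valid (ds @ [(x1, e1, i1)])" "y \<noteq> a" "k mod inn y f = k" "k = 0 \<Longrightarrow> \<not> bk (ds @ [(x1, e1, i1)]) y f"
    using Cons.prems by (auto simp: d)
  obtain L1 x e i i' J1 where IH: "run (L, J) (ew (ds @ [(x1, e1, i1)])) = ((x, e, i') # L1, J1)"
    "length L1 = length L + length ds" "hd (ds @ [(x1, e1, i1)]) = (x, e, i)" "J1 mod out x e = 0" "x \<noteq> a"
    using Cons.IH[OF v(1)] by (elim exE conjE) (rule that)
  have nb: "\<not> ((J1 + k) mod inn y f = 0 \<and> bk ((x, e, i') # L1) y f)"
  proof
    assume h: "(J1 + k) mod inn y f = 0 \<and> bk ((x, e, i') # L1) y f"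
    then have xe: "x = y" "e = (\<not> f)" by auto
    then have "J1 mod inn y f = 0" using IH(4) by simp
    then have "k mod inn y f = 0" using h by (metis add_0 mod_add_left_eq)
    then have "k = 0" using v(3) by simp
    moreover have "bk (ds @ [(x1, e1, i1)]) y f" using IH(3) xe by (cases "ds @ [(x1, e1, i1)]") auto
    ultimately show False using v(4) by blast
  qed
  have "run (L, J) (ew ((d # ds) @ [(x1, e1, i1)])) = app ((x, e, i') # L1) (J1 + k) y f"
    using IH(1) v(2) by (simp add: d run_gen_pow nstep_x)
  also have "\<dots> = ((y, f, (J1 + k) mod inn y f) # (x, e, i') # L1, (J1 + k) div inn y f * out y f)"
    by (rule app_forward[OF nb])
  finally show ?case using IH(2) v(2) by (auto simp: d)
qed

lemma ew_snoc: "ew (ds @ [(x, e, i)]) = gen_pow a i @ [(x, e)] @ ew ds"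
  by (induction ds) auto

lemma valid_butlast: "valid (ds @ [d]) \<Longrightarrow> valid ds"
proof (induction ds)
  case (Cons c ds)
  then show ?case by (cases c; cases ds) (auto simp: bk_def split: list.splits)
qed simp

end

context rose
begin

text \<open>The distance by which the element moves the base vertex of the Bass-Serre tree.\<close>

definition ell :: "'g word set \<Rightarrow> nat" where
  "ell X = length (fst (nf (SOME w. X = pc w)))"

lemma ell: "ell (pc w) = length (fst (nf w))"
proof -
  have "pc w = pc (SOME v. pc w = pc v)"
    by (rule someI[of "\<lambda>v. pc w = pc v"]) simp
  then show ?thesis
    using run_pres_eq[of w "SOME v. pc w = pc v" "([], 0)"] by (simp add: ell_def pres_class_eq_iff)
qed

lemma pc_nword: "pc (nword (nf w)) = pc w"
  using nword_nf pres_class_eq_iff by blast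

lemma ell_mult:
  assumes "X \<in> carrier (PG R)" "Y \<in> carrier (PG R)"
  shows "ell (X \<otimes>\<^bsub>PG R\<^esub> Y) \<le> ell X + ell Y"
proof -
  obtain u v where uv: "X = pc u" "Y = pc v" using assms by (auto elim!: pres_class_cases)
  have v: "valid (fst (nf v))" using run_valid[of "([], 0)" v] by simp
  have "pc (u @ v) = pc (u @ nword (nf v))" by (simp only: pres_class_append pc_nword)
  then have "ell (X \<otimes>\<^bsub>PG R\<^esub> Y) = length (fst (nf (u @ nword (nf v))))"
    by (simp add: uv mult_pres_class ell)
  also have "\<dots> \<le> length (fst (nf u)) + length (fst (nf v))"
    using length_run[of "nf u" "nword (nf v)"] filter_nword[OF v] by simp
  finally show ?thesis by (simp add: uv ell)
qed

text \<open>The two normal forms agree exactly when \<open>a^K\<close> moves through every letter of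
  the word without changing a digit.\<close>

lemma commute_iff:
  assumes v: "valid ds"
  shows "pc (nword (ds, j)) \<otimes>\<^bsub>PG R\<^esub> pc (gen_pow a K') = pc (gen_pow a K) \<otimes>\<^bsub>PG R\<^esub> pc (nword (ds, j)) \<longleftrightarrow> tr ds K = Some K'"
proof -
  let ?l = "nword (ds, j) @ gen_pow a K'" and ?r = "gen_pow a K @ nword (ds, j)"
  have l: "nf ?l = (ds, j + K')" using nf_nword[of "(ds, j)"] v by (simp add: run_gen_pow)
  have r: "nf ?r = (fst (run ([], K) (ew ds)), snd (run ([], K) (ew ds)) + j)"
    using run_gen_pow[of "fst (run ([], K) (ew ds))" "snd (run ([], K) (ew ds))" j] by (simp add: run_gen_pow nword_def)
  have "pres_eq R ?l ?r \<longleftrightarrow> nf ?l = nf ?r"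
  proof
    assume "nf ?l = nf ?r"
    then have "pc ?l = pc ?r" using pc_nword[of ?l] pc_nword[of ?r] by metis
    then show "pres_eq R ?l ?r" by (simp add: pres_class_eq_iff)
  qed (rule run_pres_eq, simp_all)
  also have "\<dots> \<longleftrightarrow> run ([], K) (ew ds) = (ds, K')" unfolding l r by (cases "run ([], K) (ew ds)") auto
  also have "\<dots> \<longleftrightarrow> tr ds K = Some K'" using tr_iff[OF v] by blast
  finally show ?thesis by (simp add: mult_pres_class pres_class_eq_iff)
qed

text \<open>Comparison of line coordinates: conjugation multiplies the exponent by the scale of the
  image vertex.\<close>

lemma commute_Dl:
  assumes "pc w \<otimes>\<^bsub>PG R\<^esub> pc (gen_pow a K') = pc (gen_pow a K) \<otimes>\<^bsub>PG R\<^esub> pc w"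
  shows "Dl (fst (nf w)) * K' = K"
proof -
  have "pres_eq R (w @ gen_pow a K') (gen_pow a K @ w)"
    using assms by (simp add: mult_pres_class pres_class_eq_iff)
  then have "nf (w @ gen_pow a K') = nf (gen_pow a K @ w)" by (rule run_pres_eq) simp
  then have "Xc (run (nf w) (gen_pow a K')) = Xc (run ([], K) w)" by (simp add: run_gen_pow)
  moreover have "Xc (run (nf w) (gen_pow a K')) = Xc (nf w) + Dl (fst (nf w)) * K'"
    using run_gen_pow[of "fst (nf w)" "snd (nf w)" K'] by (simp add: Xc_def algebra_simps)
  moreover have "Xc (run ([], K) w) = K + Xc (nf w)" using Xc_run[of "([], K)" w] by (simp add: Xc_def)
  ultimately show ?thesis by simp
qed

lemma ga_pow_inj: "pc (gen_pow a K) = pc (gen_pow a K') \<Longrightarrow> K = K'"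
  using run_pres_eq[of "gen_pow a K" "gen_pow a K'" "([], 0)"] by (simp add: pres_class_eq_iff run_gen_pow)

text \<open>An element of minimal length in its conjugacy class is cyclically reduced.\<close>

lemma ell_pow:
  assumes X: "X = pc (nword (ds, j))" "valid ds" and ds: "ds \<noteq> []"
    and minimal: "\<And>u. length ds \<le> ell (inv\<^bsub>PG R\<^esub> pc u \<otimes>\<^bsub>PG R\<^esub> X \<otimes>\<^bsub>PG R\<^esub> pc u)"
  shows "ell (X [^]\<^bsub>PG R\<^esub> Suc n) = Suc n * length ds"
proof -
  let ?G = "PG R"
  obtain es x1 e1 i1 where es: "ds = es @ [(x1, e1, i1)]" using ds by (metis prod_cases3 rev_exhaust)
  obtain xn en jn ds' where hd: "ds = (xn, en, jn) # ds'" using ds by (metis prod_cases3 list.exhaust)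
  have x1: "x1 \<noteq> a" using X(2) unfolding es by (induction es) auto
  have xn: "xn \<noteq> a" using X(2) hd by simp
  \<comment> \<open>Otherwise conjugation by the first syllable \<open>?z\<close> moves it to the
    end of the word, where it cancels, against minimality.\<close>
  have nj: "\<not> ((j + i1) mod inn x1 e1 = 0 \<and> xn = x1 \<and> en = (\<not> e1))"
  proof
    assume h: "(j + i1) mod inn x1 e1 = 0 \<and> xn = x1 \<and> en = (\<not> e1)"
    let ?z = "gen_pow a i1 @ [(x1, e1)]"
    have es0: "es \<noteq> []" using h hd es by auto
    have bk: "bk es x1 e1" using h hd es es0 by (cases es) auto
    have ves: "valid es" using valid_butlast X(2) es by blast
    obtain k es' where es': "es = (x1, \<not> e1, k) # es'" using bk by (rule bkE)
    have "X = pc ?z \<otimes>\<^bsub>?G\<^esub> pc (ew es @ gen_pow a j)"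
      by (simp add: X nword_def es ew_snoc mult_pres_class)
    then have "inv\<^bsub>?G\<^esub> pc ?z \<otimes>\<^bsub>?G\<^esub> X \<otimes>\<^bsub>?G\<^esub> pc ?z = pc ((ew es @ gen_pow a j) @ ?z)"
      by (simp only: pres_class_append[of R "ew es @ gen_pow a j" ?z] G.inv_mult_cancel pres_class_closed)
    moreover have "nf ((ew es @ gen_pow a j) @ ?z) = app es (j + i1) x1 e1"
      using x1 nf_ew[OF ves] by (simp add: run_gen_pow nstep_x)
    moreover have "length (fst (app es (j + i1) x1 e1)) < length ds"
      using h app_bk[of "j + i1" x1 e1 k es'] by (simp add: es es')
    ultimately show False using minimal[of ?z] by (simp add: ell)
  qed
  \<comment> \<open>Besides the length, the induction carries the last letter and the residue of the
    exponent. They decide whether the next copy cancels, and \<open>nj\<close> says that it does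
    not.\<close>
  have "\<exists>L i J. nf (nword (ds, j) @ concat (replicate n (nword (ds, j)))) = ((xn, en, i) # L, J)
     \<and> Suc (length L) = Suc n * length ds \<and> J mod out xn en = j mod out xn en" for n
  proof (induction n)
    case 0
    show ?case using nf_nword[of "(ds, j)"] X(2) hd by auto
  next
    case (Suc n)
    then obtain L i J where L: "nf (nword (ds, j) @ concat (replicate n (nword (ds, j)))) = ((xn, en, i) # L, J)"
      "Suc (length L) = Suc n * length ds" "J mod out xn en = j mod out xn en" by blast
    have e: "concat (replicate (Suc n) w) = concat (replicate n w) @ w" for w :: "'g word"
      by (induction n) auto
    have first: "\<not> ((J + i1) mod inn x1 e1 = 0 \<and> bk ((xn, en, i) # L) x1 e1)"
    proof
      assume h: "(J + i1) mod inn x1 e1 = 0 \<and> bk ((xn, en, i) # L) x1 e1"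
      then have xe: "xn = x1" "en = (\<not> e1)" by auto
      then have "J mod inn x1 e1 = j mod inn x1 e1" using L(3) by simp
      then have "(j + i1) mod inn x1 e1 = 0" using h by (metis mod_add_left_eq)
      then show False using nj xe by simp
    qed
    obtain L1 x e k i' J1 where r: "run ((xn, en, i) # L, J) (ew ds) = ((x, e, i') # L1, J1)" "length L1 = length ((xn, en, i) # L) + length es"
      "hd ds = (x, e, k)" "J1 mod out x e = 0"
      using first_letter[OF X(2)[unfolded es] first] by (elim exE conjE) (rule that, unfold es, assumption+)
    have xe: "x = xn" "e = en" using r(3) hd by auto
    have "nf (nword (ds, j) @ concat (replicate (Suc n) (nword (ds, j)))) = run ((xn, en, i) # L, J) (nword (ds, j))"
      unfolding e append_assoc[symmetric] foldl_append[of _ _ _ "nword (ds, j)", symmetric]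
      using L(1) by (simp only: foldl_append)
    also have "\<dots> = ((xn, en, i') # L1, J1 + j)" using r(1) xe by (simp add: nword_def run_gen_pow)
    finally have "nf (nword (ds, j) @ concat (replicate (Suc n) (nword (ds, j)))) = ((xn, en, i') # L1, J1 + j)" .
    moreover have "Suc (length L1) = Suc (Suc n) * length ds" using r(2) L(2) es by simp
    moreover have "(J1 + j) mod out xn en = j mod out xn en" using r(4) xe mod_add_left_eq[of J1 "out xn en" j] by simp
    ultimately show ?case by blast
  qed
  then obtain L i J where L: "nf (nword (ds, j) @ concat (replicate n (nword (ds, j)))) = ((xn, en, i) # L, J)"
     "Suc (length L) = Suc n * length ds" by blast
  have pw: "X [^]\<^bsub>?G\<^esub> n = pc (concat (replicate n (nword (ds, j))))" for n
  proof (induction n)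
    case (Suc n)
    have "concat (replicate (Suc n) w) = concat (replicate n w) @ w" for w :: "'g word"
      by (induction n) auto
    then show ?case using Suc by (simp only: G.nat_pow_Suc) (simp add: X mult_pres_class)
  qed (simp add: one_presented)
  have "X [^]\<^bsub>?G\<^esub> Suc n = pc (nword (ds, j) @ concat (replicate n (nword (ds, j))))"
    using pw[of "Suc n"] by simp
  then show ?thesis using L by (simp only: ell) simp
qed

text \<open>Take a conjugate of \<open>X\<close> of least length. If this length is positive, the
  lengths of its powers grow exactly linearly, while the conjugate of \<open>g\<close> relates the
  powers \<open>i * n\<close> and \<open>i' * n\<close> up to an error independent of
  \<open>n\<close>.\<close>

lemma distorted_elliptic:
  assumes X: "X \<in> carrier (PG R)" and g: "g \<in> carrier (PG R)"
    and ij: "0 < i'" "i' < (i :: nat)"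
    and eq: "g \<otimes>\<^bsub>PG R\<^esub> X [^]\<^bsub>PG R\<^esub> i = X [^]\<^bsub>PG R\<^esub> i' \<otimes>\<^bsub>PG R\<^esub> g"
  shows "\<exists>u\<in>carrier (PG R). \<exists>K. inv\<^bsub>PG R\<^esub> u \<otimes>\<^bsub>PG R\<^esub> X \<otimes>\<^bsub>PG R\<^esub> u = pc (gen_pow a K)"
proof -
  let ?G = "PG R"
  define cj where "cj u = inv\<^bsub>?G\<^esub> pc u \<otimes>\<^bsub>?G\<^esub> X \<otimes>\<^bsub>?G\<^esub> pc u" for u
  obtain u where u: "\<And>v. ell (cj u) \<le> ell (cj v)"
    using ex_has_least_nat[of "\<lambda>_. True" undefined "\<lambda>u. ell (cj u)"] by blast
  let ?u = "pc u"
  have cu: "cj u \<in> carrier ?G" using X by (simp add: cj_def)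
  then obtain w where w: "cj u = pc w" by (auto elim: pres_class_cases)
  obtain ds j where nf: "nf w = (ds, j)" by (cases "nf w")
  have v: "valid ds" using run_valid[of "([], 0)" w] nf by simp
  have c: "cj u = pc (nword (ds, j))" using w pc_nword[of w] nf by simp
  have len: "ell (cj u) = length ds" using nf w by (simp add: ell)
  have hom: "(\<lambda>x. inv\<^bsub>?G\<^esub> ?u \<otimes>\<^bsub>?G\<^esub> x \<otimes>\<^bsub>?G\<^esub> ?u) \<in> hom ?G ?G"
  proof (rule homI)
    fix x y assume "x \<in> carrier ?G" "y \<in> carrier ?G"
    then show "inv\<^bsub>?G\<^esub> ?u \<otimes>\<^bsub>?G\<^esub> (x \<otimes>\<^bsub>?G\<^esub> y) \<otimes>\<^bsub>?G\<^esub> ?u = inv\<^bsub>?G\<^esub> ?u \<otimes>\<^bsub>?G\<^esub> x \<otimes>\<^bsub>?G\<^esub> ?u \<otimes>\<^bsub>?G\<^esub> (inv\<^bsub>?G\<^esub> ?u \<otimes>\<^bsub>?G\<^esub> y \<otimes>\<^bsub>?G\<^esub> ?u)"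
      using G.inv_mult_cancel[of "inv\<^bsub>?G\<^esub> ?u"] by (simp add: G.m_assoc)
  qed simp
  interpret h: group_hom ?G ?G "\<lambda>x. inv\<^bsub>?G\<^esub> ?u \<otimes>\<^bsub>?G\<^esub> x \<otimes>\<^bsub>?G\<^esub> ?u" by (rule group_hom.intro) (use hom in \<open>auto intro: group_hom_axioms.intro G.is_group\<close>)
  let ?g = "inv\<^bsub>?G\<^esub> ?u \<otimes>\<^bsub>?G\<^esub> g \<otimes>\<^bsub>?G\<^esub> ?u"
  have gc: "?g \<in> carrier ?G" using g by simp
  have e1: "?g \<otimes>\<^bsub>?G\<^esub> cj u [^]\<^bsub>?G\<^esub> i = cj u [^]\<^bsub>?G\<^esub> i' \<otimes>\<^bsub>?G\<^esub> ?g"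
    using arg_cong[OF eq, of "\<lambda>x. inv\<^bsub>?G\<^esub> ?u \<otimes>\<^bsub>?G\<^esub> x \<otimes>\<^bsub>?G\<^esub> ?u"] g X h.hom_mult h.hom_nat_pow
    by (simp add: cj_def)
  have e: "?g \<otimes>\<^bsub>?G\<^esub> cj u [^]\<^bsub>?G\<^esub> (i * n) = cj u [^]\<^bsub>?G\<^esub> (i' * n) \<otimes>\<^bsub>?G\<^esub> ?g" for n :: nat
  proof (induction n)
    case (Suc n)
    have "?g \<otimes>\<^bsub>?G\<^esub> cj u [^]\<^bsub>?G\<^esub> (i * Suc n) = (?g \<otimes>\<^bsub>?G\<^esub> cj u [^]\<^bsub>?G\<^esub> i) \<otimes>\<^bsub>?G\<^esub> cj u [^]\<^bsub>?G\<^esub> (i * n)"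
      using cu gc by (simp only: mult_Suc_right G.nat_pow_mult[symmetric]) (simp add: G.m_assoc)
    also have "\<dots> = cj u [^]\<^bsub>?G\<^esub> i' \<otimes>\<^bsub>?G\<^esub> (?g \<otimes>\<^bsub>?G\<^esub> cj u [^]\<^bsub>?G\<^esub> (i * n))"
      using cu gc by (simp only: e1) (simp add: G.m_assoc)
    also have "\<dots> = cj u [^]\<^bsub>?G\<^esub> (i' * Suc n) \<otimes>\<^bsub>?G\<^esub> ?g"
      using cu gc unfolding Suc by (simp only: mult_Suc_right G.nat_pow_mult[symmetric]) (simp add: G.m_assoc)
    finally show ?case .
  qed (use gc in simp)
  have "ds = []"
  proof (rule ccontr)
    assume ds: "ds \<noteq> []"
    have min: "length ds \<le> ell (inv\<^bsub>?G\<^esub> pc z \<otimes>\<^bsub>?G\<^esub> cj u \<otimes>\<^bsub>?G\<^esub> pc z)" for z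
    proof -
      have "inv\<^bsub>?G\<^esub> pc z \<otimes>\<^bsub>?G\<^esub> cj u \<otimes>\<^bsub>?G\<^esub> pc z = cj (u @ z)"
        using X by (simp add: cj_def pres_class_append G.inv_mult_group G.m_assoc)
      then show ?thesis using u[of "u @ z"] len by simp
    qed
    have pow: "ell (cj u [^]\<^bsub>?G\<^esub> n) = n * length ds" if "n > 0" for n :: nat
      using ell_pow[OF c v ds min, of "n - 1"] that by simp
    define B where "B = ell ?g + ell (inv\<^bsub>?G\<^esub> ?g)"
    let ?n = "Suc B"
    have "cj u [^]\<^bsub>?G\<^esub> (i * ?n) = inv\<^bsub>?G\<^esub> ?g \<otimes>\<^bsub>?G\<^esub> (cj u [^]\<^bsub>?G\<^esub> (i' * ?n) \<otimes>\<^bsub>?G\<^esub> ?g)"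
      unfolding e[symmetric] using gc cu by (simp only: G.inv_mult_cancel G.nat_pow_closed)
    then have "ell (cj u [^]\<^bsub>?G\<^esub> (i * ?n)) \<le> ell (inv\<^bsub>?G\<^esub> ?g) + (ell (cj u [^]\<^bsub>?G\<^esub> (i' * ?n)) + ell ?g)"
      using ell_mult gc cu by (smt (verit, best) G.inv_closed G.m_closed G.nat_pow_closed add_left_mono order_trans)
    then have "i * ?n * length ds \<le> i' * ?n * length ds + B"
      using pow[of "i * ?n"] pow[of "i' * ?n"] ij by (simp add: B_def del: mult_Suc_right)
    moreover have "i' * ?n * length ds + ?n \<le> i * ?n * length ds"
    proof -
      have "1 * (?n * 1) \<le> (i - i') * (?n * length ds)" using ij ds by (intro mult_le_mono) (auto simp: Suc_le_eq)
      then show ?thesis using ij by (simp add: diff_mult_distrib algebra_simps)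
    qed
    ultimately show False by simp
  qed
  then have "cj u = pc (gen_pow a j)" using c by (simp add: nword_def)
  then show ?thesis unfolding cj_def by (intro bexI[of _ ?u] exI[of _ j]) auto
qed

end

section \<open>The modulus is a commensurability invariant\<close>

text \<open>\<open>hinv h m k K Y\<close> says \<open>Y = K (k / m)\<^sup>h\<close>.\<close>

definition hinv :: "int \<Rightarrow> int \<Rightarrow> int \<Rightarrow> int \<Rightarrow> int \<Rightarrow> bool" where
  "hinv h m k K Y \<longleftrightarrow> (if 0 \<le> h then Y * m ^ nat h = K * k ^ nat h else Y * k ^ nat (- h) = K * m ^ nat (- h))"

lemma hinv_swap: "hinv h m k K Y \<longleftrightarrow> hinv (- h) k m K Y"
  by (cases "h = 0") (auto simp: hinv_def)

text \<open>For \<open>h\<close> nonnegative, divisibility of \<open>d * Y\<close> by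
  \<open>m\<close> forces one more power of \<open>m\<close> into \<open>K * d\<close>, by
  coprimality; by assumption it already divides \<open>K\<close>, and so \<open>m\<close> divides
  \<open>Y\<close>. For \<open>h\<close> negative, \<open>Y\<close> still contains a factor
  \<open>m\<close> from an edge crossed the other way.\<close>

lemma hinv_step:
  assumes co: "coprime k m" and nz: "k \<noteq> 0" "m \<noteq> 0" and inv: "hinv h m k K Y"
    and d: "m dvd d * Y" and K: "\<And>s. m ^ s dvd K * d \<Longrightarrow> m ^ s dvd K"
  shows "m dvd Y \<and> hinv (h + 1) m k K (Y div m * k)"
proof (cases "0 \<le> h")
  case True
  define s where "s = nat h"
  have e: "Y * m ^ s = K * k ^ s" using inv True by (simp add: hinv_def s_def)
  have "m * m ^ s dvd d * Y * m ^ s" using d by (rule mult_dvd_mono) simp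
  moreover have "d * Y * m ^ s = K * d * k ^ s" using e by (simp add: algebra_simps)
  ultimately have "m ^ Suc s dvd (K * d) * k ^ s" by simp
  then have "m ^ Suc s dvd K * d" using co by (simp add: coprime_dvd_mult_left_iff coprime_commute)
  then have "m ^ Suc s dvd K" by (rule K)
  then have "m * m ^ s dvd Y * m ^ s" unfolding e by simp
  then have "m dvd Y" using nz by simp
  moreover have "nat (h + 1) = Suc s" using True by (simp add: s_def)
  moreover have "Y div m * k * m ^ Suc s = K * k ^ Suc s" using e \<open>m dvd Y\<close> by (auto elim!: dvdE simp: nz algebra_simps)
  ultimately show ?thesis using True by (simp add: hinv_def)
next
  case False
  define s where "s = nat (- h)"
  have e: "Y * k ^ s = K * m ^ s" using inv False by (simp add: hinv_def s_def)
  obtain r where r: "s = Suc r" using False by (cases s) (auto simp: s_def)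
  have "m dvd Y * k ^ s" using e r by simp
  then have my: "m dvd Y" using co by (simp add: coprime_dvd_mult_left_iff coprime_commute)
  then obtain y where y: "Y = m * y" ..
  have "m * (y * k * k ^ r) = m * (K * m ^ r)" using e y r by (simp add: algebra_simps)
  then have e': "y * k * k ^ r = K * m ^ r" using nz by simp
  show ?thesis
  proof (cases "h = -1")
    case True
    then have "r = 0" using r by (simp add: s_def)
    then show ?thesis using my y e' True nz by (simp add: hinv_def)
  next
    case F: False
    then have "nat (- (h + 1)) = r" "\<not> 0 \<le> h + 1" using r False by (auto simp: s_def)
    then show ?thesis using my y e' nz by (simp add: hinv_def)
  qed
qed

section \<open>Centralizers of powers of \<open>A\<close>\<close>

locale coprime_hnn =
  fixes k m :: int
  assumes co: "coprime k m" and k0: "k \<noteq> 0" and m0: "m \<noteq> 0"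
begin

sublocale rose gA "hp m" "hp k" "hnn_rel k 0 m 0"
  by (rule hnn_rose[OF k0 m0])

abbreviation "GG \<equiv> PG (hnn_rel k 0 m 0)"
abbreviation "aa z \<equiv> pc (gen_pow gA z)"
abbreviation "tt \<equiv> pc [(gT, True)]"

fun hgt :: "hnn_gen vertex \<Rightarrow> int" where
  "hgt [] = 0"
| "hgt ((x, e, i) # ds) = hgt ds + (if x = gT then (if e then -1 else 1) else 0)"

lemma inn_T: "inn gT e = (if e then k else m)" "out gT e = (if e then m else k)"
  by (auto simp: inn_def out_def hp_def)

lemma inn_B: "x \<noteq> gT \<Longrightarrow> inn x e = 1 \<and> out x e = 1"
  by (auto simp: inn_def out_def hp_def)

text \<open>The assumptions say that \<open>d\<close> completes no new power of \<open>m\<close> or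
  of \<open>k\<close>. Then every edge that lets the larger power pass lets the smaller one pass
  too, by \<open>hinv_step\<close>, with \<open>k\<close> and \<open>m\<close> exchanged for edges
  in the other direction.\<close>

lemma tr_divide:
  assumes d: "d \<noteq> 0" and Km: "\<And>s. m ^ s dvd K * d \<Longrightarrow> m ^ s dvd K" and Kk: "\<And>s. k ^ s dvd K * d \<Longrightarrow> k ^ s dvd K"
  shows "tr ds (K * d) = Some X \<Longrightarrow> \<exists>Y. tr ds K = Some Y \<and> X = d * Y \<and> hinv (hgt ds) m k K Y"
proof (induction ds arbitrary: X)
  case Nil
  then show ?case by (simp add: hinv_def mult.commute)
next
  case (Cons c ds)
  obtain x e i where c: "c = (x, e, i)" by (cases c)
  obtain X1 where X1: "tr ds (K * d) = Some X1" "inn x e dvd X1" "X = X1 div inn x e * out x e"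
    using Cons.prems by (auto simp: c split: option.splits if_splits)
  obtain Y1 where Y1: "tr ds K = Some Y1" "X1 = d * Y1" "hinv (hgt ds) m k K Y1" using Cons.IH[OF X1(1)] by blast
  show ?case
  proof (cases "x = gT")
    case False
    then show ?thesis using X1 Y1 inn_B[OF False] by (simp add: c)
  next
    case True
    have co': "coprime m k" using co by (simp add: coprime_commute)
    have "inn x e dvd Y1 \<and> hinv (hgt (c # ds)) m k K (Y1 div inn x e * out x e)"
    proof (cases e)
      case e: False
      then show ?thesis using hinv_step[OF co k0 m0 Y1(3) _ Km] X1(2) Y1(2) True by (simp add: c inn_T)
    next
      case e: True
      have "hinv (- hgt ds) k m K Y1" using Y1(3) hinv_swap by blast
      then have "k dvd Y1 \<and> hinv (- hgt ds + 1) k m K (Y1 div k * m)"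
        using hinv_step[OF co' m0 k0 _ _ Kk, of "- hgt ds" Y1] X1(2) Y1(2) True e by (simp add: inn_T)
      moreover have "hinv (- hgt ds + 1) k m K Z \<longleftrightarrow> hinv (hgt ds - 1) m k K Z" for Z
        using hinv_swap[of "hgt ds - 1" m k K Z] by (simp add: algebra_simps)
      ultimately show ?thesis using True e by (simp add: c inn_T)
    qed
    then show ?thesis using X1 Y1 by (auto simp: c div_mult_swap elim!: dvdE)
  qed
qed

lemma commute_divide:
  assumes g: "g \<in> carrier GG" and d: "d \<noteq> 0"
    and Km: "\<And>s. m ^ s dvd K * d \<Longrightarrow> m ^ s dvd K" and Kk: "\<And>s. k ^ s dvd K * d \<Longrightarrow> k ^ s dvd K"
    and c: "g \<otimes>\<^bsub>GG\<^esub> aa (K * d) = aa (K * d) \<otimes>\<^bsub>GG\<^esub> g"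
  shows "g \<otimes>\<^bsub>GG\<^esub> aa K = aa K \<otimes>\<^bsub>GG\<^esub> g"
proof -
  obtain w where w: "g = pc w" using g by (auto elim: pres_class_cases)
  obtain ds j where nf: "nf w = (ds, j)" by (cases "nf w")
  have v: "valid ds" using run_valid[of "([], 0)" w] nf by simp
  have g': "g = pc (nword (ds, j))" using pc_nword[of w] w nf by simp
  have "tr ds (K * d) = Some (K * d)" using c commute_iff[OF v, of j "K * d" "K * d"] g' by simp
  then obtain Y where "tr ds K = Some Y" "K * d = d * Y" using tr_divide[OF d Km Kk] by blast
  then have "tr ds K = Some K" using d by simp
  then show ?thesis using commute_iff[OF v, of j K K] g' by simp
qed

text \<open>The vertex of \<open>T^-s B^f T^s\<close>, which commutes with \<open>A^K\<close>
  exactly when \<open>m^s\<close> divides \<open>K\<close>. The letters \<open>B\<close> keep the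
  word reduced, and the free exponent \<open>f\<close> serves to reach a subgroup of finite
  index.\<close>

definition wit :: "nat \<Rightarrow> nat \<Rightarrow> hnn_gen vertex" where
  "wit s f = replicate s (gT, True, 0) @ replicate f (gB, True, 0) @ replicate s (gT, False, 0)"

lemma tr_append: "tr (us @ ds) K = (case tr ds K of None \<Rightarrow> None | Some K1 \<Rightarrow> tr us K1)"
  by (induction us) (auto split: option.splits)

lemma tr_down: "tr (replicate s (gT, False, 0)) K = Some Y \<Longrightarrow> Y * m ^ s = K * k ^ s"
  by (induction s arbitrary: Y) (auto simp: inn_T split: option.splits if_splits elim!: dvdE, simp add: m0 algebra_simps)

lemma tr_down': "tr (replicate s (gT, False, 0)) (m ^ s * y) = Some (k ^ s * y)"
proof (induction s arbitrary: y)
  case (Suc s)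
  have "tr (replicate s (gT, False, 0)) (m ^ Suc s * y) = Some (k ^ s * (m * y))"
    using Suc[of "m * y"] by (simp add: algebra_simps)
  then show ?case using m0 by (simp add: inn_T algebra_simps)
qed simp

lemma tr_up: "tr (replicate s (gT, True, 0)) (k ^ s * y) = Some (m ^ s * y)"
proof (induction s arbitrary: y)
  case (Suc s)
  have "tr (replicate s (gT, True, 0)) (k ^ Suc s * y) = Some (m ^ s * (k * y))"
    using Suc[of "k * y"] by (simp add: algebra_simps)
  then show ?case using k0 by (simp add: inn_T algebra_simps)
qed simp

lemma tr_loop: "tr (replicate f (gB, True, 0)) K = Some K"
  by (induction f) (auto simp: inn_B)

lemma tr_wit: "m ^ s dvd K \<Longrightarrow> tr (wit s f) K = Some K"
  by (auto simp: wit_def tr_append tr_down' tr_loop tr_up elim!: dvdE)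

lemma tr_wit': "\<not> m ^ s dvd K \<Longrightarrow> tr (wit s f) K = None"
proof -
  assume n: "\<not> m ^ s dvd K"
  have "tr (replicate s (gT, False, 0)) K = None"
  proof (cases "tr (replicate s (gT, False, 0)) K")
    case (Some Y)
    then have "m ^ s dvd K * k ^ s" using tr_down[of s K Y] by (metis dvd_triv_right)
    then have "m ^ s dvd K" using co by (simp add: coprime_dvd_mult_left_iff coprime_commute)
    then show ?thesis using n by blast
  qed
  then show ?thesis by (simp add: wit_def tr_append)
qed

lemma valid_replicate: "valid ds \<Longrightarrow> \<not> bk ds x e \<Longrightarrow> x \<noteq> gA \<Longrightarrow> valid (replicate n (x, e, 0) @ ds)"
proof (induction n)
  case (Suc n)
  then show ?case by (cases n) auto
qed simp

lemma wit_valid: assumes "f \<ge> 1" shows "valid (wit s f)"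
proof -
  have 1: "valid (replicate s (gT, False, 0))"
    using valid_replicate[of "[]" gT False s] by simp
  have 2: "valid (replicate f (gB, True, 0) @ replicate s (gT, False, 0))"
    by (cases s; intro valid_replicate[OF 1]; simp)
  show ?thesis unfolding wit_def
    using assms by (cases f; intro valid_replicate[OF 2]; simp)
qed

lemma ew_append: "ew (us @ ds) = ew ds @ ew us"
  by (induction us) auto

lemma ew_replicate: "ew (replicate s (x, e, 0)) = replicate s (x, e)"
  by (induction s) (auto simp: replicate_append_same)

lemma wit_pow: "pc (nword (wit s f, 0)) = pc (nword (wit s 1, 0)) [^]\<^bsub>GG\<^esub> f"
proof -
  let ?b = "pc [(gB, True)]" and ?t = "inv\<^bsub>GG\<^esub> (tt [^]\<^bsub>GG\<^esub> s)"
  have w: "pc (nword (wit s f, 0)) = ?t \<otimes>\<^bsub>GG\<^esub> ?b [^]\<^bsub>GG\<^esub> int f \<otimes>\<^bsub>GG\<^esub> inv\<^bsub>GG\<^esub> ?t" for f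
    by (simp add: nword_def wit_def ew_append ew_replicate pres_class_append pres_class_replicate pres_class_False G.nat_pow_inv G.m_assoc int_pow_int)
  show ?thesis unfolding w using G.conj_int_pow[of ?b ?t "int f"] by (simp add: int_pow_int)
qed

text \<open>Growth of the centralizer requires a new power of \<open>m\<close> by
  \<open>commute_divide\<close>. Conversely the witness for this power commutes with the larger
  power of \<open>A\<close> only, and some \<open>f\<close> puts it into \<open>H\<close> without
  affecting which powers of \<open>A\<close> it commutes with.\<close>

lemma jump_iff:
  assumes H: "fin_index GG H" and d: "d \<noteq> 0" and Kk: "\<And>s. k ^ s dvd K * d \<Longrightarrow> k ^ s dvd K"
  shows "(\<exists>g\<in>H. g \<otimes>\<^bsub>GG\<^esub> aa (K * d) = aa (K * d) \<otimes>\<^bsub>GG\<^esub> g \<and> g \<otimes>\<^bsub>GG\<^esub> aa K \<noteq> aa K \<otimes>\<^bsub>GG\<^esub> g)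
    \<longleftrightarrow> (\<exists>s. m ^ s dvd K * d \<and> \<not> m ^ s dvd K)"
proof
  assume "\<exists>g\<in>H. g \<otimes>\<^bsub>GG\<^esub> aa (K * d) = aa (K * d) \<otimes>\<^bsub>GG\<^esub> g \<and> g \<otimes>\<^bsub>GG\<^esub> aa K \<noteq> aa K \<otimes>\<^bsub>GG\<^esub> g"
  moreover have "H \<subseteq> carrier GG" using H by (simp add: fin_index_def subgroup.subset)
  ultimately show "\<exists>s. m ^ s dvd K * d \<and> \<not> m ^ s dvd K" using commute_divide[OF _ d _ Kk] by blast
next
  assume "\<exists>s. m ^ s dvd K * d \<and> \<not> m ^ s dvd K"
  then obtain s where s: "m ^ s dvd K * d" "\<not> m ^ s dvd K" by blast
  obtain f where f: "f \<ge> 1" "pc (nword (wit s 1, 0)) [^]\<^bsub>GG\<^esub> (f :: nat) \<in> H"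
    by (rule G.fin_index_power[OF H, of "pc (nword (wit s 1, 0))"]) auto
  note v = wit_valid[OF f(1), of s]
  have "pc (nword (wit s f, 0)) \<in> H" using f(2) by (simp only: wit_pow[of s f])
  moreover have "pc (nword (wit s f, 0)) \<otimes>\<^bsub>GG\<^esub> aa (K * d) = aa (K * d) \<otimes>\<^bsub>GG\<^esub> pc (nword (wit s f, 0))"
    using commute_iff[OF v, of 0 "K * d" "K * d"] tr_wit[OF s(1)] by simp
  moreover have "pc (nword (wit s f, 0)) \<otimes>\<^bsub>GG\<^esub> aa K \<noteq> aa K \<otimes>\<^bsub>GG\<^esub> pc (nword (wit s f, 0))"
    using commute_iff[OF v, of 0 K K] tr_wit'[OF s(2)] by simp
  ultimately show "\<exists>g\<in>H. g \<otimes>\<^bsub>GG\<^esub> aa (K * d) = aa (K * d) \<otimes>\<^bsub>GG\<^esub> g \<and> g \<otimes>\<^bsub>GG\<^esub> aa K \<noteq> aa K \<otimes>\<^bsub>GG\<^esub> g" by blast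
qed

lemma aa_pow: "aa K [^]\<^bsub>GG\<^esub> (n :: nat) = aa (K * int n)"
  by (simp add: pres_class_gen_pow G.int_pow_pow int_pow_int[symmetric])

lemma tt_aa: "tt \<otimes>\<^bsub>GG\<^esub> aa (m * z) = aa (k * z) \<otimes>\<^bsub>GG\<^esub> tt"
  using letter_pow[of gT True z] by (simp add: inn_T pres_class_gen_pow)

lemma tt_pow_aa: "tt [^]\<^bsub>GG\<^esub> c \<otimes>\<^bsub>GG\<^esub> aa (m ^ c * z) = aa (k ^ c * z) \<otimes>\<^bsub>GG\<^esub> tt [^]\<^bsub>GG\<^esub> (c :: nat)"
proof (induction c arbitrary: z)
  case (Suc c)
  have "tt [^]\<^bsub>GG\<^esub> Suc c \<otimes>\<^bsub>GG\<^esub> aa (m ^ Suc c * z) = tt [^]\<^bsub>GG\<^esub> c \<otimes>\<^bsub>GG\<^esub> (tt \<otimes>\<^bsub>GG\<^esub> aa (m * (m ^ c * z)))"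
    by (simp add: G.m_assoc algebra_simps)
  also have "\<dots> = (tt [^]\<^bsub>GG\<^esub> c \<otimes>\<^bsub>GG\<^esub> aa (m ^ c * (k * z))) \<otimes>\<^bsub>GG\<^esub> tt"
    unfolding tt_aa by (simp add: G.m_assoc algebra_simps)
  also have "\<dots> = aa (k ^ Suc c * z) \<otimes>\<^bsub>GG\<^esub> tt [^]\<^bsub>GG\<^esub> Suc c"
    unfolding Suc by (simp add: G.m_assoc algebra_simps)
  finally show ?case .
qed simp

text \<open>Only \<open>T\<close> changes the scale, so the modulus takes values in the powers of
  \<open>k / m\<close>.\<close>

lemma Dl_powi: "valid ds \<Longrightarrow> \<exists>e. Dl ds = (of_int k / of_int m) powi e"
proof (induction ds)
  case Nil
  show ?case by (intro exI[of _ 0]) simp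
next
  case (Cons c ds)
  obtain x f i where c: "c = (x, f, i)" by (cases c)
  have nz: "real_of_int k / of_int m \<noteq> 0" using k0 m0 by simp
  obtain e where e: "Dl ds = (of_int k / of_int m) powi e" using Cons by (auto simp: c)
  have "real_of_int (inn x f) / of_int (out x f) = (of_int k / of_int m) powi (if x = gT then if f then 1 else -1 else 0)"
    by (simp add: inn_T inn_B power_int_minus)
  then have "Dl (c # ds) = (of_int k / of_int m) powi (e + (if x = gT then if f then 1 else -1 else 0))"
    using nz by (simp add: c e power_int_add)
  then show ?case by blast
qed

end

section \<open>Comparing the periods of two groups\<close>

lemma commuting_transport:
  assumes h: "h \<in> iso (G\<lparr>carrier := H\<rparr>) (G'\<lparr>carrier := H'\<rparr>)" and xy: "x \<in> H" "y \<in> H"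
    and cl: "\<And>u v. u \<in> H \<Longrightarrow> v \<in> H \<Longrightarrow> u \<otimes>\<^bsub>G\<^esub> v \<in> H"
  shows "(\<exists>g\<in>H. g \<otimes>\<^bsub>G\<^esub> x = x \<otimes>\<^bsub>G\<^esub> g \<and> g \<otimes>\<^bsub>G\<^esub> y \<noteq> y \<otimes>\<^bsub>G\<^esub> g) \<longleftrightarrow>
    (\<exists>g\<in>H'. g \<otimes>\<^bsub>G'\<^esub> h x = h x \<otimes>\<^bsub>G'\<^esub> g \<and> g \<otimes>\<^bsub>G'\<^esub> h y \<noteq> h y \<otimes>\<^bsub>G'\<^esub> g)"
proof -
  have mult: "h (u \<otimes>\<^bsub>G\<^esub> v) = h u \<otimes>\<^bsub>G'\<^esub> h v" if "u \<in> H" "v \<in> H" for u v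
    using h that by (auto simp: iso_def hom_def)
  have inj: "inj_on h H" and img: "h ` H = H'" using h by (auto simp: iso_def bij_betw_def)
  have "g \<otimes>\<^bsub>G\<^esub> z = z \<otimes>\<^bsub>G\<^esub> g \<longleftrightarrow> h g \<otimes>\<^bsub>G'\<^esub> h z = h z \<otimes>\<^bsub>G'\<^esub> h g" if "g \<in> H" "z \<in> H" for g z
    using inj_onD[OF inj, of "g \<otimes>\<^bsub>G\<^esub> z" "z \<otimes>\<^bsub>G\<^esub> g"] mult[of g z] mult[of z g] cl that by auto
  then show ?thesis unfolding img[symmetric] using xy by simp
qed

text \<open>As \<open>m0^L\<close> divides \<open>X\<close> and \<open>L\<close> exceeds the
  valuation, the prime \<open>p\<close> alone decides: \<open>m^s\<close> becomes a divisor exactly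
  when \<open>e * s\<close> is the valuation plus 1.\<close>

lemma jump_multiplicity:
  fixes p m X m0 :: int
  assumes p: "prime p" and m: "m = p ^ e * m0" "\<not> p dvd m0" and e: "e \<ge> 1" and X: "X \<noteq> 0"
    and L: "m0 ^ L dvd X" "multiplicity p X < L"
  shows "(\<exists>s. m ^ s dvd X * p \<and> \<not> m ^ s dvd X) \<longleftrightarrow> e dvd multiplicity p X + 1"
proof -
  let ?v = "multiplicity p X"
  have cop: "coprime p (m0 ^ s)" "coprime (p ^ r) (m0 ^ s)" for r s
    using p m(2) by (simp_all add: prime_imp_coprime)
  have pw: "m ^ s = p ^ (e * s) * m0 ^ s" for s by (simp add: m power_mult_distrib power_mult)
  have np: "\<not> is_unit p" using p not_prime_unit by blast
  have le: "p ^ r dvd X \<longleftrightarrow> r \<le> ?v" for r using power_dvd_iff_le_multiplicity[OF X np] .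
  have le': "p ^ r dvd X * p \<longleftrightarrow> r \<le> Suc ?v" for r
  proof (cases r)
    case (Suc r')
    then show ?thesis using le[of r'] p by (auto simp: mult.commute[of X])
  qed simp
  show ?thesis
  proof
    assume "\<exists>s. m ^ s dvd X * p \<and> \<not> m ^ s dvd X"
    then obtain s where s: "m ^ s dvd X * p" "\<not> m ^ s dvd X" by blast
    have "m0 ^ s dvd X * p" using s(1) pw[of s] dvd_mult_right by metis
    then have 1: "m0 ^ s dvd X" using cop(1)[of s] by (simp add: coprime_dvd_mult_left_iff coprime_commute)
    have "p ^ (e * s) dvd X * p" using s(1) pw[of s] dvd_mult_left by metis
    then have "e * s \<le> Suc ?v" using le' by simp
    moreover have "\<not> e * s \<le> ?v"
    proof
      assume "e * s \<le> ?v"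
      then have "p ^ (e * s) dvd X" using le by simp
      then have "m ^ s dvd X" unfolding pw using 1 cop(2) by (simp add: divides_mult)
      then show False using s by simp
    qed
    ultimately have "e * s = ?v + 1" by simp
    then show "e dvd ?v + 1" by (metis dvd_triv_left)
  next
    assume "e dvd ?v + 1"
    then obtain s where s: "?v + 1 = e * s" ..
    have "s \<le> e * s" using e by simp
    then have "s \<le> L" using L(2) s by linarith
    then have "m0 ^ s dvd X" using L(1) le_imp_power_dvd dvd_trans by blast
    moreover have "p ^ ?v dvd X" using le by simp
    ultimately have "p ^ ?v * m0 ^ s dvd X" using cop(2) by (simp add: divides_mult)
    then have "p ^ ?v * m0 ^ s * p dvd X * p" by (rule mult_dvd_mono) simp
    moreover have "p ^ ?v * m0 ^ s * p = m ^ s" unfolding pw s[symmetric] by simp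
    ultimately have "m ^ s dvd X * p" by simp
    moreover have "\<not> m ^ s dvd X" 
    proof
      assume "m ^ s dvd X"
      then have "p ^ (e * s) dvd X" unfolding pw by (rule dvd_mult_left)
      then show False using le[of "e * s"] s by simp
    qed
    ultimately show "\<exists>s. m ^ s dvd X * p \<and> \<not> m ^ s dvd X" by blast
  qed
qed

text \<open>The window contains a multiple of \<open>e\<close> and the next one; both are hits for
  \<open>e'\<close>, so \<open>e'\<close> divides their difference \<open>e\<close>, and
  symmetrically.\<close>

lemma dvd_pattern:
  fixes e e' c c' :: nat
  assumes "e \<ge> 1" "e' \<ge> 1" and pat: "\<And>i. i \<le> 2 * (e + e') \<Longrightarrow> e dvd c + i \<longleftrightarrow> e' dvd c' + i"
  shows "e = e'"
proof -
  have "e' dvd e" if "e \<ge> 1" "e' \<ge> 1" "\<And>i. i \<le> 2 * (e + e') \<Longrightarrow> e dvd c + i \<longleftrightarrow> e' dvd c' + i" for e e' c c' :: nat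
  proof -
    define i where "i = e - c mod e"
    have i: "i \<le> e" "e dvd c + i"
    proof -
      have "c mod e < e" using that by simp
      then show "i \<le> e" by (simp add: i_def)
      have "c + i = c div e * e + e" using \<open>c mod e < e\<close> div_mult_mod_eq[of c e] unfolding i_def by linarith
      then show "e dvd c + i" by simp
    qed
    then have 1: "e' dvd c' + i" using that(3)[of i] by simp
    have "e dvd c + (i + e)" using i by (simp add: add.assoc[symmetric])
    then have "e' dvd c' + (i + e)" using that(3)[of "i + e"] i by simp
    then show "e' dvd e" using 1 by (metis add.assoc dvd_add_right_iff)
  qed
  note * = this
  have "e' dvd e" by (rule *[OF assms(1,2) pat])
  moreover have "e dvd e'" by (rule *[OF assms(2,1)]) (use pat in \<open>auto simp: add.commute\<close>)
  ultimately show ?thesis by (simp add: dvd_antisym)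
qed

text \<open>Uniqueness of reduced fractions, which splits an equality of moduli into numerators and
  denominators.\<close>

lemma coprime_pow_eq:
  fixes a b c d :: nat
  assumes "a * d = b * c" "coprime a c" "coprime b d"
  shows "a = b" "c = d"
proof -
  have "a dvd b * c" "b dvd a * d" using assms(1) by (metis dvd_triv_left)+
  then have "a dvd b" "b dvd a" using assms(2,3) by (simp_all add: coprime_dvd_mult_left_iff)
  then show ab: "a = b" by (simp add: dvd_antisym)
  have "c dvd a * d" "d dvd b * c" using assms(1) by (metis dvd_triv_right)+
  then have "c dvd d" "d dvd c" using assms(2,3) by (simp_all add: coprime_dvd_mult_right_iff coprime_commute)
  then show "c = d" by (simp add: dvd_antisym)
qed

text \<open>The strict bound on the first pair makes its \<open>A\<close> distorted, so that
  \<open>distorted_elliptic\<close> applies to the image of a power of \<open>A\<close>. The weak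
  bound on the second pair allows for a group that is unimodular a priori.\<close>

lemma commensurable_coprime_modulus:
  fixes k m k' m' :: int
  assumes co: "coprime k m" "coprime k' m'" and nz: "k \<noteq> 0" "k' \<noteq> 0"
    and le: "\<bar>k\<bar> < m" "\<bar>k'\<bar> \<le> m'"
    and comm: "commensurable (hnn_group (k, 0) (m, 0)) (hnn_group (k', 0) (m', 0))"
  shows "m = m' \<and> \<bar>k\<bar> = \<bar>k'\<bar>"
proof -
  have m: "m > 0" "m' > 0" using le nz by auto
  interpret A: coprime_hnn k m using co nz m by unfold_locales auto
  interpret A': coprime_hnn k' m' using co nz m by unfold_locales auto
  let ?G = "PG (hnn_rel k 0 m 0)" and ?G' = "PG (hnn_rel k' 0 m' 0)"
  obtain H H1 h1 where H: "fin_index ?G H" and H1: "fin_index ?G' H1"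
    and h1: "h1 \<in> iso (?G\<lparr>carrier := H\<rparr>) (?G'\<lparr>carrier := H1\<rparr>)"
    using comm unfolding commensurable_alt hnn_group_eq by blast
  have sH: "subgroup H ?G" and sH1: "subgroup H1 ?G'" using H H1 by (auto simp: fin_index_def)
  interpret GH: group "?G\<lparr>carrier := H\<rparr>" by (rule subgroup.subgroup_is_group[OF sH A.G.is_group])
  interpret GH1: group "?G'\<lparr>carrier := H1\<rparr>" by (rule subgroup.subgroup_is_group[OF sH1 A'.G.is_group])
  obtain M where M: "M \<ge> 1" "A.aa 1 [^]\<^bsub>?G\<^esub> (M :: nat) \<in> H" by (rule A.G.fin_index_power[OF H, of "A.aa 1"]) auto
  have aM: "A.aa (int M) \<in> H" using M(2) A.aa_pow[of 1 M] by simp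
  obtain c0 where c0: "c0 \<ge> 1" "A.tt [^]\<^bsub>?G\<^esub> (c0 :: nat) \<in> H" by (rule A.G.fin_index_power[OF H, of "A.tt"]) auto
  \<comment> \<open>An even exponent makes \<open>k^c\<close> positive, so both powers in the
    conjugation relation are natural numbers.\<close>
  define c where "c = 2 * c0"
  have c: "c \<ge> 1" "A.tt [^]\<^bsub>?G\<^esub> c \<in> H"
  proof -
    show "c \<ge> 1" using c0 by (simp add: c_def)
    have "A.tt [^]\<^bsub>?G\<^esub> c = A.tt [^]\<^bsub>?G\<^esub> c0 \<otimes>\<^bsub>?G\<^esub> A.tt [^]\<^bsub>?G\<^esub> c0" by (simp add: c_def A.G.nat_pow_mult mult_2)
    then show "A.tt [^]\<^bsub>?G\<^esub> c \<in> H" using c0(2) subgroup.m_closed[OF sH] by simp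
  qed
  have powH: "h1 (X [^]\<^bsub>?G\<^esub> (n :: nat)) = h1 X [^]\<^bsub>?G'\<^esub> n" "X [^]\<^bsub>?G\<^esub> n \<in> H" if "X \<in> H" for X n
  proof -
    interpret hh: group_hom "?G\<lparr>carrier := H\<rparr>" "?G'\<lparr>carrier := H1\<rparr>" h1
      by unfold_locales (use h1 in \<open>simp add: iso_def\<close>)
    have i: "X [^]\<^bsub>?G\<^esub> n = X [^]\<^bsub>?G\<lparr>carrier := H\<rparr>\<^esub> n" by (simp add: nat_pow_def)
    show "X [^]\<^bsub>?G\<^esub> n \<in> H" unfolding i using GH.nat_pow_closed[of X n] that by simp
    show "h1 (X [^]\<^bsub>?G\<^esub> n) = h1 X [^]\<^bsub>?G'\<^esub> n" unfolding i using hh.hom_nat_pow[of X n] that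
      by (simp add: nat_pow_def)
  qed
  have h1mult: "h1 (u \<otimes>\<^bsub>?G\<^esub> v) = h1 u \<otimes>\<^bsub>?G'\<^esub> h1 v" if "u \<in> H" "v \<in> H" for u v
    using h1 that by (auto simp: iso_def hom_def)
  have h1c: "h1 u \<in> carrier ?G'" if "u \<in> H" for u
    using h1 that subgroup.subset[OF sH1] by (auto simp: iso_def hom_def)
  define i j where "i = nat (m ^ c)" and "j = nat (k ^ c)"
  have kc: "k ^ c = (k ^ 2) ^ c0" by (simp add: c_def power_mult)
  have kpos: "k ^ c > 0" unfolding kc using nz by simp
  have ij: "int i = m ^ c" "int j = k ^ c" "0 < j" "j < i"
  proof -
    show "int i = m ^ c" "int j = k ^ c" using m kpos by (simp_all add: i_def j_def)
    show "0 < j" using kpos by (simp add: j_def)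
    have "k ^ c = \<bar>k\<bar> ^ c" using kpos by (simp add: power_abs[symmetric])
    also have "\<dots> < m ^ c" using le c by (intro power_strict_mono) auto
    finally show "j < i" using kpos by (simp add: i_def j_def)
  qed
  let ?X = "h1 (A.aa (int M))" and ?g = "h1 (A.tt [^]\<^bsub>?G\<^esub> c)"
  have eq0: "A.tt [^]\<^bsub>?G\<^esub> c \<otimes>\<^bsub>?G\<^esub> A.aa (int M) [^]\<^bsub>?G\<^esub> i = A.aa (int M) [^]\<^bsub>?G\<^esub> j \<otimes>\<^bsub>?G\<^esub> A.tt [^]\<^bsub>?G\<^esub> c"
    unfolding A.aa_pow ij(1,2) using A.tt_pow_aa[of c "int M"] by (simp add: mult.commute)
  have eq1: "?g \<otimes>\<^bsub>?G'\<^esub> ?X [^]\<^bsub>?G'\<^esub> i = ?X [^]\<^bsub>?G'\<^esub> j \<otimes>\<^bsub>?G'\<^esub> ?g"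
    using arg_cong[OF eq0, of h1] by (simp add: h1mult powH aM c(2))
  obtain u K where u: "u \<in> carrier ?G'" "inv\<^bsub>?G'\<^esub> u \<otimes>\<^bsub>?G'\<^esub> ?X \<otimes>\<^bsub>?G'\<^esub> u = A'.aa K"
    using A'.distorted_elliptic[OF h1c[OF aM] h1c[OF c(2)] ij(3,4) eq1] by blast
  define cj where "cj = (\<lambda>x. inv\<^bsub>?G'\<^esub> u \<otimes>\<^bsub>?G'\<^esub> x \<otimes>\<^bsub>?G'\<^esub> u)"
  have cjm: "cj (x \<otimes>\<^bsub>?G'\<^esub> y) = cj x \<otimes>\<^bsub>?G'\<^esub> cj y" if "x \<in> carrier ?G'" "y \<in> carrier ?G'" for x y
    using that u(1) A'.G.inv_mult_cancel[of "inv\<^bsub>?G'\<^esub> u"] by (simp add: cj_def A'.G.m_assoc)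
  have cj_iso: "cj \<in> iso ?G' ?G'"
  proof -
    have "cj \<in> hom ?G' ?G'" using u(1) cjm by (intro homI) (auto simp: cj_def)
    moreover have "bij_betw cj (carrier ?G') (carrier ?G')"
      by (rule bij_betwI[where g = "\<lambda>x. u \<otimes>\<^bsub>?G'\<^esub> x \<otimes>\<^bsub>?G'\<^esub> inv\<^bsub>?G'\<^esub> u"])
         (use u(1) A'.G.inv_mult_cancel[of "u"] A'.G.inv_mult_cancel[of "inv\<^bsub>?G'\<^esub> u"] in \<open>auto simp: cj_def A'.G.m_assoc\<close>)
    ultimately show ?thesis by (simp add: iso_def)
  qed
  define H' where "H' = cj ` H1"
  define h where "h = cj \<circ> h1"
  have H': "fin_index ?G' H'" unfolding H'_def
    by (rule fin_index_iso_image[OF A'.G.is_group A'.G.is_group cj_iso H1])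
  have "cj \<in> iso (?G'\<lparr>carrier := H1\<rparr>) (?G'\<lparr>carrier := H'\<rparr>)"
    unfolding H'_def by (rule iso_restrict[where H = "carrier ?G'" and H' = "carrier ?G'"])
       (use cj_iso subgroup.subset[OF sH1] in auto)
  then have h: "h \<in> iso (?G\<lparr>carrier := H\<rparr>) (?G'\<lparr>carrier := H'\<rparr>)"
    unfolding h_def using h1 iso_set_trans by blast
  have haM: "h (A.aa (int M)) = A'.aa K" using u(2) by (simp add: h_def cj_def)
  interpret cjh: group_hom ?G' ?G' cj by unfold_locales (use cj_iso in \<open>simp add: iso_def\<close>)
  have cjpow: "cj (x [^]\<^bsub>?G'\<^esub> (n :: nat)) = cj x [^]\<^bsub>?G'\<^esub> n" if "x \<in> carrier ?G'" for x n
    using that by (rule cjh.hom_nat_pow)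
  have haa: "h (A.aa (int M * int z)) = A'.aa (K * int z)" "A.aa (int M * int z) \<in> H" for z :: nat
    using powH[OF aM, of z] haM cjpow[OF h1c[OF aM], of z]
    by (simp_all add: A.aa_pow A'.aa_pow[symmetric] h_def)
  have hinj: "inj_on h H" using h by (auto simp: iso_def bij_betw_def)
  have K0: "K \<noteq> 0"
  proof
    assume "K = 0"
    then have "h (A.aa (int M * int 1)) = h (A.aa (int M * int 0))" unfolding haa(1) by simp
    from inj_onD[OF hinj this haa(2) haa(2)] have "A.aa (int M * int 1) = A.aa (int M * int 0)" .
    from A.ga_pow_inj[OF this] show False using M(1) by simp
  qed
  have modulus: "\<exists>E. (m' ^ E = m ^ c \<and> \<bar>k'\<bar> ^ E = \<bar>k\<bar> ^ c)"
  proof -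
    have ht: "h (A.tt [^]\<^bsub>?G\<^esub> c) \<in> carrier ?G'" using h1c[OF c(2)] u(1) by (simp add: h_def cj_def)
    then obtain w where w: "h (A.tt [^]\<^bsub>?G\<^esub> c) = cls (hnn_rel k' 0 m' 0) w" by (auto elim: pres_class_cases)
    have hm: "h (x \<otimes>\<^bsub>?G\<^esub> y) = h x \<otimes>\<^bsub>?G'\<^esub> h y" if "x \<in> H" "y \<in> H" for x y
      using h that unfolding iso_def hom_def by simp
    have "h (A.tt [^]\<^bsub>?G\<^esub> c) \<otimes>\<^bsub>?G'\<^esub> A'.aa (K * int i) = A'.aa (K * int j) \<otimes>\<^bsub>?G'\<^esub> h (A.tt [^]\<^bsub>?G\<^esub> c)"
      using arg_cong[OF eq0, of h] haa[of i] haa[of j] by (simp add: A.aa_pow hm c(2))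
    then have "A'.Dl (fst (A'.nf w)) * real_of_int (K * int i) = real_of_int (K * int j)"
      unfolding w by (rule A'.commute_Dl)
    then have dl: "A'.Dl (fst (A'.nf w)) * (real_of_int K * real_of_int (m ^ c)) = real_of_int K * real_of_int (k ^ c)"
      by (simp only: ij(1,2) of_int_mult)
    have mc: "real_of_int (m ^ c) > 0" using m by simp
    have dl': "A'.Dl (fst (A'.nf w)) = real_of_int (k ^ c) / real_of_int (m ^ c)"
    proof -
      have "real_of_int K * (A'.Dl (fst (A'.nf w)) * real_of_int (m ^ c)) = real_of_int K * real_of_int (k ^ c)"
        using dl by (simp only: ac_simps)
      then have "A'.Dl (fst (A'.nf w)) * real_of_int (m ^ c) = real_of_int (k ^ c)" using K0 by (simp only: mult_cancel_left of_int_eq_0_iff) simp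
      then show ?thesis using nonzero_eq_divide_eq[OF less_imp_neq[OF mc, symmetric]] by simp
    qed
    have "A'.valid (fst (A'.nf w))" using A'.run_valid[of "([], 0)" w] by simp
    then obtain e where e0: "A'.Dl (fst (A'.nf w)) = (real_of_int k' / real_of_int m') powi e" using A'.Dl_powi by blast
    have e: "(\<bar>real_of_int k'\<bar> / real_of_int m') powi e = \<bar>real_of_int k\<bar> ^ c / real_of_int m ^ c"
    proof -
      have "\<bar>(real_of_int k' / real_of_int m') powi e\<bar> = \<bar>real_of_int (k ^ c) / real_of_int (m ^ c)\<bar>"
        unfolding e0[symmetric] dl' by (rule HOL.refl)
      then show ?thesis using m by (simp add: power_int_abs abs_divide power_abs)
    qed
    have lt1: "\<bar>real_of_int k\<bar> ^ c / real_of_int m ^ c < 1"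
    proof -
      have "\<bar>real_of_int k\<bar> < real_of_int m" using le by linarith
      then have "\<bar>real_of_int k\<bar> ^ c < real_of_int m ^ c" using c by (intro power_strict_mono) auto
      then show ?thesis using m by simp
    qed
    have r: "0 < \<bar>real_of_int k'\<bar> / real_of_int m'" "\<bar>real_of_int k'\<bar> / real_of_int m' \<le> 1" using m nz le by (auto simp: divide_le_eq)
    \<comment> \<open>The right-hand side of the equation for \<open>e\<close> is below 1, whereas
      an exponent that is not positive would make the left-hand side at least 1.\<close>
    have "e > 0"
    proof (rule ccontr)
      assume "\<not> e > 0"
      then have "e = - int (nat (- e))" by simp
      then have "(\<bar>real_of_int k'\<bar> / real_of_int m') powi e = inverse ((\<bar>real_of_int k'\<bar> / real_of_int m') ^ nat (- e))"
        by (metis power_int_minus power_int_of_nat)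
      moreover have "(\<bar>real_of_int k'\<bar> / real_of_int m') ^ nat (- e) \<le> 1" using r by (intro power_le_one) auto
      moreover have "(\<bar>real_of_int k'\<bar> / real_of_int m') ^ nat (- e) > 0" using r by simp
      ultimately have "(\<bar>real_of_int k'\<bar> / real_of_int m') powi e \<ge> 1" by (simp add: one_le_inverse_iff)
      then show False using e lt1 by simp
    qed
    define E where "E = nat e"
    have "\<bar>real_of_int k'\<bar> ^ E / real_of_int m' ^ E = \<bar>real_of_int k\<bar> ^ c / real_of_int m ^ c"
      using e \<open>e > 0\<close> by (simp add: power_int_def E_def power_divide)
    then have "\<bar>real_of_int k'\<bar> ^ E * real_of_int m ^ c = \<bar>real_of_int k\<bar> ^ c * real_of_int m' ^ E"
      using m by (simp add: frac_eq_eq)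
    then have "real_of_int (\<bar>k'\<bar> ^ E * m ^ c) = real_of_int (\<bar>k\<bar> ^ c * m' ^ E)" by simp
    then have "\<bar>k'\<bar> ^ E * m ^ c = \<bar>k\<bar> ^ c * m' ^ E" by (simp only: of_int_eq_iff)
    then have n: "nat \<bar>k'\<bar> ^ E * nat m ^ c = nat \<bar>k\<bar> ^ c * nat m' ^ E"
      using m by (metis abs_ge_zero nat_mult_distrib nat_power_eq order_less_imp_le zero_le_power)
    have cop: "coprime (nat \<bar>k'\<bar> ^ E) (nat m' ^ E)" "coprime (nat \<bar>k\<bar> ^ c) (nat m ^ c)"
      using co m by (simp_all add: coprime_nat_abs_left_iff coprime_int_iff[symmetric])
    have "nat \<bar>k'\<bar> ^ E = nat \<bar>k\<bar> ^ c" "nat m' ^ E = nat m ^ c" by (rule coprime_pow_eq[OF n cop])+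
    then have "int (nat \<bar>k'\<bar> ^ E) = int (nat \<bar>k\<bar> ^ c)" "int (nat m' ^ E) = int (nat m ^ c)" by simp_all
    then show ?thesis using m by (intro exI[of _ E]) (simp add: of_nat_power)
  qed
  then obtain E where E: "m' ^ E = m ^ c" "\<bar>k'\<bar> ^ E = \<bar>k\<bar> ^ c" by blast
  have "m \<ge> 2" using le nz by auto
  then obtain p where p: "prime p" "p dvd m" using prime_divisor_exists[of m] by (auto simp: zdvd1_eq)
  have "m ^ c > 1" using \<open>m \<ge> 2\<close> c by (simp add: one_less_power)
  then have E0: "E \<noteq> 0" using E by (metis power_0 less_irrefl)
  have "p dvd m' ^ E" using p c E(1) by (metis dvd_power dvd_trans less_le_trans zero_less_one)
  then have p': "p dvd m'" using p(1) prime_dvd_power by blast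
  define e e' where "e = multiplicity p m" and "e' = multiplicity p m'"
  have ne: "m \<noteq> 0" "m' \<noteq> 0" "\<not> is_unit p" using m p not_prime_unit by auto
  obtain m0 where m0: "m = p ^ e * m0" "\<not> p dvd m0" using multiplicity_decompose'[of m p] ne e_def by metis
  obtain m0' where m0': "m' = p ^ e' * m0'" "\<not> p dvd m0'" using multiplicity_decompose'[of m' p] ne e'_def by metis
  have e1: "e \<ge> 1" "e' \<ge> 1" using p p' ne unfolding e_def e'_def by (simp_all add: multiplicity_gt_zero_iff Suc_le_eq)
  define \<mu> \<mu>' where "\<mu> = multiplicity p (int M)" and "\<mu>' = multiplicity p K"
  \<comment> \<open>\<open>L\<close> exceeds every valuation at \<open>p\<close> that occurs in the
    window of \<open>dvd_pattern\<close>. Multiplying by \<open>Q\<close> then supplies the factors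
    of \<open>m\<close> and \<open>m'\<close> prime to \<open>p\<close> without changing these
    valuations.\<close>
  define L where "L = \<mu> + \<mu>' + 2 * (e + e') + 1"
  define Q where "Q = \<bar>m0 * m0'\<bar> ^ L"
  have m00: "m0 \<noteq> 0" "m0' \<noteq> 0" using ne m0 m0' by auto
  have Q: "Q > 0" using m00 by (simp add: Q_def)
  have pQ: "multiplicity p Q = 0"
  proof -
    have "\<not> p dvd m0 * m0'" using p(1) m0(2) m0'(2) by (simp add: prime_dvd_mult_iff)
    then have "\<not> p dvd Q" using p(1) prime_dvd_power[of p "\<bar>m0 * m0'\<bar>" L] by (simp only: Q_def) auto
    then show ?thesis by (rule not_dvd_imp_multiplicity_0)
  qed
  have pp: "p > 0" using p(1) prime_gt_0_int by blast
  have mult: "multiplicity p (Y * (Q * p ^ r)) = multiplicity p Y + r" if "Y \<noteq> 0" for Y r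
    using that Q pp p(1) pQ by (simp add: prime_elem_multiplicity_mult_distrib multiplicity_same_power ne)
  have cop: "coprime (k ^ s) p" "coprime (k' ^ s) p" for s
    using co p p' by (auto intro: coprime_imp_coprime dvd_trans simp: coprime_commute[of p] prime_imp_coprime coprime_power_left_iff)
  \<comment> \<open>The isomorphism matches the growth of centralizers under multiplication by
    \<open>p\<close> in both groups; \<open>p\<close> is prime to \<open>k\<close> and
    \<open>k'\<close>, so powers of these play no part in the growth.\<close>
  have key: "e dvd (\<mu> + 1) + r \<longleftrightarrow> e' dvd (\<mu>' + 1) + r" if r: "r \<le> 2 * (e + e')" for r
  proof -
    define z where "z = nat (Q * p ^ r)"
    have z: "int z = Q * p ^ r" "int (z * nat p) = Q * p ^ r * p" using Q pp by (simp_all add: z_def)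
    let ?Y = "int M * (Q * p ^ r)" and ?Y' = "K * (Q * p ^ r)"
    have Y0: "?Y \<noteq> 0" "?Y' \<noteq> 0" using M K0 Q pp by auto
    have "m0 ^ L dvd Q" "m0' ^ L dvd Q"
      unfolding Q_def power_abs[symmetric] power_mult_distrib dvd_abs_iff by (rule dvd_triv_left dvd_triv_right)+
    then have dQ: "m0 ^ L dvd ?Y" "m0' ^ L dvd ?Y'" by (meson dvd_mult dvd_mult2)+
    have hz: "h (A.aa (?Y * p)) = A'.aa (?Y' * p)" "h (A.aa ?Y) = A'.aa ?Y'" "A.aa (?Y * p) \<in> H" "A.aa ?Y \<in> H"
      using haa[of "z * nat p"] haa[of z] unfolding z by (simp_all only: mult.assoc)
    have "(\<exists>g\<in>H. g \<otimes>\<^bsub>?G\<^esub> A.aa (?Y * p) = A.aa (?Y * p) \<otimes>\<^bsub>?G\<^esub> g \<and> g \<otimes>\<^bsub>?G\<^esub> A.aa ?Y \<noteq> A.aa ?Y \<otimes>\<^bsub>?G\<^esub> g) \<longleftrightarrow>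
      (\<exists>g\<in>H'. g \<otimes>\<^bsub>?G'\<^esub> A'.aa (?Y' * p) = A'.aa (?Y' * p) \<otimes>\<^bsub>?G'\<^esub> g \<and> g \<otimes>\<^bsub>?G'\<^esub> A'.aa ?Y' \<noteq> A'.aa ?Y' \<otimes>\<^bsub>?G'\<^esub> g)"
      using commuting_transport[OF h hz(3,4) subgroup.m_closed[OF sH]] unfolding hz(1,2) by blast
    moreover have "k ^ s dvd ?Y * p \<Longrightarrow> k ^ s dvd ?Y" "k' ^ s dvd ?Y' * p \<Longrightarrow> k' ^ s dvd ?Y'" for s
      using cop[of s] by (simp_all only: coprime_dvd_mult_left_iff)
    ultimately have "(\<exists>s. m ^ s dvd ?Y * p \<and> \<not> m ^ s dvd ?Y) \<longleftrightarrow> (\<exists>s. m' ^ s dvd ?Y' * p \<and> \<not> m' ^ s dvd ?Y')"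
      using A.jump_iff[OF H, of p ?Y] A'.jump_iff[OF H', of p ?Y'] pp by simp
    then show ?thesis
      using jump_multiplicity[OF p(1) m0 e1(1) Y0(1) dQ(1)] jump_multiplicity[OF p(1) m0' e1(2) Y0(2) dQ(2)]
        mult[of "int M" r] mult[of K r] M K0 r unfolding L_def \<mu>_def \<mu>'_def by simp
  qed
  have ee: "e = e'" by (rule dvd_pattern[OF e1 key])
  \<comment> \<open>Valuations at \<open>p\<close> of \<open>m'^E = m^c\<close>; with equal periods
    they force \<open>c = E\<close>.\<close>
  have "E * e' = c * e" using arg_cong[OF E(1), of "multiplicity p"]
    prime_elem_multiplicity_power_distrib[OF prime_imp_prime_elem[OF p(1)] ne(1), of c]
    prime_elem_multiplicity_power_distrib[OF prime_imp_prime_elem[OF p(1)] ne(2), of E]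
    by (simp add: e_def e'_def)
  then have cE: "c = E" using ee e1 by simp
  have "m = m'" using E(1) m c unfolding cE by (metis less_imp_le less_le_trans power_eq_imp_eq_base zero_less_one)
  moreover have "\<bar>k\<bar> = \<bar>k'\<bar>" using E(2) c unfolding cE by (metis abs_ge_zero less_le_trans power_eq_imp_eq_base zero_less_one)
  ultimately show ?thesis by simp
qed

section \<open>The commensurability criterion\<close>

lemma commensurable_hnn_cong:
  assumes "hnn_equiv p q r s" "hnn_equiv p' q' r' s'"
  shows "commensurable (hnn_group p q) (hnn_group p' q') \<longleftrightarrow> commensurable (hnn_group r s) (hnn_group r' s')"
  using assms commensurable_sym[OF group_hnn group_hnn] commensurable_trans[OF group_hnn group_hnn group_hnn]
  unfolding hnn_equiv_def by metis

text \<open>Scaling reduces both groups to coprime parameters, for which the criterion says that the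
  parameters agree up to the sign of the first one.\<close>

lemma commensurable_hnn_iff:
  assumes "1 \<le> \<bar>m1\<bar>" "\<bar>m1\<bar> \<le> n1" "1 \<le> \<bar>m2\<bar>" "\<bar>m2\<bar> \<le> n2"
  shows "commensurable (hnn_group (m1, 0) (n1, 0)) (hnn_group (m2, 0) (n2, 0)) \<longleftrightarrow> \<bar>m2\<bar> * n1 = \<bar>m1\<bar> * n2"
proof -
  have *: "\<exists>g k m. g > 0 \<and> k \<noteq> 0 \<and> \<bar>k\<bar> \<le> m \<and> coprime k m \<and> m1 = g * k \<and> n1 = g * m \<and> hnn_equiv (m1, 0) (n1, 0) (k, 0) (m, 0)"
    if le: "1 \<le> \<bar>m1\<bar>" "\<bar>m1\<bar> \<le> n1" for m1 n1 :: int
  proof -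
    obtain k m where km: "m1 = gcd m1 n1 * k" "n1 = gcd m1 n1 * m" "coprime k m"
      using gcd_coprime_exists[of m1 n1] le by (force simp: mult.commute)
    have g: "gcd m1 n1 > 0" using le by auto
    have "gcd m1 n1 * \<bar>k\<bar> \<le> gcd m1 n1 * m" using le(2) km(1,2) g by (metis abs_mult abs_of_pos)
    then have "\<bar>k\<bar> \<le> m" using g by simp
    moreover have "k \<noteq> 0" using km(1) le by auto
    moreover have "hnn_equiv (k, 0) (m, 0) (m1, 0) (n1, 0)" using hnn_equiv_scale[of "gcd m1 n1" k m] g km(1,2) by simp
    ultimately show ?thesis using g km by (intro exI[of _ "gcd m1 n1"] exI[of _ k] exI[of _ m]) (auto intro: hnn_equiv_sym)
  qed
  obtain g k m where km: "g > 0" "k \<noteq> 0" "\<bar>k\<bar> \<le> m" "coprime k m" "m1 = g * k" "n1 = g * m" "hnn_equiv (m1, 0) (n1, 0) (k, 0) (m, 0)"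
    using *[OF assms(1,2)] by blast
  obtain g' k' m' where km': "g' > 0" "k' \<noteq> 0" "\<bar>k'\<bar> \<le> m'" "coprime k' m'" "m2 = g' * k'" "n2 = g' * m'" "hnn_equiv (m2, 0) (n2, 0) (k', 0) (m', 0)"
    using *[OF assms(3,4)] by blast
  have "\<bar>m2\<bar> * n1 = \<bar>m1\<bar> * n2 \<longleftrightarrow> \<bar>k'\<bar> * m = \<bar>k\<bar> * m'"
    using km(1) km'(1) by (simp add: km(5,6) km'(5,6) abs_mult)
  moreover have "commensurable (hnn_group (k, 0) (m, 0)) (hnn_group (k', 0) (m', 0)) \<longleftrightarrow> \<bar>k'\<bar> * m = \<bar>k\<bar> * m'"
  proof
    assume c: "commensurable (hnn_group (k, 0) (m, 0)) (hnn_group (k', 0) (m', 0))"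
    \<comment> \<open>The group whose generator is distorted has to come first; if there is none,
      the claim is an identity.\<close>
    consider "\<bar>k\<bar> < m" | "\<bar>k'\<bar> < m'" | "\<bar>k\<bar> = m" "\<bar>k'\<bar> = m'" using km(3) km'(3) by linarith
    then show "\<bar>k'\<bar> * m = \<bar>k\<bar> * m'"
    proof cases
      case 1
      then show ?thesis using commensurable_coprime_modulus[OF km(4) km'(4) km(2) km'(2) _ km'(3) c] by simp
    next
      case 2
      then show ?thesis
        using commensurable_coprime_modulus[OF km'(4) km(4) km'(2) km(2) _ km(3) commensurable_sym[OF group_hnn group_hnn c]] by simp
    qed simp
  next
    assume eq: "\<bar>k'\<bar> * m = \<bar>k\<bar> * m'"
    have "coprime \<bar>k\<bar> m" "coprime \<bar>k'\<bar> m'" using km(4) km'(4) by simp_all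
    then have "\<bar>k'\<bar> = \<bar>k\<bar> \<and> m = m'"
      using coprime_crossproduct_int[of "\<bar>k'\<bar>" m' "\<bar>k\<bar>" m] eq km(3) km'(3) by (auto simp: mult.commute)
    then have "m' = m" "k' = k \<or> k' = - k" by (auto simp: abs_eq_iff)
    then show "commensurable (hnn_group (k, 0) (m, 0)) (hnn_group (k', 0) (m', 0))"
      using hnn_equiv_refl[of "(k, 0)" "(m, 0)"] hnn_equiv_flip[of k m] unfolding hnn_equiv_def by auto
  qed
  ultimately show ?thesis using commensurable_hnn_cong[OF km(7) km'(7)] by simp
qed

section \<open>Cubic filling\<close>

text \<open>The dual form of a cubic isoperimetric inequality: an antisymmetric function \<open>\<alpha>\<close> whose sum over every
  triangle of size \<open>R\<close> is at most 1 has sum \<open>O(l\<^sup>3)\<close> over every closed path of length \<open>l\<close>.\<close>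

definition coarse_cocycle :: "'a set \<Rightarrow> ('a \<Rightarrow> 'a \<Rightarrow> real) \<Rightarrow> real \<Rightarrow> ('a \<Rightarrow> 'a \<Rightarrow> real) \<Rightarrow> bool" where
  "coarse_cocycle X d R \<alpha> \<longleftrightarrow> (\<forall>x\<in>X. \<forall>y\<in>X. \<alpha> x y = - \<alpha> y x) \<and>
     (\<forall>x\<in>X. \<forall>y\<in>X. \<forall>z\<in>X. d x y \<le> R \<and> d y z \<le> R \<and> d x z \<le> R \<longrightarrow> \<bar>\<alpha> x y + \<alpha> y z + \<alpha> z x\<bar> \<le> 1)"

definition closed_path :: "'a set \<Rightarrow> ('a \<Rightarrow> 'a \<Rightarrow> real) \<Rightarrow> real \<Rightarrow> nat \<Rightarrow> (nat \<Rightarrow> 'a) \<Rightarrow> bool" where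
  "closed_path X d r l p \<longleftrightarrow> p 0 = p l \<and> (\<forall>i\<le>l. p i \<in> X) \<and> (\<forall>i<l. d (p i) (p (Suc i)) \<le> r)"

definition cubic_filling :: "'a set \<Rightarrow> ('a \<Rightarrow> 'a \<Rightarrow> real) \<Rightarrow> bool" where
  "cubic_filling X d \<longleftrightarrow> (\<forall>r. \<exists>R C. \<forall>\<alpha> l p. coarse_cocycle X d R \<alpha> \<longrightarrow> closed_path X d r l p \<longrightarrow>
     \<bar>\<Sum>i<l. \<alpha> (p i) (p (Suc i))\<bar> \<le> C * real (l + 1) ^ 3)"

text \<open>A cocycle on \<open>X\<close> is pulled back along the coarse inverse \<open>g\<close>.
  The given path and its image under \<open>f\<close> and \<open>g\<close> differ by one
  quadrilateral per step, which a diagonal cuts into two triangles.\<close>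

lemma cubic_filling_qi:
  assumes qi: "quasi_isometric_spaces X d Y e" and X: "pseudometric X d" and Y: "pseudometric Y e" and fill: "cubic_filling Y e"
  shows "cubic_filling X d"
  unfolding cubic_filling_def
proof (rule allI)
  fix r :: real
  obtain f g K C where f: "f \<in> X \<rightarrow> Y" and g: "g \<in> Y \<rightarrow> X" and K: "K \<ge> 1" and C: "C \<ge> 0"
    and fL: "\<And>x x'. x \<in> X \<Longrightarrow> x' \<in> X \<Longrightarrow> e (f x) (f x') \<le> K * d x x' + C"
    and gL: "\<And>y y'. y \<in> Y \<Longrightarrow> y' \<in> Y \<Longrightarrow> d (g y) (g y') \<le> K * e y y' + C"
    and gf: "\<And>x. x \<in> X \<Longrightarrow> d (g (f x)) x \<le> C"
    and "\<And>y. y \<in> Y \<Longrightarrow> e (f (g y)) y \<le> C"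
    by (rule qi_inverse[OF qi Y]) (rule that)
  define r' where "r' = K * r + C"
  obtain R' C' where RC: "\<And>\<alpha> l p. coarse_cocycle Y e R' \<alpha> \<Longrightarrow> closed_path Y e r' l p \<Longrightarrow>
     \<bar>\<Sum>i<l. \<alpha> (p i) (p (Suc i))\<bar> \<le> C' * real (l + 1) ^ 3"
    using fill unfolding cubic_filling_def by metis
  \<comment> \<open>Large enough for the images of triangles of size \<open>R'\<close> and for all
    sides and diagonals of the quadrilaterals.\<close>
  define R where "R = max (max (K * R' + C) (r + C)) (max (K * r' + C) (max r C))"
  show "\<exists>R C. \<forall>\<alpha> l p. coarse_cocycle X d R \<alpha> \<longrightarrow> closed_path X d r l p \<longrightarrow>
     \<bar>\<Sum>i<l. \<alpha> (p i) (p (Suc i))\<bar> \<le> C * real (l + 1) ^ 3"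
  proof (rule exI[of _ R], rule exI[of _ "\<bar>C'\<bar> + 2"], intro allI impI)
    fix \<alpha> :: "'a \<Rightarrow> 'a \<Rightarrow> real" and l :: nat and p
    assume cc: "coarse_cocycle X d R \<alpha>" and cp: "closed_path X d r l p"
    have anti: "\<forall>x\<in>X. \<forall>y\<in>X. \<alpha> x y = - \<alpha> y x"
      and tri: "\<forall>x\<in>X. \<forall>y\<in>X. \<forall>z\<in>X. d x y \<le> R \<and> d y z \<le> R \<and> d x z \<le> R \<longrightarrow> \<bar>\<alpha> x y + \<alpha> y z + \<alpha> z x\<bar> \<le> 1"
      using cc unfolding coarse_cocycle_def by blast+
    have p: "p 0 = p l" "\<forall>i\<le>l. p i \<in> X" "\<forall>i<l. d (p i) (p (Suc i)) \<le> r"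
      using cp unfolding closed_path_def by blast+
    define \<beta> where "\<beta> = (\<lambda>y y'. \<alpha> (g y) (g y'))"
    have b1: "\<forall>x\<in>Y. \<forall>y\<in>Y. \<beta> x y = - \<beta> y x" using anti g by (auto simp: \<beta>_def)
    have gR: "d (g y) (g y') \<le> R" if "y \<in> Y" "y' \<in> Y" "e y y' \<le> R'" for y y'
    proof -
      have "K * e y y' \<le> K * R'" using that K by simp
      then show ?thesis using gL[OF that(1,2)] by (simp add: R_def)
    qed
    have b2: "\<forall>x\<in>Y. \<forall>y\<in>Y. \<forall>z\<in>Y. e x y \<le> R' \<and> e y z \<le> R' \<and> e x z \<le> R' \<longrightarrow> \<bar>\<beta> x y + \<beta> y z + \<beta> z x\<bar> \<le> 1"
    proof (intro ballI impI)
      fix x y z assume h: "x \<in> Y" "y \<in> Y" "z \<in> Y" "e x y \<le> R' \<and> e y z \<le> R' \<and> e x z \<le> R'"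
      have "g x \<in> X" "g y \<in> X" "g z \<in> X" using g h by auto
      then show "\<bar>\<beta> x y + \<beta> y z + \<beta> z x\<bar> \<le> 1"
        using tri gR[OF h(1,2)] gR[OF h(2,3)] gR[OF h(1,3)] h(4) by (simp add: \<beta>_def)
    qed
    have fp: "f (p i) \<in> Y" "g (f (p i)) \<in> X" "p i \<in> X" if "i \<le> l" for i using f g p that by auto
    have step: "e (f (p i)) (f (p (Suc i))) \<le> r'" if "i < l" for i
    proof -
      have "K * d (p i) (p (Suc i)) \<le> K * r" using that K p(3) by simp
      then show ?thesis using fL[of "p i" "p (Suc i)"] fp(3)[of i] fp(3)[of "Suc i"] that by (simp add: r'_def)
    qed
    have "coarse_cocycle Y e R' \<beta>" unfolding coarse_cocycle_def using b1 b2 by (rule conjI)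
    moreover have "closed_path Y e r' l (\<lambda>i. f (p i))" using p(1) fp step by (simp add: closed_path_def)
    ultimately have "\<bar>\<Sum>i<l. \<beta> (f (p i)) (f (p (Suc i)))\<bar> \<le> C' * real (l + 1) ^ 3" by (rule RC)
    moreover have "\<bar>(\<Sum>i<l. \<alpha> (p i) (p (Suc i))) - (\<Sum>i<l. \<beta> (f (p i)) (f (p (Suc i))))\<bar> \<le> 2 * real l"
    proof -
      \<comment> \<open>The edges between the path and its image; their contributions telescope to 0
        around a closed path.\<close>
      define \<gamma> where "\<gamma> = (\<lambda>i. \<alpha> (p i) (g (f (p i))))"
      define E where "E = (\<lambda>i. \<alpha> (p i) (p (Suc i)) + \<gamma> (Suc i) - \<gamma> i - \<beta> (f (p i)) (f (p (Suc i))))"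
      have "\<bar>E i\<bar> \<le> 2" if i: "i < l" for i
      proof -
        let ?x = "p i" and ?x' = "p (Suc i)" and ?y = "g (f (p i))" and ?y' = "g (f (p (Suc i)))"
        have inX: "?x \<in> X" "?x' \<in> X" "?y \<in> X" "?y' \<in> X" using fp[of i] fp[of "Suc i"] i by auto
        have d1: "d ?x ?x' \<le> r" using p(3) i by simp
        have d2: "d ?x ?y \<le> C" "d ?x' ?y' \<le> C" using gf[of ?x] gf[of ?x'] inX X unfolding pseudometric_def by metis+
        have d3: "d ?x ?y' \<le> r + C" using X inX d1 d2(2) unfolding pseudometric_def by (smt (verit))
        have "K * e (f ?x) (f ?x') \<le> K * r'" using step[OF i] K by simp
        then have d4: "d ?y ?y' \<le> K * r' + C" using gL[of "f ?x" "f ?x'"] fp(1)[of i] fp(1)[of "Suc i"] i by simp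
        have R: "r \<le> R" "C \<le> R" "r + C \<le> R" "K * r' + C \<le> R" by (simp_all add: R_def)
        have e: "d ?x ?x' \<le> R" "d ?x ?y \<le> R" "d ?x' ?y' \<le> R" "d ?x ?y' \<le> R" "d ?y ?y' \<le> R"
          using d1 d2 d3 d4 R by linarith+
        have "\<bar>\<alpha> ?x ?x' + \<alpha> ?x' ?y' + \<alpha> ?y' ?x\<bar> \<le> 1" using tri[rule_format, OF inX(1,2,4)] e by blast
        moreover have "\<bar>\<alpha> ?x ?y + \<alpha> ?y ?y' + \<alpha> ?y' ?x\<bar> \<le> 1" using tri[rule_format, OF inX(1,3,4)] e by blast
        ultimately show ?thesis by (simp add: E_def \<gamma>_def \<beta>_def)
      qed
      then have "\<bar>\<Sum>i<l. E i\<bar> \<le> (\<Sum>i<l. 2)" by (intro order_trans[OF sum_abs] sum_mono) auto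
      moreover have "(\<Sum>i<l. E i) = (\<Sum>i<l. \<alpha> (p i) (p (Suc i))) + (\<Sum>i<l. \<gamma> (Suc i) - \<gamma> i) - (\<Sum>i<l. \<beta> (f (p i)) (f (p (Suc i))))"
        by (simp add: E_def sum.distrib sum_subtractf)
      moreover have "(\<Sum>i<l. \<gamma> (Suc i) - \<gamma> i) = 0"
        unfolding sum_lessThan_telescope using p(1) by (simp add: \<gamma>_def)
      ultimately show ?thesis by (simp add: mult.commute)
    qed
    ultimately have "\<bar>\<Sum>i<l. \<alpha> (p i) (p (Suc i))\<bar> \<le> C' * real (l + 1) ^ 3 + 2 * real l" by linarith
    also have "\<dots> \<le> \<bar>C'\<bar> * real (l + 1) ^ 3 + 2 * real (l + 1) ^ 3"
    proof -
      have "real l \<le> real (l + 1) ^ 3" using self_le_power[of "real (l + 1)" 3] by simp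
      moreover have "C' * real (l + 1) ^ 3 \<le> \<bar>C'\<bar> * real (l + 1) ^ 3" by (intro mult_right_mono) auto
      ultimately show ?thesis by linarith
    qed
    finally show "\<bar>\<Sum>i<l. \<alpha> (p i) (p (Suc i))\<bar> \<le> (\<bar>C'\<bar> + 2) * real (l + 1) ^ 3" by (simp add: algebra_simps)
  qed
qed

section \<open>Areas of words and sums along words\<close>

inductive area :: "('g word \<times> 'g word) set \<Rightarrow> nat \<Rightarrow> 'g word \<Rightarrow> 'g word \<Rightarrow> bool"
  for R :: "('g word \<times> 'g word) set" where
  area_rel: "(u, v) \<in> R \<Longrightarrow> area R 1 u v"
| area_cancel: "area R 0 [(x, e), (x, \<not> e)] []"
| area_refl: "area R 0 u u"
| area_sym: "area R n u v \<Longrightarrow> area R n v u"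
| area_trans: "area R n u v \<Longrightarrow> area R n' v w \<Longrightarrow> area R (n + n') u w"
| area_cong: "area R n u u' \<Longrightarrow> area R n' v v' \<Longrightarrow> area R (n + n') (u @ v) (u' @ v')"

lemma area_pres_eq: "area R n u v \<Longrightarrow> pres_eq R u v"
  by (induction rule: area.induct) (auto intro: pres_eq.intros)

lemma ex_area: "pres_eq R u v \<Longrightarrow> \<exists>n. area R n u v"
  by (induction rule: pres_eq.induct) (blast intro: area.intros)+

abbreviation "edge R \<alpha> u l \<equiv> \<alpha> (cls R u) (cls R (u @ [l]))"

fun wsum :: "('g word \<times> 'g word) set \<Rightarrow> ('g word set \<Rightarrow> 'g word set \<Rightarrow> real) \<Rightarrow> 'g word \<Rightarrow> 'g word \<Rightarrow> real" where
  "wsum R \<alpha> u [] = 0"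
| "wsum R \<alpha> u (l # w) = edge R \<alpha> u l + wsum R \<alpha> (u @ [l]) w"

lemma wsum_append: "wsum R \<alpha> u (v @ w) = wsum R \<alpha> u v + wsum R \<alpha> (u @ v) w"
  by (induction v arbitrary: u) auto

lemma pres_class_cong: "cls R u = cls R u' \<Longrightarrow> cls R (u @ v) = cls R (u' @ v)"
  by (simp add: pres_class_append)

lemma wsum_cong: "cls R u = cls R u' \<Longrightarrow> wsum R \<alpha> u w = wsum R \<alpha> u' w"
proof (induction w arbitrary: u u')
  case (Cons l w)
  note e = pres_class_cong[OF Cons.prems, of "[l]"]
  show ?case unfolding wsum.simps Cons.prems e Cons.IH[OF e] by (rule HOL.refl)
qed simp

text \<open>Discrete Stokes: each application of a relator changes the sum by at most
  \<open>M\<close>, and a free cancellation does not change it because of antisymmetry.\<close>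

lemma wsum_area:
  assumes anti: "\<And>u v. \<alpha> (cls R u) (cls R v) = - \<alpha> (cls R v) (cls R u)"
    and rel: "\<And>u v x. (u, v) \<in> R \<Longrightarrow> \<bar>wsum R \<alpha> x u - wsum R \<alpha> x v\<bar> \<le> M"
  shows "area R n u v \<Longrightarrow> \<bar>wsum R \<alpha> x u - wsum R \<alpha> x v\<bar> \<le> M * real n"
proof (induction arbitrary: x rule: area.induct)
  case (area_rel u v)
  then show ?case using rel by simp
next
  case (area_cancel y e)
  have "pres_eq R ((x @ [(y, e)]) @ [(y, \<not> e)]) x"
    using pres_eq.cong[OF pres_eq.refl[of R x] pres_eq.cancel[of R y e]] by simp
  then have "cls R ((x @ [(y, e)]) @ [(y, \<not> e)]) = cls R x" by (simp only: pres_class_eq_iff)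
  then show ?case using anti[of x "x @ [(y, e)]"] by simp
next
  case (area_refl u)
  then show ?case by simp
next
  case (area_sym n u v)
  show ?case using area_sym.IH[of x] by simp
next
  case (area_trans n u v n' w)
  show ?case using area_trans.IH(1)[of x] area_trans.IH(2)[of x] unfolding of_nat_add distrib_left by linarith
next
  case (area_cong n u u' n' v v')
  have "cls R (x @ u) = cls R (x @ u')"
    using area_pres_eq[OF area_cong.hyps(1)] by (simp add: pres_class_append pres_class_eq_iff[symmetric])
  then have "wsum R \<alpha> (x @ u) v = wsum R \<alpha> (x @ u') v" by (rule wsum_cong)
  then show ?case using area_cong.IH(1)[of x] area_cong.IH(2)[of "x @ u'"]
    unfolding wsum_append of_nat_add distrib_left by linarith
qed

text \<open>The path is triangulated from its starting point, and each further letter costs one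
  triangle.\<close>

lemma wsum_chord:
  fixes R :: "('g::finite word \<times> 'g word) set"
  assumes cc: "coarse_cocycle (carrier (PG R)) (pdist R) \<rho> \<alpha>"
  shows "real (length w) \<le> \<rho> \<Longrightarrow> \<bar>wsum R \<alpha> u w - \<alpha> (cls R u) (cls R (u @ w))\<bar> \<le> real (length w)"
proof (induction w rule: rev_induct)
  case Nil
  have "\<alpha> (cls R u) (cls R u) = - \<alpha> (cls R u) (cls R u)"
    using cc pres_class_closed unfolding coarse_cocycle_def by blast
  then show ?case by simp
next
  case (snoc l w)
  let ?x = "cls R u" and ?y = "cls R (u @ w)" and ?z = "cls R (u @ w @ [l])"
  have "pdist R ?x ?y \<le> \<rho>" using pdist_le[of R u w] snoc.prems by simp
  moreover have "pdist R ?x ?z \<le> \<rho>" using pdist_le[of R u "w @ [l]"] snoc.prems by simp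
  moreover have "pdist R ?y ?z \<le> \<rho>" using pdist_le[of R "u @ w" "[l]"] snoc.prems by simp
  ultimately have "\<bar>\<alpha> ?x ?y + \<alpha> ?y ?z + \<alpha> ?z ?x\<bar> \<le> 1" using cc pres_class_closed unfolding coarse_cocycle_def by blast
  moreover have "\<alpha> ?z ?x = - \<alpha> ?x ?z" using cc pres_class_closed unfolding coarse_cocycle_def by blast
  ultimately show ?case using snoc by (simp add: wsum_append)
qed

text \<open>A closed path is refined by geodesics to a closed word of proportional length; the word
  is filled by relators, and each relator is itself triangulated.\<close>

lemma cubic_area_filling:
  fixes R :: "('g::finite word \<times> 'g word) set" and C :: real
  assumes fin: "finite R" and ar: "\<And>w. pres_eq R w [] \<Longrightarrow> \<exists>n. area R n w [] \<and> real n \<le> C * real (length w + 1) ^ 3"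
  shows "cubic_filling (carrier (PG R)) (pdist R)"
  unfolding cubic_filling_def
proof (rule allI)
  fix r :: real
  let ?X = "carrier (PG R)"
  define N where "N = nat \<lceil>r\<rceil>"
  define L where "L = (\<Sum>(u, v)\<in>R. length u + length v)"
  have L: "length u + length v \<le> L" if "(u, v) \<in> R" for u v
    unfolding L_def using member_le_sum[OF that, of "\<lambda>(u, v). length u + length v"] fin by simp
  have C0: "C \<ge> 0" using ar[OF pres_eq.refl] by (auto intro: order_trans[OF of_nat_0_le_iff])
  define K where "K = real N + real L * (C * real (N + 1) ^ 3)"
  show "\<exists>\<rho> C. \<forall>\<alpha> l p. coarse_cocycle ?X (pdist R) \<rho> \<alpha> \<longrightarrow> closed_path ?X (pdist R) r l p \<longrightarrow>
     \<bar>\<Sum>i<l. \<alpha> (p i) (p (Suc i))\<bar> \<le> C * real (l + 1) ^ 3"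
  \<comment> \<open>The scale on which triangles must be controlled: geodesics between consecutive
    points of the path have length at most \<open>N\<close>, the sides of relators at most
    \<open>L\<close>.\<close>
  proof (rule exI[of _ "real (N + L)"], rule exI[of _ K], intro allI impI)
    fix \<alpha> l p
    assume cc: "coarse_cocycle ?X (pdist R) (real (N + L)) \<alpha>" and cp: "closed_path ?X (pdist R) r l p"
    have anti: "\<alpha> (cls R u) (cls R v) = - \<alpha> (cls R v) (cls R u)" for u v
      using cc pres_class_closed unfolding coarse_cocycle_def by blast
    have rel: "\<bar>wsum R \<alpha> x u - wsum R \<alpha> x v\<bar> \<le> real L" if uv: "(u, v) \<in> R" for u v x
    proof -
      have "cls R (x @ u) = cls R (x @ v)"
        using pres_eq.rel[OF uv] by (simp add: pres_class_append pres_class_eq_iff[symmetric])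
      then show ?thesis using wsum_chord[OF cc, of u x] wsum_chord[OF cc, of v x] L[OF uv] by simp
    qed
    have pX: "p i \<in> ?X" if "i \<le> l" for i using cp that by (simp add: closed_path_def)
    obtain y where y: "p 0 = cls R y" using pX[of 0] by (auto elim: pres_class_cases)
    have "\<exists>w. p j = cls R (y @ w) \<and> length w \<le> N * j \<and> \<bar>(\<Sum>i<j. \<alpha> (p i) (p (Suc i))) - wsum R \<alpha> y w\<bar> \<le> real (N * j)"
      if "j \<le> l" for j using that
    proof (induction j)
      case 0
      then show ?case using y by (intro exI[of _ "[]"]) simp
    next
      case (Suc j)
      then obtain w where w: "p j = cls R (y @ w)" "length w \<le> N * j"
        "\<bar>(\<Sum>i<j. \<alpha> (p i) (p (Suc i))) - wsum R \<alpha> y w\<bar> \<le> real (N * j)" by auto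
      obtain z where z: "p (Suc j) = cls R z" using pX[OF Suc.prems] by (auto elim: pres_class_cases)
      obtain v where v: "pres_eq R ((y @ w) @ v) z" "length v = pdist R (cls R (y @ w)) (cls R z)"
        by (rule pdist_attained)
      have "pdist R (p j) (p (Suc j)) \<le> r" using cp Suc.prems by (simp add: closed_path_def)
      then have "real (length v) \<le> r" unfolding w(1) z v(2) .
      then have lv: "length v \<le> N" unfolding N_def by linarith
      have pz: "p (Suc j) = cls R (y @ w @ v)" using v(1) z by (simp add: pres_class_eq_iff pres_eq.sym)
      have "\<bar>wsum R \<alpha> (y @ w) v - \<alpha> (p j) (p (Suc j))\<bar> \<le> real (length v)"
        using wsum_chord[OF cc, of v "y @ w"] lv unfolding pz w(1) by simp
      then show ?case using w(2,3) lv pz by (intro exI[of _ "w @ v"]) (simp add: wsum_append)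
    qed
    from this[of l] obtain w where w: "p l = cls R (y @ w)" "length w \<le> N * l"
        "\<bar>(\<Sum>i<l. \<alpha> (p i) (p (Suc i))) - wsum R \<alpha> y w\<bar> \<le> real (N * l)" by auto
    have "cls R (y @ w) = cls R y" using w(1) y cp by (simp add: closed_path_def)
    then have "pres_eq R ((inv_word y @ y) @ w) (inv_word y @ y)"
      by (metis append_assoc pres_class_eq_iff pres_eq.cong pres_eq.refl)
    then have "pres_eq R w []"
      by (metis (no_types, lifting) append_Nil inv_word_left pres_eq.cong pres_eq.refl pres_eq.sym pres_eq.trans)
    then obtain n where n: "area R n w []" "real n \<le> C * real (length w + 1) ^ 3" using ar by blast
    have "\<bar>wsum R \<alpha> y w\<bar> \<le> real L * real n" using wsum_area[OF anti rel n(1), of y] by simp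
    also have "\<dots> \<le> real L * (C * real (length w + 1) ^ 3)" using n(2) by (intro mult_left_mono) auto
    also have "\<dots> \<le> real L * (C * (real (N + 1) * real (l + 1)) ^ 3)"
    proof -
      have "real (length w + 1) \<le> real ((N + 1) * (l + 1))" using w(2) by (simp only: of_nat_le_iff) (simp add: algebra_simps)
      then have "real (length w + 1) ^ 3 \<le> (real (N + 1) * real (l + 1)) ^ 3"
        by (intro power_mono) (simp_all only: of_nat_mult of_nat_0_le_iff)
      then show ?thesis using C0 by (intro mult_left_mono) auto
    qed
    finally have "\<bar>wsum R \<alpha> y w\<bar> \<le> real L * (C * real (N + 1) ^ 3) * real (l + 1) ^ 3" by (simp add: power_mult_distrib mult.assoc)
    moreover have "real (N * l) \<le> real N * real (l + 1) ^ 3"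
    proof -
      have "real l \<le> real (l + 1) ^ 3" using self_le_power[of "real (l + 1)" 3] by simp
      then show ?thesis by (simp add: mult_left_mono)
    qed
    ultimately show "\<bar>\<Sum>i<l. \<alpha> (p i) (p (Suc i))\<bar> \<le> K * real (l + 1) ^ 3"
      using w(3) by (simp only: K_def distrib_right)
  qed
qed

lemma finite_words: "finite {w :: ('g::finite) word. length w \<le> n}"
proof -
  have "finite {w :: 'g word. set w \<subseteq> UNIV \<and> length w \<le> n}" by (rule finite_lists_length_le) simp
  then show ?thesis by simp
qed

lemma area_bound:
  fixes R :: "('g::finite word \<times> 'g word) set"
  shows "\<exists>M. \<forall>w. length w \<le> n \<and> pres_eq R w [] \<longrightarrow> (\<exists>m\<le>M. area R m w [])"
proof -
  let ?W = "{w :: 'g word. length w \<le> n \<and> pres_eq R w []}"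
  have fin: "finite ?W" by (rule finite_subset[OF _ finite_words[of n]]) auto
  have "\<forall>w\<in>?W. \<exists>m. area R m w []" using ex_area by blast
  then obtain m where m: "\<And>w. w \<in> ?W \<Longrightarrow> area R (m w) w []" by metis
  have "m w \<le> sum m ?W" if "w \<in> ?W" for w using member_le_sum[OF that, of m] fin by simp
  then show ?thesis using m by blast
qed

text \<open>\<open>\<beta>\<close> is controlled along edges only, but a coarse cocycle is required
  at an arbitrary scale. It is integrated along chosen geodesics, made antisymmetric and divided by
  a bound for small loops, which loses a constant factor.\<close>

lemma not_cubic_fillingI:
  fixes R :: "('g::finite word \<times> 'g word) set"
  assumes anti: "\<And>u v. \<beta> (cls R u) (cls R v) = - \<beta> (cls R v) (cls R u)"
    and rel: "\<And>u v x. (u, v) \<in> R \<Longrightarrow> \<bar>wsum R \<beta> x u - wsum R \<beta> x v\<bar> \<le> 1"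
    and loops: "\<And>C. \<exists>w. pres_eq R w [] \<and> C * real (length w + 1) ^ 3 < \<bar>wsum R \<beta> [] w\<bar>"
  shows "\<not> cubic_filling (carrier (PG R)) (pdist R)"
proof
  let ?X = "carrier (PG R)"
  interpret gen_group "PG R" "std_gens R" by (rule gen_group_presented)
  assume "cubic_filling ?X (pdist R)"
  then have "\<exists>\<rho> C. \<forall>\<alpha> l p. coarse_cocycle ?X (pdist R) \<rho> \<alpha> \<longrightarrow> closed_path ?X (pdist R) 1 l p \<longrightarrow>
     \<bar>\<Sum>i<l. \<alpha> (p i) (p (Suc i))\<bar> \<le> C * real (l + 1) ^ 3" unfolding cubic_filling_def by (rule spec)
  then obtain \<rho> C where "\<forall>\<alpha> l p. coarse_cocycle ?X (pdist R) \<rho> \<alpha> \<longrightarrow> closed_path ?X (pdist R) 1 l p \<longrightarrow>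
     \<bar>\<Sum>i<l. \<alpha> (p i) (p (Suc i))\<bar> \<le> C * real (l + 1) ^ 3" by (elim exE)
  note fill = this[rule_format]
  define N where "N = nat \<lceil>\<rho>\<rceil>"
  \<comment> \<open>The loops to be bounded are triangles of geodesics of length at most
    \<open>N\<close> and bigons made of one edge and a geodesic of length at most 1.\<close>
  obtain M where M: "\<And>w. length w \<le> 3 * N + 2 \<Longrightarrow> pres_eq R w [] \<Longrightarrow> \<exists>m\<le>M. area R m w []"
    using area_bound[of "3 * N + 2" R] by blast
  have loop: "\<bar>wsum R \<beta> x w\<bar> \<le> real (M + 1)" if w: "length w \<le> 3 * N + 2" "pres_eq R w []" for x w
  proof -
    obtain m where "m \<le> M" "area R m w []" using M[OF w] by blast
    then show ?thesis using wsum_area[OF anti rel, of m w "[]" x] by simp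
  qed
  define \<nu> where "\<nu> = (\<lambda>X. SOME w. X = cls R w)"
  have nu: "cls R (\<nu> X) = X" if "X \<in> ?X" for X
  proof -
    have "\<exists>w. X = cls R w" using that by (auto elim: pres_class_cases)
    from someI_ex[OF this] show ?thesis unfolding \<nu>_def ..
  qed
  define v where "v = (\<lambda>X Y. SOME w. cls R (\<nu> X @ w) = Y \<and> length w = pdist R X Y)"
  have v: "cls R (\<nu> X @ v X Y) = Y" "length (v X Y) = pdist R X Y" if XY: "X \<in> ?X" "Y \<in> ?X" for X Y
  proof -
    obtain w where "pres_eq R (\<nu> X @ w) (\<nu> Y)" "length w = pdist R (cls R (\<nu> X)) (cls R (\<nu> Y))"
      by (rule pdist_attained)
    then have "\<exists>w. cls R (\<nu> X @ w) = Y \<and> length w = pdist R X Y"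
      using nu XY by (metis pres_class_eq_iff)
    from someI_ex[OF this] show "cls R (\<nu> X @ v X Y) = Y" "length (v X Y) = pdist R X Y" unfolding v_def by blast+
  qed
  define s where "s = (\<lambda>X Y. wsum R \<beta> (\<nu> X) (v X Y))"
  define \<alpha> where "\<alpha> = (\<lambda>X Y. (s X Y - s Y X) / (2 * real (M + 1)))"
  have tri: "\<bar>s X Y + s Y Z + s Z X\<bar> \<le> real (M + 1)"
    if XYZ: "X \<in> ?X" "Y \<in> ?X" "Z \<in> ?X" "pdist R X Y \<le> \<rho>" "pdist R Y Z \<le> \<rho>" "pdist R Z X \<le> \<rho>" for X Y Z
  proof -
    let ?w = "v X Y @ v Y Z @ v Z X"
    have c1: "cls R (\<nu> X @ v X Y) = cls R (\<nu> Y)" using v XYZ nu by simp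
    then have c2: "cls R (\<nu> X @ v X Y @ v Y Z) = cls R (\<nu> Z)"
      using pres_class_cong[OF c1, of "v Y Z"] v XYZ nu by simp
    then have c3: "cls R (\<nu> X @ ?w) = cls R (\<nu> X)"
      using pres_class_cong[OF c2, of "v Z X"] v XYZ nu by simp
    then have "cls R ?w = cls R []"
      by (simp add: pres_class_append one_presented[symmetric])
    then have "pres_eq R ?w []" by (simp only: pres_class_eq_iff)
    moreover have "length ?w \<le> 3 * N + 2"
    proof -
      have "length (v X Y) \<le> N" "length (v Y Z) \<le> N" "length (v Z X) \<le> N"
        using v(2)[of X Y] v(2)[of Y Z] v(2)[of Z X] XYZ unfolding N_def by linarith+
      then show ?thesis by simp
    qed
    ultimately have "\<bar>wsum R \<beta> (\<nu> X) ?w\<bar> \<le> real (M + 1)" by (rule loop[rotated])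
    moreover have "wsum R \<beta> (\<nu> X) ?w = s X Y + s Y Z + s Z X"
      using wsum_cong[OF c1, of \<beta> "v Y Z"] wsum_cong[OF c2, of \<beta> "v Z X"] by (simp add: wsum_append s_def)
    ultimately show ?thesis by simp
  qed
  have diff_le: "\<bar>a - b\<bar> \<le> 2 * K" if "\<bar>a\<bar> \<le> K" "\<bar>b\<bar> \<le> K" for a b K :: real using that by linarith
  have diff_le2: "\<bar>a - b - 2 * e\<bar> \<le> 2 * K" if "\<bar>a - e\<bar> \<le> K" "\<bar>b + e\<bar> \<le> K" for a b e K :: real using that by linarith
  have scale: "\<bar>x / (2 * K) - e / K\<bar> \<le> 1" if "0 < K" "\<bar>x - 2 * e\<bar> \<le> 2 * K" for x e K :: real
  proof -
    have "x / (2 * K) - e / K = (x - 2 * e) / (2 * K)" using that(1) by (simp add: field_simps)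
    then show ?thesis using that by (simp add: abs_divide)
  qed
  have cc: "coarse_cocycle ?X (pdist R) \<rho> \<alpha>"
    unfolding coarse_cocycle_def
  proof (intro conjI ballI impI; (elim conjE)?)
    show "\<alpha> X Y = - \<alpha> Y X" for X Y by (simp add: \<alpha>_def minus_divide_left)
    fix X Y Z assume XYZ: "X \<in> ?X" "Y \<in> ?X" "Z \<in> ?X" and d: "pdist R X Y \<le> \<rho>" "pdist R Y Z \<le> \<rho>" "pdist R X Z \<le> \<rho>"
    have d': "pdist R Y X \<le> \<rho>" "pdist R Z Y \<le> \<rho>" "pdist R Z X \<le> \<rho>" using d wd_sym XYZ by simp_all
    have "\<bar>(s X Y + s Y Z + s Z X) - (s X Z + s Z Y + s Y X)\<bar> \<le> 2 * real (M + 1)"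
      by (rule diff_le[OF tri[OF XYZ d(1,2) d'(3)] tri[OF XYZ(1,3,2) d(3) d'(2,1)]])
    moreover have "\<alpha> X Y + \<alpha> Y Z + \<alpha> Z X = ((s X Y + s Y Z + s Z X) - (s X Z + s Z Y + s Y X)) / (2 * real (M + 1))"
      by (simp add: \<alpha>_def add_divide_distrib diff_divide_distrib)
    ultimately show "\<bar>\<alpha> X Y + \<alpha> Y Z + \<alpha> Z X\<bar> \<le> 1" by (simp add: abs_divide)
  qed
  \<comment> \<open>The factor \<open>M + 1\<close> undoes the normalisation of
    \<open>\<alpha>\<close>, and the 1 added to the absolute value of \<open>C\<close> absorbs its
    error of 1 per edge.\<close>
  obtain w where w: "pres_eq R w []" "(real (M + 1) * (\<bar>C\<bar> + 1)) * real (length w + 1) ^ 3 < \<bar>wsum R \<beta> [] w\<bar>"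
    using loops by blast
  define p where "p = (\<lambda>i. cls R (take i w))"
  have "closed_path ?X (pdist R) 1 (length w) p"
    unfolding closed_path_def
  proof (intro conjI allI impI)
    show "p 0 = p (length w)" using w(1) by (simp add: p_def pres_class_eq_iff pres_eq.sym)
    show "p i \<in> ?X" for i by (simp add: p_def)
    show "pdist R (p i) (p (Suc i)) \<le> 1" if "i < length w" for i
      using pdist_le[of R "take i w" "[w ! i]"] that by (simp add: p_def take_Suc_conv_app_nth)
  qed
  from fill[OF cc this] have le: "\<bar>\<Sum>i<length w. \<alpha> (p i) (p (Suc i))\<bar> \<le> C * real (length w + 1) ^ 3" .
  have step: "\<bar>s (cls R u) (cls R (u @ [l])) - edge R \<beta> u l\<bar> \<le> real (M + 1)"
    "\<bar>s (cls R (u @ [l])) (cls R u) + edge R \<beta> u l\<bar> \<le> real (M + 1)" for u l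
  proof -
    let ?X = "cls R u" and ?Y = "cls R (u @ [l])"
    have n: "cls R (\<nu> ?X) = ?X" "cls R (\<nu> ?Y) = ?Y" using nu by simp_all
    have d: "pdist R ?X ?Y \<le> 1" using pdist_le[of R u "[l]"] by simp
    have d': "pdist R ?Y ?X \<le> 1" using d wd_sym[of ?X ?Y] by simp
    have n': "cls R (\<nu> ?X @ [l]) = ?Y" using pres_class_cong[OF n(1), of "[l]"] .
    let ?w = "v ?X ?Y @ inv_word [l]" and ?w' = "l # v ?Y ?X"
    have e0: "pres_eq R (\<nu> ?X @ ?w') (\<nu> ?X)"
      using pres_class_cong[OF n', of "v ?Y ?X"] pres_class_cong[OF n(2), of "v ?Y ?X"] v(1)[of ?Y ?X] n
      unfolding pres_class_eq_iff[symmetric] by simp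
    have "pres_eq R ?w' []" using e0 unfolding pres_class_eq_iff[symmetric]
      by (simp add: pres_class_append one_presented[symmetric] del: append_Cons)
    moreover have "length ?w' \<le> 3 * N + 2" using v(2)[of ?Y ?X] d' by simp
    ultimately have "\<bar>wsum R \<beta> (\<nu> ?X) ?w'\<bar> \<le> real (M + 1)" by (rule loop[rotated])
    moreover have "wsum R \<beta> (\<nu> ?X) ?w' = edge R \<beta> u l + s ?Y ?X"
      using wsum_cong[of R "\<nu> ?X @ [l]" "\<nu> ?Y" \<beta> "v ?Y ?X"] n n' by (simp add: s_def)
    ultimately show "\<bar>s ?Y ?X + edge R \<beta> u l\<bar> \<le> real (M + 1)" by linarith
    have c: "cls R (\<nu> ?X @ v ?X ?Y) = cls R (\<nu> ?X @ [l])" using v(1)[of ?X ?Y] n' by simp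
    have e1: "cls R ((\<nu> ?X @ [l]) @ inv_word [l]) = ?X"
      using inv_word_right[of R "[l]"] n(1) pres_eq.cong[OF pres_eq.refl[of R "\<nu> ?X"]]
      by (metis append_assoc append_Nil2 pres_class_eq_iff)
    have "cls R (\<nu> ?X @ ?w) = cls R (\<nu> ?X)" using pres_class_cong[OF c, of "inv_word [l]"] e1 n(1) by simp
    then have "cls R ?w = cls R []"
      by (simp add: pres_class_append one_presented[symmetric])
    then have "pres_eq R ?w []" by (simp only: pres_class_eq_iff)
    moreover have "length ?w \<le> 3 * N + 2" using v(2)[of ?X ?Y] d by simp
    ultimately have "\<bar>wsum R \<beta> (\<nu> ?X) ?w\<bar> \<le> real (M + 1)" by (rule loop[rotated])
    moreover have "wsum R \<beta> (\<nu> ?X @ v ?X ?Y) (inv_word [l]) = - edge R \<beta> u l"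
    proof -
      obtain x e where l: "l = (x, e)" by (cases l)
      show ?thesis unfolding wsum_cong[OF c] using e1 n' anti[of u "u @ [l]"] by (simp add: l inv_word_def)
    qed
    ultimately show "\<bar>s ?X ?Y - edge R \<beta> u l\<bar> \<le> real (M + 1)" by (simp add: wsum_append s_def)
  qed
  have "\<bar>(\<Sum>i<j. \<alpha> (p i) (p (Suc i))) - wsum R \<beta> [] (take j w) / real (M + 1)\<bar> \<le> real j" if "j \<le> length w" for j
    using that
  proof (induction j)
    case (Suc j)
    let ?u = "take j w" and ?l = "w ! j"
    have p: "p j = cls R ?u" "p (Suc j) = cls R (?u @ [?l])"
      using Suc.prems by (simp_all add: p_def take_Suc_conv_app_nth)
    have "\<bar>(s (p j) (p (Suc j)) - s (p (Suc j)) (p j)) - 2 * edge R \<beta> ?u ?l\<bar> \<le> 2 * real (M + 1)"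
      unfolding p by (rule diff_le2[OF step])
    then have "\<bar>\<alpha> (p j) (p (Suc j)) - edge R \<beta> ?u ?l / real (M + 1)\<bar> \<le> 1"
      unfolding \<alpha>_def by (intro scale) simp_all
    moreover have "wsum R \<beta> [] (take (Suc j) w) = wsum R \<beta> [] ?u + edge R \<beta> ?u ?l"
      using Suc.prems by (simp add: take_Suc_conv_app_nth wsum_append)
    ultimately show ?case using Suc.IH Suc.prems by (simp add: add_divide_distrib)
  qed simp
  from this[of "length w"] have "\<bar>wsum R \<beta> [] w / real (M + 1)\<bar> \<le> C * real (length w + 1) ^ 3 + real (length w)"
    using le by simp
  also have "\<dots> \<le> \<bar>C\<bar> * real (length w + 1) ^ 3 + real (length w + 1) ^ 3"
  proof -
    have "real (length w) \<le> real (length w + 1) ^ 3" using self_le_power[of "real (length w + 1)" 3] by simp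
    moreover have "C * real (length w + 1) ^ 3 \<le> \<bar>C\<bar> * real (length w + 1) ^ 3" by (intro mult_right_mono) auto
    ultimately show ?thesis by linarith
  qed
  finally have "\<bar>wsum R \<beta> [] w\<bar> / real (M + 1) \<le> (\<bar>C\<bar> + 1) * real (length w + 1) ^ 3" by (simp add: algebra_simps abs_divide)
  then have "\<bar>wsum R \<beta> [] w\<bar> \<le> (\<bar>C\<bar> + 1) * real (length w + 1) ^ 3 * real (M + 1)" by (simp only: pos_divide_le_eq of_nat_0_less_iff zero_less_Suc Suc_eq_plus1[symmetric])
  then show False using w(2) by (simp only: mult.commute mult.left_commute)
qed

definition esum :: "('g \<Rightarrow> int) \<Rightarrow> 'g word \<Rightarrow> int" where
  "esum f w = (\<Sum>(x, e)\<leftarrow>w. if e then f x else - f x)"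

lemma esum_simps [simp]: "esum f [] = 0" "esum f ((x, e) # w) = (if e then f x else - f x) + esum f w"
  "esum f (u @ v) = esum f u + esum f v"
  by (simp_all add: esum_def)

lemma esum_replicate: "esum f (replicate n (x, e)) = (if e then int n * f x else - (int n * f x))"
  by (induction n) (auto simp: algebra_simps)

lemma esum_gen_pow [simp]: "esum f (gen_pow x z) = z * f x"
  by (simp add: gen_pow_def esum_replicate)

lemma esum_pres_eq:
  assumes "pres_eq R u v" "\<And>u v. (u, v) \<in> R \<Longrightarrow> esum f u = esum f v" shows "esum f u = esum f v"
  using assms by (induction rule: pres_eq.induct) auto

section \<open>Exponential area in the group with \<open>T A^2 T^-1 = A\<close>\<close>

abbreviation "BS12 \<equiv> hnn_rel 1 0 2 0"
abbreviation "P12 \<equiv> hP 1 0 2 0"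
abbreviation "bexp \<equiv> esum (\<lambda>x. if x = gB then 1 else 0)"

lemma bexp_pres_eq: "pres_eq BS12 u v \<Longrightarrow> bexp u = bexp v"
  by (erule esum_pres_eq) (auto simp: hnn_rel_def)

lemma pres_class_letter_A: "cls BS12 [(gA, e)] = P12 (if e then 1 else -1) 0"
  and pres_class_letter_B: "cls BS12 [(gB, e)] = P12 0 (if e then 1 else -1)"
  by (simp_all add: hP_def gen_pow_def)

text \<open>The \<open>B\<close>-exponent is a homomorphism, and powers of \<open>A\<close> are told
  apart by normal forms.\<close>

lemma P12_inj: assumes "P12 x y = P12 x' y'" shows "x = x' \<and> y = y'"
proof -
  interpret rose gA "hp 2" "hp 1" BS12 by (rule hnn_rose) simp_all
  have "bexp (w2 x y) = bexp (w2 x' y')" using assms by (intro bexp_pres_eq) (simp add: hP_def pres_class_eq_iff)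
  then have y: "y = y'" by simp
  have "P12 x y \<otimes>\<^bsub>PG BS12\<^esub> P12 0 (- y) = P12 x' y \<otimes>\<^bsub>PG BS12\<^esub> P12 0 (- y)" using assms y by simp
  then have "P12 x 0 = P12 x' 0" by (simp add: hP_mult)
  then have "cls BS12 (gen_pow gA x) = cls BS12 (gen_pow gA x')" by (simp add: hP_def gen_pow_def[of gB])
  then show ?thesis using ga_pow_inj y by simp
qed

definition plane12 :: "hnn_gen word set set" where
  "plane12 = {P12 x y | x y. True}"

lemma P12_plane12 [simp]: "P12 x y \<in> plane12"
  by (auto simp: plane12_def)

definition cA :: "hnn_gen word set \<Rightarrow> int" where
  "cA X = (THE x. \<exists>y. X = P12 x y)"

definition cB :: "hnn_gen word set \<Rightarrow> int" where
  "cB X = (THE y. \<exists>x. X = P12 x y)"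

lemma cA_P12 [simp]: "cA (P12 x y) = x" and cB_P12 [simp]: "cB (P12 x y) = y"
  unfolding cA_def cB_def using P12_inj by blast+

lemma plane12_iff: "X \<in> carrier (PG BS12) \<Longrightarrow> X \<otimes>\<^bsub>PG BS12\<^esub> P12 x y \<in> plane12 \<longleftrightarrow> X \<in> plane12"
proof
  interpret group "PG BS12" by (rule group_presented_group)
  assume X: "X \<in> carrier (PG BS12)"
  show "X \<otimes>\<^bsub>PG BS12\<^esub> P12 x y \<in> plane12" if "X \<in> plane12" using that by (auto simp: plane12_def hP_mult) blast
  assume "X \<otimes>\<^bsub>PG BS12\<^esub> P12 x y \<in> plane12"
  then obtain x' y' where "X \<otimes>\<^bsub>PG BS12\<^esub> P12 x y = P12 x' y'" by (auto simp: plane12_def)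
  then have "X = P12 x' y' \<otimes>\<^bsub>PG BS12\<^esub> P12 (- x) (- y)" using X by (simp add: inv_solve_right hP_inv[symmetric])
  then show "X \<in> plane12" unfolding hP_mult plane12_def by blast
qed

text \<open>The form \<open>x dy\<close> on the flat \<open>{A\<^sup>x B\<^sup>y}\<close>, extended by 0.\<close>

definition area_form :: "hnn_gen word set \<Rightarrow> hnn_gen word set \<Rightarrow> real" where
  "area_form X Y = (if X \<in> plane12 \<and> Y \<in> plane12 then (real_of_int (cA X) + real_of_int (cA Y)) / 2 * (real_of_int (cB Y) - real_of_int (cB X)) else 0)"

text \<open>An edge with another label keeps the \<open>B\<close>-exponent, so the form vanishes on
  it; an edge labelled \<open>B\<close> that starts in the flat stays in it.\<close>

lemma area_form_edge:
  "x \<noteq> gB \<Longrightarrow> edge BS12 area_form u (x, e) = 0"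
  "edge BS12 area_form u (gB, e) =
     (if cls BS12 u \<in> plane12 then (if e then 1 else -1) * real_of_int (cA (cls BS12 u)) else 0)"
proof -
  show "edge BS12 area_form u (x, e) = 0" if x: "x \<noteq> gB"
  proof (cases "cls BS12 u \<in> plane12 \<and> cls BS12 (u @ [(x, e)]) \<in> plane12")
    case True
    then obtain i j i' j' where ij: "cls BS12 u = P12 i j" "cls BS12 (u @ [(x, e)]) = P12 i' j'"
      by (auto simp: plane12_def)
    have "pres_eq BS12 u (w2 i j)" "pres_eq BS12 (u @ [(x, e)]) (w2 i' j')"
      using ij unfolding hP_def pres_class_eq_iff by blast+
    from this[THEN bexp_pres_eq] have "j = j'" using x by (cases e) auto
    then show ?thesis unfolding area_form_def ij by simp
  qed (auto simp: area_form_def)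
  show "edge BS12 area_form u (gB, e) =
     (if cls BS12 u \<in> plane12 then (if e then 1 else -1) * real_of_int (cA (cls BS12 u)) else 0)"
  proof (cases "cls BS12 u \<in> plane12")
    case False
    then show ?thesis by (simp add: area_form_def)
  next
    case True
    then obtain i j where ij: "cls BS12 u = P12 i j" by (auto simp: plane12_def)
    have "cls BS12 (u @ [(gB, e)]) = P12 i (j + (if e then 1 else -1))"
      by (simp add: pres_class_append pres_class_letter_B ij hP_mult)
    moreover from this have "cls BS12 (u @ [(gB, e)]) \<in> plane12" by (auto simp: plane12_def)
    ultimately show ?thesis using True ij by (simp add: area_form_def)
  qed
qed

lemma wsum_no_B: "\<forall>l\<in>set w. fst l \<noteq> gB \<Longrightarrow> wsum BS12 area_form u w = 0"
  by (induction w arbitrary: u) (auto simp: area_form_edge)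

text \<open>\<open>T^-n A T^n\<close>, a word of length \<open>2 * n + 1\<close> for
  \<open>A^(2^n)\<close>.\<close>

fun loop12 :: "nat \<Rightarrow> hnn_gen word" where
  "loop12 0 = [(gA, True)]"
| "loop12 (Suc n) = (gT, False) # loop12 n @ [(gT, True)]"

lemma length_loop12 [simp]: "length (loop12 n) = 2 * n + 1"
  by (induction n) auto

lemma loop12_no_B: "l \<in> set (loop12 n) \<Longrightarrow> fst l \<noteq> gB" "l \<in> set (inv_word (loop12 n)) \<Longrightarrow> fst l \<noteq> gB"
proof -
  show *: "l \<in> set (loop12 n) \<Longrightarrow> fst l \<noteq> gB" for l by (induction n) auto
  show "l \<in> set (inv_word (loop12 n)) \<Longrightarrow> fst l \<noteq> gB" using * by (force simp: inv_word_def)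
qed

lemma loop12: "cls BS12 (loop12 n) = P12 (2 ^ n) 0"
proof (induction n)
  case 0
  then show ?case using pres_class_letter_A[of True] by simp
next
  case (Suc n)
  interpret group "PG BS12" by (rule group_presented_group)
  let ?G = "PG BS12"
  have "cls BS12 (loop12 (Suc n)) = inv\<^bsub>?G\<^esub> hT 1 0 2 0 \<otimes>\<^bsub>?G\<^esub> (P12 (2 ^ n) 0 \<otimes>\<^bsub>?G\<^esub> hT 1 0 2 0)"
    unfolding Suc.IH[symmetric] by (simp add: hT_def pres_class_False[symmetric] mult_pres_class)
  also have "P12 (2 ^ n) 0 \<otimes>\<^bsub>?G\<^esub> hT 1 0 2 0 = hT 1 0 2 0 \<otimes>\<^bsub>?G\<^esub> P12 (2 ^ Suc n) 0"
    using hT_hP_mult[of 1 0 2 0 "2 ^ n"] by (simp add: mult.commute)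
  also have "inv\<^bsub>?G\<^esub> hT 1 0 2 0 \<otimes>\<^bsub>?G\<^esub> (hT 1 0 2 0 \<otimes>\<^bsub>?G\<^esub> P12 (2 ^ Suc n) 0) = P12 (2 ^ Suc n) 0"
    by (simp add: m_assoc[symmetric])
  finally show ?case .
qed

lemma cube_less_power2: "\<exists>n. C * real (4 * n + 5) ^ 3 < 2 ^ n"
proof -
  define D where "D = (\<bar>C\<bar> + 1) * (9 / ln 2) ^ 3"
  have D: "D > 0" by (simp add: D_def)
  have "\<forall>\<^sub>F x in at_top. (x :: real) ^ 3 / exp x < 1 / D"
    using tendsto_power_div_exp_0[of 3] D by (intro order_tendstoD) auto
  then obtain x0 where x0: "\<And>x :: real. x \<ge> x0 \<Longrightarrow> x ^ 3 / exp x < 1 / D" by (auto simp: eventually_at_top_linorder)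
  obtain n :: nat where n: "real n * ln 2 \<ge> x0" "n \<ge> 1"
  proof -
    obtain n :: nat where "real n \<ge> max 1 (x0 / ln 2)" using real_arch_simple by blast
    then show ?thesis by (intro that[of n]) (auto simp: field_simps)
  qed
  have "(real n * ln 2) ^ 3 / 2 ^ n < 1 / D"
    using x0[OF n(1)] by (simp add: exp_of_nat_mult)
  then have "D * (real n * ln 2) ^ 3 < 2 ^ n" using D by (simp add: field_simps)
  moreover have "D * (real n * ln 2) ^ 3 = (\<bar>C\<bar> + 1) * (9 * real n) ^ 3" by (simp add: D_def power_mult_distrib power_divide)
  moreover have "real (4 * n + 5) ^ 3 \<le> (9 * real n) ^ 3" using n(2) by (intro power_mono) auto
  then have "C * real (4 * n + 5) ^ 3 \<le> (\<bar>C\<bar> + 1) * (9 * real n) ^ 3" by (intro mult_mono) auto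
  ultimately show ?thesis by (intro exI[of _ n]) linarith
qed

theorem not_cubic_filling_BS12: "\<not> cubic_filling (carrier (PG BS12)) (pdist BS12)"
proof (rule not_cubic_fillingI[where \<beta> = area_form])
  let ?G = "PG BS12"
  interpret group ?G by (rule group_presented_group)
  show "area_form (cls BS12 u) (cls BS12 v) = - area_form (cls BS12 v) (cls BS12 u)" for u v
    by (simp add: area_form_def field_simps)
  show "\<bar>wsum BS12 area_form x u - wsum BS12 area_form x v\<bar> \<le> 1" if uv: "(u, v) \<in> BS12" for u v x
  proof -
    consider "u = [(gA, True), (gB, True), (gA, False), (gB, False)]" "v = []"
      | "u = [(gT, True), (gA, True), (gA, True), (gT, False)]" "v = [(gA, True)]"
      using uv by (auto simp: hnn_rel_def gen_pow_def numeral_2_eq_2)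
    then show ?thesis
    proof cases
      case 1
      let ?x1 = "x @ [(gA, True)]" and ?x3 = "((x @ [(gA, True)]) @ [(gB, True)]) @ [(gA, False)]"
      have c1: "cls BS12 ?x1 = cls BS12 x \<otimes>\<^bsub>?G\<^esub> P12 1 0"
        by (simp add: pres_class_append pres_class_letter_A)
      have c3: "cls BS12 ?x3 = cls BS12 x \<otimes>\<^bsub>?G\<^esub> P12 0 1"
        unfolding pres_class_append pres_class_letter_A pres_class_letter_B by (simp add: m_assoc hP_mult)
      have w: "wsum BS12 area_form x u = edge BS12 area_form ?x1 (gB, True) + edge BS12 area_form ?x3 (gB, False)"
        unfolding 1 wsum.simps using area_form_edge(1)[of gA x True]
          area_form_edge(1)[of gA "(x @ [(gA, True)]) @ [(gB, True)]" False] by simp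
      show ?thesis
      proof (cases "cls BS12 x \<in> plane12")
        case True
        then obtain i j where "cls BS12 x = P12 i j" by (auto simp: plane12_def)
        then have "wsum BS12 area_form x u = 1"
          unfolding w area_form_edge(2) unfolding c1 c3 by (simp add: hP_mult)
        then show ?thesis by (simp add: 1)
      next
        case False
        then show ?thesis unfolding w area_form_edge(2) unfolding c1 c3 by (simp add: plane12_iff 1)
      qed
    next
      case 2
      have "wsum BS12 area_form x u = 0" "wsum BS12 area_form x v = 0" using 2 by (intro wsum_no_B; simp)+
      then show ?thesis by simp
    qed
  qed
  show "\<exists>w. pres_eq BS12 w [] \<and> C * real (length w + 1) ^ 3 < \<bar>wsum BS12 area_form [] w\<bar>" for C
  proof -
    \<comment> \<open>The commutator of \<open>loop12 n\<close> with \<open>B\<close> has length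
      \<open>4 * n + 4\<close>. Of its edges only the first one labelled \<open>B\<close>
      contributes, at \<open>A^(2^n)\<close>; the last one lies at coordinate 0.\<close>
    obtain n where n: "C * real (4 * n + 5) ^ 3 < 2 ^ n" using cube_less_power2 by blast
    let ?w = "loop12 n" and ?b = "[(gB, True)]" and ?b' = "[(gB, False)]"
    have c: "cls BS12 (?w @ ?b @ inv_word ?w) = P12 0 1"
      by (simp only: pres_class_append inv_pres_class[symmetric] loop12 pres_class_letter_B hP_inv) (simp add: hP_mult)
    have "cls BS12 ((?w @ ?b @ inv_word ?w) @ ?b') = cls BS12 []"
      unfolding pres_class_append[of BS12 "?w @ ?b @ inv_word ?w"] c
      by (simp add: pres_class_letter_B hP_mult one_presented[symmetric] hP_0)
    then have "pres_eq BS12 ((?w @ ?b @ inv_word ?w) @ ?b') []" by (simp only: pres_class_eq_iff)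
    moreover have "wsum BS12 area_form [] ((?w @ ?b @ inv_word ?w) @ ?b') = 2 ^ n"
    proof -
      have "P12 (2 ^ n) 0 \<in> plane12" by (auto simp: plane12_def)
      then have "edge BS12 area_form ?w (gB, True) = 2 ^ n" unfolding area_form_edge(2) unfolding loop12 by simp
      moreover have "edge BS12 area_form (?w @ ?b @ inv_word ?w) (gB, False) = 0"
        unfolding area_form_edge(2) unfolding c by simp
      ultimately show ?thesis
        using wsum_no_B[of ?w "[]"] wsum_no_B[of "inv_word ?w" "?w @ ?b"] loop12_no_B by (simp add: wsum_append)
    qed
    ultimately show ?thesis using n by (intro exI[of _ "(?w @ ?b @ inv_word ?w) @ ?b'"]) (simp add: algebra_simps)
  qed
qed

section \<open>Normal forms for transverse and unimodular groups\<close>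

lemma area_context: "area R n u v \<Longrightarrow> area R n (x @ u @ y) (x @ v @ y)"
  using area_cong[OF area_refl[of R x] area_cong[OF _ area_refl[of R y]], of n u v] by simp

lemma area_zero_trans: "area R n u v \<Longrightarrow> area R 0 v w \<Longrightarrow> area R n u w"
  "area R 0 u v \<Longrightarrow> area R n v w \<Longrightarrow> area R n u w"
  using area_trans[of R n u v 0 w] area_trans[of R 0 u v n w] by simp_all

lemma area_cancel': "area R 0 (u @ [(x, e), (x, \<not> e)] @ v) (u @ v)"
  using area_context[OF area_cancel, of R u x e v] by simp

lemma area_conj_inverse:
  assumes "area R n (u @ [(x, e)]) ([(x', e)] @ u)"
  shows "area R n (u @ [(x, \<not> e)]) ([(x', \<not> e)] @ u)"
proof -
  have 1: "area R 0 (u @ [(x, \<not> e)]) ((x', \<not> e) # (x', e) # u @ [(x, \<not> e)])"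
    using area_sym[OF area_cancel'[of R "[]" x' "\<not> e" "u @ [(x, \<not> e)]"]] by simp
  have 2: "area R n ((x', \<not> e) # (x', e) # u @ [(x, \<not> e)]) ((x', \<not> e) # u @ [(x, e), (x, \<not> e)])"
    using area_context[OF area_sym[OF assms], of "[(x', \<not> e)]" "[(x, \<not> e)]"] by simp
  have 3: "area R 0 ((x', \<not> e) # u @ [(x, e), (x, \<not> e)]) ((x', \<not> e) # u)"
    using area_cancel'[of R "(x', \<not> e) # u" x e "[]"] by simp
  show ?thesis using area_zero_trans(1)[OF area_zero_trans(2)[OF 1 2] 3] by simp
qed

lemma area_conj_replicate:
  assumes "area R n (u @ [(x, e)]) ([(x', e)] @ u)"
  shows "area R (i * n) (u @ replicate i (x, e)) (replicate i (x', e) @ u)"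
proof (induction i)
  case 0
  then show ?case by (simp add: area_refl)
next
  case (Suc i)
  have "area R n ((u @ [(x, e)]) @ replicate i (x, e)) (([(x', e)] @ u) @ replicate i (x, e))"
    using area_context[OF assms, of "[]" "replicate i (x, e)"] by simp
  moreover have "area R (i * n) ([(x', e)] @ u @ replicate i (x, e)) ([(x', e)] @ replicate i (x', e) @ u)"
    using area_context[OF Suc.IH, of "[(x', e)]" "[]"] by simp
  ultimately show ?case using area_trans by fastforce
qed

lemma area_conj_gen_pow:
  assumes "area R n (u @ [(x, True)]) ([(x', True)] @ u)"
  shows "area R (nat \<bar>z\<bar> * n) (u @ gen_pow x z) (gen_pow x' z @ u)"
  using area_conj_replicate[OF assms] area_conj_replicate[OF area_conj_inverse[OF assms]]
  by (cases "0 \<le> z") (simp_all add: gen_pow_def)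

lemma area_gen_pow_Suc: "area R 0 (gen_pow x z @ [(x, e)]) (gen_pow x (z + (if e then 1 else -1)))"
proof -
  have r: "replicate i (x, b) @ [(x, b)] = replicate (Suc i) (x, b)" for i and b :: bool by (simp add: replicate_append_same)
  have c: "area R 0 (replicate (Suc i) (x, b) @ [(x, \<not> b)]) (replicate i (x, b))" for i b
    using area_cancel'[of R "replicate i (x, b)" x b "[]"] by (simp add: replicate_append_same[symmetric])
  show ?thesis
  proof (cases "(0 \<le> z) = e \<or> z = 0")
    case True
    define i where "i = nat \<bar>z\<bar>"
    have "gen_pow x z = replicate i (x, e)" using True by (cases "z = 0") (auto simp: gen_pow_def i_def)
    moreover have "nat \<bar>z + (if e then 1 else -1)\<bar> = Suc i" "(0 \<le> z + (if e then 1 else -1)) = e"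
      using True by (auto simp: i_def)
    then have "gen_pow x (z + (if e then 1 else -1)) = replicate (Suc i) (x, e)" by (simp only: gen_pow_def)
    ultimately have "gen_pow x z @ [(x, e)] = gen_pow x (z + (if e then 1 else -1))" by (simp only: r)
    then show ?thesis by (simp add: area_refl)
  next
    case False
    define i where "i = nat \<bar>z\<bar> - 1"
    have "nat \<bar>z\<bar> = Suc i" "(0 \<le> z) = (\<not> e)" using False by (auto simp: i_def)
    then have "gen_pow x z = replicate (Suc i) (x, \<not> e)" by (simp only: gen_pow_def)
    moreover have "nat \<bar>z + (if e then 1 else -1)\<bar> = i" "i = 0 \<or> (0 \<le> z + (if e then 1 else -1)) = (\<not> e)"
      using False by (auto simp: i_def)
    then have "gen_pow x (z + (if e then 1 else -1)) = replicate i (x, \<not> e)" by (auto simp: gen_pow_def)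
    then have "area R 0 (replicate i (x, \<not> e)) (gen_pow x (z + (if e then 1 else -1)))" by (simp add: area_refl)
    ultimately show ?thesis using area_zero_trans(1)[OF c[of i "\<not> e"]] by (simp only: not_not)
  qed
qed

text \<open>\<open>s\<close> selects between \<open>T A T\<inverse> = B\<close> and \<open>T A T\<inverse> = A\<close>.  Every element is a product of
  syllables \<open>A\<^sup>d T\<close>, \<open>B\<^sup>d T\<close>, \<open>B\<^sup>d T\<inverse>\<close>, most recent syllable first, followed by \<open>A\<^sup>x B\<^sup>y\<close>.\<close>

type_synonym flat_state = "(int \<times> bool) list \<times> int \<times> int"

locale flat_hnn =
  fixes s :: bool
begin

abbreviation "QR \<equiv> hnn_rel (if s then 0 else 1) (if s then 1 else 0) 1 0"
abbreviation "cg \<equiv> (if s then gB else gA)"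

text \<open>Before \<open>T\<close> the edge group is generated by \<open>cg\<close>, before
  \<open>T^-1\<close> by \<open>A\<close>. Each is a direct factor of the flat, so cosets are
  represented by powers of the complementary generator: the digit is a coordinate, and no division
  occurs.\<close>

fun stp :: "flat_state \<Rightarrow> hnn_gen \<times> bool \<Rightarrow> flat_state" where
  "stp (ds, x, y) (gA, e) = (ds, x + (if e then 1 else -1), y)"
| "stp (ds, x, y) (gB, e) = (ds, x, y + (if e then 1 else -1))"
| "stp (ds, x, y) (gT, True) =
     (let r = (if s then x else y); q = (if s then y else x) in
      case ds of (d, False) # ds' \<Rightarrow> if r = 0 then (ds', q, d) else ((r, True) # ds, q, 0)
      | _ \<Rightarrow> ((r, True) # ds, q, 0))"
| "stp (ds, x, y) (gT, False) =
     (case ds of (d, True) # ds' \<Rightarrow> if y = 0 then (if s then (ds', d, x) else (ds', x, d))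
         else ((y, False) # ds, if s then (0, x) else (x, 0))
      | _ \<Rightarrow> ((y, False) # ds, if s then (0, x) else (x, 0)))"

fun vld :: "(int \<times> bool) list \<Rightarrow> bool" where
  "vld [] \<longleftrightarrow> True"
| "vld ((d, e) # ds) \<longleftrightarrow> vld ds \<and> (d = 0 \<longrightarrow> ds = [] \<or> snd (hd ds) = e)"

abbreviation "States \<equiv> {\<sigma> :: flat_state. vld (fst \<sigma>)}"

fun syl :: "int \<times> bool \<Rightarrow> hnn_gen word" where
  "syl (d, e) = gen_pow (if s \<and> e then gA else gB) d @ [(gT, e)]"

fun syls :: "(int \<times> bool) list \<Rightarrow> hnn_gen word" where
  "syls [] = []"
| "syls (c # ds) = syls ds @ syl c"

fun nwd :: "flat_state \<Rightarrow> hnn_gen word" where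
  "nwd (ds, x, y) = syls ds @ w2 x y"

definition "base = ([] :: (int \<times> bool) list, 0 :: int, 0 :: int)"
abbreviation "nst w \<equiv> foldl stp base w"

lemma syl_cases [case_names Nil True False]:
  obtains "ds = []" | d ds' where "ds = (d, True) # ds'" | d ds' where "ds = (d, False) # ds'"
  by (metis (full_types) list.exhaust surj_pair)

lemma stp_cases [case_names A B T T']:
  obtains e where "l = (gA, e)" | e where "l = (gB, e)" | "l = (gT, True)" | "l = (gT, False)"
  by (metis (full_types) hnn_gen.exhaust surj_pair)

lemma stp_closed: assumes "\<sigma> \<in> States" shows "stp \<sigma> l \<in> States"
proof -
  obtain ds x y where \<sigma>: "\<sigma> = (ds, x, y)" by (cases \<sigma>)
  show ?thesis using assms unfolding \<sigma>
    by (cases l rule: stp_cases; cases ds rule: syl_cases) (auto simp: Let_def flat_hnn.stp.simps)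
qed

lemma stp_cancel: assumes "\<sigma> \<in> States" shows "stp (stp \<sigma> (x, e)) (x, \<not> e) = \<sigma>"
proof -
  obtain ds i j where \<sigma>: "\<sigma> = (ds, i, j)" by (cases \<sigma>)
  show ?thesis
  proof (cases ds rule: syl_cases)
    case Nil
    then show ?thesis by (cases x; cases e) (auto simp: \<sigma> Let_def flat_hnn.stp.simps)
  next
    case (True d ds')
    then show ?thesis using assms
      by (cases ds' rule: syl_cases; cases x; cases e) (auto simp: \<sigma> Let_def flat_hnn.stp.simps)
  next
    case (False d ds')
    then show ?thesis using assms
      by (cases ds' rule: syl_cases; cases x; cases e) (auto simp: \<sigma> Let_def flat_hnn.stp.simps)
  qed
qed

lemma QR_cases:
  assumes "(u, v) \<in> QR"
  obtains "u = [(gA, True), (gB, True), (gA, False), (gB, False)]" "v = []"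
  | "u = [(gT, True), (gA, True), (gT, False)]" "v = [(cg, True)]"
  using assms by (auto simp: hnn_rel_def gen_pow_def split: if_splits)

lemma stp_rel: assumes "\<sigma> \<in> States" "(u, v) \<in> QR" shows "foldl stp \<sigma> u = foldl stp \<sigma> v"
proof -
  obtain ds x y where \<sigma>: "\<sigma> = (ds, x, y)" by (cases \<sigma>)
  show ?thesis using assms(2)
  proof (cases rule: QR_cases)
    case 1
    then show ?thesis by (simp add: \<sigma>)
  next
    case 2
    show ?thesis
    proof (cases ds rule: syl_cases)
      case (False d ds')
      then show ?thesis using assms(1) 2 by (cases ds' rule: syl_cases) (auto simp: \<sigma> Let_def flat_hnn.stp.simps)
    qed (use 2 in \<open>auto simp: \<sigma> Let_def flat_hnn.stp.simps\<close>)
  qed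
qed

lemma base_States: "base \<in> States"
  by (simp add: base_def)

lemma nst_pres_eq: "pres_eq QR u v \<Longrightarrow> nst u = nst v"
  by (rule run_cong[where S = States, OF stp_closed stp_cancel stp_rel _ base_States])

lemma nst_States: "nst w \<in> States"
proof (induction w rule: rev_induct)
  case (snoc l w)
  then show ?case using stp_closed[of "nst w" l] by simp
qed (simp add: base_def)

text \<open>The total exponent of the normal form without the letters \<open>T\<close>. It grows by
  at most 1 per letter and bounds the sides of the rectangles to be filled.\<close>

fun sz :: "flat_state \<Rightarrow> nat" where
  "sz (ds, x, y) = (\<Sum>(d, e)\<leftarrow>ds. nat \<bar>d\<bar>) + nat \<bar>x\<bar> + nat \<bar>y\<bar>"

lemma sz_stp: "sz (stp \<sigma> l) \<le> sz \<sigma> + 1"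
proof -
  obtain ds x y where \<sigma>: "\<sigma> = (ds, x, y)" by (cases \<sigma>)
  show ?thesis unfolding \<sigma> by (cases l rule: stp_cases; cases ds rule: syl_cases) (auto simp: Let_def flat_hnn.stp.simps)
qed

lemma sz_nst: "sz (nst w) \<le> length w"
proof (induction w rule: rev_induct)
  case (snoc l w)
  then show ?case using sz_stp[of "nst w" l] by simp
qed (simp add: base_def)

section \<open>Cubic area of closed words\<close>

lemma area_TA: "area QR 1 ([(gT, True)] @ [(gA, True)]) ([(cg, True)] @ [(gT, True)])"
proof -
  have "area QR 1 [(gT, True), (gA, True), (gT, False)] [(cg, True)]"
    by (rule area_rel) (auto simp: hnn_rel_def gen_pow_def)
  from area_context[OF this, of "[]" "[(gT, True)]"]
  have "area QR 1 ([(gT, True), (gA, True)] @ [(gT, False), (gT, \<not> False)] @ []) ([(cg, True)] @ [(gT, True)])"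
    by simp
  then show ?thesis using area_zero_trans(2)[OF area_sym[OF area_cancel'[of QR "[(gT, True), (gA, True)]" gT False "[]"]]]
    by simp
qed

lemma area_T'c: "area QR 1 ([(gT, False)] @ [(cg, True)]) ([(gA, True)] @ [(gT, False)])"
proof -
  have "area QR 1 [(gT, True), (gA, True), (gT, False)] [(cg, True)]"
    by (rule area_rel) (auto simp: hnn_rel_def gen_pow_def)
  from area_context[OF area_sym[OF this], of "[(gT, False)]" "[]"]
  have "area QR 1 ([(gT, False)] @ [(cg, True)]) ([] @ [(gT, False), (gT, \<not> False)] @ [(gA, True), (gT, False)])"
    by simp
  from area_zero_trans(1)[OF this area_cancel'] show ?thesis by simp
qed

lemma area_AB: "area QR 1 ([(gA, True)] @ [(gB, True)]) ([(gB, True)] @ [(gA, True)])"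
proof -
  have "area QR 1 [(gA, True), (gB, True), (gA, False), (gB, False)] []"
    by (rule area_rel) (auto simp: hnn_rel_def)
  from area_context[OF this, of "[]" "[(gB, True), (gA, True)]"]
  have 1: "area QR 1 ([(gA, True), (gB, True), (gA, False)] @ [(gB, False), (gB, \<not> False)] @ [(gA, True)]) [(gB, True), (gA, True)]"
    by simp
  have "area QR 0 ([(gA, True), (gB, True)] @ [(gA, False), (gA, \<not> False)] @ []) ([(gA, True), (gB, True)] @ [])"
    by (rule area_cancel')
  moreover note area_cancel'[of QR "[(gA, True), (gB, True), (gA, False)]" gB False "[(gA, True)]"]
  ultimately have "area QR 0 ([(gA, True), (gB, True), (gA, False)] @ [(gB, False), (gB, \<not> False)] @ [(gA, True)]) [(gA, True), (gB, True)]"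
    using area_trans[of QR 0 _ _ 0] by simp
  from area_zero_trans(2)[OF area_sym[OF this] 1] show ?thesis by simp
qed

lemma area_T: "area QR (nat \<bar>z\<bar>) ([(gT, True)] @ gen_pow gA z) (gen_pow cg z @ [(gT, True)])"
  and area_T': "area QR (nat \<bar>z\<bar>) ([(gT, False)] @ gen_pow cg z) (gen_pow gA z @ [(gT, False)])"
  using area_conj_gen_pow[OF area_TA] area_conj_gen_pow[OF area_T'c] by simp_all

lemma area_commute: "area QR (nat \<bar>y\<bar>) (gen_pow gB y @ [(gA, e)]) ([(gA, e)] @ gen_pow gB y)"
  and area_commute2: "area QR (nat \<bar>x\<bar> * nat \<bar>y\<bar>) (gen_pow gB y @ gen_pow gA x) (gen_pow gA x @ gen_pow gB y)"
proof -
  have *: "area QR (nat \<bar>y\<bar>) (gen_pow gB y @ [(gA, True)]) ([(gA, True)] @ gen_pow gB y)"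
    using area_sym[OF area_conj_gen_pow[OF area_AB]] by simp
  show "area QR (nat \<bar>y\<bar>) (gen_pow gB y @ [(gA, e)]) ([(gA, e)] @ gen_pow gB y)"
    using * area_conj_inverse[OF *] by (cases e) simp_all
  show "area QR (nat \<bar>x\<bar> * nat \<bar>y\<bar>) (gen_pow gB y @ gen_pow gA x) (gen_pow gA x @ gen_pow gB y)"
    by (rule area_conj_gen_pow[OF *])
qed

end

definition area_le :: "('g word \<times> 'g word) set \<Rightarrow> nat \<Rightarrow> 'g word \<Rightarrow> 'g word \<Rightarrow> bool" where
  "area_le R k u v \<longleftrightarrow> (\<exists>n\<le>k. area R n u v)"

lemma area_leI: "area R n u v \<Longrightarrow> n \<le> k \<Longrightarrow> area_le R k u v"
  by (auto simp: area_le_def)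

lemma area_le_trans: "area_le R i u v \<Longrightarrow> area_le R j v w \<Longrightarrow> i + j \<le> k \<Longrightarrow> area_le R k u w"
  unfolding area_le_def using area_trans by (meson add_mono le_trans)

lemma area_le_context: "area R i u v \<Longrightarrow> i \<le> k \<Longrightarrow> area_le R k (x @ u @ y) (x @ v @ y)"
  using area_context unfolding area_le_def by blast

context flat_hnn
begin

abbreviation "ag \<equiv> (if s then gA else gB)"

text \<open>Sorting an abelian word costs a rectangle of commutators, and moving a power across
  \<open>T\<close> costs one relator per letter. Both are at most quadratic in the size, so a word
  of length \<open>l\<close> costs \<open>O(l^3)\<close> in all.\<close>

lemma area_step: "area_le QR ((sz \<sigma> + 1)^2) (nwd \<sigma> @ [l]) (nwd (stp \<sigma> l))"
proof -
  obtain ds x y where \<sigma>: "\<sigma> = (ds, x, y)" by (cases \<sigma>)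
  have lin: "sz \<sigma> \<le> (sz \<sigma> + 1)^2" by (simp add: power2_eq_square)
  have quad: "p * q + p \<le> (sz \<sigma> + 1)^2" if "p + q \<le> sz \<sigma>" for p q
  proof -
    have "p * (q + 1) \<le> (sz \<sigma> + 1) * (sz \<sigma> + 1)" using that by (intro mult_le_mono) auto
    then show ?thesis by (simp add: power2_eq_square algebra_simps)
  qed
  let ?x = "nat \<bar>x\<bar>" and ?y = "nat \<bar>y\<bar>"
  show ?thesis
  proof (cases l rule: stp_cases)
    case (A e)
    have "area QR ?y (nwd \<sigma> @ [l]) (syls ds @ gen_pow gA x @ [(gA, e)] @ gen_pow gB y)"
      using area_context[OF area_commute[of y e], of "syls ds @ gen_pow gA x" "[]"] by (simp add: \<sigma> A)
    moreover have "area QR 0 (syls ds @ gen_pow gA x @ [(gA, e)] @ gen_pow gB y) (nwd (stp \<sigma> l))"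
      using area_context[OF area_gen_pow_Suc[of QR gA x e], of "syls ds" "gen_pow gB y"] by (simp add: \<sigma> A)
    ultimately have "area QR ?y (nwd \<sigma> @ [l]) (nwd (stp \<sigma> l))" by (rule area_zero_trans)
    then show ?thesis by (rule area_leI) (use lin in \<open>simp add: \<sigma>\<close>)
  next
    case (B e)
    have "area QR 0 (nwd \<sigma> @ [l]) (nwd (stp \<sigma> l))"
      using area_context[OF area_gen_pow_Suc[of QR gB y e], of "syls ds @ gen_pow gA x" "[]"] by (simp add: \<sigma> B)
    then show ?thesis by (rule area_leI) simp
  next
    case T
    define r q where "r = (if s then x else y)" and "q = (if s then y else x)"
    let ?r = "nat \<bar>r\<bar>" and ?q = "nat \<bar>q\<bar>"
    have sz: "?q + ?r \<le> sz \<sigma>" by (simp add: \<sigma> r_def q_def)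
    have push: "area_le QR ((sz \<sigma> + 1)^2) (nwd \<sigma> @ [l]) (nwd ((r, True) # ds, q, 0))"
    proof (rule area_le_trans[OF _ _ quad[OF sz]])
      \<comment> \<open>When \<open>s\<close> holds, \<open>A^x B^y\<close> already has the power of
        \<open>cg\<close> next to \<open>T\<close>.\<close>
      have sw: "area QR (if s then 0 else ?q * ?r) (w2 x y) (gen_pow ag r @ gen_pow cg q)"
        using area_sym[OF area_commute2[of x y]] by (cases s) (simp_all add: r_def q_def area_refl)
      show "area_le QR (?q * ?r) (nwd \<sigma> @ [l]) (syls ds @ (gen_pow ag r @ gen_pow cg q) @ [l])"
        using area_le_context[OF sw, of "?q * ?r" "syls ds" "[l]"] by (simp add: \<sigma>)
      show "area_le QR ?q (syls ds @ (gen_pow ag r @ gen_pow cg q) @ [l]) (nwd ((r, True) # ds, q, 0))"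
        using area_le_context[OF area_sym[OF area_T[of q]], of ?q "syls ds @ gen_pow ag r" "[]"] by (simp add: T)
    qed
    show ?thesis
    proof (cases "r = 0 \<and> (\<exists>d ds'. ds = (d, False) # ds')")
      case False
      then have "stp \<sigma> l = ((r, True) # ds, q, 0)" by (cases ds rule: syl_cases) (auto simp: \<sigma> T Let_def r_def q_def)
      then show ?thesis using push by simp
    next
      case True
      then obtain d ds' where ds: "ds = (d, False) # ds'" and r: "r = 0" by blast
      have st: "stp \<sigma> l = (ds', q, d)" using ds r by (simp add: \<sigma> T Let_def r_def q_def split: if_splits)
      have wxy: "w2 x y = gen_pow cg q" using r by (auto simp: r_def q_def split: if_splits)
      have sz': "?q + nat \<bar>d\<bar> \<le> sz \<sigma>" by (simp add: \<sigma> q_def ds)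
      have "area QR ?q (nwd \<sigma> @ [l]) (syls ds' @ gen_pow gB d @ gen_pow gA q @ [(gT, False), (gT, True)])"
        using area_context[OF area_T'[of q], of "syls ds' @ gen_pow gB d" "[(gT, True)]"] by (simp only: \<sigma> nwd.simps wxy) (simp add: ds T)
      from area_zero_trans(1)[OF this, of "syls ds' @ gen_pow gB d @ gen_pow gA q"]
      have 1: "area QR ?q (nwd \<sigma> @ [l]) (syls ds' @ gen_pow gB d @ gen_pow gA q)"
        using area_cancel'[of QR "syls ds' @ gen_pow gB d @ gen_pow gA q" gT False "[]"] by simp
      have 2: "area QR (?q * nat \<bar>d\<bar>) (syls ds' @ gen_pow gB d @ gen_pow gA q) (nwd (stp \<sigma> l))"
        using area_context[OF area_commute2[of q d], of "syls ds'" "[]"] by (simp add: st)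
      show ?thesis by (rule area_leI[OF area_trans[OF 1 2]]) (use quad[OF sz'] in simp)
    qed
  next
    case T'
    have sz: "?x + ?y \<le> sz \<sigma>" by (simp add: \<sigma>)
    note nwd' = flat_hnn.nwd.simps flat_hnn.syls.simps flat_hnn.syl.simps
    have push: "area_le QR ((sz \<sigma> + 1)^2) (nwd \<sigma> @ [l]) (nwd ((y, False) # ds, if s then (0, x) else (x, 0)))"
    proof (rule area_leI)
      have 1: "area QR (?x * ?y) (nwd \<sigma> @ [l]) (syls ds @ (gen_pow gB y @ gen_pow gA x) @ [l])"
        using area_context[OF area_sym[OF area_commute2[of x y]], of "syls ds" "[l]"] by (simp add: \<sigma>)
      have 2: "area QR ?x (syls ds @ (gen_pow gB y @ gen_pow gA x) @ [l]) (nwd ((y, False) # ds, if s then (0, x) else (x, 0)))"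
        using area_context[OF area_sym[OF area_T'[of x]], of "syls ds @ gen_pow gB y" "[]"] by (cases s) (simp_all add: T' nwd')
      show "area QR (?x * ?y + ?x) (nwd \<sigma> @ [l]) (nwd ((y, False) # ds, if s then (0, x) else (x, 0)))"
        by (rule area_trans[OF 1 2])
      show "?x * ?y + ?x \<le> (sz \<sigma> + 1)^2" by (rule quad[OF sz])
    qed
    show ?thesis
    proof (cases "y = 0 \<and> (\<exists>d ds'. ds = (d, True) # ds')")
      case False
      then have "stp \<sigma> l = ((y, False) # ds, if s then (0, x) else (x, 0))" by (cases ds rule: syl_cases) (auto simp: \<sigma> T')
      then show ?thesis using push by (simp only:)
    next
      case True
      then obtain d ds' where ds: "ds = (d, True) # ds'" and y: "y = 0" by blast
      have sz': "?x + nat \<bar>d\<bar> \<le> sz \<sigma>" by (simp add: \<sigma> ds)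
      have "area QR ?x (nwd \<sigma> @ [l]) (syls ds' @ gen_pow ag d @ gen_pow cg x @ [(gT, True), (gT, False)])"
        using area_context[OF area_T[of x], of "syls ds' @ gen_pow ag d" "[(gT, False)]"] by (simp add: \<sigma> y ds T')
      from area_zero_trans(1)[OF this, of "syls ds' @ gen_pow ag d @ gen_pow cg x"]
      have 1: "area QR ?x (nwd \<sigma> @ [l]) (syls ds' @ gen_pow ag d @ gen_pow cg x)"
        using area_cancel'[of QR "syls ds' @ gen_pow ag d @ gen_pow cg x" gT True "[]"] by simp
      have 2: "area QR (if s then 0 else ?x * nat \<bar>d\<bar>) (syls ds' @ gen_pow ag d @ gen_pow cg x) (nwd (stp \<sigma> l))"
        using area_context[OF area_commute2[of x d], of "syls ds'" "[]"] by (cases s) (simp_all add: \<sigma> T' y ds area_refl nwd' flat_hnn.stp.simps)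
      have "?x + (if s then 0 else ?x * nat \<bar>d\<bar>) \<le> (sz \<sigma> + 1)^2" using quad[OF sz'] by simp
      then show ?thesis by (rule area_leI[OF area_trans[OF 1 2]])
    qed
  qed
qed

lemma area_nf: "area_le QR (length w * (length w + 1)^2) w (nwd (nst w))"
proof (induction w rule: rev_induct)
  case Nil
  show ?case by (rule area_leI[of _ 0]) (simp_all add: base_def area_refl)
next
  case (snoc l w)
  obtain n where n: "n \<le> length w * (length w + 1)^2" "area QR n w (nwd (nst w))" using snoc by (auto simp: area_le_def)
  have 1: "area_le QR (length w * (length w + 1)^2) (w @ [l]) (nwd (nst w) @ [l])"
    using area_le_context[OF n(2,1), of "[]" "[l]"] by simp
  have a: "(sz (nst w) + 1)^2 \<le> (length (w @ [l]) + 1)^2" using sz_nst[of w] by (intro power_mono) auto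
  have b: "length w * (length w + 1)^2 \<le> length w * (length (w @ [l]) + 1)^2" by (intro mult_le_mono power_mono) auto
  have "length w * (length w + 1)^2 + (sz (nst w) + 1)^2 \<le> length w * (length (w @ [l]) + 1)^2 + (length (w @ [l]) + 1)^2"
    by (rule add_mono[OF b a])
  also have "\<dots> = length (w @ [l]) * (length (w @ [l]) + 1)^2" by simp
  finally have "length w * (length w + 1)^2 + (sz (nst w) + 1)^2 \<le> length (w @ [l]) * (length (w @ [l]) + 1)^2" .
  then show ?case using area_le_trans[OF 1 area_step] by simp
qed

theorem cubic_filling_QR: "cubic_filling (carrier (PG QR)) (pdist QR)"
proof (rule cubic_area_filling[where C = 1])
  show "finite QR" by (simp add: hnn_rel_def)
  fix w assume "pres_eq QR w []"
  then have "nst w = base" using nst_pres_eq[of w "[]"] by simp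
  then have "area_le QR (length w * (length w + 1)^2) w []" using area_nf[of w] by (simp add: base_def)
  then obtain n where n: "area QR n w []" "n \<le> length w * (length w + 1)^2" by (auto simp: area_le_def)
  have "length w * (length w + 1)^2 \<le> (length w + 1) * (length w + 1)^2" by simp
  also have "\<dots> = (length w + 1)^3" by (simp add: power3_eq_cube power2_eq_square)
  finally have "real n \<le> real ((length w + 1)^3)" using n(2) by (simp only: of_nat_le_iff)
  then show "\<exists>n. area QR n w [] \<and> real n \<le> 1 * real (length w + 1) ^ 3" using n(1) by (intro exI[of _ n]) simp
qed

end

section \<open>Linear divergence\<close>

definition avoiding_path :: "'a set \<Rightarrow> ('a \<Rightarrow> 'a \<Rightarrow> real) \<Rightarrow> 'a \<Rightarrow> real \<Rightarrow> real \<Rightarrow> nat \<Rightarrow> (nat \<Rightarrow> 'a) \<Rightarrow> bool" where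
  "avoiding_path X d p R r n q \<longleftrightarrow> (\<forall>i\<le>n. q i \<in> X \<and> R \<le> d p (q i)) \<and> (\<forall>i<n. d (q i) (q (Suc i)) \<le> r)"

text \<open>Detours around \<open>p\<close> of length linear in the distances. One natural number
  serves as step length, as slack for the end points and as rate, which keeps the notion stable
  under quasi-isometries.\<close>

definition linear_divergence :: "'a set \<Rightarrow> ('a \<Rightarrow> 'a \<Rightarrow> real) \<Rightarrow> bool" where
  "linear_divergence X d \<longleftrightarrow> (\<exists>L::nat. L \<ge> 1 \<and> (\<forall>p\<in>X. \<forall>x\<in>X. \<forall>y\<in>X. \<forall>R::nat.
     real (L * R + L) \<le> d p x \<and> real (L * R + L) \<le> d p y \<longrightarrow>
     (\<exists>n q. q 0 = x \<and> q n = y \<and> real n \<le> real L * (d p x + d p y + real R + 1) \<and> avoiding_path X d p (real R) (real L) n q)))"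

text \<open>The detour is taken in \<open>Y\<close> around \<open>f p\<close> and mapped back by
  \<open>g\<close>, with \<open>x\<close> and \<open>y\<close> attached at its ends. The constant
  \<open>\<mu>\<close> is a sum that dominates each bound required on the way.\<close>

lemma linear_divergence_qi:
  assumes qi: "quasi_isometric_spaces X d Y e" and X: "pseudometric X d" and Y: "pseudometric Y e" and div: "linear_divergence Y e"
  shows "linear_divergence X d"
proof -
  obtain f g K0 C0 where f: "f \<in> X \<rightarrow> Y" and g: "g \<in> Y \<rightarrow> X" and K0: "K0 \<ge> 1" and C0: "C0 \<ge> 0"
    and fL0: "\<And>x x'. x \<in> X \<Longrightarrow> x' \<in> X \<Longrightarrow> e (f x) (f x') \<le> K0 * d x x' + C0"
    and gL0: "\<And>y y'. y \<in> Y \<Longrightarrow> y' \<in> Y \<Longrightarrow> d (g y) (g y') \<le> K0 * e y y' + C0"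
    and gf0: "\<And>x. x \<in> X \<Longrightarrow> d (g (f x)) x \<le> C0"
    and fg0: "\<And>y. y \<in> Y \<Longrightarrow> e (f (g y)) y \<le> C0"
    by (rule qi_inverse[OF qi Y]) (rule that)
  define K C where "K = nat \<lceil>K0\<rceil>" and "C = nat \<lceil>C0\<rceil>"
  have KC: "K0 \<le> real K" "C0 \<le> real C" unfolding K_def C_def by linarith+
  have K1: "real K \<ge> 1" using KC K0 by linarith
  have nn: "0 \<le> d x x'" if "x \<in> X" "x' \<in> X" for x x' using X that unfolding pseudometric_def by blast
  have nn': "0 \<le> e x x'" if "x \<in> Y" "x' \<in> Y" for x x' using Y that unfolding pseudometric_def by blast
  have fL: "e (f x) (f x') \<le> real K * d x x' + real C" if "x \<in> X" "x' \<in> X" for x x'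
    using fL0[OF that] mult_right_mono[OF KC(1) nn[OF that]] KC(2) by linarith
  have gL: "d (g x) (g x') \<le> real K * e x x' + real C" if "x \<in> Y" "x' \<in> Y" for x x'
    using gL0[OF that] mult_right_mono[OF KC(1) nn'[OF that]] KC(2) by linarith
  have gf: "d (g (f x)) x \<le> real C" if "x \<in> X" for x using gf0[OF that] KC(2) by linarith
  have fg: "e (f (g y)) y \<le> real C" if "y \<in> Y" for y using fg0[OF that] KC(2) by linarith
  have tri: "d x z \<le> d x y + d y z" and sy: "d x y = d y x" if "x \<in> X" "y \<in> X" "z \<in> X" for x y z
    using X that unfolding pseudometric_def by blast+
  have tri': "e x z \<le> e x y + e y z" and sy': "e x y = e y x" if "x \<in> Y" "y \<in> Y" "z \<in> Y" for x y z
    using Y that unfolding pseudometric_def by blast+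
  obtain \<kappa> :: nat where \<kappa>: "\<kappa> \<ge> 1" and path: "\<forall>p\<in>Y. \<forall>x\<in>Y. \<forall>y\<in>Y. \<forall>R::nat.
     real (\<kappa> * R + \<kappa>) \<le> e p x \<and> real (\<kappa> * R + \<kappa>) \<le> e p y \<longrightarrow>
     (\<exists>n q. q 0 = x \<and> q n = y \<and> real n \<le> real \<kappa> * (e p x + e p y + real R + 1) \<and> avoiding_path Y e p (real R) (real \<kappa>) n q)"
    using div unfolding linear_divergence_def by blast
  define \<mu> where "\<mu> = K * (K * \<kappa>) + K * (\<kappa> * (2 * C) + \<kappa>) + 3 * C + (\<kappa> * K + \<kappa> * (4 * C + 1)) + 2 + K * \<kappa> + C"
  show ?thesis unfolding linear_divergence_def
  proof (rule exI[of _ \<mu>], intro conjI ballI allI impI)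
    show "1 \<le> \<mu>" by (simp add: \<mu>_def)
    fix p x y and R :: nat
    assume p: "p \<in> X" and x: "x \<in> X" and y: "y \<in> X" and far0: "real (\<mu> * R + \<mu>) \<le> d p x \<and> real (\<mu> * R + \<mu>) \<le> d p y"
    note far = far0[THEN conjunct1] far0[THEN conjunct2]
    \<comment> \<open>Chosen so that a point at distance at least \<open>R'\<close> from
      \<open>f p\<close> comes back at distance at least \<open>R\<close> from
      \<open>p\<close>.\<close>
    define R' where "R' = K * R + 2 * C"
    have inY: "f p \<in> Y" "f x \<in> Y" "f y \<in> Y" using f p x y by auto
    have far': "real (\<kappa> * R' + \<kappa>) \<le> e (f p) (f z)" if z: "z \<in> X" and fz: "real (\<mu> * R + \<mu>) \<le> d p z" for z
    proof -
      have iz: "f z \<in> Y" "g (f z) \<in> X" "g (f p) \<in> X" using f g z p by auto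
      have "d p z \<le> d p (g (f p)) + (d (g (f p)) (g (f z)) + d (g (f z)) z)"
        using tri[OF p iz(3) z] tri[OF iz(3,2) z] by linarith
      also have "d p (g (f p)) = d (g (f p)) p" using sy p iz by blast
      finally have "d p z \<le> real K * e (f p) (f z) + 3 * real C" using gf[OF p] gf[OF z] gL[OF inY(1) iz(1)] by linarith
      moreover have "K * (\<kappa> * R' + \<kappa>) + 3 * C \<le> \<mu> * R + \<mu>"
        by (simp add: R'_def \<mu>_def algebra_simps)
      then have "real (K * (\<kappa> * R' + \<kappa>) + 3 * C) \<le> real (\<mu> * R + \<mu>)" by (simp only: of_nat_le_iff)
      ultimately have "real K * real (\<kappa> * R' + \<kappa>) \<le> real K * e (f p) (f z)" using fz by simp
      then show ?thesis using K1 by simp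
    qed
    obtain n q where q: "q 0 = f x" "q n = f y" "real n \<le> real \<kappa> * (e (f p) (f x) + e (f p) (f y) + real R' + 1)"
      "avoiding_path Y e (f p) (real R') (real \<kappa>) n q"
      using path[rule_format, OF inY] far'[OF x far(1)] far'[OF y far(2)] by blast
    define q' where "q' = (\<lambda>i. if i = 0 then x else if i \<le> Suc n then g (q (i - 1)) else y)"
    show "\<exists>n q. q 0 = x \<and> q n = y \<and> real n \<le> real \<mu> * (d p x + d p y + real R + 1) \<and> avoiding_path X d p (real R) (real \<mu>) n q"
    proof (intro exI[of _ "n + 2"] exI[of _ q'] conjI)
      show "q' 0 = x" "q' (n + 2) = y" by (simp_all add: q'_def)
      have "real \<kappa> * (e (f p) (f x) + e (f p) (f y) + real R' + 1) \<le>
        real \<kappa> * (real K * d p x + real K * d p y + 2 * real C + real R' + 1)"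
        using fL[OF p x] fL[OF p y] by (intro mult_left_mono) auto
      also have "\<dots> + 2 \<le> real \<mu> * (d p x + d p y + real R + 1)"
      proof -
        have "real (\<kappa> * K) * (d p x + d p y + real R) \<le> real \<mu> * (d p x + d p y + real R)"
        proof (rule mult_right_mono)
          show "real (\<kappa> * K) \<le> real \<mu>" by (simp only: of_nat_le_iff) (simp add: \<mu>_def)
          show "0 \<le> d p x + d p y + real R" using nn p x y by simp
        qed
        moreover have "real (\<kappa> * (4 * C + 1) + 2) \<le> real \<mu>" by (simp only: of_nat_le_iff) (simp add: \<mu>_def)
        ultimately show ?thesis by (simp add: R'_def algebra_simps)
      qed
      finally show "real (n + 2) \<le> real \<mu> * (d p x + d p y + real R + 1)" using q(3) by simp
      have qY: "q i \<in> Y" "g (q i) \<in> X" "real R' \<le> e (f p) (q i)" if "i \<le> n" for i using q(4) g that by (auto simp: avoiding_path_def)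
      have muR: "real R \<le> real (\<mu> * R + \<mu>)" by (simp only: of_nat_le_iff) (simp add: \<mu>_def algebra_simps)
      have far2: "real R \<le> d p (g (q i))" if i: "i \<le> n" for i
      proof -
        have "f (g (q i)) \<in> Y" using f qY[OF i] by auto
        then have "e (f p) (q i) \<le> real K * d p (g (q i)) + 2 * real C"
          using tri'[OF inY(1) _ qY(1)[OF i], of "f (g (q i))"] fL[OF p qY(2)[OF i]] fg[OF qY(1)[OF i]] by linarith
        then have "real K * real R \<le> real K * d p (g (q i))" using qY(3)[OF i] by (simp add: R'_def)
        then show ?thesis using K1 by simp
      qed
      have muC: "real C \<le> real \<mu>" "real K * real \<kappa> + real C \<le> real \<mu>"
      proof -
        show "real C \<le> real \<mu>" by (simp only: of_nat_le_iff) (simp add: \<mu>_def)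
        have "real (K * \<kappa> + C) \<le> real \<mu>" by (simp only: of_nat_le_iff) (simp add: \<mu>_def)
        then show "real K * real \<kappa> + real C \<le> real \<mu>" by simp
      qed
      show "avoiding_path X d p (real R) (real \<mu>) (n + 2) q'"
        unfolding avoiding_path_def
      proof (intro conjI allI impI)
        fix i assume "i \<le> n + 2"
        then show "q' i \<in> X" using x y qY(2)[of "i - 1"] by (auto simp: q'_def)
        show "real R \<le> d p (q' i)" using far muR far2[of "i - 1"] by (auto simp: q'_def)
      next
        fix i assume i: "i < n + 2"
        consider "i = 0" | "1 \<le> i" "i \<le> n" | "i = Suc n" using i by linarith
        then show "d (q' i) (q' (Suc i)) \<le> real \<mu>"
        proof cases
          case 1
          have "g (f x) \<in> X" using g inY by auto
          then have "d x (g (f x)) \<le> real \<mu>" using gf[OF x] sy[OF x _ x, of "g (f x)"] muC(1) by linarith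
          then show ?thesis using 1 q(1) by (simp add: q'_def)
        next
          case 2
          then obtain j where j: "i = Suc j" "j < n" by (cases i) auto
          have "real K * e (q j) (q (Suc j)) \<le> real K * real \<kappa>" using q(4) j K1 by (simp add: avoiding_path_def)
          then have "d (g (q j)) (g (q (Suc j))) \<le> real \<mu>" using gL[of "q j" "q (Suc j)"] qY(1)[of j] qY(1)[of "Suc j"] j muC by simp
          then show ?thesis using j by (simp add: q'_def)
        next
          case 3
          have "d (g (f y)) y \<le> real \<mu>" using gf[OF y] muC(1) by linarith
          then show ?thesis using 3 q(2) by (simp add: q'_def)
        qed
      qed
    qed
  qed
qed

section \<open>Distances to the identity along words\<close>

abbreviation "wnorm R w \<equiv> word_length (PG R) (std_gens R) (cls R w)"

lemma pdist_wnorm: "pdist (R :: ('g::finite word \<times> 'g word) set) (cls R u) (cls R (u @ w)) = real (wnorm R w)"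
proof -
  interpret gen_group "PG R" "std_gens R" by (rule gen_group_presented)
  show ?thesis by (simp add: pres_class_append wd_mult)
qed

lemma wnorm_append: "wnorm (R :: ('g::finite word \<times> 'g word) set) (u @ w) \<le> wnorm R u + length w"
proof -
  interpret gen_group "PG R" "std_gens R" by (rule gen_group_presented)
  show ?thesis using wl_mult[of "cls R u" "cls R w"] word_length_presented_le[of R w] by (simp add: pres_class_append)
qed

lemma esum_le_length: "(\<And>x. \<bar>f x\<bar> \<le> 1) \<Longrightarrow> \<bar>esum f w\<bar> \<le> int (length w)"
proof (induction w)
  case (Cons l w)
  obtain x e where l: "l = (x, e)" by (cases l)
  show ?case using Cons.IH[OF Cons.prems] Cons.prems[of x] by (cases e) (auto simp: l)
qed simp

lemma esum_le_wnorm: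
  fixes R :: "('g::finite word \<times> 'g word) set"
  assumes "\<And>x. \<bar>f x\<bar> \<le> 1" "\<And>u v. (u, v) \<in> R \<Longrightarrow> esum f u = esum f v"
  shows "\<bar>esum f w\<bar> \<le> int (wnorm R w)"
proof -
  obtain v where v: "pres_eq R w v" "length v = wnorm R w" by (rule word_length_presented_attained)
  show ?thesis using esum_pres_eq[OF v(1) assms(2)] esum_le_length[of f v, OF assms(1)] v(2) by simp
qed

lemma esum_inv_word [simp]: "esum f (inv_word w) = - esum f w"
  by (induction w) (auto simp: inv_word_Cons)

text \<open>\<open>take\<close> is constant beyond the length of \<open>v\<close>, so the quantifier
  over all \<open>i\<close> includes the end point.\<close>

definition far :: "('g word \<times> 'g word) set \<Rightarrow> nat \<Rightarrow> 'g word \<Rightarrow> 'g word \<Rightarrow> bool" where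
  "far R r u v \<longleftrightarrow> (\<forall>i. r \<le> wnorm R (u @ take i v))"

lemma far_append: "far R r u v \<Longrightarrow> far R r (u @ v) w \<Longrightarrow> far R r u (v @ w)"
  unfolding far_def by (metis append_assoc take_append take_all nat_le_linear diff_is_0_eq take_0 append_Nil2)

lemma far_cong: "cls R u = cls R u' \<Longrightarrow> far R r u v \<longleftrightarrow> far R r u' v"
  unfolding far_def by (simp add: pres_class_append)

text \<open>A prefix of the inverse word ends at a point already visited by
  \<open>v\<close>.\<close>

lemma far_inv_word: "far R r u v \<Longrightarrow> far R r (u @ v) (inv_word v)"
  unfolding far_def
proof
  fix i assume h: "\<forall>i. r \<le> wnorm R (u @ take i v)"
  define w where "w = take i (inv_word v)"
  have "inv_word v = inv_word (drop (length v - i) v) @ inv_word (take (length v - i) v)"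
    by (metis append_take_drop_id inv_word_append)
  then have "take i (inv_word v) = inv_word (drop (length v - i) v)" if "i \<le> length v" using that by simp
  moreover have "take i (inv_word v) = inv_word v" if "length v \<le> i" using that by simp
  ultimately have "take i (inv_word v) = inv_word (drop (length v - i) v)" by (cases "i \<le> length v") auto
  then have "u @ v @ take i (inv_word v) = (u @ take (length v - i) v) @ (drop (length v - i) v @ inv_word (drop (length v - i) v))" by simp
  moreover have "cls R (drop (length v - i) v @ inv_word (drop (length v - i) v)) = cls R []"
    using inv_word_right by (simp only: pres_class_eq_iff)
  ultimately have "cls R (u @ v @ take i (inv_word v)) = cls R (u @ take (length v - i) v)"
    by (metis append_Nil2 mult_pres_class)
  then show "r \<le> wnorm R ((u @ v) @ take i (inv_word v))" using h by simp
qed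

text \<open>The free group on \<open>B\<close>, \<open>T\<close> times the infinite cyclic group of \<open>A\<close>.\<close>

abbreviation "FZ \<equiv> hnn_rel 1 0 1 0"
abbreviation "drop_A \<equiv> filter (\<lambda>l :: hnn_gen \<times> bool. fst l \<noteq> gA)"
abbreviation "aexp \<equiv> esum (\<lambda>x. if x = gA then 1 else 0)"
abbreviation "texp \<equiv> esum (\<lambda>x. if x = gT then 1 else 0)"

text \<open>Deleting \<open>A\<close> is the projection to the free factor; it respects classes
  because each relator becomes a free cancellation or trivial.\<close>

lemma drop_A_pres_eq: "pres_eq FZ u v \<Longrightarrow> pres_eq FZ (drop_A u) (drop_A v)"
proof (induction rule: pres_eq.induct)
  case (rel u v)
  then consider "u = [(gA, True), (gB, True), (gA, False), (gB, False)]" "v = []"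
    | "u = [(gT, True), (gA, True), (gT, False)]" "v = [(gA, True)]"
    by (auto simp: hnn_rel_def gen_pow_def)
  then show ?case using pres_eq.cancel[of FZ _ True] by cases auto
qed (auto intro: pres_eq.intros)

lemma wnorm_drop_A: "wnorm FZ (drop_A w) \<le> wnorm FZ w"
proof -
  obtain v where v: "pres_eq FZ w v" "length v = wnorm FZ w" by (rule word_length_presented_attained)
  have "cls FZ (drop_A w) = cls FZ (drop_A v)" using drop_A_pres_eq[OF v(1)] by (simp only: pres_class_eq_iff)
  then have "wnorm FZ (drop_A w) \<le> length (drop_A v)" using word_length_presented_le[of FZ "drop_A v"] by simp
  also have "\<dots> \<le> length v" by simp
  finally show ?thesis using v(2) by simp
qed

lemma aexp_le_wnorm: "\<bar>aexp w\<bar> \<le> int (wnorm FZ w)" and texp_le_wnorm: "\<bar>texp w\<bar> \<le> int (wnorm FZ w)"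
  by (rule esum_le_wnorm; auto simp: hnn_rel_def)+

lemma A_central: "cls FZ (w @ gen_pow gA z) = cls FZ (gen_pow gA z @ w)"
proof -
  let ?G = "PG FZ" and ?a = "cls FZ [(gA, True)]"
  interpret group ?G by (rule group_presented_group)
  have gen: "?a \<otimes>\<^bsub>?G\<^esub> cls FZ [(x, True)] = cls FZ [(x, True)] \<otimes>\<^bsub>?G\<^esub> ?a" for x
    using hnn_AB_commute[of 1 0 1 0] hT_hP[of 1 0 1 0] by (cases x) (simp_all add: hT_def hP_def gen_pow_def)
  have "?a [^]\<^bsub>?G\<^esub> z \<otimes>\<^bsub>?G\<^esub> cls FZ w = cls FZ w \<otimes>\<^bsub>?G\<^esub> ?a [^]\<^bsub>?G\<^esub> z"
  proof (induction w)
    case Nil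
    then show ?case by (simp add: one_presented[symmetric])
  next
    case (Cons l w)
    obtain x e where l: "l = (x, e)" by (cases l)
    have xt: "?a [^]\<^bsub>?G\<^esub> z \<otimes>\<^bsub>?G\<^esub> cls FZ [(x, True)] = cls FZ [(x, True)] \<otimes>\<^bsub>?G\<^esub> ?a [^]\<^bsub>?G\<^esub> z"
      by (rule commute_int_pow[OF _ _ gen]) simp_all
    have le: "?a [^]\<^bsub>?G\<^esub> z \<otimes>\<^bsub>?G\<^esub> cls FZ [l] = cls FZ [l] \<otimes>\<^bsub>?G\<^esub> ?a [^]\<^bsub>?G\<^esub> z"
      using xt commute_inv[OF _ _ xt[symmetric]] by (cases e) (simp_all add: l pres_class_False)
    have "cls FZ (l # w) = cls FZ [l] \<otimes>\<^bsub>?G\<^esub> cls FZ w" by (simp add: mult_pres_class)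
    then show ?case using Cons.IH le by (metis int_pow_closed m_assoc pres_class_closed)
  qed
  then show ?thesis by (simp add: pres_class_append pres_class_gen_pow)
qed

lemma FZ_normal_form: "cls FZ w = cls FZ (drop_A w @ gen_pow gA (aexp w))"
proof (induction w rule: rev_induct)
  case (snoc l w)
  obtain x e where l: "l = (x, e)" by (cases l)
  have 1: "cls FZ (w @ [l]) = cls FZ (drop_A w @ gen_pow gA (aexp w) @ [l])"
    using pres_class_cong[OF snoc.IH, of "[l]"] by simp
  show ?case
  proof (cases "x = gA")
    case True
    have "pres_eq FZ (gen_pow gA (aexp w) @ [l]) (gen_pow gA (aexp (w @ [l])))"
      using area_pres_eq[OF area_gen_pow_Suc[of FZ gA "aexp w" e]] True by (cases e) (simp_all add: l)
    then have "cls FZ (gen_pow gA (aexp w) @ [l]) = cls FZ (gen_pow gA (aexp (w @ [l])))"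
      by (simp only: pres_class_eq_iff)
    then show ?thesis unfolding 1 using True by (simp add: l pres_class_append)
  next
    case False
    have "aexp (w @ [l]) = aexp w" "drop_A (w @ [l]) = drop_A w @ [l]" using False by (simp_all add: l)
    then show ?thesis unfolding 1 using A_central[of "[l]" "aexp w"] by (simp add: pres_class_append)
  qed
qed simp

lemma texp_drop_A: "texp (drop_A w) = texp w" and aexp_drop_A: "aexp (drop_A w) = 0"
  by (induction w) auto

text \<open>Three legs, each guarded by a quantity that bounds the norm from below: the first raises
  a small \<open>A\<close>-exponent to \<open>r\<close> while the free part is large, the second
  replaces the free part by \<open>T^r\<close> at this exponent, the third brings the exponent to 0
  while the \<open>T\<close>-exponent is \<open>r\<close>. Two points are then connected through the
  common hub \<open>T^r\<close>.\<close>

lemma far_to_hub: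
  assumes w: "8 * r + 8 \<le> wnorm FZ w"
  obtains v where "far FZ r w v" "cls FZ (w @ v) = cls FZ (replicate r (gT, True))"
    "length v \<le> 2 * wnorm FZ w + 4 * r"
proof -
  obtain w' where w': "pres_eq FZ w w'" "length w' = wnorm FZ w" by (rule word_length_presented_attained)
  have ww: "cls FZ w = cls FZ w'" using w'(1) by (simp only: pres_class_eq_iff)
  define z u where "z = aexp w'" and "u = drop_A w'"
  have zle: "\<bar>z\<bar> \<le> int (wnorm FZ w)" using aexp_le_wnorm[of w'] by (simp add: z_def ww)
  have ule: "length u \<le> wnorm FZ w" using w'(2) by (simp add: u_def flip: w'(2))
  define v1 where "v1 = (if int r \<le> \<bar>z\<bar> then [] else gen_pow gA (int r - z))"
  define z1 where "z1 = (if int r \<le> \<bar>z\<bar> then z else int r)"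
  define v2 where "v2 = inv_word u @ replicate r (gT, True)"
  define v3 where "v3 = gen_pow gA (- z1)"
  have z1: "int r \<le> \<bar>z1\<bar>" "aexp (w' @ v1) = z1" "\<bar>z1\<bar> \<le> int (wnorm FZ w) + int r"
    using zle by (auto simp: z1_def v1_def z_def)
  have f1: "far FZ r w' v1"
    unfolding far_def
  proof
    fix i
    show "r \<le> wnorm FZ (w' @ take i v1)"
    proof (cases "int r \<le> \<bar>z\<bar>")
      case True
      then show ?thesis using w by (simp add: v1_def ww)
    next
      case False
      \<comment> \<open>With an \<open>A\<close>-exponent below \<open>r\<close> in absolute value,
        at least \<open>7 * r + 8\<close> of the norm lies in the free part, which this leg does not
        touch.\<close>
      have "wnorm FZ w \<le> wnorm FZ u + nat \<bar>z\<bar>"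
        using wnorm_append[of FZ u "gen_pow gA z"] FZ_normal_form[of w'] by (simp add: ww u_def z_def gen_pow_def)
      moreover have "drop_A (take i v1) = []" using False by (auto simp: v1_def gen_pow_def filter_empty_conv dest: in_set_takeD)
      then have "wnorm FZ u \<le> wnorm FZ (w' @ take i v1)" using wnorm_drop_A[of "w' @ take i v1"] by (simp add: u_def)
      ultimately show ?thesis using w False by linarith
    qed
  qed
  have f2: "far FZ r (w' @ v1) v2"
    unfolding far_def
  proof
    fix i
    have "drop_A v2 = v2" unfolding filter_id_conv by (auto simp: v2_def u_def inv_word_def)
    then have "drop_A (take i v2) = take i v2" by (metis filter_id_conv in_set_takeD)
    then have "aexp (take i v2) = 0" using aexp_drop_A[of "take i v2"] by simp
    then have "aexp ((w' @ v1) @ take i v2) = z1" using z1(2) by simp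
    then show "r \<le> wnorm FZ ((w' @ v1) @ take i v2)" using aexp_le_wnorm[of "(w' @ v1) @ take i v2"] z1(1) by linarith
  qed
  have f3: "far FZ r ((w' @ v1) @ v2) v3"
    unfolding far_def
  proof
    fix i
    have "texp v1 = 0" by (simp add: v1_def)
    moreover have "texp v2 = int r - texp w'" by (simp add: v2_def esum_replicate u_def texp_drop_A)
    moreover have "drop_A (take i v3) = []" by (auto simp: v3_def gen_pow_def filter_empty_conv dest: in_set_takeD)
    then have "texp (take i v3) = 0" using texp_drop_A[of "take i v3"] by simp
    ultimately have "texp (((w' @ v1) @ v2) @ take i v3) = int r" by simp
    then show "r \<le> wnorm FZ (((w' @ v1) @ v2) @ take i v3)" using texp_le_wnorm[of "((w' @ v1) @ v2) @ take i v3"] by linarith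
  qed
  show ?thesis
  proof (rule that)
    show "far FZ r w (v1 @ v2 @ v3)"
      unfolding far_cong[OF ww] by (rule far_append[OF f1 far_append[OF f2 f3]])
    have d: "drop_A (w' @ v1) = u" by (auto simp: v1_def gen_pow_def u_def)
    have "cls FZ (w' @ v1) = cls FZ (u @ gen_pow gA z1)" using FZ_normal_form[of "w' @ v1"] d z1(2) by (simp only:)
    also have "\<dots> = cls FZ (gen_pow gA z1 @ u)" by (rule A_central)
    finally have "cls FZ ((w' @ v1) @ v2 @ v3) = cls FZ (gen_pow gA z1 @ (u @ inv_word u) @ (replicate r (gT, True) @ gen_pow gA (- z1)))"
      using pres_class_cong[of FZ "w' @ v1" "gen_pow gA z1 @ u" "v2 @ v3"] by (simp add: v2_def v3_def)
    also have "\<dots> = cls FZ (gen_pow gA z1 @ gen_pow gA (- z1) @ replicate r (gT, True))"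
      using inv_word_right[of FZ u] A_central[of "replicate r (gT, True)" "- z1"]
      by (simp only: pres_class_append pres_class_eq_iff[symmetric]) (simp only: pres_class_append[symmetric] append_Nil)
    also have "\<dots> = cls FZ (replicate r (gT, True))"
    proof -
      interpret group "PG FZ" by (rule group_presented_group)
      show ?thesis by (simp add: pres_class_append pres_class_gen_pow int_pow_neg m_assoc[symmetric])
    qed
    finally show "cls FZ (w @ v1 @ v2 @ v3) = cls FZ (replicate r (gT, True))"
      using pres_class_cong[OF ww, of "v1 @ v2 @ v3"] by simp
    show "length (v1 @ v2 @ v3) \<le> 2 * wnorm FZ w + 4 * r"
      using ule z1(3) by (auto simp: v1_def v2_def v3_def gen_pow_def)
  qed
qed

theorem linear_divergence_FZ: "linear_divergence (carrier (PG FZ)) (pdist FZ)"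
  unfolding linear_divergence_def
proof (rule exI[of _ 8], intro conjI ballI allI impI)
  fix p x y and r :: nat
  let ?X = "carrier (PG FZ)"
  assume p: "p \<in> ?X" and x: "x \<in> ?X" and y: "y \<in> ?X"
    and far: "real (8 * r + 8) \<le> pdist FZ p x \<and> real (8 * r + 8) \<le> pdist FZ p y"
  obtain z where z: "p = cls FZ z" using p by (auto elim: pres_class_cases)
  have rep: "\<exists>w. x = cls FZ (z @ w)" if x: "x \<in> ?X" for x
  proof -
    obtain w where "x = cls FZ w" using x by (auto elim: pres_class_cases)
    then have "x = cls FZ (z @ inv_word z @ w)"
      using pres_eq.cong[OF inv_word_right[of FZ z] pres_eq.refl[of FZ w]] by (simp add: pres_class_eq_iff pres_eq.sym)
    then show ?thesis by blast
  qed
  obtain u where u: "x = cls FZ (z @ u)" using rep[OF x] by blast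
  obtain w where w: "y = cls FZ (z @ w)" using rep[OF y] by blast
  have du: "pdist FZ p x = real (wnorm FZ u)" and dw: "pdist FZ p y = real (wnorm FZ w)"
    unfolding z u w by (rule pdist_wnorm)+
  have "8 * r + 8 \<le> wnorm FZ u" "8 * r + 8 \<le> wnorm FZ w" using far unfolding du dw of_nat_le_iff by blast+
  note hub = far_to_hub[OF this(1)] far_to_hub[OF this(2)]
  obtain v where v: "far FZ r u v" "cls FZ (u @ v) = cls FZ (replicate r (gT, True))"
    "length v \<le> 2 * wnorm FZ u + 4 * r" by (rule hub(1))
  obtain v' where v': "far FZ r w v'" "cls FZ (w @ v') = cls FZ (replicate r (gT, True))"
    "length v' \<le> 2 * wnorm FZ w + 4 * r" by (rule hub(2))
  define V where "V = v @ inv_word v'"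
  have uv: "cls FZ (u @ v) = cls FZ (w @ v')" using v v' by simp
  have fV: "far FZ r u V" unfolding V_def
    by (rule far_append[OF v(1)]) (use far_inv_word[OF v'(1)] far_cong[OF uv] in simp)
  have "cls FZ (u @ V) = cls FZ (w @ v' @ inv_word v')" using pres_class_cong[OF uv, of "inv_word v'"] by (simp add: V_def)
  also have "\<dots> = cls FZ w" using pres_eq.cong[OF pres_eq.refl[of FZ w] inv_word_right[of FZ v']] by (simp add: pres_class_eq_iff)
  finally have e: "cls FZ (z @ u @ V) = y" by (simp add: w pres_class_append)
  define q where "q = (\<lambda>i. cls FZ (z @ u @ take i V))"
  show "\<exists>n q. q 0 = x \<and> q n = y \<and> real n \<le> real 8 * (pdist FZ p x + pdist FZ p y + real r + 1) \<and>
      avoiding_path ?X (pdist FZ) p (real r) (real 8) n q"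
  proof (rule exI[of _ "length V"], rule exI[of _ q], intro conjI)
    show "q 0 = x" "q (length V) = y" by (simp_all add: q_def u e)
    show "real (length V) \<le> real 8 * (pdist FZ p x + pdist FZ p y + real r + 1)"
      using v(3) v'(3) unfolding du dw by (simp add: V_def)
    show "avoiding_path ?X (pdist FZ) p (real r) (real 8) (length V) q"
      unfolding avoiding_path_def
    proof (intro conjI allI impI)
      show "q i \<in> ?X" for i by (simp add: q_def)
      show "real r \<le> pdist FZ p (q i)" for i
        using fV unfolding q_def z pdist_wnorm far_def of_nat_le_iff by blast
      show "pdist FZ (q i) (q (Suc i)) \<le> real 8" if "i < length V" for i
        using pdist_le[of FZ "z @ u @ take i V" "[V ! i]"] that by (simp add: q_def take_Suc_conv_app_nth)
    qed
  qed
qed simp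

text \<open>In the transverse group, the flats \<open>T\<^sup>i \<langle>A, B\<rangle>\<close> are glued along their axes \<open>B\<close> and \<open>A\<close>.
  \<open>loc\<close> returns the index of the flat of this row from which an element branches off, and the first
  syllable of the branch.\<close>

fun loc :: "(int \<times> bool) list \<Rightarrow> nat \<times> (int \<times> bool) option" where
  "loc [] = (0, None)"
| "loc (c # ds) = (case loc ds of (j, None) \<Rightarrow> if c = (0, True) then (Suc j, None) else (j, Some c)
     | (j, Some f) \<Rightarrow> (j, Some f))"

text \<open>The position \<open>\<bar>Y\<bar> - \<bar>X\<bar>\<close> of the projection \<open>(X, Y)\<close> to the flat.  A branch is attached along an axis,
  and the unknown coordinate on the axis is read off from the homomorphism \<open>A, B \<mapsto> 1\<close>, \<open>T \<mapsto> 0\<close>.\<close>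

fun crossing :: "(int \<times> bool) option \<Rightarrow> int \<Rightarrow> int \<Rightarrow> int \<Rightarrow> int" where
  "crossing None h x y = \<bar>y\<bar> - \<bar>x\<bar>"
| "crossing (Some (d, e)) h x y = (if e then \<bar>h - d\<bar> - \<bar>d\<bar> else \<bar>d\<bar> - \<bar>h - d\<bar>)"

definition clamp :: "int \<Rightarrow> int \<Rightarrow> int" where
  "clamp k v = max (- k) (min k v)"

fun hsum :: "flat_state \<Rightarrow> int" where
  "hsum (ds, x, y) = (\<Sum>(d, e)\<leftarrow>ds. d) + x + y"

text \<open>Half the change charged for passing flat \<open>i\<close> outside the ball of radius
  \<open>r\<close> around \<open>T^N\<close>. The 1 is subtracted so that, on the axis shared by two
  consecutive flats, the bound holds for both indices.\<close>

definition width :: "nat \<Rightarrow> nat \<Rightarrow> nat \<Rightarrow> int" where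
  "width N r i = max 0 (int r - \<bar>int i - int N\<bar> - 1)"

text \<open>A potential that, far from the ball, grows by twice the width from the
  \<open>A\<close>-axis of a flat to its \<open>B\<close>-axis: the two sums differ by the current
  flat, so the clamp moves the value between twice the widths below \<open>j\<close> and twice the
  widths up to \<open>j\<close>.\<close>

definition cross :: "nat \<Rightarrow> nat \<Rightarrow> flat_state \<Rightarrow> int" where
  "cross N r \<sigma> = (case \<sigma> of (ds, x, y) \<Rightarrow> case loc ds of (j, f) \<Rightarrow>
     sum (width N r) {..<j} + sum (width N r) {..<Suc j} + clamp (width N r j) (crossing f (hsum \<sigma>) x y))"

lemma loc_None: "loc ds = (j, None) \<Longrightarrow> ds = replicate j (0, True)"
  by (induction ds arbitrary: j) (auto split: prod.splits option.splits if_splits)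

lemma loc_replicate: "loc (replicate j (0, True)) = (j, None)"
  by (induction j) auto

lemma width_nonneg: "0 \<le> width N r i"
  by (simp add: width_def)

interpretation G0: flat_hnn True .

text \<open>On entering a branch or inside one, a letter \<open>T\<close> changes neither the
  projection to the flat nor \<open>hsum\<close>. Between two flats of the row it passes from the
  \<open>B\<close>-axis of one to the \<open>A\<close>-axis of the next; far enough out both clamps
  are saturated and the values agree.\<close>

lemma cross_T:
  assumes "\<And>j. fst \<sigma> = replicate j (0, True) \<Longrightarrow> fst (snd \<sigma>) = 0 \<Longrightarrow>
    width N r j \<le> \<bar>snd (snd \<sigma>)\<bar> \<and> width N r (Suc j) \<le> \<bar>snd (snd \<sigma>)\<bar>"
  shows "cross N r (G0.stp \<sigma> (gT, True)) = cross N r \<sigma>"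
proof -
  obtain ds x y where \<sigma>: "\<sigma> = (ds, x, y)" by (cases \<sigma>)
  show ?thesis
  proof (cases "x = 0 \<and> (\<exists>d ds'. ds = (d, False) # ds')")
    case True
    then obtain d ds' where ds: "ds = (d, False) # ds'" and x: "x = 0" by blast
    have st: "G0.stp \<sigma> (gT, True) = (ds', y, d)" by (simp add: \<sigma> ds x Let_def)
    obtain j f where l: "loc ds' = (j, f)" by (cases "loc ds'")
    show ?thesis
    proof (cases f)
      case None
      then have "ds' = replicate j (0, True)" using l loc_None by simp
      then have "(\<Sum>(d, e)\<leftarrow>ds'. d) = 0" by (simp add: sum_list_replicate)
      then show ?thesis unfolding st using None l by (simp add: cross_def \<sigma> ds x)
    next
      case (Some g)
      then show ?thesis unfolding st using l by (cases g) (auto simp: cross_def \<sigma> ds x ac_simps)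
    qed
  next
    case False
    then have st: "G0.stp \<sigma> (gT, True) = ((x, True) # ds, y, 0)"
      by (cases ds rule: G0.syl_cases) (auto simp: \<sigma> Let_def)
    obtain j f where l: "loc ds = (j, f)" by (cases "loc ds")
    show ?thesis
    proof (cases f)
      case None
      then have ds: "ds = replicate j (0, True)" using l loc_None by simp
      show ?thesis
      proof (cases "x = 0")
        case True
        then have c: "width N r j \<le> \<bar>y\<bar>" "width N r (Suc j) \<le> \<bar>y\<bar>" using assms[of j] by (simp_all add: \<sigma> ds)
        have "clamp (width N r j) \<bar>y\<bar> = width N r j" "clamp (width N r (Suc j)) (- \<bar>y\<bar>) = - width N r (Suc j)"
          using c width_nonneg[of N r j] width_nonneg[of N r "Suc j"] by (auto simp: clamp_def)
        then show ?thesis unfolding st using None l True by (simp add: cross_def \<sigma>)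
      next
        case F: False
        have "(\<Sum>(d, e)\<leftarrow>ds. d) = 0" using ds by (simp add: sum_list_replicate)
        then show ?thesis unfolding st using None l F by (simp add: cross_def \<sigma>)
      qed
    next
      case (Some g)
      then show ?thesis unfolding st using l by (cases g) (auto simp: cross_def \<sigma> ac_simps)
    qed
  qed
qed

lemma clamp_lipschitz: "\<bar>clamp k v - clamp k w\<bar> \<le> \<bar>v - w\<bar>"
  by (auto simp: clamp_def)

lemma cross_AB: assumes "x \<noteq> gT" shows "\<bar>cross N r (G0.stp \<sigma> (x, e)) - cross N r \<sigma>\<bar> \<le> 1"
proof -
  obtain ds i k where \<sigma>: "\<sigma> = (ds, i, k)" by (cases \<sigma>)
  obtain i' k' where st: "G0.stp \<sigma> (x, e) = (ds, i', k')" and d: "\<bar>i' - i\<bar> + \<bar>k' - k\<bar> \<le> 1"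
    using assms by (cases x) (auto simp: \<sigma>)
  obtain j f where l: "loc ds = (j, f)" by (cases "loc ds")
  have "\<bar>crossing f (hsum (ds, i', k')) i' k' - crossing f (hsum (ds, i, k)) i k\<bar> \<le> 1"
  proof (cases f)
    case None
    have "\<bar>\<bar>k'\<bar> - \<bar>i'\<bar> - (\<bar>k\<bar> - \<bar>i\<bar>)\<bar> \<le> 1" using d by arith
    then show ?thesis by (simp add: None)
  next
    case (Some g)
    obtain d' e' where g: "g = (d', e')" by (cases g)
    have "\<bar>hsum (ds, i', k') - hsum (ds, i, k)\<bar> \<le> 1" using d by simp
    then have "\<bar>\<bar>hsum (ds, i', k') - d'\<bar> - \<bar>hsum (ds, i, k) - d'\<bar>\<bar> \<le> 1" by arith
    then show ?thesis by (cases e') (auto simp: Some g simp del: hsum.simps)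
  qed
  then show ?thesis
    using clamp_lipschitz[of "width N r j" "crossing f (hsum (ds, i', k')) i' k'" "crossing f (hsum (ds, i, k)) i k"]
    unfolding st by (simp add: cross_def \<sigma> l)
qed

section \<open>Quadratic detours in the transverse group\<close>

abbreviation "TR \<equiv> hnn_rel 0 1 1 0"
abbreviation "tpow N \<equiv> replicate N (gT, True)"

lemma pres_class_nwd: "cls TR w = cls TR (G0.nwd (G0.nst w))"
  using G0.area_nf[of w] area_pres_eq by (auto simp: area_le_def pres_class_eq_iff)

lemma syls_replicate: "G0.syls (replicate j (0, True)) = tpow j"
  by (induction j) (auto simp: replicate_append_same)

lemma axis_wnorm:
  assumes "G0.nst w = (replicate j (0, True), 0, y)"
  shows "int (wnorm TR (inv_word (tpow N) @ w)) \<le> \<bar>int j - int N\<bar> + \<bar>y\<bar>"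
proof -
  interpret group "PG TR" by (rule group_presented_group)
  have "cls TR w = cls TR (tpow j @ gen_pow gB y)"
    using pres_class_nwd[of w] by (simp add: assms syls_replicate)
  then have "cls TR (inv_word (tpow N) @ w) = cls TR (inv_word (tpow N) @ tpow j @ gen_pow gB y)"
    by (simp add: pres_class_append)
  also have "\<dots> = cls TR (gen_pow gT (int j - int N) @ gen_pow gB y)"
  proof -
    have "tpow i = gen_pow gT (int i)" for i by (simp add: gen_pow_def)
    then have "cls TR (inv_word (tpow N) @ tpow j) = cls TR (gen_pow gT (int j - int N))"
      by (simp only: pres_class_append inv_pres_class[symmetric] pres_class_gen_pow)
         (simp add: int_pow_neg[symmetric] int_pow_mult[symmetric])
    then show ?thesis by (simp add: pres_class_append m_assoc[symmetric])
  qed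
  finally have "wnorm TR (inv_word (tpow N) @ w) \<le> length (gen_pow gT (int j - int N) @ gen_pow gB y)"
    by (simp only: word_length_presented_le)
  then show ?thesis by (simp add: gen_pow_def)
qed

lemma width_le_axis:
  assumes "G0.nst w = (replicate j (0, True), 0, y)" "r \<le> wnorm TR (inv_word (tpow N) @ w)"
  shows "width N r j \<le> \<bar>y\<bar> \<and> width N r (Suc j) \<le> \<bar>y\<bar>"
  using axis_wnorm[OF assms(1), of N] assms(2) by (auto simp: width_def)

text \<open>A letter \<open>T^-1\<close> is a letter \<open>T\<close> read backwards from the other
  end point, which is why both ends have to be far away.\<close>

lemma cross_edge:
  assumes "r \<le> wnorm TR (inv_word (tpow N) @ w)" "r \<le> wnorm TR (inv_word (tpow N) @ w @ [l])"
  shows "\<bar>cross N r (G0.nst (w @ [l])) - cross N r (G0.nst w)\<bar> \<le> 1"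
proof (cases l rule: G0.stp_cases)
  case (A e)
  then show ?thesis using cross_AB[of gA N r "G0.nst w" e] by simp
next
  case (B e)
  then show ?thesis using cross_AB[of gB N r "G0.nst w" e] by simp
next
  case T
  have "cross N r (G0.stp (G0.nst w) (gT, True)) = cross N r (G0.nst w)"
    by (rule cross_T) (metis assms(1) prod.collapse width_le_axis)
  then show ?thesis by (simp add: T)
next
  case T'
  have "cross N r (G0.stp (G0.nst (w @ [l])) (gT, True)) = cross N r (G0.nst (w @ [l]))"
    by (rule cross_T) (metis assms(2) prod.collapse width_le_axis)
  moreover have "G0.stp (G0.nst (w @ [l])) (gT, True) = G0.nst w"
    using G0.stp_cancel[OF G0.nst_States, of w gT False] by (simp add: T')
  ultimately show ?thesis by simp
qed

lemma cross_far: "far TR r (inv_word (tpow N) @ w) v \<Longrightarrow> \<bar>cross N r (G0.nst (w @ v)) - cross N r (G0.nst w)\<bar> \<le> int (length v)"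
proof (induction v arbitrary: w)
  case (Cons l v)
  have f: "r \<le> wnorm TR ((inv_word (tpow N) @ w) @ take i (l # v))" for i using Cons.prems unfolding far_def by blast
  have "\<bar>cross N r (G0.nst (w @ [l])) - cross N r (G0.nst w)\<bar> \<le> 1"
    by (rule cross_edge) (use f[of 0] f[of 1] in simp_all)
  moreover have "far TR r (inv_word (tpow N) @ (w @ [l])) v" unfolding far_def
  proof
    show "r \<le> wnorm TR ((inv_word (tpow N) @ w @ [l]) @ take i v)" for i using f[of "Suc i"] by simp
  qed
  from Cons.IH[OF this] have "\<bar>cross N r (G0.nst ((w @ [l]) @ v)) - cross N r (G0.nst (w @ [l]))\<bar> \<le> int (length v)" .
  ultimately show ?case by simp
qed simp

lemma nst_cong: "cls TR u = cls TR v \<Longrightarrow> G0.nst u = G0.nst v"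
  using G0.nst_pres_eq[of u v] by (simp add: pres_class_eq_iff)

lemma nst_tpow: "G0.nst (tpow m) = (replicate m (0, True), 0, 0)"
proof (induction m)
  case 0
  then show ?case by (simp add: G0.base_def)
next
  case (Suc m)
  have "tpow (Suc m) = tpow m @ [(gT, True)]" by (simp add: replicate_append_same)
  then have "G0.nst (tpow (Suc m)) = G0.stp (replicate m (0, True), 0, 0) (gT, True)" using Suc by (simp del: replicate.simps)
  then show ?case by (cases m) (simp_all add: Let_def)
qed

lemma cross_tpow: "cross N r (G0.nst (tpow m)) = sum (width N r) {..<m} + sum (width N r) {..<Suc m}"
  using width_nonneg[of N r m] by (simp add: nst_tpow cross_def loc_replicate clamp_def)

text \<open>The \<open>2 * k + 1\<close> flats around \<open>T^N\<close> have width at least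
  \<open>k\<close> each, and every one counts twice.\<close>

lemma cross_total:
  assumes "2 * k + 1 \<le> N"
  shows "int (4 * k * k) \<le> cross N (2 * k + 1) (G0.nst (tpow (2 * N))) - cross N (2 * k + 1) (G0.nst (tpow 0))"
proof -
  let ?w = "width N (2 * k + 1)"
  have "int k \<le> ?w i" if "i \<in> {N - k..N + k}" for i
  proof -
    have "\<bar>int i - int N\<bar> \<le> int k" using that assms by (simp add: abs_le_iff) linarith
    then show ?thesis by (simp add: width_def)
  qed
  then have "of_nat (card {N - k..N + k}) * int k \<le> sum ?w {N - k..N + k}" by (rule sum_bounded_below)
  also have "\<dots> \<le> sum ?w {..<2 * N}" using assms by (intro sum_mono2) (auto simp: width_nonneg)
  finally have "int (2 * k * k) \<le> sum ?w {..<2 * N}" using assms by (simp add: algebra_simps)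
  moreover have "?w 0 = 0" using assms by (simp add: width_def)
  ultimately show ?thesis using width_nonneg[of N "2 * k + 1" "2 * N"] unfolding cross_tpow by simp
qed

lemma wnorm_append': "wnorm (R :: ('g::finite word \<times> 'g word) set) u \<le> wnorm R (u @ v) + length v"
proof -
  have "cls R u = cls R ((u @ v) @ inv_word v)"
    using pres_eq.cong[OF pres_eq.refl[of R u] inv_word_right[of R v]] by (simp add: pres_class_eq_iff pres_eq.sym)
  then show ?thesis using wnorm_append[of R "u @ v" "inv_word v"] by simp
qed

theorem not_linear_divergence_TR: "\<not> linear_divergence (carrier (PG TR)) (pdist TR)"
proof
  let ?X = "carrier (PG TR)"
  assume "linear_divergence ?X (pdist TR)"
  then obtain L :: nat where L: "L \<ge> 1" and path: "\<forall>p\<in>?X. \<forall>x\<in>?X. \<forall>y\<in>?X. \<forall>R::nat.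
     real (L * R + L) \<le> pdist TR p x \<and> real (L * R + L) \<le> pdist TR p y \<longrightarrow>
     (\<exists>n q. q 0 = x \<and> q n = y \<and> real n \<le> real L * (pdist TR p x + pdist TR p y + real R + 1) \<and> avoiding_path ?X (pdist TR) p (real R) (real L) n q)"
    unfolding linear_divergence_def by blast
  \<comment> \<open>A detour of linear length would make \<open>4 * k * k\<close> at most
    \<open>D * (2 * k + 2 + L)\<close>; \<open>k\<close> is a multiple of \<open>D\<close> large
    enough to violate this.\<close>
  define D where "D = L * L * (2 * L + 1)"
  define k where "k = D * (L + 2)"
  define r where "r = 2 * k + 1"
  \<comment> \<open>Consecutive points of the path may be \<open>L\<close> apart; the margin keeps
    the words between them outside radius \<open>r\<close>.\<close>
  define R where "R = r + L"
  define N where "N = L * R + L"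
  define F where "F = (\<lambda>w. cross N r (G0.nst w))"
  have dist: "pdist TR (cls TR (tpow N)) (cls TR w) = real (wnorm TR (inv_word (tpow N) @ w))" for w
  proof -
    have "cls TR (tpow N @ inv_word (tpow N) @ w) = cls TR w"
      using pres_eq.cong[OF inv_word_right[of TR "tpow N"] pres_eq.refl[of TR w]] by (simp add: pres_class_eq_iff)
    then show ?thesis using pdist_wnorm[of TR "tpow N" "inv_word (tpow N) @ w"] by simp
  qed
  have w1: "wnorm TR (inv_word (tpow N) @ tpow 0) = N" and w2: "wnorm TR (inv_word (tpow N) @ tpow (2 * N)) = N"
  proof -
    have te: "\<bar>texp w\<bar> \<le> int (wnorm TR w)" for w by (rule esum_le_wnorm) (auto simp: hnn_rel_def)
    have "int (wnorm TR (inv_word (tpow N) @ tpow 0)) \<le> N" "int (wnorm TR (inv_word (tpow N) @ tpow (2 * N))) \<le> N"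
      using axis_wnorm[OF nst_tpow[of 0], of N] axis_wnorm[OF nst_tpow[of "2 * N"], of N] by simp_all
    then show "wnorm TR (inv_word (tpow N) @ tpow 0) = N" "wnorm TR (inv_word (tpow N) @ tpow (2 * N)) = N"
      using te[of "inv_word (tpow N) @ tpow 0"] te[of "inv_word (tpow N) @ tpow (2 * N)"] by (auto simp: esum_replicate)
  qed
  obtain n q where q: "q 0 = cls TR (tpow 0)" "q n = cls TR (tpow (2 * N))"
    "real n \<le> real L * (real N + real N + real R + 1)"
    "avoiding_path ?X (pdist TR) (cls TR (tpow N)) (real R) (real L) n q"
    using path[rule_format, OF pres_class_closed[of TR "tpow N"] pres_class_closed[of TR "tpow 0"] pres_class_closed[of TR "tpow (2 * N)"], of R]
    unfolding dist w1 w2 by (auto simp: N_def)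
  have "\<exists>w. q j = cls TR w \<and> \<bar>F w - F (tpow 0)\<bar> \<le> int (L * j)" if "j \<le> n" for j using that
  proof (induction j)
    case 0
    then show ?case using q(1) by (intro exI[of _ "tpow 0"]) simp
  next
    case (Suc j)
    then obtain w where w: "q j = cls TR w" "\<bar>F w - F (tpow 0)\<bar> \<le> int (L * j)" by auto
    have "q (Suc j) \<in> ?X" using q(4) Suc.prems by (simp add: avoiding_path_def)
    then obtain z where z: "q (Suc j) = cls TR z" by (auto elim: pres_class_cases)
    obtain v where v: "pres_eq TR (w @ v) z" "length v = pdist TR (cls TR w) (cls TR z)"
      by (rule pdist_attained)
    have "pdist TR (q j) (q (Suc j)) \<le> real L" using q(4) Suc.prems by (simp add: avoiding_path_def)
    then have lv: "length v \<le> L" using v(2) unfolding w z by simp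
    have "real R \<le> pdist TR (cls TR (tpow N)) (q j)" using q(4) Suc.prems by (simp add: avoiding_path_def)
    then have "r + L \<le> wnorm TR (inv_word (tpow N) @ w)" unfolding w(1) dist R_def by simp
    then have "far TR r (inv_word (tpow N) @ w) v" unfolding far_def
    proof (intro allI)
      fix i
      assume h: "r + L \<le> wnorm TR (inv_word (tpow N) @ w)"
      have "length (take i v) \<le> L" using lv by simp
      then show "r \<le> wnorm TR ((inv_word (tpow N) @ w) @ take i v)"
        using h wnorm_append'[of TR "inv_word (tpow N) @ w" "take i v"] by linarith
    qed
    from cross_far[OF this] have "\<bar>F (w @ v) - F w\<bar> \<le> int (length v)" by (simp add: F_def)
    moreover have "q (Suc j) = cls TR (w @ v)" using v(1) z by (simp add: pres_class_eq_iff pres_eq.sym)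
    ultimately show ?case using w(2) lv by (intro exI[of _ "w @ v"]) (simp add: algebra_simps)
  qed
  from this[of n] obtain w where "q n = cls TR w" "\<bar>F w - F (tpow 0)\<bar> \<le> int (L * n)" by auto
  then have "\<bar>F (tpow (2 * N)) - F (tpow 0)\<bar> \<le> int (L * n)" using nst_cong[of w "tpow (2 * N)"] q(2) by (simp add: F_def)
  moreover have "2 * k + 1 \<le> N"
  proof -
    have "1 * R \<le> L * R" by (rule mult_le_mono1[OF L])
    then show ?thesis unfolding N_def by (simp add: R_def r_def)
  qed
  from cross_total[OF this] have "int (4 * k * k) \<le> F (tpow (2 * N)) - F (tpow 0)" by (simp add: F_def r_def)
  ultimately have "4 * k * k \<le> L * n" by linarith
  moreover have "n \<le> L * (N + N + R + 1)"
  proof -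
    have "real n \<le> real (L * (N + N + R + 1))" using q(3) by (simp add: algebra_simps)
    then show ?thesis by (simp only: of_nat_le_iff)
  qed
  then have "L * n \<le> L * (L * (N + N + R + 1))" by (rule mult_le_mono2)
  moreover have "L * (L * (N + N + R + 1)) = D * (2 * k + 2 + L)"
    by (simp add: N_def R_def r_def D_def algebra_simps)
  ultimately have le: "4 * k * k \<le> D * (2 * k + 2 + L)" by linarith
  have D: "D \<ge> 1" unfolding D_def using mult_le_mono[OF mult_le_mono[OF L L], of 1 "2 * L + 1"] by simp
  have eq: "4 * k * k = D * (4 * k * (L + 2))" by (simp add: k_def algebra_simps)
  have "0 < D \<longrightarrow> 4 * k * (L + 2) \<le> 2 * k + 2 + L" using le unfolding eq mult_le_cancel1 .
  then have "4 * k * (L + 2) \<le> 2 * k + 2 + L" using D by linarith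
  moreover have "L + 2 \<le> k" using mult_le_mono1[OF D, of "L + 2"] by (simp add: k_def)
  moreover have "4 * k * 3 \<le> 4 * k * (L + 2)" using L by (intro mult_le_mono2) simp
  ultimately show False by linarith
qed

section \<open>The three quasi-isometry classes\<close>

lemma not_quasi_isometric_cubic:
  fixes R :: "('g::finite word \<times> 'g word) set" and R' :: "('h::finite word \<times> 'h word) set"
  assumes "cubic_filling (carrier (PG R')) (pdist R')" "\<not> cubic_filling (carrier (PG R)) (pdist R)"
  shows "\<not> quasi_isometric (PG R) (PG R')"
  using assms cubic_filling_qi gen_group.pseudometric_wd[OF gen_group_presented] gen_group.pseudometric_wd[OF gen_group_presented]
  unfolding quasi_isometric_presented by blast

lemma not_quasi_isometric_divergence:
  fixes R :: "('g::finite word \<times> 'g word) set" and R' :: "('h::finite word \<times> 'h word) set"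
  assumes "linear_divergence (carrier (PG R')) (pdist R')" "\<not> linear_divergence (carrier (PG R)) (pdist R)"
  shows "\<not> quasi_isometric (PG R) (PG R')"
  using assms linear_divergence_qi gen_group.pseudometric_wd[OF gen_group_presented] gen_group.pseudometric_wd[OF gen_group_presented]
  unfolding quasi_isometric_presented by blast

lemma classes_not_quasi_isometric:
  "\<not> quasi_isometric (hnn_group (1, 0) (2, 0)) (hnn_group (0, 1) (1, 0))"
  "\<not> quasi_isometric (hnn_group (1, 0) (2, 0)) (hnn_group (1, 0) (1, 0))"
  "\<not> quasi_isometric (hnn_group (0, 1) (1, 0)) (hnn_group (1, 0) (1, 0))"
  unfolding hnn_group_eq
  using not_quasi_isometric_cubic[OF _ not_cubic_filling_BS12] flat_hnn.cubic_filling_QR[of True] flat_hnn.cubic_filling_QR[of False]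
    not_quasi_isometric_divergence[OF linear_divergence_FZ not_linear_divergence_TR] by simp_all

text \<open>Lagrange's identity: the inner product and the determinant cannot both vanish.\<close>

lemma collinear_inner_nonzero:
  fixes k l m n :: int
  assumes "(k, l) \<noteq> (0, 0)" "(m, n) \<noteq> (0, 0)" "k * n - l * m = 0"
  shows "k * m + l * n \<noteq> 0"
proof
  assume "k * m + l * n = 0"
  then have "(k^2 + l^2) * (m^2 + n^2) = 0" using assms(3) by algebra
  then show False using assms(1,2) by (auto simp: sum_power2_eq_zero_iff)
qed

text \<open>Multiplying the gcd by a coordinate and substituting \<open>k * n = l * m\<close>
  compares the coordinates up to sign; the two signs agree by collinearity.\<close>

lemma collinear_gcd_eq:
  fixes k l m n :: int
  assumes "(k, l) \<noteq> (0, 0)" and det: "k * n - l * m = 0" and eq: "gcd k l = gcd m n"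
  shows "(m, n) = (k, l) \<or> (m, n) = (- k, - l)"
proof -
  have kn: "k * n = l * m" using det by simp
  have "gcd k l * \<bar>m\<bar> = gcd (k * m) (l * m)" using gcd_mult_distrib_int[of m k l] by (simp add: mult.commute)
  also have "\<dots> = gcd (k * m) (k * n)" by (simp add: kn)
  also have "\<dots> = \<bar>k\<bar> * gcd m n" by (simp add: gcd_mult_distrib_int)
  finally have 1: "gcd k l * \<bar>m\<bar> = gcd k l * \<bar>k\<bar>" by (simp add: eq mult.commute)
  have "gcd k l * \<bar>n\<bar> = gcd (k * n) (l * n)" using gcd_mult_distrib_int[of n k l] by (simp add: mult.commute)
  also have "\<dots> = gcd (l * m) (l * n)" by (simp add: kn)
  also have "\<dots> = \<bar>l\<bar> * gcd m n" by (simp add: gcd_mult_distrib_int)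
  finally have 2: "gcd k l * \<bar>n\<bar> = gcd k l * \<bar>l\<bar>" by (simp add: eq mult.commute)
  have "gcd k l \<noteq> 0" using assms(1) by simp
  then have "\<bar>m\<bar> = \<bar>k\<bar>" "\<bar>n\<bar> = \<bar>l\<bar>" using 1 2 unfolding mult_cancel_left by blast+
  then show ?thesis using kn by (auto simp: abs_eq_iff)
qed

section \<open>Sorting the parameters into the three classes\<close>

lemma transverse_quasi_isometric:
  assumes "(p, q) \<in> transverse_params"
  shows "quasi_isometric (hnn_group p q) (hnn_group (0, 1) (1, 0))"
  using assms hnn_transverse_equiv unfolding transverse_params_def hnn_equiv_def by auto

lemma unimodular_quasi_isometric:
  assumes "(p, q) \<in> unimodular_params"
  shows "quasi_isometric (hnn_group p q) (hnn_group (1, 0) (1, 0))"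
proof -
  obtain k l m n where pq: "p = (k, l)" "q = (m, n)" by (cases p; cases q)
  have 0: "(k, l) \<noteq> (0, 0)" "(m, n) \<noteq> (0, 0)" and mn: "(m, n) = (k, l) \<or> (m, n) = (- k, - l)"
    using assms by (auto simp: unimodular_params_def params_def pq)
  define g where "g = gcd k l"
  have g: "g \<noteq> 0" using 0 by (simp add: g_def)
  have gm: "gcd m n = g" using mn by (auto simp: g_def)
  have det: "k * n - l * m = 0" using mn by auto
  have "\<bar>sgn (k * m + l * n)\<bar> = 1" using collinear_inner_nonzero[OF 0 det] by (simp add: abs_sgn_eq)
  then have "sgn (k * m + l * n) = 1 \<or> sgn (k * m + l * n) = -1" by linarith
  then have "hnn_equiv (sgn (k * m + l * n) * g, 0) (g, 0) (g, 0) (g, 0)"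
    using hnn_equiv_refl[of "(g, 0)" "(g, 0)"] hnn_equiv_sym[OF hnn_equiv_flip[of g g]] by auto
  with hnn_collinear_iso(2)[OF 0 det] have "hnn_equiv p q (g, 0) (g, 0)" unfolding pq gm g_def[symmetric] by (rule hnn_equiv_trans)
  moreover have "hnn_equiv (g, 0) (g, 0) (1, 0) (1, 0)" using hnn_equiv_sym[OF hnn_equiv_scale[OF g, of 1 1]] by simp
  ultimately have "hnn_equiv p q (1, 0) (1, 0)" by (rule hnn_equiv_trans)
  then show ?thesis by (simp add: hnn_equiv_def)
qed

lemma nonunimodular_iso:
  assumes "(p, q) \<in> nonunimodular_params"
  obtains m n where "m \<noteq> 0" "n \<noteq> 0" "m \<noteq> n" "m \<noteq> - n" "hnn_group p q \<cong> hnn_group (m, 0) (n, 0)" "hnn_equiv p q (m, 0) (n, 0)"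
proof -
  obtain k l m n where pq: "p = (k, l)" "q = (m, n)" by (cases p; cases q)
  have 0: "(k, l) \<noteq> (0, 0)" "(m, n) \<noteq> (0, 0)" and det: "k * n - l * m = 0"
    and mn: "(k, l) \<noteq> (m, n)" "(k, l) \<noteq> (- m, - n)"
    using assms by (auto simp: nonunimodular_params_def params_def pq)
  define s where "s = sgn (k * m + l * n)"
  have "\<bar>s\<bar> = 1" using collinear_inner_nonzero[OF 0 det] by (simp add: s_def abs_sgn_eq)
  then have s: "s = 1 \<or> s = -1" by linarith
  have "gcd k l \<noteq> gcd m n" using collinear_gcd_eq[OF 0(1) det] mn by auto
  moreover have "gcd k l > 0" "gcd m n > 0" using 0 by (simp_all add: less_le)
  moreover have "s * a \<noteq> 0 \<and> b \<noteq> 0 \<and> s * a \<noteq> b \<and> s * a \<noteq> - b" if "a \<noteq> b" "0 < a" "0 < b" for a b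
    using s that by auto
  ultimately have "s * gcd k l \<noteq> 0 \<and> gcd m n \<noteq> 0 \<and> s * gcd k l \<noteq> gcd m n \<and> s * gcd k l \<noteq> - gcd m n" by blast
  then show ?thesis using hnn_collinear_iso[OF 0 det] that unfolding pq s_def by blast
qed

lemma nonunimodular_quasi_isometric:
  assumes "(p, q) \<in> nonunimodular_params"
  shows "quasi_isometric (hnn_group p q) (baumslag_solitar 2 3)"
proof -
  obtain m n where mn: "m \<noteq> 0" "n \<noteq> 0" "m \<noteq> n" "m \<noteq> - n" "hnn_equiv p q (m, 0) (n, 0)" using nonunimodular_iso[OF assms] .
  then have "quasi_isometric (hnn_group (m, 0) (n, 0)) (baumslag_solitar 2 3)" by (intro nonunimodular_bs) (auto simp: abs_eq_iff)
  moreover have "quasi_isometric (hnn_group p q) (hnn_group (m, 0) (n, 0))" using mn(5) by (simp add: hnn_equiv_def)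
  moreover obtain R where "hnn_group p q = PG R" using hnn_presented by blast
  ultimately show ?thesis unfolding hnn_group_eq bs_group_eq using quasi_isometric_presented_trans by metis
qed

text \<open>The negative results concern a member of the family, so BS(2,3) is traded for the
  exponents 1 and 2.\<close>

lemma nonunimodular_quasi_isometric':
  assumes "(p, q) \<in> nonunimodular_params"
  shows "quasi_isometric (hnn_group p q) (hnn_group (1, 0) (2, 0))"
proof -
  have "((1, 0), (2, 0)) \<in> nonunimodular_params" by (simp add: nonunimodular_params_def params_def)
  from nonunimodular_quasi_isometric[OF this] nonunimodular_quasi_isometric[OF assms] show ?thesis
    using hnn_presented[of p q] quasi_isometric_presented_sym quasi_isometric_presented_trans
    unfolding hnn_group_eq bs_group_eq by metis
qed

lemma params_cases:
  assumes "(p, q) \<in> params"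
  obtains "(p, q) \<in> transverse_params" "(p, q) \<notin> unimodular_params" "(p, q) \<notin> nonunimodular_params"
  | "(p, q) \<notin> transverse_params" "(p, q) \<in> unimodular_params" "(p, q) \<notin> nonunimodular_params"
  | "(p, q) \<notin> transverse_params" "(p, q) \<notin> unimodular_params" "(p, q) \<in> nonunimodular_params"
proof -
  obtain k l m n where pq: "p = (k, l)" "q = (m, n)" by (cases p; cases q)
  have u: "(m, n) = (k, l) \<or> (m, n) = (- k, - l) \<longleftrightarrow> (k, l) = (m, n) \<or> (k, l) = (- m, - n)"
    "(m, n) = (k, l) \<or> (m, n) = (- k, - l) \<Longrightarrow> k * n - l * m = 0" by auto
  have "(p, q) \<in> transverse_params \<longleftrightarrow> k * n - l * m \<noteq> 0"
    "(p, q) \<in> unimodular_params \<longleftrightarrow> (m, n) = (k, l) \<or> (m, n) = (- k, - l)"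
    "(p, q) \<in> nonunimodular_params \<longleftrightarrow> k * n - l * m = 0 \<and> \<not> ((k, l) = (m, n) \<or> (k, l) = (- m, - n))"
    using assms by (simp_all add: pq transverse_params_def unimodular_params_def nonunimodular_params_def)
  with u that show ?thesis by metis
qed

lemma quasi_isometric_hnn_cong:
  assumes "quasi_isometric (hnn_group p q) (hnn_group r s)" "quasi_isometric (hnn_group p' q') (hnn_group r' s')"
  shows "quasi_isometric (hnn_group p q) (hnn_group p' q') \<longleftrightarrow> quasi_isometric (hnn_group r s) (hnn_group r' s')"
  using assms quasi_isometric_hnn_sym quasi_isometric_hnn_trans by blast

lemma quasi_isometric_hnn_iff:
  assumes pq: "(p, q) \<in> params" "(p', q') \<in> params"
  shows "quasi_isometric (hnn_group p q) (hnn_group p' q') \<longleftrightarrow>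
    (p, q) \<in> transverse_params \<and> (p', q') \<in> transverse_params \<or>
    (p, q) \<in> unimodular_params \<and> (p', q') \<in> unimodular_params \<or>
    (p, q) \<in> nonunimodular_params \<and> (p', q') \<in> nonunimodular_params"
proof -
  note n = classes_not_quasi_isometric classes_not_quasi_isometric[THEN contrapos_nn[OF _ quasi_isometric_hnn_sym]]
  have r: "quasi_isometric (hnn_group r s) (hnn_group r s)" for r s using hnn_equiv_refl unfolding hnn_equiv_def by blast
  show ?thesis using pq(1)
  proof (cases rule: params_cases)
    case p: 1
    show ?thesis using pq(2)
    proof (cases rule: params_cases)
      case 1
      show ?thesis unfolding quasi_isometric_hnn_cong[OF transverse_quasi_isometric[OF p(1)] transverse_quasi_isometric[OF 1(1)]] using p 1 n r by simp
    next
      case 2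
      show ?thesis unfolding quasi_isometric_hnn_cong[OF transverse_quasi_isometric[OF p(1)] unimodular_quasi_isometric[OF 2(2)]] using p 2 n r by simp
    next
      case 3
      show ?thesis unfolding quasi_isometric_hnn_cong[OF transverse_quasi_isometric[OF p(1)] nonunimodular_quasi_isometric'[OF 3(3)]] using p 3 n r by simp
    qed
  next
    case p: 2
    show ?thesis using pq(2)
    proof (cases rule: params_cases)
      case 1
      show ?thesis unfolding quasi_isometric_hnn_cong[OF unimodular_quasi_isometric[OF p(2)] transverse_quasi_isometric[OF 1(1)]] using p 1 n r by simp
    next
      case 2
      show ?thesis unfolding quasi_isometric_hnn_cong[OF unimodular_quasi_isometric[OF p(2)] unimodular_quasi_isometric[OF 2(2)]] using p 2 n r by simp
    next
      case 3
      show ?thesis unfolding quasi_isometric_hnn_cong[OF unimodular_quasi_isometric[OF p(2)] nonunimodular_quasi_isometric'[OF 3(3)]] using p 3 n r by simp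
    qed
  next
    case p: 3
    show ?thesis using pq(2)
    proof (cases rule: params_cases)
      case 1
      show ?thesis unfolding quasi_isometric_hnn_cong[OF nonunimodular_quasi_isometric'[OF p(3)] transverse_quasi_isometric[OF 1(1)]] using p 1 n r by simp
    next
      case 2
      show ?thesis unfolding quasi_isometric_hnn_cong[OF nonunimodular_quasi_isometric'[OF p(3)] unimodular_quasi_isometric[OF 2(2)]] using p 2 n r by simp
    next
      case 3
      show ?thesis unfolding quasi_isometric_hnn_cong[OF nonunimodular_quasi_isometric'[OF p(3)] nonunimodular_quasi_isometric'[OF 3(3)]] using p 3 n r by simp
    qed
  qed
qed

lemma unimodular_iso:
  assumes "(k, l) \<noteq> (0, 0)" "s = 1 \<or> s = - 1"
  shows "\<exists>m. m \<noteq> 0 \<and> hnn_group (k, l) (s * k, s * l) \<cong> hnn_group (m, 0) (s * m, 0)"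
proof -
  have "k * k + l * l > 0" using assms(1) by (auto simp: sum_squares_gt_zero_iff)
  then have "sgn (k * (s * k) + l * (s * l)) = s"
    using assms(2) by (auto simp: sgn_if)
  moreover have "gcd (s * k) (s * l) = gcd k l" using assms(2) by auto
  moreover have "(s * k, s * l) \<noteq> (0, 0)" "k * (s * l) - l * (s * k) = 0" using assms by auto
  ultimately have iso: "hnn_group (k, l) (s * k, s * l) \<cong> hnn_group (s * gcd k l, 0) (gcd k l, 0)"
    using hnn_collinear_iso(1)[OF assms(1), of "s * k" "s * l"] by simp
  \<comment> \<open>The reduction puts the sign on the first parameter; with \<open>m\<close> equal
    to \<open>s\<close> times the gcd it moves to the second, because \<open>s\<close> is its own
    inverse.\<close>
  have e: "s * (s * gcd k l) = gcd k l" and nz: "s * gcd k l \<noteq> 0" using assms by auto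
  show ?thesis
  proof (intro exI conjI)
    show "hnn_group (k, l) (s * k, s * l) \<cong> hnn_group (s * gcd k l, 0) (s * (s * gcd k l), 0)" unfolding e by (rule iso)
  qed (rule nz)
qed

lemma ratio_iff:
  fixes m1 n1 m2 n2 :: int
  assumes "1 \<le> \<bar>m1\<bar>" "\<bar>m1\<bar> \<le> n1" "1 \<le> \<bar>m2\<bar>" "\<bar>m2\<bar> \<le> n2"
  shows "(\<exists>m. (m = m1 \<or> m = - m1) \<and> rat_of_int m2 / rat_of_int m = rat_of_int n2 / rat_of_int n1) \<longleftrightarrow> \<bar>m2\<bar> * n1 = \<bar>m1\<bar> * n2"
proof -
  have n: "n1 > 0" "n2 > 0" "m1 \<noteq> 0" using assms by auto
  have "rat_of_int m2 / rat_of_int m = rat_of_int n2 / rat_of_int n1 \<longleftrightarrow> m2 * n1 = n2 * m" if "m \<noteq> 0" for m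
  proof -
    have "rat_of_int m2 / rat_of_int m = rat_of_int n2 / rat_of_int n1 \<longleftrightarrow> rat_of_int (m2 * n1) = rat_of_int (n2 * m)"
      using that n by (simp add: frac_eq_eq)
    then show ?thesis by (simp only: of_int_eq_iff)
  qed
  then have "(\<exists>m. (m = m1 \<or> m = - m1) \<and> rat_of_int m2 / rat_of_int m = rat_of_int n2 / rat_of_int n1) \<longleftrightarrow> m2 * n1 = n2 * m1 \<or> m2 * n1 = - (n2 * m1)"
    using n by (metis mult_minus_right neg_equal_0_iff_equal)
  also have "\<dots> \<longleftrightarrow> \<bar>m2 * n1\<bar> = \<bar>n2 * m1\<bar>" by (simp only: abs_eq_iff)
  also have "\<dots> \<longleftrightarrow> \<bar>m2\<bar> * n1 = \<bar>m1\<bar> * n2" using n by (simp add: abs_mult mult.commute)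
  finally show ?thesis .
qed

text \<open>In the criterion \<open>m\<close> runs over both signs of \<open>m1\<close>, which
  composes the two moves of the classification, change of sign and scaling. In the collinear clause
  \<open>sgn\<close> of the inner product records whether the two vectors point the same way, which
  the gcd forgets. The quasi-isometry clause is an equivalence and thus contains that the three
  classes are distinct.\<close>

theorem theorem1:
  shows
    "(\<forall>k l m n k' l' m' n'. k * n - l * m \<noteq> 0 \<and> k' * n' - l' * m' \<noteq> 0 \<longrightarrow>
        commensurable (hnn_group (k, l) (m, n)) (hnn_group (k', l') (m', n')))
     \<and>
     (\<forall>k l m n. (k, l) \<noteq> (0, 0) \<and> (m, n) \<noteq> (0, 0) \<and> k * n - l * m = 0 \<longrightarrow>
        hnn_group (k, l) (m, n) \<cong> hnn_group (sgn (k * m + l * n) * gcd k l, 0) (gcd m n, 0))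
     \<and>
     (\<forall>m1 n1 m2 n2. 1 \<le> \<bar>m1\<bar> \<and> \<bar>m1\<bar> \<le> n1 \<and> 1 \<le> \<bar>m2\<bar> \<and> \<bar>m2\<bar> \<le> n2 \<longrightarrow>
        (commensurable (hnn_group (m1, 0) (n1, 0)) (hnn_group (m2, 0) (n2, 0)) \<longleftrightarrow>
         (\<exists>m. (m = m1 \<or> m = - m1) \<and> rat_of_int m2 / rat_of_int m = rat_of_int n2 / rat_of_int n1)))
     \<and>
     (\<forall>m n. 1 \<le> \<bar>m\<bar> \<and> \<bar>m\<bar> \<le> n \<longrightarrow>
        commensurable (hnn_group (m, 0) (n, 0)) (hnn_group (- m, 0) (n, 0)) \<and>
        (\<forall>c. c \<noteq> 0 \<longrightarrow> commensurable (hnn_group (m, 0) (n, 0)) (hnn_group (c * m, 0) (c * n, 0))))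
     \<and>
     (\<forall>(p, q) \<in> params. \<forall>(p', q') \<in> params.
        quasi_isometric (hnn_group p q) (hnn_group p' q') \<longleftrightarrow>
          (p, q) \<in> transverse_params \<and> (p', q') \<in> transverse_params \<or>
          (p, q) \<in> unimodular_params \<and> (p', q') \<in> unimodular_params \<or>
          (p, q) \<in> nonunimodular_params \<and> (p', q') \<in> nonunimodular_params)
     \<and>
     (\<forall>k l s. (k, l) \<noteq> (0, 0) \<and> (s = 1 \<or> s = - 1) \<longrightarrow>
        (\<exists>m. m \<noteq> 0 \<and> hnn_group (k, l) (s * k, s * l) \<cong> hnn_group (m, 0) (s * m, 0)))
     \<and>
     (\<forall>(p, q) \<in> nonunimodular_params.
        (\<exists>m n. m \<noteq> 0 \<and> n \<noteq> 0 \<and> m \<noteq> n \<and> m \<noteq> - n \<and> hnn_group p q \<cong> hnn_group (m, 0) (n, 0)) \<and>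
        quasi_isometric (hnn_group p q) (baumslag_solitar 2 3))"
proof (intro conjI)
  show "\<forall>k l m n k' l' m' n'. k * n - l * m \<noteq> 0 \<and> k' * n' - l' * m' \<noteq> 0 \<longrightarrow>
        commensurable (hnn_group (k, l) (m, n)) (hnn_group (k', l') (m', n'))"
  proof (intro allI impI)
    fix k l m n k' l' m' n' :: int
    assume det: "k * n - l * m \<noteq> 0 \<and> k' * n' - l' * m' \<noteq> 0"
    have "hnn_equiv (k, l) (m, n) (k', l') (m', n')"
      by (rule hnn_equiv_trans[OF hnn_transverse_equiv[OF det[THEN conjunct1]] hnn_equiv_sym[OF hnn_transverse_equiv[OF det[THEN conjunct2]]]])
    then show "commensurable (hnn_group (k, l) (m, n)) (hnn_group (k', l') (m', n'))" by (simp add: hnn_equiv_def)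
  qed
  show "\<forall>k l m n. (k, l) \<noteq> (0, 0) \<and> (m, n) \<noteq> (0, 0) \<and> k * n - l * m = 0 \<longrightarrow>
        hnn_group (k, l) (m, n) \<cong> hnn_group (sgn (k * m + l * n) * gcd k l, 0) (gcd m n, 0)"
    using hnn_collinear_iso(1) by blast
  show "\<forall>m1 n1 m2 n2. 1 \<le> \<bar>m1\<bar> \<and> \<bar>m1\<bar> \<le> n1 \<and> 1 \<le> \<bar>m2\<bar> \<and> \<bar>m2\<bar> \<le> n2 \<longrightarrow>
        (commensurable (hnn_group (m1, 0) (n1, 0)) (hnn_group (m2, 0) (n2, 0)) \<longleftrightarrow>
         (\<exists>m. (m = m1 \<or> m = - m1) \<and> rat_of_int m2 / rat_of_int m = rat_of_int n2 / rat_of_int n1))"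
    by (intro allI impI, elim conjE) (simp only: commensurable_hnn_iff ratio_iff)
  show "\<forall>m n. 1 \<le> \<bar>m\<bar> \<and> \<bar>m\<bar> \<le> n \<longrightarrow>
        commensurable (hnn_group (m, 0) (n, 0)) (hnn_group (- m, 0) (n, 0)) \<and>
        (\<forall>c. c \<noteq> 0 \<longrightarrow> commensurable (hnn_group (m, 0) (n, 0)) (hnn_group (c * m, 0) (c * n, 0)))"
    using hnn_equiv_flip[unfolded hnn_equiv_def] hnn_equiv_scale[unfolded hnn_equiv_def] by simp
  show "\<forall>(p, q) \<in> params. \<forall>(p', q') \<in> params.
        quasi_isometric (hnn_group p q) (hnn_group p' q') \<longleftrightarrow>
          (p, q) \<in> transverse_params \<and> (p', q') \<in> transverse_params \<or>
          (p, q) \<in> unimodular_params \<and> (p', q') \<in> unimodular_params \<or>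
          (p, q) \<in> nonunimodular_params \<and> (p', q') \<in> nonunimodular_params"
    unfolding Ball_def split_paired_All prod.case using quasi_isometric_hnn_iff by simp
  show "\<forall>k l s. (k, l) \<noteq> (0, 0) \<and> (s = 1 \<or> s = - 1) \<longrightarrow>
        (\<exists>m. m \<noteq> 0 \<and> hnn_group (k, l) (s * k, s * l) \<cong> hnn_group (m, 0) (s * m, 0))"
    using unimodular_iso by blast
  have "(\<exists>m n. m \<noteq> 0 \<and> n \<noteq> 0 \<and> m \<noteq> n \<and> m \<noteq> - n \<and> hnn_group p q \<cong> hnn_group (m, 0) (n, 0)) \<and>
        quasi_isometric (hnn_group p q) (baumslag_solitar 2 3)" if "(p, q) \<in> nonunimodular_params" for p q
    using nonunimodular_iso[OF that] nonunimodular_quasi_isometric[OF that] by metis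
  then show "\<forall>(p, q) \<in> nonunimodular_params.
        (\<exists>m n. m \<noteq> 0 \<and> n \<noteq> 0 \<and> m \<noteq> n \<and> m \<noteq> - n \<and> hnn_group p q \<cong> hnn_group (m, 0) (n, 0)) \<and>
        quasi_isometric (hnn_group p q) (baumslag_solitar 2 3)"
    by blast
qed

end
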